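(* For each integer $N\ge 1$ let $G_N$ be an $N\times N$ complex Ginibre random matrix. Let $\gamma\in\mathbb{C}$ with $\mathrm{Re}(\gamma)>-2$ and let $z\in\mathbb{C}$ with $|z|<1$. Then, as $N\to\infty$, $$\mathbb{E}\,|\det(G_N-z)|^{\gamma}=(1+o(1))\,N^{\frac{\gamma^2}{8}}\,e^{\frac{\gamma}{2}N(|z|^2-1)}\,\frac{(2\pi)^{\frac{\gamma}{4}}}{G(1+\frac{\gamma}{2})},$$ where $G$ is the Barnes $G$-function. Moreover, the error $o(1)$ is uniform in $\gamma$ when $\gamma$ is restricted to a compact subset of $\{\gamma\in\mathbb{C}:\mathrm{Re}(\gamma)>-2\}$ and uniform in $z\in\{w\in\mathbb{C}: r\le |w|\le R\}$ with fixed $0<r\le R<1$.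
   Context: A complex Ginibre random matrix $G_N$ is an $N\times N$ random matrix whose entries are i.i.d. and distributed as $N^{-1/2}Z$, where $Z$ is a standard complex Gaussian (density $\pi^{-1}e^{-|w|^2}$ with respect to Lebesgue measure on $\mathbb{C}$, so $\mathbb{E}|Z|^2=1$). Here $\det(G_N-z)$ means $\det(G_N-zI)$. The Barnes $G$-function is the standard entire function with $G(1)=1$ and $G(u+1)=\Gamma(u)G(u)$. *)

theory Defs
  imports "HOL-Probability.Probability" "Jordan_Normal_Form.Determinant"
begin

text \<open>The Weierstrass product
  \<open>G(1+w) = (2\<pi>)\<^sup>w\<^sup>/\<^sup>2 exp(-(w + w\<^sup>2(1+c))/2) \<Prod>\<^sub>k\<^sub>\<ge>\<^sub>1 (1+w/k)\<^sup>k exp(w\<^sup>2/(2k) - w)\<close>,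
  \<open>c\<close> being Euler's constant, with \<open>w = u - 1\<close> and the product index shifted by one.\<close>

definition barnes_G :: "complex \<Rightarrow> complex" where
  "barnes_G u = (let w = u - 1 in
     of_real (2 * pi) powr (w / 2) * exp (- (w + w\<^sup>2 * (1 + euler_mascheroni)) / 2) *
     (\<Prod>k. (1 + w / of_nat (Suc k)) ^ Suc k * exp (w\<^sup>2 / (2 * of_nat (Suc k)) - w)))"

definition std_complex_gaussian :: "complex measure" where
  "std_complex_gaussian = density lborel (\<lambda>w. ennreal (exp (- (cmod w)\<^sup>2) / pi))"

text \<open>Measurability of the entries is part of \<open>indep_vars\<close>.\<close>

definition complex_ginibre :: "nat \<Rightarrow> 'a measure \<Rightarrow> ('a \<Rightarrow> complex mat) \<Rightarrow> bool" where
  "complex_ginibre N M A \<longleftrightarrow>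
     prob_space M \<and>
     (\<forall>\<omega>\<in>space M. A \<omega> \<in> carrier_mat N N) \<and>
     prob_space.indep_vars M (\<lambda>_. borel) (\<lambda>(i, j) \<omega>. A \<omega> $$ (i, j)) ({..<N} \<times> {..<N}) \<and>
     (\<forall>i<N. \<forall>j<N. distr M borel (\<lambda>\<omega>. A \<omega> $$ (i, j)) =
        distr std_complex_gaussian borel (\<lambda>w. w / of_real (sqrt (real N))))"

text \<open>The modulus is raised to a complex power through the principal branch; since
  \<open>0 powr \<gamma> = 0\<close> for every \<open>\<gamma>\<close>, singular matrices (a null event for the
  Ginibre ensemble) contribute nothing.\<close>

definition charpoly_moment :: "'a measure \<Rightarrow> ('a \<Rightarrow> complex mat) \<Rightarrow> nat \<Rightarrow> complex \<Rightarrow> complex \<Rightarrow> complex" where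
  "charpoly_moment M A N \<gamma> z =
     (\<integral>\<omega>. of_real (cmod (Determinant.det (A \<omega> - z \<cdot>\<^sub>m 1\<^sub>m N))) powr \<gamma> \<partial>M)"

definition moment_asymptotic :: "nat \<Rightarrow> complex \<Rightarrow> complex \<Rightarrow> complex" where
  "moment_asymptotic N \<gamma> z =
     of_nat N powr (\<gamma>\<^sup>2 / 8) *
     exp (\<gamma> / 2 * of_nat N * of_real ((cmod z)\<^sup>2 - 1)) *
     (of_real (2 * pi) powr (\<gamma> / 4) / barnes_G (1 + \<gamma> / 2))"

end

theory Submission
  imports Defs "HOL-Complex_Analysis.Complex_Analysis"
begin

text \<open>Put \<open>s = \<gamma> / 2\<close> and \<open>x = N |z|\<^sup>2\<close>. For real \<open>s\<close>, Givens rotations of the unnormalised Ginibre matrix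
  (which preserve the Gaussian measure) concentrate the last column on one coordinate. This gives a
  recursion in the size for the moments in which the last diagonal entry carries its own shift \<open>\<zeta>\<close>;
  its solution is \<open>\<E> |det|\<^sup>2\<^sup>s = c\<^sub>N(s) D\<^sub>N(s, x)\<close> with \<open>c\<^sub>N(s) = \<Prod>\<^sub>i\<^sub><\<^sub>N \<Gamma>(s + 1 + i) / i!\<close> and \<open>D\<^sub>N\<close> the
  Toeplitz determinant of the symbol \<open>(1 + 1/u)\<^sup>s e\<^sup>x\<^sup>u\<close>: up to an elementary factor, the solution at size \<open>n\<close>
  is the combination of \<open>n\<close> confluent hypergeometric functions that vanishes to order \<open>n - 1\<close> at \<open>x\<close>,
  and Cramer's rule turns this into determinants. Both sides are holomorphic in \<open>s\<close>, so the formula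
  extends to \<open>Re s > -1\<close>.

  The Wiener-Hopf factorisation of the symbol shows that \<open>D\<^sub>N' - s D\<^sub>N\<close> is exponentially small compared
  with \<open>D\<^sub>N\<close> for \<open>x \<le> R N\<close>, \<open>R < 1\<close>, hence \<open>D\<^sub>N e\<^sup>-\<^sup>s\<^sup>x\<close> tends to 1 uniformly. Finally
  \<open>c\<^sub>N(s) = (\<Gamma>(s + N + 1) / N!)\<^sup>N / \<Prod>\<^sub>k\<^sub>\<le>\<^sub>N (1 + s/k)\<^sup>k\<close> is compared with the Weierstrass product of the
  Barnes function.\<close>

section \<open>Toeplitz determinants of a confluent hypergeometric symbol\<close>

text \<open>The separate shift \<zeta> is forced by the elimination. Conjugation by rotations of the
  first n coordinates keeps the scalar shift z, but isolating the last column finally takes a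
  rotation of two rows alone, which multiplies the last remaining diagonal shift by a random number
  of modulus at most 1. Matrices with one special diagonal shift are stable under this step, and the
  law of the new |\<zeta>|^2 produces the integrals over [0,1] in the recursion.

  For real s all integrands are nonnegative, so interchanges are instances of Tonelli, and
  finiteness of the moments is an outcome of the computation; it is what makes the complex moment
  holomorphic afterwards.

  The determinants are compared with \<open>exp (s x)\<close> for x as large as a multiple of N, so
  the error has to be controlled relative to the determinant itself. The two families of Laurent
  coefficients in the Wiener-Hopf system carry factors \<open>exp x\<close> and
  \<open>exp (-x)\<close>; these cancel and leave \<open>q^N\<close> with
  \<open>q = R exp (1 - R) < 1\<close>.

  The comparison with the Barnes function is an exact identity with explicit error factors, each of
  which tends to 1 uniformly; no expansion of the Barnes function enters.\<close>

definition int_gbinomial :: "'a::{real_normed_field,banach} \<Rightarrow> int \<Rightarrow> 'a" where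
  "int_gbinomial s j = (if j < 0 then 0 else s gchoose nat j)"

text \<open>The Laurent coefficient of \<open>u\<^sup>n\<close> in \<open>(1 + 1/u)\<^sup>s e\<^sup>x\<^sup>u\<close>.\<close>

definition symbol_coeff :: "'a::{real_normed_field,banach} \<Rightarrow> int \<Rightarrow> 'a \<Rightarrow> 'a" where
  "symbol_coeff s n x = (\<Sum>k. int_gbinomial s (int k - n) / fact k * x ^ k)"

section \<open>Bounds and identities for the Laurent coefficients of the symbol\<close>

lemma norm_gbinomial_le:
  fixes s :: "'a::real_normed_field"
  shows "norm (s gchoose m) \<le> (1 + norm s) ^ m"
proof (induction m)
  case (Suc m)
  have "of_nat (Suc m) * (s gchoose Suc m) = (s - of_nat m) * (s gchoose m)"
    using gbinomial_mult_1[of s m] by (simp add: algebra_simps)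
  hence "real (Suc m) * norm (s gchoose Suc m) = norm (s - of_nat m) * norm (s gchoose m)"
    by (metis norm_mult norm_of_nat)
  also have "\<dots> \<le> (norm s + real m) * (1 + norm s) ^ m"
    using norm_triangle_ineq4[of s "of_nat m"] Suc by (intro mult_mono) auto
  also have "\<dots> \<le> (real (Suc m) * (1 + norm s)) * (1 + norm s) ^ m"
    by (intro mult_right_mono) (auto simp: algebra_simps)
  finally have "real (Suc m) * norm (s gchoose Suc m) \<le> real (Suc m) * (1 + norm s) ^ Suc m"
    by (simp only: mult.assoc power_Suc)
  thus ?case by (simp del: of_nat_Suc power_Suc)
qed simp

lemma norm_pochhammer_le:
  fixes a :: "'a::real_normed_field"
  shows "norm (pochhammer a k) \<le> (1 + norm a) ^ k * fact k"
proof (induction k)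
  case (Suc k)
  have "norm (pochhammer a (Suc k)) = norm (pochhammer a k) * norm (a + of_nat k)"
    by (simp add: pochhammer_Suc norm_mult)
  also have "\<dots> \<le> ((1 + norm a) ^ k * fact k) * (norm a + real k)"
    using norm_triangle_ineq[of a "of_nat k"] Suc by (intro mult_mono) auto
  also have "\<dots> \<le> ((1 + norm a) ^ k * fact k) * ((1 + norm a) * real (Suc k))"
    by (intro mult_left_mono) (auto simp: algebra_simps)
  finally show ?case by (simp add: mult_ac)
qed simp

lemma norm_int_gbinomial_le: "norm (int_gbinomial s j) \<le> (1 + norm s) ^ nat j"
  using norm_gbinomial_le[of s "nat j"] by (simp add: int_gbinomial_def)

lemma int_gbinomial_Suc: "int_gbinomial (s + 1) j = int_gbinomial s j + int_gbinomial s (j - 1)"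
proof (cases "j \<le> 0")
  case True thus ?thesis by (cases "j = 0") (auto simp: int_gbinomial_def)
next
  case False
  define m where "m = nat (j - 1)"
  have "nat j = Suc m" "nat (j - 1) = m" using False by (auto simp: m_def)
  thus ?thesis using False gbinomial_Suc_Suc[of s m] by (simp add: int_gbinomial_def)
qed

lemma int_gbinomial_absorb: "of_int (j + 1) * int_gbinomial s (j + 1) = (s - of_int j) * int_gbinomial s j"
proof (cases "j < 0")
  case True
  thus ?thesis by (cases "j = -1") (auto simp: int_gbinomial_def)
next
  case False
  define m where "m = nat j"
  have j: "j = int m" using False by (simp add: m_def)
  have "nat (j + 1) = Suc m" using j by simp
  moreover have "of_nat (Suc m) * (s gchoose Suc m) = (s - of_nat m) * (s gchoose m)"
    using gbinomial_mult_1[of s m] by (simp add: algebra_simps)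
  ultimately show ?thesis by (simp add: int_gbinomial_def j algebra_simps)
qed

lemma summable_norm_symbol_coeff:
  "summable (\<lambda>k. norm (int_gbinomial s (int k - n) / fact k * x ^ k))"
proof (rule summable_comparison_test')
  let ?B = "1 + norm s"
  show "summable (\<lambda>k. ?B ^ nat (-n) * ((?B * norm x) ^ k / fact k))"
    by (intro summable_mult) (use summable_exp[of "?B * norm x"] in \<open>simp add: field_simps\<close>)
  fix k
  have "norm (int_gbinomial s (int k - n)) \<le> ?B ^ nat (int k - n)" by (rule norm_int_gbinomial_le)
  also have "\<dots> \<le> ?B ^ (nat (-n) + k)" by (intro power_increasing) auto
  finally have "norm (int_gbinomial s (int k - n)) * (norm x ^ k / fact k) \<le> ?B ^ (nat (-n) + k) * (norm x ^ k / fact k)"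
    by (intro mult_right_mono) auto
  thus "norm (norm (int_gbinomial s (int k - n) / fact k * x ^ k)) \<le> ?B ^ nat (-n) * ((?B * norm x) ^ k / fact k)"
    by (simp add: norm_mult norm_divide norm_power power_add power_mult_distrib mult_ac)
qed

lemma summable_symbol_coeff: "summable (\<lambda>k. int_gbinomial s (int k - n) / fact k * x ^ k)"
  by (rule summable_norm_cancel[OF summable_norm_symbol_coeff])

lemma sums_symbol_coeff: "(\<lambda>k. int_gbinomial s (int k - n) / fact k * x ^ k) sums symbol_coeff s n x"
  unfolding symbol_coeff_def by (rule summable_sums[OF summable_symbol_coeff])

text \<open>Differentiation in x multiplies the symbol by u, and the coefficient of
  \<open>u^n\<close> in that product is the one of index n - 1 in the symbol. Derivatives therefore
  never leave the family of Laurent coefficients.\<close>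

lemma symbol_coeff_deriv: "(symbol_coeff s n has_field_derivative symbol_coeff s (n - 1) x) (at x)"
proof -
  have "((\<lambda>x. \<Sum>k. int_gbinomial s (int k - n) / fact k * x ^ k) has_field_derivative
      (\<Sum>k. diffs (\<lambda>k. int_gbinomial s (int k - n) / fact k) k * x ^ k)) (at x)"
    by (rule termdiffs_strong_converges_everywhere) (rule summable_symbol_coeff)
  also have "diffs (\<lambda>k. int_gbinomial s (int k - n) / fact k) = (\<lambda>k. int_gbinomial s (int k - (n - 1)) / fact k)"
    by (rule ext) (simp add: diffs_def algebra_simps of_nat_Suc[symmetric] del: of_nat_Suc)
  finally show ?thesis by (simp add: symbol_coeff_def[abs_def])
qed

lemma isCont_symbol_coeff: "isCont (symbol_coeff s n) x"
  by (rule DERIV_isCont[OF symbol_coeff_deriv])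

lemma continuous_on_symbol_coeff [continuous_intros]:
  "continuous_on A f \<Longrightarrow> continuous_on A (\<lambda>b. symbol_coeff s n (f b))"
  by (rule continuous_on_compose2[of UNIV "symbol_coeff s n"])
     (auto simp: continuous_on_eq_continuous_at isCont_symbol_coeff)

lemma symbol_coeff_at_0: "symbol_coeff s n 0 = int_gbinomial s (- n)"
  using sums_unique[OF powser_sums_zero[of "\<lambda>k. int_gbinomial s (int k - n) / fact k"]]
  by (simp add: symbol_coeff_def)

text \<open>Raising s by one multiplies the symbol by 1 + 1/u; on the level of coefficients this is
  Pascal's rule.\<close>

lemma symbol_coeff_add_1: "symbol_coeff (s + 1) n x = symbol_coeff s n x + symbol_coeff s (n + 1) x"
proof -
  have "(\<lambda>k. int_gbinomial s (int k - n) / fact k * x ^ k + int_gbinomial s (int k - (n + 1)) / fact k * x ^ k)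
     sums (symbol_coeff s n x + symbol_coeff s (n + 1) x)"
    by (intro sums_add sums_symbol_coeff)
  also have "(\<lambda>k. int_gbinomial s (int k - n) / fact k * x ^ k + int_gbinomial s (int k - (n + 1)) / fact k * x ^ k)
     = (\<lambda>k. int_gbinomial (s + 1) (int k - n) / fact k * x ^ k)"
  proof
    fix k
    have "int k - (n + 1) = int k - n - 1" by simp
    thus "int_gbinomial s (int k - n) / fact k * x ^ k + int_gbinomial s (int k - (n + 1)) / fact k * x ^ k
       = int_gbinomial (s + 1) (int k - n) / fact k * x ^ k"
      by (simp only: int_gbinomial_Suc add_divide_distrib distrib_right)
  qed
  finally show ?thesis using sums_symbol_coeff sums_unique2 by blast
qed

text \<open>This is Kummer's equation x f'' + (1 + x) f' = s f for the constant coefficient f, since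
  lowering the index is differentiation. On power series coefficients it becomes the absorption
  identity for binomials.\<close>

lemma symbol_coeff_ode:
  "x * symbol_coeff s (-2) x + (1 + x) * symbol_coeff s (-1) x = s * symbol_coeff s 0 x"
proof -
  let ?b = "\<lambda>j k. int_gbinomial s (int k + j)"
  have shift: "(\<lambda>k. of_nat k * ?b j k / fact k * x ^ k) sums (x * symbol_coeff s (- j - 1) x)" for j
  proof -
    have "(\<lambda>k. x * (int_gbinomial s (int k - (- j - 1)) / fact k * x ^ k)) sums (x * symbol_coeff s (- j - 1) x)"
      by (intro sums_mult sums_symbol_coeff)
    also have "(\<lambda>k. x * (int_gbinomial s (int k - (- j - 1)) / fact k * x ^ k)) = (\<lambda>k. of_nat (Suc k) * ?b j (Suc k) / fact (Suc k) * x ^ Suc k)"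
      by (rule ext) (simp add: algebra_simps of_nat_Suc[symmetric] del: of_nat_Suc)
    finally show ?thesis by (subst (asm) sums_Suc_iff) simp
  qed
  have "(\<lambda>k. of_nat k * ?b 1 k / fact k * x ^ k + (?b 1 k / fact k * x ^ k + of_nat k * ?b 0 k / fact k * x ^ k))
     sums (x * symbol_coeff s (- 1 - 1) x + (symbol_coeff s (-1) x + x * symbol_coeff s (- 0 - 1) x))"
    using sums_symbol_coeff[of s "-1" x] by (intro sums_add shift) simp
  also have "(\<lambda>k. of_nat k * ?b 1 k / fact k * x ^ k + (?b 1 k / fact k * x ^ k + of_nat k * ?b 0 k / fact k * x ^ k))
      = (\<lambda>k. s * (int_gbinomial s (int k - 0) / fact k * x ^ k))"
  proof
    fix k
    have "of_nat k * ?b 1 k + (?b 1 k + of_nat k * ?b 0 k) = s * ?b 0 k"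
      using int_gbinomial_absorb[of "int k" s] by (simp add: algebra_simps)
    hence "(of_nat k * ?b 1 k + (?b 1 k + of_nat k * ?b 0 k)) * (x ^ k / fact k) = s * ?b 0 k * (x ^ k / fact k)" by (rule arg_cong)
    thus "of_nat k * ?b 1 k / fact k * x ^ k + (?b 1 k / fact k * x ^ k + of_nat k * ?b 0 k / fact k * x ^ k) = s * (int_gbinomial s (int k - 0) / fact k * x ^ k)"
      by (simp add: algebra_simps)
  qed
  finally have "s * symbol_coeff s 0 x = x * symbol_coeff s (- 1 - 1) x + (symbol_coeff s (-1) x + x * symbol_coeff s (- 0 - 1) x)"
    using sums_mult[OF sums_symbol_coeff[of s 0 x], of s] sums_unique2 by blast
  thus ?thesis by (simp add: algebra_simps)
qed

text \<open>One of the two factorials absorbs the rising factorial, the other makes the series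
  entire. The bounded factor \<mu> leaves room for the beta moments of the recursion.\<close>

lemma summable_norm_pochhammer_series:
  fixes a y :: "'a::{real_normed_field,banach}"
  assumes "\<And>k. norm (\<mu> k) \<le> B"
  shows "summable (\<lambda>k. norm (pochhammer a k / (fact k)\<^sup>2 * \<mu> k * y ^ k))"
proof (rule summable_comparison_test')
  have B: "B \<ge> 0" using assms[of 0] norm_ge_zero[of "\<mu> 0"] by linarith
  show "summable (\<lambda>k. B * (((1 + norm a) * norm y) ^ k / fact k))"
    by (intro summable_mult) (use summable_exp[of "(1 + norm a) * norm y"] in \<open>simp add: field_simps\<close>)
  fix k
  have "norm (pochhammer a k) * norm (\<mu> k) * norm y ^ k \<le> ((1 + norm a) ^ k * fact k) * B * norm y ^ k"
    using norm_pochhammer_le[of a k] assms[of k] by (intro mult_right_mono mult_mono) auto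
  hence "norm (pochhammer a k) * norm (\<mu> k) * norm y ^ k / (fact k)\<^sup>2 \<le> ((1 + norm a) ^ k * fact k) * B * norm y ^ k / (fact k)\<^sup>2"
    by (intro divide_right_mono) auto
  also have "\<dots> = B * (((1 + norm a) * norm y) ^ k / fact k)"
    by (simp add: power_mult_distrib power2_eq_square)
  finally show "norm (norm (pochhammer a k / (fact k)\<^sup>2 * \<mu> k * y ^ k)) \<le> B * (((1 + norm a) * norm y) ^ k / fact k)"
    by (simp add: norm_mult norm_divide norm_power)
qed

text \<open>Kummer's transformation exp(-y) 1F1(s + 1; 1; y) = 1F1(-s; 1; -y), obtained by
  multiplying the two power series.\<close>

lemma kummer_symbol_coeff:
  fixes s y :: "'a::{real_normed_field,banach}"
  shows "exp (- y) * (\<Sum>k. pochhammer (s + 1) k / (fact k)\<^sup>2 * y ^ k) = symbol_coeff s 0 y"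
proof -
  let ?a = "\<lambda>k. pochhammer (s + 1) k / (fact k)\<^sup>2 * y ^ k" and ?e = "\<lambda>k. (- y) ^ k /\<^sub>R fact k"
  have sa: "summable (\<lambda>k. norm (?a k))" using summable_norm_pochhammer_series[of "\<lambda>_. 1" 1 "s + 1" y] by simp
  have se: "summable (\<lambda>k. norm (?e k))" by (rule summable_norm_exp)
  have "(\<lambda>n. \<Sum>k\<le>n. ?a k * ?e (n - k)) sums ((\<Sum>k. ?a k) * (\<Sum>k. ?e k))"
    by (rule Cauchy_product_sums[OF sa se])
  also have "(\<Sum>k. ?e k) = exp (- y)" by (simp add: exp_def)
  also have "(\<lambda>n. \<Sum>k\<le>n. ?a k * ?e (n - k)) = (\<lambda>n. int_gbinomial s (int n - 0) / fact n * y ^ n)"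
  proof
    fix n
    \<comment> \<open>The rising factorial is written as a binomial with negated upper index and the
      exponential contributes binom(n, n - k), so that the convolution is of Vandermonde
      type.\<close>
    have "(\<Sum>k\<le>n. ?a k * ?e (n - k)) = (\<Sum>k\<le>n. (-1) ^ n / fact n * y ^ n * ((- s - 1 gchoose k) * (of_nat n gchoose (n - k))))"
    proof (rule sum.cong[OF refl], goal_cases)
      case (1 k)
      hence k: "k \<le> n" by simp
      have g: "(- s - 1 gchoose k) = (-1) ^ k * pochhammer (s + 1) k / fact k"
        by (simp add: gbinomial_pochhammer add.commute)
      have b: "(of_nat n gchoose (n - k)) = (fact n / (fact k * fact (n - k)) :: 'a)"
        using binomial_fact[OF diff_le_self[of n k], where 'a = 'a] k by (simp add: binomial_gbinomial)
      have sg: "(-1) ^ n * (-1) ^ k = ((-1) ^ (n - k) :: 'a)"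
      proof -
        have "(-1) ^ n * (-1) ^ k = ((-1) ^ (n - k + 2 * k) :: 'a)" using k by (simp add: power_add[symmetric] add.commute)
        thus ?thesis by (simp add: power_add power_mult)
      qed
      have yy: "y ^ n = y ^ k * y ^ (n - k)" using k by (simp add: power_add[symmetric])
      have "(-1) ^ n / fact n * y ^ n * ((- s - 1 gchoose k) * (of_nat n gchoose (n - k)))
         = ((-1) ^ n * (-1) ^ k) * y ^ n * pochhammer (s + 1) k / (fact k * fact k * fact (n - k))"
        unfolding g b by (simp add: field_simps)
      also have "\<dots> = (-1) ^ (n - k) * (y ^ k * y ^ (n - k)) * pochhammer (s + 1) k / (fact k * fact k * fact (n - k))"
        unfolding sg yy ..
      also have "\<dots> = ?a k * ?e (n - k)"
        by (simp add: power_minus[of y] scaleR_conv_of_real power2_eq_square field_simps)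
      finally show ?case ..
    qed
    also have "\<dots> = (-1) ^ n / fact n * y ^ n * (\<Sum>k=0..n. (- s - 1 gchoose k) * (of_nat n gchoose (n - k)))"
      by (simp add: sum_distrib_left atMost_atLeast0)
    also have "(\<Sum>k=0..n. (- s - 1 gchoose k) * (of_nat n gchoose (n - k))) = (- s - 1 + of_nat n gchoose n)"
      by (rule gbinomial_Vandermonde)
    also have "(- s - 1 + of_nat n gchoose n) = (-1) ^ n * (s gchoose n)"
      by (subst gbinomial_negated_upper) (simp add: algebra_simps)
    finally show "(\<Sum>k\<le>n. ?a k * ?e (n - k)) = int_gbinomial s (int n - 0) / fact n * y ^ n"
      by (simp add: int_gbinomial_def mult_ac power_mult_distrib[symmetric])
  qed
  finally have "(\<Sum>k. ?a k) * exp (- y) = symbol_coeff s 0 y"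
    by (rule sums_unique2[OF _ sums_symbol_coeff])
  thus ?thesis by (simp only: mult.commute)
qed

text \<open>Up to a constant, \<open>moment_fun s x m y\<close> is the moment of order \<open>2 s\<close> of the determinant of an
  unnormalised Ginibre matrix of size \<open>m + 1\<close>, shifted on the diagonal by \<open>z\<close> with \<open>x = |z|\<^sup>2\<close> except for
  its last entry, which is shifted by \<open>\<zeta>\<close> with \<open>y = |\<zeta>|\<^sup>2\<close>.\<close>

primrec moment_fun :: "real \<Rightarrow> real \<Rightarrow> nat \<Rightarrow> real \<Rightarrow> real" where
  "moment_fun s x 0 y = exp (- y) * (\<Sum>k. pochhammer (s + 1) k / (fact k)\<^sup>2 * y ^ k)"
| "moment_fun s x (Suc m) y = exp (- y) * (\<Sum>k. pochhammer (s + 1 + real (Suc m)) k / (fact k)\<^sup>2 *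
     (real (Suc m) * integral {0..1} (\<lambda>b. (1 - b) ^ m * b ^ k * moment_fun s x m (x * b))) * y ^ k)"

text \<open>The weight (m + 1) (1 - b)^m is the density of the Beta law with parameters 1 and m + 1,
  the law of |a|^2 relative to the squared norm of a centred Gaussian vector with m + 2 entries, one
  of which is a. The power b^k stems from the noncentral expansion of the last entry.\<close>

definition beta_moment :: "real \<Rightarrow> real \<Rightarrow> nat \<Rightarrow> nat \<Rightarrow> real" where
  "beta_moment s x m k = real (Suc m) * integral {0..1} (\<lambda>b. (1 - b) ^ m * b ^ k * moment_fun s x m (x * b))"

text \<open>One coefficient sequence covers both clauses of the recursion; for positive m it uses
  the beta moment built from the function with index m - 1.\<close>

definition moment_coeff :: "real \<Rightarrow> real \<Rightarrow> nat \<Rightarrow> nat \<Rightarrow> real" where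
  "moment_coeff s x m k = pochhammer (s + 1 + real m) k / (fact k)\<^sup>2 * (if m = 0 then 1 else beta_moment s x (m - 1) k)"

section \<open>Continuity, decay and positivity of the moment functions\<close>

lemma moment_fun_eq: "moment_fun s x m y = exp (- y) * (\<Sum>k. moment_coeff s x m k * y ^ k)"
  by (cases m) (simp_all add: moment_coeff_def beta_moment_def)

declare moment_fun.simps [simp del]

lemma beta_moment_bounded:
  assumes cont: "continuous_on UNIV (moment_fun s x m)"
  obtains B where "\<And>k. \<bar>beta_moment s x m k\<bar> \<le> B"
proof -
  have c1: "continuous_on {0..1} (\<lambda>b. moment_fun s x m (x * b))"
    by (intro continuous_on_compose2[OF cont] continuous_intros) auto
  have "compact ((\<lambda>b. moment_fun s x m (x * b)) ` {0..1})"
    using c1 by (rule compact_continuous_image) simp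
  then obtain B where B: "\<And>b. b \<in> {0..1} \<Longrightarrow> \<bar>moment_fun s x m (x * b)\<bar> \<le> B"
    using compact_imp_bounded[of "(\<lambda>b. moment_fun s x m (x * b)) ` {0..1}"] unfolding bounded_iff
    by (metis image_eqI real_norm_def)
  have B0: "B \<ge> 0" using B[of 0] by auto
  have "\<bar>beta_moment s x m k\<bar> \<le> real (Suc m) * B" for k
  proof -
    have "norm (integral {0..1} (\<lambda>b. (1 - b) ^ m * b ^ k * moment_fun s x m (x * b))) \<le> B * (1 - 0)"
    proof (rule integral_bound)
      show "continuous_on {0..1} (\<lambda>b. (1 - b) ^ m * b ^ k * moment_fun s x m (x * b))"
        by (intro continuous_intros c1)
      fix b :: real assume b: "b \<in> {0..1}"
      have "(1 - b) ^ m * b ^ k \<le> 1 * 1" using b by (intro mult_mono power_le_one) auto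
      hence "(1 - b) ^ m * b ^ k * \<bar>moment_fun s x m (x * b)\<bar> \<le> 1 * B" using B[OF b] b by (intro mult_mono) auto
      thus "norm ((1 - b) ^ m * b ^ k * moment_fun s x m (x * b)) \<le> B" using b by (simp add: abs_mult)
    qed simp
    thus ?thesis unfolding beta_moment_def abs_mult by (intro mult_mono) auto
  qed
  thus ?thesis by (rule that)
qed

text \<open>Summability and continuity have to be proved together: continuity at index m bounds the
  beta moments, these make the series at index m + 1 converge everywhere, and an everywhere
  convergent power series is continuous.\<close>

lemma moment_fun_cont_summable:
  "summable (\<lambda>k. norm (moment_coeff s x m k * y ^ k)) \<and> continuous_on UNIV (moment_fun s x m)"
proof (induction m arbitrary: y)
  have cont: "continuous_on UNIV (moment_fun s x m)"
    if sm: "\<And>y. summable (\<lambda>k. norm (moment_coeff s x m k * y ^ k))" for m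
  proof -
    have "((\<lambda>y. \<Sum>k. moment_coeff s x m k * y ^ k) has_field_derivative (\<Sum>k. diffs (moment_coeff s x m) k * y ^ k)) (at y)" for y
      by (rule termdiffs_strong_converges_everywhere) (rule summable_norm_cancel[OF sm])
    hence "isCont (\<lambda>y. \<Sum>k. moment_coeff s x m k * y ^ k) y" for y by (rule DERIV_isCont)
    hence "continuous_on UNIV (\<lambda>y. \<Sum>k. moment_coeff s x m k * y ^ k)"
      by (simp add: continuous_on_eq_continuous_at)
    hence "continuous_on UNIV (\<lambda>y. exp (- y) * (\<Sum>k. moment_coeff s x m k * y ^ k))"
      by (intro continuous_intros)
    thus ?thesis by (simp add: moment_fun_eq[abs_def])
  qed
  {
    case 0
    have "summable (\<lambda>k. norm (moment_coeff s x 0 k * y ^ k))" for y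
      using summable_norm_pochhammer_series[of "\<lambda>_. 1" 1 "s + 1" y] by (simp add: moment_coeff_def)
    thus ?case using cont by blast
  next
    case (Suc m)
    obtain B where "\<And>k. \<bar>beta_moment s x m k\<bar> \<le> B" using beta_moment_bounded Suc by blast
    hence "summable (\<lambda>k. norm (moment_coeff s x (Suc m) k * y ^ k))" for y
      using summable_norm_pochhammer_series[of "beta_moment s x m" B "s + 1 + real (Suc m)" y] by (simp add: moment_coeff_def)
    thus ?case using cont by blast
  }
qed

lemmas summable_norm_moment = moment_fun_cont_summable[THEN conjunct1]
lemmas continuous_on_moment_fun = moment_fun_cont_summable[THEN conjunct2]
lemmas summable_moment = summable_norm_cancel[OF summable_norm_moment]

lemma continuous_on_beta_integrand:
  "continuous_on {0..1} (\<lambda>b. (1 - b) ^ m * b ^ k * moment_fun s x m (x * b))"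
  by (intro continuous_intros continuous_on_compose2[OF continuous_on_moment_fun]) auto

text \<open>Integration by parts trades a power of 1 - b for a power of b.\<close>

lemma beta_integral_rec:
  "integral {0..1} (\<lambda>b::real. (1 - b) ^ Suc m * b ^ k) = real (Suc m) / real (Suc k) * integral {0..1} (\<lambda>b. (1 - b) ^ m * b ^ Suc k)"
proof -
  have "((\<lambda>b::real. (1 - b) ^ Suc m * b ^ k - real (Suc m) / real (Suc k) * ((1 - b) ^ m * b ^ Suc k)) has_integral
     (1 - 1) ^ Suc m * 1 ^ Suc k / real (Suc k) - (1 - 0) ^ Suc m * 0 ^ Suc k / real (Suc k)) {0..1}"
  proof (rule fundamental_theorem_of_calculus)
    fix b :: real
    have "((\<lambda>b. (1 - b) ^ Suc m * b ^ Suc k / real (Suc k)) has_real_derivative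
       ((1 - b) ^ Suc m * (real (Suc k) * b ^ k) + - (real (Suc m) * (1 - b) ^ m) * b ^ Suc k) / real (Suc k)) (at b)"
      by (rule derivative_eq_intros refl | simp)+
    also have "((1 - b) ^ Suc m * (real (Suc k) * b ^ k) + - (real (Suc m) * (1 - b) ^ m) * b ^ Suc k) / real (Suc k)
       = (1 - b) ^ Suc m * b ^ k - real (Suc m) / real (Suc k) * ((1 - b) ^ m * b ^ Suc k)"
      by (simp add: field_simps del: power_Suc of_nat_Suc)
    finally show "((\<lambda>b. (1 - b) ^ Suc m * b ^ Suc k / real (Suc k)) has_vector_derivative
       (1 - b) ^ Suc m * b ^ k - real (Suc m) / real (Suc k) * ((1 - b) ^ m * b ^ Suc k)) (at b within {0..1})"
      by (simp add: has_real_derivative_iff_has_vector_derivative has_vector_derivative_at_within)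
  qed simp
  hence "integral {0..1} (\<lambda>b::real. (1 - b) ^ Suc m * b ^ k - real (Suc m) / real (Suc k) * ((1 - b) ^ m * b ^ Suc k)) = 0"
    by (simp add: integral_unique)
  moreover have "integral {0..1} (\<lambda>b::real. (1 - b) ^ Suc m * b ^ k - real (Suc m) / real (Suc k) * ((1 - b) ^ m * b ^ Suc k))
     = integral {0..1} (\<lambda>b::real. (1 - b) ^ Suc m * b ^ k) - integral {0..1} (\<lambda>b. real (Suc m) / real (Suc k) * ((1 - b) ^ m * b ^ Suc k))"
    by (intro Henstock_Kurzweil_Integration.integral_diff integrable_continuous_real continuous_intros)
  ultimately show ?thesis by simp
qed

lemma beta_integral_0: "integral {0..1} (\<lambda>b::real. b ^ k) = 1 / real (Suc k)"
proof -
  have "((\<lambda>b::real. b ^ k) has_integral 1 ^ Suc k / real (Suc k) - 0 ^ Suc k / real (Suc k)) {0..1}"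
  proof (rule fundamental_theorem_of_calculus)
    fix b :: real
    have "((\<lambda>b. b ^ Suc k / real (Suc k)) has_real_derivative (real (Suc k) * b ^ k) / real (Suc k)) (at b)"
      by (rule derivative_eq_intros refl | simp)+
    thus "((\<lambda>b. b ^ Suc k / real (Suc k)) has_vector_derivative b ^ k) (at b within {0..1})"
      by (simp add: has_real_derivative_iff_has_vector_derivative has_vector_derivative_at_within del: of_nat_Suc power_Suc)
  qed simp
  thus ?thesis by (simp add: integral_unique)
qed

text \<open>The exact value is m! / ((k + 1) ... (k + m + 1)); only positivity and the decay of
  order m + 1 in k are retained.\<close>

lemma beta_integral_le:
  "0 < integral {0..1} (\<lambda>b::real. (1 - b) ^ m * b ^ k) \<and>
   integral {0..1} (\<lambda>b::real. (1 - b) ^ m * b ^ k) \<le> fact m / real (Suc k) ^ Suc m"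
proof (induction m arbitrary: k)
  case 0
  thus ?case by (simp add: beta_integral_0)
next
  case (Suc m)
  let ?J = "integral {0..1} (\<lambda>b::real. (1 - b) ^ m * b ^ Suc k)"
  have "real (Suc m) / real (Suc k) * ?J \<le> real (Suc m) / real (Suc k) * (fact m / real (Suc k) ^ Suc m)"
  proof (intro mult_left_mono)
    have "?J \<le> fact m / real (Suc (Suc k)) ^ Suc m" using Suc[of "Suc k"] by blast
    also have "\<dots> \<le> fact m / real (Suc k) ^ Suc m"
      by (intro divide_left_mono power_mono mult_pos_pos zero_less_power) auto
    finally show "?J \<le> fact m / real (Suc k) ^ Suc m" .
  qed simp
  also have "\<dots> = fact (Suc m) / real (Suc k) ^ Suc (Suc m)"
    by simp
  finally show ?case using Suc[of "Suc k"] unfolding beta_integral_rec by simp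
qed

text \<open>Positivity travels through the recursion: a positive continuous function on [0,1] has a
  positive minimum, so its beta moment of order 0 is positive, and this is the first term of a
  series without negative terms. The value at y = 0 is later divided out in the recursion for the
  determinants.\<close>

lemma moment_fun_pos:
  assumes s: "s > -1" and x: "x \<ge> 0"
  shows "y \<ge> 0 \<Longrightarrow> moment_fun s x m y > 0" and "beta_moment s x m 0 > 0" and "beta_moment s x m k \<ge> 0"
proof -
  have beta: "beta_moment s x m 0 > 0 \<and> (\<forall>k. beta_moment s x m k \<ge> 0)"
    if pos: "\<And>y. y \<ge> 0 \<Longrightarrow> moment_fun s x m y > 0" for m
  proof
    show "\<forall>k. beta_moment s x m k \<ge> 0"
    proof
      fix k
      have "integral {0..1} (\<lambda>b. (1 - b) ^ m * b ^ k * moment_fun s x m (x * b)) \<ge> 0"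
      proof (rule Henstock_Kurzweil_Integration.integral_nonneg)
        fix b :: real assume "b \<in> {0..1}"
        thus "0 \<le> (1 - b) ^ m * b ^ k * moment_fun s x m (x * b)" using pos[of "x * b"] x by simp
      qed (intro integrable_continuous_real continuous_on_beta_integrand)
      thus "beta_moment s x m k \<ge> 0" by (simp add: beta_moment_def)
    qed
    have "\<exists>c\<in>{0..1}. \<forall>b\<in>{0..1}. moment_fun s x m (x * c) \<le> moment_fun s x m (x * b)"
      by (intro continuous_attains_inf continuous_on_compose2[OF continuous_on_moment_fun] continuous_intros) auto
    then obtain c where c: "c \<in> {0..1}" "\<And>b. b \<in> {0..1} \<Longrightarrow> moment_fun s x m (x * c) \<le> moment_fun s x m (x * b)" by auto
    let ?d = "moment_fun s x m (x * c)"
    have d: "?d > 0" using c(1) x by (intro pos) simp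
    have "0 < ?d * integral {0..1} (\<lambda>b::real. (1 - b) ^ m * b ^ 0)"
      using d beta_integral_le[of m 0] by (intro mult_pos_pos) auto
    also have "\<dots> = integral {0..1} (\<lambda>b. (1 - b) ^ m * b ^ 0 * ?d)" by simp
    also have "\<dots> \<le> integral {0..1} (\<lambda>b. (1 - b) ^ m * b ^ 0 * moment_fun s x m (x * b))"
    proof (rule Henstock_Kurzweil_Integration.integral_le)
      show "(\<lambda>b. (1 - b) ^ m * b ^ 0 * ?d) integrable_on {0..1}" by (intro integrable_continuous_real continuous_intros)
      show "(\<lambda>b. (1 - b) ^ m * b ^ 0 * moment_fun s x m (x * b)) integrable_on {0..1}"
        by (intro integrable_continuous_real continuous_on_beta_integrand)
      fix b :: real assume "b \<in> {0..1}"
      thus "(1 - b) ^ m * b ^ 0 * ?d \<le> (1 - b) ^ m * b ^ 0 * moment_fun s x m (x * b)"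
        using c(2)[of b] by (intro mult_left_mono) auto
    qed
    finally show "beta_moment s x m 0 > 0" by (simp add: beta_moment_def)
  qed
  have pos: "moment_fun s x m y > 0" if "y \<ge> 0" for m y
    using that
  proof (induction m arbitrary: y)
    case (0 y)
    have "moment_coeff s x 0 k * y ^ k \<ge> 0" for k
      using s 0 by (auto simp: moment_coeff_def intro!: mult_nonneg_nonneg divide_nonneg_nonneg pochhammer_nonneg)
    hence "(\<Sum>k. moment_coeff s x 0 k * y ^ k) \<ge> (\<Sum>k<1. moment_coeff s x 0 k * y ^ k)"
      by (intro sum_le_suminf summable_moment) auto
    hence "(\<Sum>k. moment_coeff s x 0 k * y ^ k) > 0" by (simp add: moment_coeff_def)
    thus ?case unfolding moment_fun_eq by simp
  next
    case (Suc m y)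
    have b: "beta_moment s x m 0 > 0" "\<And>k. beta_moment s x m k \<ge> 0" using beta[of m] Suc.IH by auto
    have "moment_coeff s x (Suc m) k * y ^ k \<ge> 0" for k
      using s Suc.prems b(2)[of k] by (auto simp: moment_coeff_def intro!: mult_nonneg_nonneg divide_nonneg_nonneg pochhammer_nonneg)
    hence "(\<Sum>k. moment_coeff s x (Suc m) k * y ^ k) \<ge> (\<Sum>k<1. moment_coeff s x (Suc m) k * y ^ k)"
      by (intro sum_le_suminf summable_moment) auto
    hence "(\<Sum>k. moment_coeff s x (Suc m) k * y ^ k) > 0" using b by (simp add: moment_coeff_def)
    thus ?case unfolding moment_fun_eq by simp
  qed
  show "y \<ge> 0 \<Longrightarrow> moment_fun s x m y > 0" by (rule pos)
  show "beta_moment s x m 0 > 0" "beta_moment s x m k \<ge> 0" using beta[of m] pos by auto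
qed

lemma moment_fun_Suc_0: "moment_fun s x (Suc m) 0 = beta_moment s x m 0"
  unfolding moment_fun_eq using sums_unique[OF powser_sums_zero[of "moment_coeff s x (Suc m)"]]
  by (simp add: moment_coeff_def)

lemma moment_fun_0_0: "moment_fun s x 0 0 = 1"
  unfolding moment_fun_eq using sums_unique[OF powser_sums_zero[of "moment_coeff s x 0"]]
  by (simp add: moment_coeff_def)

lemma moment_fun_0_symbol_coeff: "moment_fun s x 0 y = symbol_coeff s 0 y"
  using kummer_symbol_coeff[of y s] by (simp add: moment_fun.simps)

text \<open>The decay of order m + 1 in k is what limits the degree of the polynomial found in
  \<open>moment_fun_in_span\<close>; boundedness would not be enough there.\<close>

lemma beta_moment_le:
  obtains B where "B \<ge> 0" "\<And>k. \<bar>beta_moment s x m k\<bar> * real (Suc k) ^ Suc m \<le> B"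
proof -
  have c1: "continuous_on {0..1} (\<lambda>b. moment_fun s x m (x * b))"
    by (intro continuous_on_compose2[OF continuous_on_moment_fun] continuous_intros) auto
  have "compact ((\<lambda>b. moment_fun s x m (x * b)) ` {0..1})"
    using c1 by (rule compact_continuous_image) simp
  then obtain B where B: "\<And>b. b \<in> {0..1} \<Longrightarrow> \<bar>moment_fun s x m (x * b)\<bar> \<le> B"
    using compact_imp_bounded[of "(\<lambda>b. moment_fun s x m (x * b)) ` {0..1}"] unfolding bounded_iff
    by (metis image_eqI real_norm_def)
  have B0: "B \<ge> 0" using B[of 0] by auto
  have "\<bar>beta_moment s x m k\<bar> * real (Suc k) ^ Suc m \<le> real (Suc m) * (B * fact m)" for k
  proof -
    have "norm (integral {0..1} (\<lambda>b. (1 - b) ^ m * b ^ k * moment_fun s x m (x * b))) \<le> integral {0..1} (\<lambda>b. (1 - b) ^ m * b ^ k * B)"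
    proof (rule Henstock_Kurzweil_Integration.integral_norm_bound_integral)
      fix b :: real assume b: "b \<in> {0..1}"
      thus "norm ((1 - b) ^ m * b ^ k * moment_fun s x m (x * b)) \<le> (1 - b) ^ m * b ^ k * B"
        using B[OF b] by (simp add: abs_mult mult_left_mono)
    qed (intro integrable_continuous_real continuous_on_beta_integrand continuous_intros)+
    also have "\<dots> = B * integral {0..1} (\<lambda>b. (1 - b) ^ m * b ^ k)" by (simp add: mult.commute)
    also have "\<dots> \<le> B * (fact m / real (Suc k) ^ Suc m)"
      using beta_integral_le[of m k] B0 by (intro mult_left_mono) auto
    finally have "\<bar>beta_moment s x m k\<bar> \<le> real (Suc m) * (B * (fact m / real (Suc k) ^ Suc m))"
      unfolding beta_moment_def abs_mult by (intro mult_mono) auto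
    hence "\<bar>beta_moment s x m k\<bar> * real (Suc k) ^ Suc m \<le> real (Suc m) * (B * (fact m / real (Suc k) ^ Suc m)) * real (Suc k) ^ Suc m"
      by (intro mult_right_mono) auto
    also have "\<dots> = real (Suc m) * (B * fact m)"
      by (simp del: power_Suc of_nat_Suc)
    finally show ?thesis .
  qed
  thus ?thesis using B0 by (intro that[of "real (Suc m) * (B * fact m)"]) auto
qed

text \<open>The effect on the normalised power series coefficients of a function of multiplying it by one
  factor \<open>1 - y / x\<close>.\<close>

definition shift_op :: "real \<Rightarrow> real \<Rightarrow> (nat \<Rightarrow> real) \<Rightarrow> nat \<Rightarrow> real" where
  "shift_op x a u k = (a + real k) * u k - (real k)\<^sup>2 * u (k - 1) / x"

section \<open>Multiplication by powers of 1 - y / x on power series coefficients\<close>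

primrec iter_shift :: "real \<Rightarrow> real \<Rightarrow> nat \<Rightarrow> (nat \<Rightarrow> real) \<Rightarrow> nat \<Rightarrow> real" where
  "iter_shift x a 0 u = u"
| "iter_shift x a (Suc j) u = iter_shift x a j (shift_op x (a + real j) u)"

text \<open>The two operators differ by a - b times the identity.\<close>

lemma shift_op_commute: "shift_op x a (shift_op x b u) = shift_op x b (shift_op x a u)"
  by (rule ext) (simp add: shift_op_def algebra_simps diff_divide_distrib add_divide_distrib)

lemma shift_op_sum: "shift_op x a (\<lambda>k. \<Sum>i\<in>I. c i * u i k) = (\<lambda>k. \<Sum>i\<in>I. c i * shift_op x a (u i) k)"
  by (rule ext) (simp add: shift_op_def sum_distrib_left sum_divide_distrib sum_subtractf[symmetric] algebra_simps)

lemma iter_shift_sum: "iter_shift x a j (\<lambda>k. \<Sum>i\<in>I. c i * u i k) = (\<lambda>k. \<Sum>i\<in>I. c i * iter_shift x a j (u i) k)"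
  by (induction j arbitrary: u) (simp_all add: shift_op_sum)

definition poly_seq :: "(nat \<Rightarrow> real) \<Rightarrow> bool" where
  "poly_seq u \<longleftrightarrow> (\<exists>p. \<forall>k. u k = poly p (real k))"

lemma poly_seq_shift_op:
  assumes "poly_seq u"
  shows "poly_seq (shift_op x a u)"
proof -
  obtain p where p: "\<And>k. u k = poly p (real k)" using assms by (auto simp: poly_seq_def)
  \<comment> \<open>At k = 0 the natural number k - 1 is again 0, whereas the polynomial is
    evaluated at -1; the factor k^2 removes the discrepancy.\<close>
  have "shift_op x a u k = poly ([:a, 1:] * p - Polynomial.smult (1 / x) ([:0, 0, 1:] * pcompose p [:-1, 1:])) (real k)" for k
  proof (cases k)
    case 0 thus ?thesis by (simp add: shift_op_def p)
  next
    case (Suc j)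
    have "poly (pcompose p [:-1, 1:]) (real k) = poly p (real j)" by (simp add: poly_pcompose Suc)
    thus ?thesis by (simp add: shift_op_def p Suc power2_eq_square algebra_simps)
  qed
  thus ?thesis unfolding poly_seq_def by blast
qed

lemma poly_seq_iter_shift: "poly_seq u \<Longrightarrow> poly_seq (iter_shift x a j u)"
  by (induction j arbitrary: u) (simp_all add: poly_seq_shift_op)

text \<open>By commutation the factor with parameter a + i may be applied first. Once it has
  produced a polynomial sequence, the remaining factors keep it polynomial.\<close>

lemma poly_seq_iter_shift_factor:
  assumes "i < j" "poly_seq (shift_op x (a + real i) u)"
  shows "poly_seq (iter_shift x a j u)"
  using assms
proof (induction j arbitrary: u)
  case (Suc j)
  show ?case
  proof (cases "i = j")
    case True thus ?thesis using Suc.prems by (simp add: poly_seq_iter_shift)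
  next
    case False
    hence "poly_seq (shift_op x (a + real i) (shift_op x (a + real j) u))"
      using Suc.prems poly_seq_shift_op by (subst shift_op_commute) blast
    thus ?thesis using Suc.IH[of "shift_op x (a + real j) u"] False Suc.prems by simp
  qed
qed simp

lemma poly_seq_sum: "(\<And>i. i \<in> I \<Longrightarrow> poly_seq (u i)) \<Longrightarrow> poly_seq (\<lambda>k. \<Sum>i\<in>I. c i * u i k)"
proof -
  assume "\<And>i. i \<in> I \<Longrightarrow> poly_seq (u i)"
  then obtain p where "\<And>i k. i \<in> I \<Longrightarrow> u i k = poly (p i) (real k)" unfolding poly_seq_def by metis
  hence "(\<Sum>i\<in>I. c i * u i k) = poly (\<Sum>i\<in>I. Polynomial.smult (c i) (p i)) (real k)" for k by (simp add: poly_sum)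
  thus ?thesis unfolding poly_seq_def by blast
qed

text \<open>One application costs two powers of k, on account of the coefficient k^2.\<close>

lemma shift_op_growth:
  assumes x: "x > 0" and u: "\<And>k. \<bar>u k\<bar> * real (Suc k) ^ n \<le> B * real (Suc k) ^ d"
  shows "\<exists>B'. \<forall>k. \<bar>shift_op x a u k\<bar> * real (Suc k) ^ n \<le> B' * real (Suc k) ^ (d + 2)"
proof -
  have "\<bar>u 0\<bar> \<le> B" using u[of 0] by simp
  hence B0: "B \<ge> 0" using abs_ge_zero[of "u 0"] by linarith
  define B' where "B' = B * (\<bar>a\<bar> + 1) + B * 2 ^ n / x"
  have "\<bar>shift_op x a u k\<bar> * real (Suc k) ^ n \<le> B' * real (Suc k) ^ (d + 2)" for k
  proof -
    have t1: "\<bar>(a + real k) * u k\<bar> * real (Suc k) ^ n \<le> B * (\<bar>a\<bar> + 1) * real (Suc k) ^ (d + 2)"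
    proof -
      have "\<bar>a + real k\<bar> \<le> \<bar>a\<bar> + real k" by simp
      also have "\<dots> \<le> (\<bar>a\<bar> + 1) * real (Suc k)" by (simp add: algebra_simps)
      also have "\<dots> \<le> (\<bar>a\<bar> + 1) * real (Suc k) ^ 2"
        by (intro mult_left_mono self_le_power) auto
      finally have X: "\<bar>a + real k\<bar> \<le> (\<bar>a\<bar> + 1) * real (Suc k) ^ 2" .
      have "\<bar>a + real k\<bar> * (\<bar>u k\<bar> * real (Suc k) ^ n) \<le> ((\<bar>a\<bar> + 1) * real (Suc k) ^ 2) * (B * real (Suc k) ^ d)"
        by (rule mult_mono[OF X u]) auto
      thus ?thesis by (simp add: abs_mult power_add power2_eq_square mult_ac)
    qed
    have t2: "\<bar>(real k)\<^sup>2 * u (k - 1) / x\<bar> * real (Suc k) ^ n \<le> B * 2 ^ n / x * real (Suc k) ^ (d + 2)"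
    proof (cases k)
      case 0 thus ?thesis using B0 x by simp
    next
      case (Suc j)
      have "real (Suc k) ^ n \<le> (2 * real k) ^ n" using Suc by (intro power_mono) auto
      hence "\<bar>u j\<bar> * real (Suc k) ^ n \<le> \<bar>u j\<bar> * (2 * real k) ^ n" by (intro mult_left_mono) auto
      also have "\<dots> = 2 ^ n * (\<bar>u j\<bar> * real (Suc j) ^ n)" by (simp only: Suc power_mult_distrib mult_ac)
      also have "\<dots> \<le> 2 ^ n * (B * real (Suc j) ^ d)" using u[of j] by (intro mult_left_mono) auto
      also have "\<dots> \<le> 2 ^ n * (B * real (Suc k) ^ d)" using B0 Suc by (intro mult_left_mono power_mono) auto
      finally have X: "\<bar>u j\<bar> * real (Suc k) ^ n \<le> 2 ^ n * (B * real (Suc k) ^ d)" .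
      have "(real k)\<^sup>2 * (\<bar>u j\<bar> * real (Suc k) ^ n) \<le> (real (Suc k))\<^sup>2 * (2 ^ n * (B * real (Suc k) ^ d))"
        by (rule mult_mono[OF _ X]) auto
      hence "(real k)\<^sup>2 * (\<bar>u j\<bar> * real (Suc k) ^ n) / x \<le> (real (Suc k))\<^sup>2 * (2 ^ n * (B * real (Suc k) ^ d)) / x"
        using x by (intro divide_right_mono) auto
      moreover have "u (k - 1) = u j" using Suc by simp
      ultimately show ?thesis using x by (simp only: abs_mult abs_divide power_add) (simp add: mult_ac)
    qed
    have "\<bar>shift_op x a u k\<bar> * real (Suc k) ^ n \<le> (\<bar>(a + real k) * u k\<bar> + \<bar>(real k)\<^sup>2 * u (k - 1) / x\<bar>) * real (Suc k) ^ n"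
      unfolding shift_op_def by (intro mult_right_mono abs_triangle_ineq4) auto
    also have "\<dots> \<le> B' * real (Suc k) ^ (d + 2)" using t1 t2 by (simp add: B'_def distrib_right)
    finally show ?thesis .
  qed
  thus ?thesis by blast
qed

lemma iter_shift_growth:
  assumes x: "x > 0" and u: "\<And>k. \<bar>u k\<bar> * real (Suc k) ^ n \<le> B * real (Suc k) ^ d"
  shows "\<exists>B'. \<forall>k. \<bar>iter_shift x a j u k\<bar> * real (Suc k) ^ n \<le> B' * real (Suc k) ^ (d + 2 * j)"
  using u
proof (induction j arbitrary: u B d)
  case (Suc j)
  obtain B' where "\<And>k. \<bar>shift_op x (a + real j) u k\<bar> * real (Suc k) ^ n \<le> B' * real (Suc k) ^ (d + 2)"
    using shift_op_growth[OF x Suc.prems] by blast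
  from Suc.IH[OF this] show ?case by (simp add: algebra_simps)
qed auto

text \<open>A polynomial of larger degree would eventually exceed every multiple of (k + 1)^n,
  already along the integers.\<close>

lemma degree_le_of_growth:
  fixes p :: "real poly"
  assumes "\<And>k::nat. \<bar>poly p (real k)\<bar> \<le> B * real (Suc k) ^ n"
  shows "degree p \<le> n"
proof (rule ccontr)
  assume "\<not> degree p \<le> n"
  hence d: "n < degree p" by simp
  let ?q = "[:1, 1:] ^ n :: real poly"
  have "degree ?q = n" by (simp add: degree_power_eq)
  hence "LIM t at_top. poly ?q t / poly p t :> nhds 0"
    by (intro filterlim_mono[OF poly_divide_tendsto_0_at_infinity order_refl at_top_le_at_infinity]) (use d in auto)
  hence lim: "((\<lambda>k. poly ?q (real k) / poly p (real k)) \<longlongrightarrow> 0) sequentially"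
    by (rule filterlim_compose[OF _ filterlim_real_sequentially])
  have B: "B \<ge> 0" using assms[of 0] by (auto intro: order_trans[OF abs_ge_zero])
  hence "eventually (\<lambda>k. \<bar>poly ?q (real k) / poly p (real k)\<bar> < 1 / (B + 1)) sequentially"
    using lim by (auto simp: tendsto_iff dist_real_def)
  moreover have "eventually (\<lambda>k. poly p (real k) \<noteq> 0) sequentially"
  proof -
    have "finite {t. poly p t = 0}" using d by (intro poly_roots_finite) auto
    hence "finite (real -` {t. poly p t = 0})" by (rule finite_vimageI) (simp add: inj_on_def)
    then obtain K where "\<And>k. k \<in> real -` {t. poly p t = 0} \<Longrightarrow> k < K"
      unfolding finite_nat_set_iff_bounded by auto
    hence "eventually (\<lambda>k. k \<notin> real -` {t. poly p t = 0}) sequentially"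
      unfolding eventually_sequentially by (intro exI[of _ K]) force
    thus ?thesis by simp
  qed
  ultimately have "eventually (\<lambda>k::nat. False) sequentially"
  proof eventually_elim
    case (elim k)
    have "poly ?q (real k) = real (Suc k) ^ n" by (simp add: poly_power)
    hence "real (Suc k) ^ n / \<bar>poly p (real k)\<bar> < 1 / (B + 1)" using elim by (simp add: abs_divide)
    hence "real (Suc k) ^ n * (B + 1) < \<bar>poly p (real k)\<bar>" using elim B by (simp add: field_simps)
    also have "\<dots> \<le> B * real (Suc k) ^ n" by (rule assms)
    finally have "real (Suc k) ^ n < 0" by (simp add: algebra_simps)
    thus False by (simp add: not_less[symmetric])
  qed
  thus False by simp
qed

text \<open>Rising factorials in a + t are the right basis because (a)_k (a + k)_i = (a)_i (a +
  i)_k: each basis element turns a hypergeometric series with parameter a into one with parameter a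
  + i.\<close>

lemma poly_as_pochhammer_sum:
  fixes p :: "real poly"
  assumes "degree p \<le> n"
  shows "\<exists>d. \<forall>t. poly p t = (\<Sum>i\<le>n. d i * pochhammer (a + t) i)"
  using assms
proof (induction n arbitrary: p)
  case 0
  then obtain c where "p = [:c:]" by (metis degree_eq_zeroE le_zero_eq)
  thus ?case by (intro exI[of _ "\<lambda>_. c"]) simp
next
  case (Suc n)
  define q where "q = (\<Prod>j<Suc n. [:a + real j, 1:])"
  have qd: "degree q = Suc n" unfolding q_def by (subst degree_prod_eq_sum_degree) auto
  have ql: "lead_coeff q = 1" unfolding q_def by (simp only: lead_coeff_prod) (rule prod.neutral, simp)
  have qp: "poly q t = pochhammer (a + t) (Suc n)" for t
    by (simp add: q_def poly_prod pochhammer_prod lessThan_atLeast0 algebra_simps)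
  define c where "c = coeff p (Suc n)"
  have "degree (p - Polynomial.smult c q) \<le> n"
  proof (rule degree_le, intro allI impI)
    fix i assume i: "n < i"
    show "coeff (p - Polynomial.smult c q) i = 0"
    proof (cases "i = Suc n")
      case True
      thus ?thesis using ql qd by (simp add: c_def)
    next
      case False
      hence "i > Suc n" using i by simp
      thus ?thesis using Suc.prems qd by (simp add: coeff_eq_0)
    qed
  qed
  then obtain d where d: "\<And>t. poly (p - Polynomial.smult c q) t = (\<Sum>i\<le>n. d i * pochhammer (a + t) i)" using Suc.IH by blast
  have "poly p t = (\<Sum>i\<le>Suc n. (d(Suc n := c)) i * pochhammer (a + t) i)" for t
  proof -
    have "poly p t = poly (p - Polynomial.smult c q) t + c * pochhammer (a + t) (Suc n)" by (simp add: qp)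
    also have "\<dots> = (\<Sum>i\<le>n. (d(Suc n := c)) i * pochhammer (a + t) i) + c * pochhammer (a + t) (Suc n)" unfolding d by simp
    finally show ?thesis by simp
  qed
  thus ?case by blast
qed

text \<open>Since a (a + 1)_k = (a)_k (a + k), the factor a (1 - y / x) lowers the hypergeometric
  parameter from a + 1 to a, and \<open>shift_op\<close> is what it does to the rest of the
  coefficient.\<close>

lemma mult_one_minus_series:
  fixes y :: real
  assumes x: "x \<noteq> 0" and a: "a \<noteq> 0"
    and sm: "summable (\<lambda>k. pochhammer (a + 1) k / (fact k)\<^sup>2 * u k * y ^ k)"
  shows "(\<lambda>k. pochhammer a k / (fact k)\<^sup>2 * shift_op x a u k * y ^ k) sums
     (a * (1 - y / x) * (\<Sum>k. pochhammer (a + 1) k / (fact k)\<^sup>2 * u k * y ^ k))"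
proof -
  let ?f = "\<lambda>k. pochhammer (a + 1) k / (fact k)\<^sup>2 * u k * y ^ k"
  let ?F = "\<Sum>k. ?f k"
  define g where "g k = (case k of 0 \<Rightarrow> 0 | Suc j \<Rightarrow> y / x * ?f j)" for k
  have f: "?f sums ?F" using sm by (rule summable_sums)
  have "(\<lambda>k. g (Suc k)) sums (y / x * ?F)" unfolding g_def by (simp del: times_divide_eq_left add: sums_mult[OF f])
  hence g: "g sums (y / x * ?F)" by (subst (asm) sums_Suc_iff) (simp add: g_def)
  have "(\<lambda>k. a * (?f k - g k)) sums (a * (?F - y / x * ?F))" by (intro sums_mult sums_diff f g)
  also have "(\<lambda>k. a * (?f k - g k)) = (\<lambda>k. pochhammer a k / (fact k)\<^sup>2 * shift_op x a u k * y ^ k)"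
  proof
    fix k
    show "a * (?f k - g k) = pochhammer a k / (fact k)\<^sup>2 * shift_op x a u k * y ^ k"
    proof (cases k)
      case 0 thus ?thesis by (simp add: g_def shift_op_def)
    next
      case (Suc j)
      let ?P = "pochhammer (a + 1) j"
      have p1: "pochhammer a (Suc j) = a * ?P" by (rule pochhammer_rec)
      have p2: "pochhammer (a + 1) (Suc j) = ?P * (a + real (Suc j))" by (simp add: pochhammer_Suc algebra_simps)
      have ff: "(fact (Suc j))\<^sup>2 = (real (Suc j))\<^sup>2 * (fact j)\<^sup>2" by (simp add: power_mult_distrib)
      have nz: "real (Suc j) \<noteq> 0" "fact j \<noteq> (0::real)" by auto
      have "a * (?P * (a + real (Suc j)) / ((real (Suc j))\<^sup>2 * (fact j)\<^sup>2) * u (Suc j) * y ^ Suc j - y / x * (?P / (fact j)\<^sup>2 * u j * y ^ j))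
        = a * ?P / ((real (Suc j))\<^sup>2 * (fact j)\<^sup>2) * ((a + real (Suc j)) * u (Suc j) - (real (Suc j))\<^sup>2 * u j / x) * y ^ Suc j"
        using nz x by (simp add: divide_simps del: of_nat_Suc) (simp add: algebra_simps del: of_nat_Suc)
      thus ?thesis unfolding Suc g_def shift_op_def p1 p2 ff by simp
    qed
  qed
  also have "a * (?F - y / x * ?F) = a * (1 - y / x) * ?F" by (simp add: algebra_simps)
  finally show ?thesis .
qed

text \<open>The parameter descends from a + n to a one unit at a time, which is why
  \<open>iter_shift\<close> applies the operator with the largest parameter first.\<close>

lemma mult_one_minus_power_series:
  fixes y :: real
  assumes x: "x \<noteq> 0" and a: "a > 0"
    and sm: "summable (\<lambda>k. pochhammer (a + real n) k / (fact k)\<^sup>2 * u k * y ^ k)"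
  shows "(\<lambda>k. pochhammer a k / (fact k)\<^sup>2 * iter_shift x a n u k * y ^ k) sums
     (pochhammer a n * (1 - y / x) ^ n * (\<Sum>k. pochhammer (a + real n) k / (fact k)\<^sup>2 * u k * y ^ k))"
  using sm
proof (induction n arbitrary: u)
  case 0
  thus ?case by (simp add: summable_sums)
next
  case (Suc n)
  have e: "a + real n + 1 = a + real (Suc n)" by simp
  have n0: "a + real n \<noteq> 0" using a by linarith
  have *: "(\<lambda>k. pochhammer (a + real n) k / (fact k)\<^sup>2 * shift_op x (a + real n) u k * y ^ k) sums
     ((a + real n) * (1 - y / x) * (\<Sum>k. pochhammer (a + real (Suc n)) k / (fact k)\<^sup>2 * u k * y ^ k))"
    using mult_one_minus_series[of x "a + real n" u y, OF x n0] Suc.prems unfolding e by blast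
  have "(\<lambda>k. pochhammer a k / (fact k)\<^sup>2 * iter_shift x a (Suc n) u k * y ^ k) sums
     (pochhammer a n * (1 - y / x) ^ n * (\<Sum>k. pochhammer (a + real n) k / (fact k)\<^sup>2 * shift_op x (a + real n) u k * y ^ k))"
    using Suc.IH[OF sums_summable[OF *]] by simp
  also have "(\<Sum>k. pochhammer (a + real n) k / (fact k)\<^sup>2 * shift_op x (a + real n) u k * y ^ k) =
     (a + real n) * (1 - y / x) * (\<Sum>k. pochhammer (a + real (Suc n)) k / (fact k)\<^sup>2 * u k * y ^ k)"
    using * by (rule sums_unique[symmetric])
  finally show ?case by (simp add: pochhammer_Suc mult_ac)
qed

text \<open>Integrated against powers of b, Kummer's equation says that the operator turns these
  moments into boundary terms at b = 1, and these are of degree at most one in k.\<close>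

lemma poly_seq_shift_op_integral:
  fixes x :: real
  assumes x: "x \<noteq> 0"
  shows "poly_seq (shift_op x (s + 1) (\<lambda>k. integral {0..1} (\<lambda>b. b ^ k * symbol_coeff s 0 (x * b))))"
proof -
  let ?f = "symbol_coeff s 0" and ?f1 = "symbol_coeff s (-1)" and ?f2 = "symbol_coeff s (-2)"
  have d0: "(?f has_field_derivative ?f1 t) (at t)" for t using symbol_coeff_deriv[of s 0 t] by simp
  have d1: "(?f1 has_field_derivative ?f2 t) (at t)" for t using symbol_coeff_deriv[of s "-1" t] by simp
  have cf: "continuous_on {0..1} (\<lambda>b. ?f (x * b))"
    by (intro continuous_intros)
  have eq: "shift_op x (s + 1) (\<lambda>k. integral {0..1} (\<lambda>b. b ^ k * ?f (x * b))) k = ?f x + ?f1 x - real k / x * ?f x" for k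
  proof -
    \<comment> \<open>This primitive is found by integrating by parts: once Kummer's equation at x b
      is inserted, its derivative is the integrand of the shifted moments. It vanishes at b = 0, for
      k = 0 thanks to the factor k / x.\<close>
    define G where "G b = b ^ Suc k * (?f (x * b) + ?f1 (x * b)) - real k / x * b ^ k * ?f (x * b)" for b
    let ?g = "\<lambda>b. (s + 1 + real k) * (b ^ k * ?f (x * b)) - (real k)\<^sup>2 / x * (b ^ (k - 1) * ?f (x * b))"
    have "(?g has_integral (G 1 - G 0)) {0..1}"
    proof (rule fundamental_theorem_of_calculus)
      fix b :: real
      have e0: "((\<lambda>b. ?f (x * b)) has_real_derivative ?f1 (x * b) * x) (at b)"
        by (rule DERIV_chain'[OF _ d0]) (rule derivative_eq_intros refl | simp)+
      have e1: "((\<lambda>b. ?f1 (x * b)) has_real_derivative ?f2 (x * b) * x) (at b)"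
        by (rule DERIV_chain'[OF _ d1]) (rule derivative_eq_intros refl | simp)+
      have "(G has_real_derivative (real (Suc k) * b ^ k) * (?f (x * b) + ?f1 (x * b)) + b ^ Suc k * (?f1 (x * b) * x + ?f2 (x * b) * x)
          - (real k / x * (real k * b ^ (k - 1)) * ?f (x * b) + real k / x * b ^ k * (?f1 (x * b) * x))) (at b)"
        unfolding G_def by (rule derivative_eq_intros e0 e1 refl | simp)+
      also have "(real (Suc k) * b ^ k) * (?f (x * b) + ?f1 (x * b)) + b ^ Suc k * (?f1 (x * b) * x + ?f2 (x * b) * x)
          - (real k / x * (real k * b ^ (k - 1)) * ?f (x * b) + real k / x * b ^ k * (?f1 (x * b) * x)) = ?g b"
      proof -
        have ode: "x * b * ?f2 (x * b) + (1 + x * b) * ?f1 (x * b) = s * ?f (x * b)" by (rule symbol_coeff_ode)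
        have "(real (Suc k) * b ^ k) * (?f (x * b) + ?f1 (x * b)) + b ^ Suc k * (?f1 (x * b) * x + ?f2 (x * b) * x)
          - (real k / x * (real k * b ^ (k - 1)) * ?f (x * b) + real k / x * b ^ k * (?f1 (x * b) * x))
          = real (Suc k) * b ^ k * ?f (x * b) + b ^ k * (x * b * ?f2 (x * b) + (1 + x * b) * ?f1 (x * b)) - (real k)\<^sup>2 / x * (b ^ (k - 1) * ?f (x * b))"
          using x by (simp add: algebra_simps power2_eq_square)
        thus ?thesis unfolding ode by (simp add: algebra_simps)
      qed
      finally show "(G has_vector_derivative ?g b) (at b within {0..1})"
        by (simp add: has_real_derivative_iff_has_vector_derivative has_vector_derivative_at_within)
    qed simp
    hence "integral {0..1} ?g = G 1 - G 0" by (rule integral_unique)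
    also have "G 1 - G 0 = ?f x + ?f1 x - real k / x * ?f x" by (cases k) (auto simp: G_def)
    also have "integral {0..1} ?g = integral {0..1} (\<lambda>b. (s + 1 + real k) * (b ^ k * ?f (x * b))) - integral {0..1} (\<lambda>b. (real k)\<^sup>2 / x * (b ^ (k - 1) * ?f (x * b)))"
      by (intro Henstock_Kurzweil_Integration.integral_diff integrable_continuous_real continuous_intros cf)
    also have "\<dots> = shift_op x (s + 1) (\<lambda>k. integral {0..1} (\<lambda>b. b ^ k * ?f (x * b))) k"
      by (simp add: shift_op_def)
    finally show ?thesis .
  qed
  have "?f x + ?f1 x - real k / x * ?f x = poly [:?f x + ?f1 x, - ?f x / x:] (real k)" for k by simp
  thus ?thesis unfolding poly_seq_def eq by blast
qed

text \<open>Induction on m. The weight (1 - b)^m of the beta moments equals (1 - y / x)^m at y = x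
  b, so they are combinations of moments of m + 1 confluent functions. With n = m + 1, the n shift
  operators make each of these polynomial in k. The beta moments decay like k^(-n) and the operators
  gain at most k^(2 n), so the degree is at most n, and expansion in rising factorials returns n + 1
  confluent functions.\<close>

lemma moment_fun_in_span:
  assumes s: "s > -1" and x: "x > 0"
  shows "\<exists>c. \<forall>y. (1 - y / x) ^ m * moment_fun s x m y = (\<Sum>i<Suc m. c i * symbol_coeff (s + real i) 0 y)"
proof (induction m)
  case 0
  show ?case by (rule exI[of _ "\<lambda>_. 1"]) (simp only: moment_fun_0_symbol_coeff, simp)
next
  case (Suc m)
  then obtain c where c: "\<And>y. (1 - y / x) ^ m * moment_fun s x m y = (\<Sum>i<Suc m. c i * symbol_coeff (s + real i) 0 y)" by blast
  define n where "n = Suc m"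
  let ?a = "s + 1"
  define v where "v i k = integral {0..1} (\<lambda>b. b ^ k * symbol_coeff (s + real i) 0 (x * b))" for i k
  let ?u = "beta_moment s x m"
  have cont: "continuous_on {0..1} (\<lambda>b. symbol_coeff r 0 (x * b))" for r
    by (intro continuous_intros)
  have u: "?u k = (\<Sum>i<n. (real n * c i) * v i k)" for k
  proof -
    have "(1 - b) ^ m * b ^ k * moment_fun s x m (x * b) = (\<Sum>i<n. c i * (b ^ k * symbol_coeff (s + real i) 0 (x * b)))" for b
    proof -
      have "(1 - b) ^ m * b ^ k * moment_fun s x m (x * b) = b ^ k * ((1 - x * b / x) ^ m * moment_fun s x m (x * b))"
        using x by simp
      also have "\<dots> = (\<Sum>i<n. c i * (b ^ k * symbol_coeff (s + real i) 0 (x * b)))"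
        unfolding c n_def by (simp add: sum_distrib_left mult_ac del: sum.lessThan_Suc)
      finally show ?thesis .
    qed
    hence "?u k = real n * integral {0..1} (\<lambda>b. \<Sum>i<n. c i * (b ^ k * symbol_coeff (s + real i) 0 (x * b)))"
      by (simp add: beta_moment_def n_def)
    also have "integral {0..1} (\<lambda>b. \<Sum>i<n. c i * (b ^ k * symbol_coeff (s + real i) 0 (x * b))) = (\<Sum>i<n. integral {0..1} (\<lambda>b. c i * (b ^ k * symbol_coeff (s + real i) 0 (x * b))))"
      by (rule Henstock_Kurzweil_Integration.integral_sum) (auto intro!: integrable_continuous_real continuous_intros cont)
    finally show ?thesis by (simp add: v_def sum_distrib_left mult_ac)
  qed
  \<comment> \<open>Among the n commuting operators the one with parameter s + 1 + i is adapted to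
    Kummer's equation with exponent s + i.\<close>
  have "poly_seq (iter_shift x ?a n (v i))" if "i < n" for i
    using poly_seq_shift_op_integral[of x "s + real i"] x that
    by (intro poly_seq_iter_shift_factor[of i]) (simp_all add: v_def[abs_def] add_ac)
  hence "poly_seq (\<lambda>k. \<Sum>i<n. (real n * c i) * iter_shift x ?a n (v i) k)" by (intro poly_seq_sum) auto
  hence "poly_seq (iter_shift x ?a n (\<lambda>k. \<Sum>i<n. (real n * c i) * v i k))" by (simp add: iter_shift_sum)
  moreover have "(\<lambda>k. \<Sum>i<n. (real n * c i) * v i k) = ?u" using u by auto
  ultimately obtain p where p: "\<And>k. iter_shift x ?a n ?u k = poly p (real k)" by (auto simp: poly_seq_def)
  obtain B where "\<And>k. \<bar>?u k\<bar> * real (Suc k) ^ n \<le> B" using beta_moment_le[of s x m] by (auto simp: n_def)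
  hence "\<And>k. \<bar>?u k\<bar> * real (Suc k) ^ n \<le> B * real (Suc k) ^ 0" by simp
  from iter_shift_growth[OF x this, of ?a n] obtain B' where
    B': "\<And>k. \<bar>iter_shift x ?a n ?u k\<bar> * real (Suc k) ^ n \<le> B' * real (Suc k) ^ (0 + 2 * n)" by blast
  have "\<bar>poly p (real k)\<bar> \<le> B' * real (Suc k) ^ n" for k
  proof -
    have "\<bar>poly p (real k)\<bar> * real (Suc k) ^ n \<le> (B' * real (Suc k) ^ n) * real (Suc k) ^ n"
      using B'[of k] unfolding p by (simp add: mult_2 power_add mult.assoc del: of_nat_Suc)
    thus ?thesis by (simp del: of_nat_Suc)
  qed
  hence "degree p \<le> n" by (rule degree_le_of_growth)
  then obtain d where d: "\<And>t. poly p t = (\<Sum>i\<le>n. d i * pochhammer (?a + t) i)" using poly_as_pochhammer_sum by blast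
  have an: "pochhammer ?a n > 0" using s by (intro pochhammer_pos) simp
  define e where "e i = d i * pochhammer ?a i / pochhammer ?a n" for i
  have "(1 - y / x) ^ n * moment_fun s x n y = (\<Sum>i<Suc n. e i * symbol_coeff (s + real i) 0 y)" for y
  proof -
    have mc: "moment_coeff s x n k * y ^ k = pochhammer (?a + real n) k / (fact k)\<^sup>2 * ?u k * y ^ k" for k
      by (simp add: moment_coeff_def n_def)
    have "summable (\<lambda>k. pochhammer (?a + real n) k / (fact k)\<^sup>2 * ?u k * y ^ k)"
      using summable_moment[of s x n y] unfolding mc .
    from mult_one_minus_power_series[OF _ _ this, of x] x s
    have A: "(\<lambda>k. pochhammer ?a k / (fact k)\<^sup>2 * iter_shift x ?a n ?u k * y ^ k) sums
       (pochhammer ?a n * (1 - y / x) ^ n * (\<Sum>k. moment_coeff s x n k * y ^ k))"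
      unfolding mc by simp
    have E: "(\<lambda>k. pochhammer ?a k / (fact k)\<^sup>2 * iter_shift x ?a n ?u k * y ^ k) =
       (\<lambda>k. \<Sum>i\<le>n. d i * pochhammer ?a i * (pochhammer (s + real i + 1) k / (fact k)\<^sup>2 * y ^ k))"
    proof
      fix k
      \<comment> \<open>Both sides are the rising factorial of length k + i, split in the two
        possible orders.\<close>
      have "pochhammer ?a k * pochhammer (?a + real k) i = pochhammer ?a i * pochhammer (s + real i + 1) k" for i
        using pochhammer_product'[of ?a k i] pochhammer_product'[of ?a i k] by (simp add: add_ac)
      hence h: "pochhammer ?a k * (d i * pochhammer (?a + real k) i) = d i * pochhammer ?a i * pochhammer (s + real i + 1) k" for i
        by (metis mult.assoc mult.left_commute)
      show "pochhammer ?a k / (fact k)\<^sup>2 * iter_shift x ?a n ?u k * y ^ k = (\<Sum>i\<le>n. d i * pochhammer ?a i * (pochhammer (s + real i + 1) k / (fact k)\<^sup>2 * y ^ k))"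
        unfolding p d sum_distrib_left sum_distrib_right
      proof (rule sum.cong[OF refl])
        fix i
        have "pochhammer ?a k / (fact k)\<^sup>2 * (d i * pochhammer (?a + real k) i) * y ^ k = (pochhammer ?a k * (d i * pochhammer (?a + real k) i)) * (y ^ k / (fact k)\<^sup>2)"
          by simp
        also have "\<dots> = d i * pochhammer ?a i * (pochhammer (s + real i + 1) k / (fact k)\<^sup>2 * y ^ k)"
          unfolding h by simp
        finally show "pochhammer ?a k / (fact k)\<^sup>2 * (d i * pochhammer (?a + real k) i) * y ^ k = d i * pochhammer ?a i * (pochhammer (s + real i + 1) k / (fact k)\<^sup>2 * y ^ k)" .
      qed
    qed
    have S: "(\<lambda>k. \<Sum>i\<le>n. d i * pochhammer ?a i * (pochhammer (s + real i + 1) k / (fact k)\<^sup>2 * y ^ k)) sums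
        (\<Sum>i\<le>n. d i * pochhammer ?a i * (exp y * symbol_coeff (s + real i) 0 y))"
    proof (intro sums_sum sums_mult)
      fix i
      have "summable (\<lambda>k. pochhammer (s + real i + 1) k / (fact k)\<^sup>2 * y ^ k)"
        using summable_norm_cancel[OF summable_norm_pochhammer_series[of "\<lambda>_. 1" 1 "s + real i + 1" y]] by simp
      moreover have "(\<Sum>k. pochhammer (s + real i + 1) k / (fact k)\<^sup>2 * y ^ k) = exp y * symbol_coeff (s + real i) 0 y"
        unfolding kummer_symbol_coeff[symmetric] by (simp add: exp_minus)
      ultimately show "(\<lambda>k. pochhammer (s + real i + 1) k / (fact k)\<^sup>2 * y ^ k) sums (exp y * symbol_coeff (s + real i) 0 y)"
        by (simp add: sums_iff)
    qed
    have "pochhammer ?a n * (1 - y / x) ^ n * (\<Sum>k. moment_coeff s x n k * y ^ k) = (\<Sum>i\<le>n. d i * pochhammer ?a i * (exp y * symbol_coeff (s + real i) 0 y))"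
      by (rule sums_unique2[OF A[unfolded E] S])
    hence "pochhammer ?a n * (1 - y / x) ^ n * (\<Sum>k. moment_coeff s x n k * y ^ k) * (exp (- y) / pochhammer ?a n)
      = (\<Sum>i\<le>n. d i * pochhammer ?a i * (exp y * symbol_coeff (s + real i) 0 y)) * (exp (- y) / pochhammer ?a n)" by simp
    also have "\<dots> = (\<Sum>i\<le>n. e i * symbol_coeff (s + real i) 0 y)"
      unfolding sum_distrib_right e_def by (intro sum.cong refl) (simp add: exp_minus)
    finally show ?thesis using an unfolding moment_fun_eq by (simp add: mult_ac lessThan_Suc_atMost)
  qed
  thus ?case unfolding n_def[symmetric] by blast
qed

section \<open>From the order of vanishing to Toeplitz determinants\<close>

lemma derivative_sequence_at_zero:
  fixes f K :: "nat \<Rightarrow> real \<Rightarrow> real"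
  assumes "\<And>i t. (f i has_real_derivative f (Suc i) t) (at t)"
    and "\<And>i t. (K i has_real_derivative K (Suc i) t) (at t)"
    and "\<And>t. f 0 t = (t - x) ^ m * K 0 t"
  shows "(\<forall>i<m. f i x = 0) \<and> f m x = fact m * K 0 x"
  using assms
proof (induction m arbitrary: f K)
  case (Suc m)
  \<comment> \<open>By Leibniz, \<open>L 0\<close> is the factor of (t - x)^m in the derivative of
    (t - x)^(m + 1) \<open>K 0\<close>, and \<open>L j\<close> is its j-th derivative.\<close>
  define L where "L j t = (real (Suc m) + real j) * K j t + (t - x) * K (Suc j) t" for j t
  have dL: "(L j has_real_derivative L (Suc j) t) (at t)" for j t
    unfolding L_def by (rule derivative_eq_intros Suc.prems(2) refl | simp add: algebra_simps)+
  have f1: "f (Suc 0) t = (t - x) ^ m * L 0 t" for t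
  proof -
    have "((\<lambda>t. (t - x) ^ Suc m * K 0 t) has_real_derivative real (Suc m) * (t - x) ^ m * K 0 t + (t - x) ^ Suc m * K (Suc 0) t) (at t)"
      by (rule derivative_eq_intros Suc.prems(2) refl | simp)+
    moreover have "((\<lambda>t. (t - x) ^ Suc m * K 0 t) has_real_derivative f (Suc 0) t) (at t)"
      using Suc.prems(1)[of 0 t] Suc.prems(3) by (simp add: fun_eq_iff[symmetric] del: power_Suc)
    ultimately have "f (Suc 0) t = real (Suc m) * (t - x) ^ m * K 0 t + (t - x) ^ Suc m * K (Suc 0) t"
      by (metis DERIV_unique)
    thus ?thesis by (simp add: L_def algebra_simps)
  qed
  have "(\<forall>i<m. f (Suc i) x = 0) \<and> f (Suc m) x = fact m * L 0 x"
    using Suc.IH[of "\<lambda>i. f (Suc i)" L] Suc.prems(1) dL f1 by simp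
  moreover have "f 0 x = 0" using Suc.prems(3)[of x] by simp
  ultimately show ?case by (auto simp: L_def less_Suc_eq_0_disj)
qed simp

text \<open>Differentiating exp(-t) times a power series with coefficients c amounts to replacing c
  by \<open>diffs c\<close> - c, so all derivatives can be written down by iterating one map on
  coefficients.\<close>

lemma moment_fun_derivative_sequence:
  obtains K where "K 0 = moment_fun s x m" "\<And>i t. (K i has_real_derivative K (Suc i) t) (at t)"
proof -
  define T where "T c k = diffs c k - c k" for c :: "nat \<Rightarrow> real" and k
  define C where "C i = (T ^^ i) (moment_coeff s x m)" for i
  define K where "K i t = exp (- t) * (\<Sum>k. C i k * t ^ k)" for i t
  have sm: "summable (\<lambda>k. C i k * t ^ k)" for i t
  proof (induction i arbitrary: t)
    case 0 thus ?case by (simp add: C_def summable_moment)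
  next
    case (Suc i)
    have "summable (\<lambda>k. diffs (C i) k * t ^ k - C i k * t ^ k)"
      by (intro summable_diff termdiff_converges_all Suc)
    thus ?case by (simp add: C_def T_def left_diff_distrib)
  qed
  have "(K i has_real_derivative K (Suc i) t) (at t)" for i t
  proof -
    have d: "((\<lambda>t. \<Sum>k. C i k * t ^ k) has_real_derivative (\<Sum>k. diffs (C i) k * t ^ k)) (at t)"
      by (rule termdiffs_strong_converges_everywhere) (rule sm)
    have "((\<lambda>t. exp (- t) * (\<Sum>k. C i k * t ^ k)) has_real_derivative
       - exp (- t) * (\<Sum>k. C i k * t ^ k) + exp (- t) * (\<Sum>k. diffs (C i) k * t ^ k)) (at t)"
      by (rule derivative_eq_intros d refl | simp)+
    also have "- exp (- t) * (\<Sum>k. C i k * t ^ k) + exp (- t) * (\<Sum>k. diffs (C i) k * t ^ k) = exp (- t) * ((\<Sum>k. diffs (C i) k * t ^ k) - (\<Sum>k. C i k * t ^ k))"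
      by (simp add: algebra_simps)
    also have "(\<Sum>k. diffs (C i) k * t ^ k) - (\<Sum>k. C i k * t ^ k) = (\<Sum>k. diffs (C i) k * t ^ k - C i k * t ^ k)"
      by (rule suminf_diff[OF termdiff_converges_all[OF sm] sm])
    also have "\<dots> = (\<Sum>k. C (Suc i) k * t ^ k)"
      by (simp add: C_def T_def left_diff_distrib)
    finally show ?thesis by (simp add: K_def[abs_def])
  qed
  moreover have "K 0 = moment_fun s x m" by (rule ext) (simp add: K_def C_def moment_fun_eq)
  ultimately show ?thesis using that by blast
qed

lemma symbol_coeff_add_nat:
  "\<exists>c. \<forall>x. symbol_coeff (s + of_nat i) n x = (\<Sum>j\<le>i. c j * symbol_coeff s (n + int j) x)"
proof (induction i arbitrary: n)
  case 0
  show ?case by (rule exI[of _ "\<lambda>_. 1"]) simp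
next
  case (Suc i)
  obtain c where c: "\<And>x. symbol_coeff (s + of_nat i) n x = (\<Sum>j\<le>i. c j * symbol_coeff s (n + int j) x)" using Suc by blast
  obtain d where d: "\<And>x. symbol_coeff (s + of_nat i) (n + 1) x = (\<Sum>j\<le>i. d j * symbol_coeff s (n + 1 + int j) x)" using Suc by blast
  define e where "e j = (if j \<le> i then c j else 0) + (case j of 0 \<Rightarrow> 0 | Suc j \<Rightarrow> d j)" for j
  have "symbol_coeff (s + of_nat (Suc i)) n x = (\<Sum>j\<le>Suc i. e j * symbol_coeff s (n + int j) x)" for x
  proof -
    have "symbol_coeff (s + of_nat (Suc i)) n x = symbol_coeff (s + of_nat i) n x + symbol_coeff (s + of_nat i) (n + 1) x"
      using symbol_coeff_add_1[of "s + of_nat i" n x] by (simp add: add_ac)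
    also have "symbol_coeff (s + of_nat i) n x = (\<Sum>j\<le>Suc i. (if j \<le> i then c j else 0) * symbol_coeff s (n + int j) x)"
      unfolding c by (simp add: if_distrib cong: if_cong)
    also have "symbol_coeff (s + of_nat i) (n + 1) x = (\<Sum>j\<le>Suc i. (case j of 0 \<Rightarrow> 0 | Suc j \<Rightarrow> d j) * symbol_coeff s (n + int j) x)"
      unfolding d by (subst sum.atMost_Suc_shift) (simp add: add_ac)
    finally show ?thesis by (simp only: e_def distrib_right sum.distrib)
  qed
  thus ?case by blast
qed

text \<open>Trades shifts of the exponent s for shifts of the Laurent index. The recursion produces
  the former; the latter are the entries of a row of a Toeplitz matrix.\<close>

lemma symbol_coeff_span:
  "\<exists>p. \<forall>y. (\<Sum>i<n. c i * symbol_coeff (s + of_nat i) 0 y) = (\<Sum>l<n. p l * symbol_coeff s (int l) y)"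
proof (induction n)
  case (Suc n)
  then obtain p where p: "\<And>y. (\<Sum>i<n. c i * symbol_coeff (s + of_nat i) 0 y) = (\<Sum>l<n. p l * symbol_coeff s (int l) y)" by blast
  obtain e where e: "\<And>x. symbol_coeff (s + of_nat n) 0 x = (\<Sum>j\<le>n. e j * symbol_coeff s (int j) x)"
    using symbol_coeff_add_nat[of s n 0] by auto
  have "(\<Sum>i<Suc n. c i * symbol_coeff (s + of_nat i) 0 y) = (\<Sum>l<Suc n. ((if l < n then p l else 0) + c n * e l) * symbol_coeff s (int l) y)" for y
  proof -
    have "(\<Sum>i<n. c i * symbol_coeff (s + of_nat i) 0 y) = (\<Sum>l<Suc n. (if l < n then p l else 0) * symbol_coeff s (int l) y)"
      unfolding p by simp
    moreover have "c n * symbol_coeff (s + of_nat n) 0 y = (\<Sum>l<Suc n. c n * e l * symbol_coeff s (int l) y)"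
      unfolding e lessThan_Suc_atMost by (simp add: sum_distrib_left mult.assoc)
    ultimately show ?thesis by (simp only: sum.lessThan_Suc[of _ n] distrib_right sum.distrib)
  qed
  thus ?case by (intro exI[of _ "\<lambda>l. (if l < n then p l else 0) + c n * e l"] allI)
qed simp

text \<open>The offset d corresponds to an extra power of u in the symbol; d = 1 occurs as the
  auxiliary minor when Cramer's rule is applied with d = 0.\<close>

definition toeplitz :: "'a::{real_normed_field,banach} \<Rightarrow> int \<Rightarrow> nat \<Rightarrow> 'a \<Rightarrow> 'a mat" where
  "toeplitz s d n x = mat n n (\<lambda>(i, l). symbol_coeff s (int l - int i + d) x)"

lemma toeplitz_carrier [simp]: "toeplitz s d n x \<in> carrier_mat n n"
  by (simp add: toeplitz_def)

text \<open>Cramer's rule for the first unknown in division-free form: row 0 of the identity adj A A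
  = det A.\<close>

lemma det_times_component:
  fixes A :: "'a::comm_ring_1 mat"
  assumes A: "A \<in> carrier_mat n n" and n: "0 < n"
  shows "Determinant.det A * p 0 = (\<Sum>j<n. cofactor A j 0 * (\<Sum>l<n. A $$ (j, l) * p l))"
proof -
  have e: "(\<Sum>j<n. cofactor A j 0 * A $$ (j, l)) = (if l = 0 then Determinant.det A else 0)" if l: "l < n" for l
  proof -
    have "(adj_mat A * A) $$ (0, l) = (Determinant.det A \<cdot>\<^sub>m 1\<^sub>m n) $$ (0, l)"
      using adj_mat(3)[OF A] by simp
    moreover have "(adj_mat A * A) $$ (0, l) = (\<Sum>j<n. cofactor A j 0 * A $$ (j, l))"
      using A l n adj_mat(1)[OF A] by (simp add: scalar_prod_def adj_mat_def lessThan_atLeast0)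
    ultimately show ?thesis using l n by simp
  qed
  have "(\<Sum>j<n. cofactor A j 0 * (\<Sum>l<n. A $$ (j, l) * p l)) = (\<Sum>l<n. (\<Sum>j<n. cofactor A j 0 * A $$ (j, l)) * p l)"
  proof -
    have "(\<Sum>j<n. cofactor A j 0 * (\<Sum>l<n. A $$ (j, l) * p l)) = (\<Sum>j<n. \<Sum>l<n. cofactor A j 0 * A $$ (j, l) * p l)"
      by (simp add: sum_distrib_left mult.assoc)
    also have "\<dots> = (\<Sum>l<n. \<Sum>j<n. cofactor A j 0 * A $$ (j, l) * p l)" by (rule sum.swap)
    finally show ?thesis by (simp add: sum_distrib_right)
  qed
  also have "\<dots> = (\<Sum>l<n. if l = 0 then Determinant.det A * p l else 0)"
    by (intro sum.cong refl) (simp add: e)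
  also have "\<dots> = Determinant.det A * p 0" using n by simp
  finally show ?thesis ..
qed

lemma mat_delete_toeplitz_last:
  "mat_delete (toeplitz s 0 (Suc m) x) m 0 = toeplitz s 1 m x"
  by (rule eq_matI) (auto simp: mat_delete_def toeplitz_def algebra_simps)

lemma mat_delete_toeplitz_first:
  "mat_delete (toeplitz s d (Suc m) x) 0 0 = toeplitz s d m x"
  by (rule eq_matI) (auto simp: mat_delete_def toeplitz_def algebra_simps)

text \<open>The coefficients p of the combination that vanishes to order m at x solve two Toeplitz
  systems: its i-th derivative at x is row i of the matrix with offset 0 applied to p, and its
  integral from 0 to x is row 0 of the matrix with offset 1. Hence the right-hand side has a single
  nonzero entry in both cases, the last one for offset 0 and the first one for offset 1. Cramer's
  rule for p_0 gives the two identities.\<close>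

lemma moment_fun_toeplitz:
  assumes s: "s > -1" and x: "x > 0"
  shows "Determinant.det (toeplitz s 1 (Suc m) x) * moment_fun s x m 0
           = Determinant.det (toeplitz s 1 m x) * (x / real (Suc m) * moment_fun s x (Suc m) 0)"
    and "Determinant.det (toeplitz s 0 (Suc m) x) * moment_fun s x m 0
           = Determinant.det (toeplitz s 1 m x) * (fact m / x ^ m * moment_fun s x m x)"
proof -
  let ?n = "Suc m"
  obtain c where "\<And>y. (1 - y / x) ^ m * moment_fun s x m y = (\<Sum>i<?n. c i * symbol_coeff (s + real i) 0 y)"
    using moment_fun_in_span[OF s x] by blast
  then obtain p where p: "\<And>y. (1 - y / x) ^ m * moment_fun s x m y = (\<Sum>l<?n. p l * symbol_coeff s (int l) y)"
    using symbol_coeff_span[where n = ?n and c = c and s = s] by auto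
  define f where "f i t = (\<Sum>l<?n. p l * symbol_coeff s (int l - int i) t)" for i t
  have df: "(f i has_real_derivative f (Suc i) t) (at t)" for i t
  proof -
    have "((\<lambda>t. \<Sum>l<?n. p l * symbol_coeff s (int l - int i) t) has_real_derivative (\<Sum>l<?n. p l * symbol_coeff s (int l - int i - 1) t)) (at t)"
      by (intro DERIV_sum DERIV_cmult symbol_coeff_deriv)
    thus ?thesis by (simp add: f_def[abs_def] algebra_simps del: sum.lessThan_Suc)
  qed
  obtain H where H: "H 0 = moment_fun s x m" "\<And>i t. (H i has_real_derivative H (Suc i) t) (at t)"
    using moment_fun_derivative_sequence by blast
  have f0: "f 0 t = (t - x) ^ m * ((- 1 / x) ^ m * H 0 t)" for t
  proof -
    have "(1 - t / x) ^ m = (t - x) ^ m * (- 1 / x) ^ m"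
      unfolding power_mult_distrib[symmetric] using x by (intro arg_cong[where f = "\<lambda>z. z ^ m"]) (simp add: field_simps)
    thus ?thesis using p[of t] by (simp add: f_def H(1) mult.assoc del: sum.lessThan_Suc)
  qed
  have "(\<forall>i<m. f i x = 0) \<and> f m x = fact m * ((- 1 / x) ^ m * H 0 x)"
    by (rule derivative_sequence_at_zero[where K = "\<lambda>i t. (- 1 / x) ^ m * H i t"])
       (auto intro: df DERIV_cmult H(2) simp: f0)
  hence van: "\<And>i. i < m \<Longrightarrow> f i x = 0" and top: "f m x = fact m * ((- 1 / x) ^ m * moment_fun s x m x)"
    by (auto simp: H(1))
  \<comment> \<open>At y = 0 the coefficients of positive index vanish and the one of index 0 equals
    1.\<close>
  have p0: "p 0 = moment_fun s x m 0"
    using p[of 0] unfolding sum.lessThan_Suc_shift by (simp add: symbol_coeff_at_0 int_gbinomial_def)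
  have int: "(\<Sum>l<?n. p l * symbol_coeff s (int l + 1) x) = x / real (Suc m) * moment_fun s x (Suc m) 0"
  proof -
    let ?F = "\<lambda>b. \<Sum>l<?n. p l * symbol_coeff s (int l + 1) (x * b)"
    have "((\<lambda>b. x * ((1 - b) ^ m * b ^ 0 * moment_fun s x m (x * b))) has_integral ?F 1 - ?F 0) {0..1}"
    proof (rule fundamental_theorem_of_calculus)
      fix b :: real
      have ch: "((\<lambda>b. symbol_coeff s (int l + 1) (x * b)) has_real_derivative symbol_coeff s (int l + 1 - 1) (x * b) * x) (at b)" for l
        by (rule DERIV_chain'[OF _ symbol_coeff_deriv]) (rule derivative_eq_intros refl | simp)+
      have "(?F has_real_derivative (\<Sum>l<?n. p l * (symbol_coeff s (int l + 1 - 1) (x * b) * x))) (at b)"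
        by (intro DERIV_sum DERIV_cmult ch)
      also have "(\<Sum>l<?n. p l * (symbol_coeff s (int l + 1 - 1) (x * b) * x)) = x * ((1 - x * b / x) ^ m * moment_fun s x m (x * b))"
        unfolding p by (simp add: sum_distrib_left mult_ac del: sum.lessThan_Suc)
      also have "x * b / x = b" using x by simp
      finally show "(?F has_vector_derivative x * ((1 - b) ^ m * b ^ 0 * moment_fun s x m (x * b))) (at b within {0..1})"
        by (simp add: has_real_derivative_iff_has_vector_derivative has_vector_derivative_at_within del: sum.lessThan_Suc)
    qed simp
    hence "integral {0..1} (\<lambda>b. x * ((1 - b) ^ m * b ^ 0 * moment_fun s x m (x * b))) = ?F 1 - ?F 0" by (rule integral_unique)
    moreover have "?F 0 = 0" by (simp add: symbol_coeff_at_0 int_gbinomial_def del: sum.lessThan_Suc)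
    ultimately have "?F 1 = x * integral {0..1} (\<lambda>b. (1 - b) ^ m * b ^ 0 * moment_fun s x m (x * b))" by simp
    thus ?thesis by (simp add: moment_fun_Suc_0 beta_moment_def del: sum.lessThan_Suc of_nat_Suc)
  qed
  let ?A = "toeplitz s 1 ?n x" and ?B = "toeplitz s 0 ?n x"
  have "Determinant.det ?A * p 0 = (\<Sum>j<?n. cofactor ?A j 0 * (\<Sum>l<?n. ?A $$ (j, l) * p l))"
    by (rule det_times_component) auto
  also have "\<dots> = (\<Sum>j<?n. if j = 0 then cofactor ?A 0 0 * (x / real (Suc m) * moment_fun s x (Suc m) 0) else 0)"
  proof (intro sum.cong refl)
    fix j assume j: "j \<in> {..<?n}"
    have "(\<Sum>l<?n. ?A $$ (j, l) * p l) = (\<Sum>l<?n. p l * symbol_coeff s (int l - int j + 1) x)"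
      using j by (intro sum.cong refl) (simp add: toeplitz_def mult.commute)
    moreover have "(\<Sum>l<?n. p l * symbol_coeff s (int l - int j + 1) x) = f (j - 1) x" if "j > 0"
      using that by (simp add: f_def of_nat_diff algebra_simps del: sum.lessThan_Suc)
    ultimately show "cofactor ?A j 0 * (\<Sum>l<?n. ?A $$ (j, l) * p l) = (if j = 0 then cofactor ?A 0 0 * (x / real (Suc m) * moment_fun s x (Suc m) 0) else 0)"
      using int van[of "j - 1"] j by (cases "j = 0") (simp_all del: sum.lessThan_Suc)
  qed
  also have "\<dots> = cofactor ?A 0 0 * (x / real (Suc m) * moment_fun s x (Suc m) 0)" by simp
  also have "cofactor ?A 0 0 = Determinant.det (toeplitz s 1 m x)" by (simp add: cofactor_def mat_delete_toeplitz_first)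
  finally show "Determinant.det ?A * moment_fun s x m 0 = Determinant.det (toeplitz s 1 m x) * (x / real (Suc m) * moment_fun s x (Suc m) 0)"
    unfolding p0 .
  have "Determinant.det ?B * p 0 = (\<Sum>j<?n. cofactor ?B j 0 * (\<Sum>l<?n. ?B $$ (j, l) * p l))"
    by (rule det_times_component) auto
  also have "\<dots> = (\<Sum>j<?n. if j = m then cofactor ?B m 0 * f m x else 0)"
  proof (intro sum.cong refl)
    fix j assume j: "j \<in> {..<?n}"
    have "(\<Sum>l<?n. ?B $$ (j, l) * p l) = f j x"
      using j unfolding f_def by (intro sum.cong refl) (simp add: toeplitz_def mult.commute)
    thus "cofactor ?B j 0 * (\<Sum>l<?n. ?B $$ (j, l) * p l) = (if j = m then cofactor ?B m 0 * f m x else 0)"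
      using van[of j] j by (cases "j = m") (simp_all del: sum.lessThan_Suc)
  qed
  also have "\<dots> = cofactor ?B m 0 * f m x" by simp
  also have "cofactor ?B m 0 = (-1) ^ m * Determinant.det (toeplitz s 1 m x)" by (simp add: cofactor_def mat_delete_toeplitz_last)
  also have "(-1) ^ m * Determinant.det (toeplitz s 1 m x) * f m x = Determinant.det (toeplitz s 1 m x) * (fact m * (((-1) * (- 1 / x)) ^ m) * moment_fun s x m x)"
    unfolding top power_mult_distrib by (simp add: mult_ac)
  also have "((-1) * (- 1 / x)) ^ m = 1 / x ^ m" by (simp add: power_divide)
  finally show "Determinant.det ?B * moment_fun s x m 0 = Determinant.det (toeplitz s 1 m x) * (fact m / x ^ m * moment_fun s x m x)"
    unfolding p0 by simp
qed

text \<open>The auxiliary determinants with offset 1 are found in closed form by telescoping.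
  Inserted into the second identity, they cancel everything except the value at x; the divisions are
  by the positive values at 0.\<close>

theorem det_toeplitz_eq_moment_fun:
  assumes s: "s > -1" and x: "x > 0"
  shows "Determinant.det (toeplitz s 0 (Suc m) x) = moment_fun s x m x"
proof -
  have nz: "moment_fun s x m 0 \<noteq> 0" for m using moment_fun_pos(1)[OF s, of x 0 m] x by simp
  have D: "Determinant.det (toeplitz s 1 m x) = x ^ m / fact m * moment_fun s x m 0" for m
  proof (induction m)
    case 0
    show ?case by (simp add: moment_fun_0_0 det_dim_zero[OF toeplitz_carrier])
  next
    case (Suc m)
    have "Determinant.det (toeplitz s 1 (Suc m) x) * moment_fun s x m 0
        = (x ^ Suc m / fact (Suc m) * moment_fun s x (Suc m) 0) * moment_fun s x m 0"
      unfolding moment_fun_toeplitz(1)[OF s x] Suc fact_Suc by (simp add: mult_ac del: of_nat_Suc)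
    thus ?case by (simp only: mult_right_cancel[OF nz])
  qed
  have "Determinant.det (toeplitz s 0 (Suc m) x) * moment_fun s x m 0 = moment_fun s x m x * moment_fun s x m 0"
    unfolding moment_fun_toeplitz(2)[OF s x] D using x by (simp)
  thus ?thesis by (simp only: mult_right_cancel[OF nz])
qed

section \<open>Moments of shifted Ginibre determinants\<close>

lemma nn_integral_lborel_shift:
  fixes c :: "'a::euclidean_space"
  assumes [measurable]: "F \<in> borel_measurable borel"
  shows "(\<integral>\<^sup>+ a. F (a + c) \<partial>lborel) = (\<integral>\<^sup>+ a. F a \<partial>lborel)"
proof -
  have "(\<integral>\<^sup>+ a. F a \<partial>lborel) = (\<integral>\<^sup>+ a. F a \<partial>distr lborel borel ((+) c))"
    by (simp add: lborel_distr_plus)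
  also have "\<dots> = (\<integral>\<^sup>+ a. F (c + a) \<partial>lborel)"
    by (subst nn_integral_distr) auto
  finally show ?thesis by (simp add: add.commute)
qed

lemma nn_integral_shear_fst:
  fixes F :: "complex \<times> complex \<Rightarrow> ennreal"
  assumes [measurable]: "F \<in> borel_measurable (borel \<Otimes>\<^sub>M borel)"
  shows "(\<integral>\<^sup>+ a. \<integral>\<^sup>+ b. F (a + p * b, b) \<partial>lborel \<partial>lborel) = (\<integral>\<^sup>+ a. \<integral>\<^sup>+ b. F (a, b) \<partial>lborel \<partial>lborel)"
proof -
  have "(\<integral>\<^sup>+ a. \<integral>\<^sup>+ b. F (a + p * b, b) \<partial>lborel \<partial>lborel) = (\<integral>\<^sup>+ b. \<integral>\<^sup>+ a. F (a + p * b, b) \<partial>lborel \<partial>lborel)"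
    by (rule lborel_pair.Fubini') measurable
  also have "\<dots> = (\<integral>\<^sup>+ b. \<integral>\<^sup>+ a. F (a, b) \<partial>lborel \<partial>lborel)"
    by (intro nn_integral_cong nn_integral_lborel_shift) measurable
  also have "\<dots> = (\<integral>\<^sup>+ a. \<integral>\<^sup>+ b. F (a, b) \<partial>lborel \<partial>lborel)"
    by (rule lborel_pair.Fubini') measurable
  finally show ?thesis .
qed

lemma nn_integral_shear_snd:
  fixes F :: "complex \<times> complex \<Rightarrow> ennreal"
  assumes [measurable]: "F \<in> borel_measurable (borel \<Otimes>\<^sub>M borel)"
  shows "(\<integral>\<^sup>+ a. \<integral>\<^sup>+ b. F (a, b + p * a) \<partial>lborel \<partial>lborel) = (\<integral>\<^sup>+ a. \<integral>\<^sup>+ b. F (a, b) \<partial>lborel \<partial>lborel)"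
  by (intro nn_integral_cong nn_integral_lborel_shift) measurable

text \<open>With q nonzero the unitary matrix is a product of three shears, upper, lower and upper
  triangular. Each preserves Lebesgue measure by translation invariance and Fubini, so that no
  Jacobian has to be computed.\<close>

lemma nn_integral_lborel_rotate2:
  fixes F :: "complex \<times> complex \<Rightarrow> ennreal"
  assumes F[measurable]: "F \<in> borel_measurable (borel \<Otimes>\<^sub>M borel)"
    and pq: "p * cnj p + q * cnj q = 1" and q0: "q \<noteq> 0"
  shows "(\<integral>\<^sup>+ a. \<integral>\<^sup>+ b. F (p * a + q * b, - cnj q * a + cnj p * b) \<partial>lborel \<partial>lborel)
       = (\<integral>\<^sup>+ a. \<integral>\<^sup>+ b. F (a, b) \<partial>lborel \<partial>lborel)"
proof -
  define k where "k = - cnj q"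
  define r where "r = (p - 1) / k"
  define t where "t = (cnj p - 1) / k"
  have k0: "k \<noteq> 0" using q0 by (simp add: k_def)
  have e1: "1 + r * k = p" "1 + k * t = cnj p" using k0 by (simp_all add: r_def t_def)
  have "k * (t + r * cnj p) = k * t + (r * k) * cnj p" by (simp add: algebra_simps)
  also have "\<dots> = (cnj p - 1) + (p - 1) * cnj p"
  proof -
    have "k * t = cnj p - 1" "r * k = p - 1" using e1 by (simp_all add: algebra_simps)
    thus ?thesis by (simp only:)
  qed
  also have "\<dots> = k * q" using pq by (simp add: k_def algebra_simps)
  finally have e2: "t + r * cnj p = q" using k0 by simp
  have "(\<integral>\<^sup>+ a. \<integral>\<^sup>+ b. F (a, b) \<partial>lborel \<partial>lborel) = (\<integral>\<^sup>+ a. \<integral>\<^sup>+ b. F (a + r * b, b) \<partial>lborel \<partial>lborel)"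
    by (rule nn_integral_shear_fst[symmetric]) measurable
  also have "\<dots> = (\<integral>\<^sup>+ a. \<integral>\<^sup>+ b. F (a + r * (b + k * a), b + k * a) \<partial>lborel \<partial>lborel)"
    by (subst nn_integral_shear_snd[symmetric, where p = k and F = "\<lambda>(a, b). F (a + r * b, b)", simplified]) simp_all
  also have "\<dots> = (\<integral>\<^sup>+ a. \<integral>\<^sup>+ b. F (a + t * b + r * (b + k * (a + t * b)), b + k * (a + t * b)) \<partial>lborel \<partial>lborel)"
    by (subst nn_integral_shear_fst[symmetric, where p = t and F = "\<lambda>(a, b). F (a + r * (b + k * a), b + k * a)", simplified]) simp_all
  also have "\<dots> = (\<integral>\<^sup>+ a. \<integral>\<^sup>+ b. F (p * a + q * b, - cnj q * a + cnj p * b) \<partial>lborel \<partial>lborel)"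
  proof -
    have "b + k * (a + t * b) = - cnj q * a + cnj p * b" for a b
    proof -
      have "b + k * (a + t * b) = k * a + (1 + k * t) * b" by (simp add: algebra_simps)
      thus ?thesis by (simp only: e1) (simp add: k_def)
    qed
    moreover have "a + t * b + r * (b + k * (a + t * b)) = p * a + q * b" for a b
    proof -
      have "a + t * b + r * (b + k * (a + t * b)) = (1 + r * k) * a + (t + r * (1 + k * t)) * b"
        by (simp add: algebra_simps)
      thus ?thesis by (simp only: e1 e2)
    qed
    ultimately show ?thesis by simp
  qed
  finally show ?thesis by simp
qed

lemma sets_gauss [measurable_cong, simp]: "sets std_complex_gaussian = sets borel"
  by (simp add: std_complex_gaussian_def)

lemma space_gauss [simp]: "space std_complex_gaussian = UNIV"
  by (simp add: std_complex_gaussian_def)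

lemma nn_integral_gauss:
  assumes [measurable]: "F \<in> borel_measurable borel"
  shows "(\<integral>\<^sup>+ a. F a \<partial>std_complex_gaussian) = (\<integral>\<^sup>+ a. ennreal (exp (- (cmod a)\<^sup>2) / pi) * F a \<partial>lborel)"
  unfolding std_complex_gaussian_def by (subst nn_integral_density) auto

lemma nn_integral_gauss2:
  assumes F[measurable]: "F \<in> borel_measurable (borel \<Otimes>\<^sub>M borel)"
  shows "(\<integral>\<^sup>+ a. \<integral>\<^sup>+ b. F (a, b) \<partial>std_complex_gaussian \<partial>std_complex_gaussian) =
    (\<integral>\<^sup>+ a. \<integral>\<^sup>+ b. ennreal (exp (- ((cmod a)\<^sup>2 + (cmod b)\<^sup>2)) / (pi * pi)) * F (a, b) \<partial>lborel \<partial>lborel)"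
proof -
  have "(\<integral>\<^sup>+ a. \<integral>\<^sup>+ b. F (a, b) \<partial>std_complex_gaussian \<partial>std_complex_gaussian) =
    (\<integral>\<^sup>+ a. \<integral>\<^sup>+ b. ennreal (exp (- (cmod b)\<^sup>2) / pi) * F (a, b) \<partial>lborel \<partial>std_complex_gaussian)"
    by (intro nn_integral_cong nn_integral_gauss) measurable
  also have "\<dots> = (\<integral>\<^sup>+ a. ennreal (exp (- (cmod a)\<^sup>2) / pi) * (\<integral>\<^sup>+ b. ennreal (exp (- (cmod b)\<^sup>2) / pi) * F (a, b) \<partial>lborel) \<partial>lborel)"
    by (subst nn_integral_gauss) measurable
  also have "\<dots> = (\<integral>\<^sup>+ a. \<integral>\<^sup>+ b. ennreal (exp (- ((cmod a)\<^sup>2 + (cmod b)\<^sup>2)) / (pi * pi)) * F (a, b) \<partial>lborel \<partial>lborel)"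
  proof (rule nn_integral_cong)
    fix a :: complex
    have "exp (- ((cmod a)\<^sup>2 + (cmod b)\<^sup>2)) / (pi * pi) = (exp (- (cmod a)\<^sup>2) / pi) * (exp (- (cmod b)\<^sup>2) / pi)" for b
      by (simp add: exp_add[symmetric])
    hence eq: "ennreal (exp (- ((cmod a)\<^sup>2 + (cmod b)\<^sup>2)) / (pi * pi)) = ennreal (exp (- (cmod a)\<^sup>2) / pi) * ennreal (exp (- (cmod b)\<^sup>2) / pi)" for b
      by (simp only: ennreal_mult[symmetric] divide_nonneg_pos exp_ge_zero pi_gt_zero)
    show "ennreal (exp (- (cmod a)\<^sup>2) / pi) * (\<integral>\<^sup>+ b. ennreal (exp (- (cmod b)\<^sup>2) / pi) * F (a, b) \<partial>lborel) =
      (\<integral>\<^sup>+ b. ennreal (exp (- ((cmod a)\<^sup>2 + (cmod b)\<^sup>2)) / (pi * pi)) * F (a, b) \<partial>lborel)"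
      unfolding eq mult.assoc by (rule nn_integral_cmult[symmetric]) measurable
  qed
  finally show ?thesis .
qed

lemma nn_integral_gauss_rotate2:
  fixes F :: "complex \<times> complex \<Rightarrow> ennreal"
  assumes F[measurable]: "F \<in> borel_measurable (borel \<Otimes>\<^sub>M borel)"
    and pq: "p * cnj p + q * cnj q = 1" and q0: "q \<noteq> 0"
  shows "(\<integral>\<^sup>+ a. \<integral>\<^sup>+ b. F (p * a + q * b, - cnj q * a + cnj p * b) \<partial>std_complex_gaussian \<partial>std_complex_gaussian)
       = (\<integral>\<^sup>+ a. \<integral>\<^sup>+ b. F (a, b) \<partial>std_complex_gaussian \<partial>std_complex_gaussian)"
proof -
  define d where "d = (\<lambda>(a, b). ennreal (exp (- ((cmod a)\<^sup>2 + (cmod b)\<^sup>2)) / (pi * pi)))"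
  have [measurable]: "d \<in> borel_measurable (borel \<Otimes>\<^sub>M borel)" unfolding d_def by measurable
  have inv: "(cmod (p * a + q * b))\<^sup>2 + (cmod (- cnj q * a + cnj p * b))\<^sup>2 = (cmod a)\<^sup>2 + (cmod b)\<^sup>2" for a b
  proof -
    have "complex_of_real ((cmod (p * a + q * b))\<^sup>2 + (cmod (- cnj q * a + cnj p * b))\<^sup>2)
        = (p * a + q * b) * cnj (p * a + q * b) + (- cnj q * a + cnj p * b) * cnj (- cnj q * a + cnj p * b)"
      by (simp only: of_real_add complex_norm_square)
    also have "\<dots> = (p * cnj p + q * cnj q) * (a * cnj a + b * cnj b)" by (simp add: algebra_simps)
    also have "\<dots> = complex_of_real ((cmod a)\<^sup>2 + (cmod b)\<^sup>2)" 
      by (simp only: pq of_real_add complex_norm_square mult_1)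
    finally show ?thesis by (simp only: of_real_eq_iff)
  qed
  have "(\<integral>\<^sup>+ a. \<integral>\<^sup>+ b. F (a, b) \<partial>std_complex_gaussian \<partial>std_complex_gaussian) = (\<integral>\<^sup>+ a. \<integral>\<^sup>+ b. d (a, b) * F (a, b) \<partial>lborel \<partial>lborel)"
    by (subst nn_integral_gauss2) (simp_all add: d_def)
  also have "\<dots> = (\<integral>\<^sup>+ a. \<integral>\<^sup>+ b. d (p * a + q * b, - cnj q * a + cnj p * b) * F (p * a + q * b, - cnj q * a + cnj p * b) \<partial>lborel \<partial>lborel)"
    by (rule nn_integral_lborel_rotate2[OF _ pq q0, where F = "\<lambda>x. d x * F x", symmetric]) measurable
  also have "\<dots> = (\<integral>\<^sup>+ a. \<integral>\<^sup>+ b. d (a, b) * F (p * a + q * b, - cnj q * a + cnj p * b) \<partial>lborel \<partial>lborel)"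
    unfolding d_def prod.case inv ..
  also have "\<dots> = (\<integral>\<^sup>+ a. \<integral>\<^sup>+ b. F (p * a + q * b, - cnj q * a + cnj p * b) \<partial>std_complex_gaussian \<partial>std_complex_gaussian)"
    by (subst nn_integral_gauss2[where F = "\<lambda>(a, b). F (p * a + q * b, - cnj q * a + cnj p * b)", unfolded prod.case]) (measurable, simp only: d_def prod.case)
  finally show ?thesis ..
qed

text \<open>The points with |w|^2 at most a form a disc of area pi a, so the image of planar
  Lebesgue measure is pi times Lebesgue measure on the positive axis. This takes the place of polar
  coordinates.\<close>

lemma nn_integral_norm_square_lborel:
  fixes F :: "real \<Rightarrow> ennreal"
  assumes [measurable]: "F \<in> borel_measurable borel"
  shows "(\<integral>\<^sup>+ w. F ((cmod w)\<^sup>2) \<partial>lborel) = (\<integral>\<^sup>+ t. ennreal (pi * indicator {0<..} t) * F t \<partial>lborel)"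
proof -
  let ?A = "distr lborel borel (\<lambda>w::complex. (cmod w)\<^sup>2)"
  let ?B = "density lborel (\<lambda>t. ennreal (pi * indicator {0<..} t))"
  have em: "emeasure ?A {..a} = ennreal (pi * max 0 a)" for a :: real
  proof -
    have "emeasure ?A {..a} = emeasure lborel ((\<lambda>w::complex. (cmod w)\<^sup>2) -` {..a})"
      by (subst emeasure_distr) auto
    also have "\<dots> = ennreal (pi * max 0 a)"
    proof (cases "a < 0")
      case True
      have "(\<lambda>w::complex. (cmod w)\<^sup>2) -` {..a} = {}" using True
        by (auto simp: not_le) (meson less_le_trans not_less zero_le_power2)
      thus ?thesis using True by simp
    next
      case False
      have "(\<lambda>w::complex. (cmod w)\<^sup>2) -` {..a} = cball 0 (sqrt a)" using False
        by (auto simp: real_le_rsqrt sqrt_le_D) (smt (verit) norm_ge_zero power_mono real_sqrt_pow2_iff)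
      thus ?thesis using False by (simp add: emeasure_cball unit_ball_vol_2)
    qed
    finally show ?thesis .
  qed
  let ?E = "range (atMost :: real \<Rightarrow> real set)"
  have "?A = ?B"
  proof (rule measure_eqI_generator_eq[where E = "?E" and \<Omega> = UNIV and A = "\<lambda>n::nat. {..real n}"])
    show "Int_stable ?E"
      by (auto simp: Int_stable_def)
    show "\<And>X. X \<in> ?E \<Longrightarrow> emeasure ?A X = emeasure ?B X"
    proof safe
      fix a :: real
      have "emeasure ?B {..a} = (\<integral>\<^sup>+ t. ennreal pi * indicator {0<..a} t \<partial>lborel)"
        by (subst emeasure_density) (auto intro!: nn_integral_cong simp: indicator_def)
      also have "\<dots> = ennreal (pi * max 0 a)"
        by (subst nn_integral_cmult_indicator) (auto simp: ennreal_mult[symmetric] max_def)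
      finally show "emeasure ?A {..a} = emeasure ?B {..a}" using em by simp
    qed
    show "sets ?A = sigma_sets UNIV ?E" "sets ?B = sigma_sets UNIV ?E"
    proof -
      have *: "sets (borel :: real measure) = sigma_sets UNIV ?E"
        by (subst borel_eq_atMost, subst sets_measure_of) auto
      show "sets ?A = sigma_sets UNIV ?E" unfolding sets_distr by (fact *)
      show "sets ?B = sigma_sets UNIV ?E" unfolding sets_density sets_lborel by (fact *)
    qed
    show "(\<Union>i. {..real i}) = UNIV" using real_arch_simple by auto
    show "emeasure ?A {..real i} \<noteq> \<infinity>" for i by (simp only: em) simp
  qed auto
  hence "(\<integral>\<^sup>+ t. F t \<partial>?A) = (\<integral>\<^sup>+ t. F t \<partial>?B)" by simp
  thus ?thesis by (subst (asm) nn_integral_distr, simp, simp, subst (asm) nn_integral_density, simp, simp)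
qed


lemma nn_integral_gauss_norm_square:
  fixes F :: "real \<Rightarrow> ennreal"
  assumes [measurable]: "F \<in> borel_measurable borel"
  shows "(\<integral>\<^sup>+ w. F ((cmod w)\<^sup>2) \<partial>std_complex_gaussian) = (\<integral>\<^sup>+ t. ennreal (exp (- t) * indicator {0<..} t) * F t \<partial>lborel)"
proof -
  have "(\<integral>\<^sup>+ w. F ((cmod w)\<^sup>2) \<partial>std_complex_gaussian) = (\<integral>\<^sup>+ w. (\<lambda>t. ennreal (exp (- t) / pi) * F t) ((cmod w)\<^sup>2) \<partial>lborel)"
    by (subst nn_integral_gauss) simp_all
  also have "\<dots> = (\<integral>\<^sup>+ t. ennreal (pi * indicator {0<..} t) * (ennreal (exp (- t) / pi) * F t) \<partial>lborel)"
    by (rule nn_integral_norm_square_lborel) measurable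
  also have "\<dots> = (\<integral>\<^sup>+ t. ennreal (exp (- t) * indicator {0<..} t) * F t \<partial>lborel)"
    unfolding mult.assoc[symmetric] by (intro nn_integral_cong) (auto simp: ennreal_mult[symmetric] indicator_def)
  finally show ?thesis .
qed

lemma prob_space_gauss: "prob_space std_complex_gaussian"
proof
  have "emeasure std_complex_gaussian (space std_complex_gaussian) = (\<integral>\<^sup>+ w. (\<lambda>_. 1) ((cmod w)\<^sup>2) \<partial>std_complex_gaussian)"
    by simp
  also have "\<dots> = (\<integral>\<^sup>+ t. ennreal (exp (- t) * indicator {0<..} t) * 1 \<partial>lborel)"
    by (rule nn_integral_gauss_norm_square) simp
  also have "\<dots> = (\<integral>\<^sup>+ t. ennreal (t ^ 0 * exp (- t)) * indicator {0..} t \<partial>lborel)"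
  proof (rule nn_integral_cong_AE)
    show "AE t in lborel. ennreal (exp (- t) * indicator {0<..} t) * 1 = ennreal (t ^ 0 * exp (- t)) * indicator {0..} t"
      using AE_lborel_singleton[of "0::real"] by eventually_elim (auto simp: indicator_def)
  qed
  also have "\<dots> = 1" by (subst nn_intergal_power_times_exp_Ici) simp
  finally show "emeasure std_complex_gaussian (space std_complex_gaussian) = 1" .
qed

section \<open>Rotations of Gaussian families and of determinants\<close>

lemma nn_integral_PiM_gauss_rotate2:
  fixes F :: "('i \<Rightarrow> complex) \<Rightarrow> ennreal"
  assumes F[measurable]: "F \<in> borel_measurable (PiM I (\<lambda>_. std_complex_gaussian))"
    and I: "finite I" "i \<in> I" "j \<in> I" "i \<noteq> j"
    and pq: "p * cnj p + q * cnj q = 1" and q0: "q \<noteq> 0"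
  shows "(\<integral>\<^sup>+ g. F (g(i := p * g i + q * g j, j := - cnj q * g i + cnj p * g j)) \<partial>PiM I (\<lambda>_. std_complex_gaussian))
       = (\<integral>\<^sup>+ g. F g \<partial>PiM I (\<lambda>_. std_complex_gaussian))"
proof -
  interpret G: prob_space std_complex_gaussian by (rule prob_space_gauss)
  interpret product_sigma_finite "\<lambda>_::'i. std_complex_gaussian" ..
  define K where "K = I - {i, j}"
  have K: "I = insert i (insert j K)" "finite K" "i \<notin> insert j K" "j \<notin> K" "finite (insert j K)" using I by (auto simp: K_def)
  have [measurable]: "F \<in> borel_measurable (PiM (insert i (insert j K)) (\<lambda>_. std_complex_gaussian))"
    using F by (simp only: K(1)[symmetric])
  let ?g = "std_complex_gaussian"
  have *: "(\<integral>\<^sup>+ g. H g \<partial>PiM I (\<lambda>_. ?g)) = (\<integral>\<^sup>+ x. \<integral>\<^sup>+ a. \<integral>\<^sup>+ b. H (x(j := b, i := a)) \<partial>?g \<partial>?g \<partial>PiM K (\<lambda>_. ?g))"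
    if [measurable]: "H \<in> borel_measurable (PiM (insert i (insert j K)) (\<lambda>_. ?g))" for H :: "('i \<Rightarrow> complex) \<Rightarrow> ennreal"
  proof -
    have "(\<integral>\<^sup>+ g. H g \<partial>PiM I (\<lambda>_. ?g)) = (\<integral>\<^sup>+ a. \<integral>\<^sup>+ x. H (x(i := a)) \<partial>PiM (insert j K) (\<lambda>_. ?g) \<partial>?g)"
      unfolding K(1) by (rule product_nn_integral_insert_rev) (use K in auto)
    also have "\<dots> = (\<integral>\<^sup>+ a. \<integral>\<^sup>+ x. \<integral>\<^sup>+ b. H (x(j := b, i := a)) \<partial>?g \<partial>PiM K (\<lambda>_. ?g) \<partial>?g)"
      by (intro nn_integral_cong product_nn_integral_insert) (use K in \<open>auto intro!: measurable_compose[OF _ that] measurable_fun_upd simp: insert_commute\<close>)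
    also have "\<dots> = (\<integral>\<^sup>+ x. \<integral>\<^sup>+ a. \<integral>\<^sup>+ b. H (x(j := b, i := a)) \<partial>?g \<partial>?g \<partial>PiM K (\<lambda>_. ?g))"
    proof -
      interpret P: finite_product_prob_space "\<lambda>_::'i. std_complex_gaussian" K by standard (rule K)
      interpret pair_sigma_finite ?g "PiM K (\<lambda>_. ?g)" ..
      show ?thesis
        by (rule Fubini'[symmetric]) measurable
    qed
    finally show ?thesis .
  qed
  let ?H = "\<lambda>g. F (g(i := p * g i + q * g j, j := - cnj q * g i + cnj p * g j))"
  have "(\<lambda>g. g(i := p * g i + q * g j, j := - cnj q * g i + cnj p * g j)) \<in> measurable (PiM I (\<lambda>_. ?g)) (PiM I (\<lambda>_. ?g))"
    using I by (intro measurable_fun_upd[where J = I]) auto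
  hence [measurable]: "?H \<in> borel_measurable (PiM (insert i (insert j K)) (\<lambda>_. ?g))"
    using F unfolding K(1)[symmetric] by (rule measurable_compose)
  have "(\<integral>\<^sup>+ g. ?H g \<partial>PiM I (\<lambda>_. ?g)) = (\<integral>\<^sup>+ x. \<integral>\<^sup>+ a. \<integral>\<^sup>+ b. ?H (x(j := b, i := a)) \<partial>?g \<partial>?g \<partial>PiM K (\<lambda>_. ?g))"
    by (rule *) measurable
  also have "\<dots> = (\<integral>\<^sup>+ x. \<integral>\<^sup>+ a. \<integral>\<^sup>+ b. F (x(j := - cnj q * a + cnj p * b, i := p * a + q * b)) \<partial>?g \<partial>?g \<partial>PiM K (\<lambda>_. ?g))"
    using I(4) by (intro nn_integral_cong arg_cong[where f = F]) (auto simp: fun_eq_iff)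
  also have "\<dots> = (\<integral>\<^sup>+ x. \<integral>\<^sup>+ a. \<integral>\<^sup>+ b. F (x(j := b, i := a)) \<partial>?g \<partial>?g \<partial>PiM K (\<lambda>_. ?g))"
  proof (rule nn_integral_cong)
    fix x assume [measurable]: "x \<in> space (PiM K (\<lambda>_. ?g))"
    show "(\<integral>\<^sup>+ a. \<integral>\<^sup>+ b. F (x(j := - cnj q * a + cnj p * b, i := p * a + q * b)) \<partial>?g \<partial>?g) = (\<integral>\<^sup>+ a. \<integral>\<^sup>+ b. F (x(j := b, i := a)) \<partial>?g \<partial>?g)"
      by (rule nn_integral_gauss_rotate2[OF _ pq q0, where F = "\<lambda>(a, b). F (x(j := b, i := a))", unfolded prod.case]) measurable
  qed
  also have "\<dots> = (\<integral>\<^sup>+ g. F g \<partial>PiM I (\<lambda>_. ?g))"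
    by (rule *[symmetric]) measurable
  finally show ?thesis .
qed

text \<open>The same three shears as for Lebesgue measure, now read as row additions, which leave a
  determinant unchanged.\<close>

lemma det_rot_rows:
  fixes A :: "complex mat"
  assumes A: "A \<in> carrier_mat m m" and k: "k < m" "l < m" "k \<noteq> l"
    and pq: "p * cnj p + q * cnj q = 1" and q0: "q \<noteq> 0"
  shows "Determinant.det (mat m m (\<lambda>(i, j). if i = k then p * A $$ (k, j) + q * A $$ (l, j)
     else if i = l then - cnj q * A $$ (k, j) + cnj p * A $$ (l, j) else A $$ (i, j))) = Determinant.det A"
proof -
  define c where "c = - cnj q"
  define r where "r = (p - 1) / c"
  define t where "t = (cnj p - 1) / c"
  have c0: "c \<noteq> 0" using q0 by (simp add: c_def)
  have e1: "1 + r * c = p" "1 + c * t = cnj p" using c0 by (simp_all add: r_def t_def)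
  have "c * (t + r * cnj p) = c * t + (r * c) * cnj p" by (simp add: algebra_simps)
  also have "\<dots> = (cnj p - 1) + (p - 1) * cnj p"
  proof -
    have "c * t = cnj p - 1" "r * c = p - 1" using e1 by (simp_all add: algebra_simps)
    thus ?thesis by (simp only:)
  qed
  also have "\<dots> = c * q" using pq by (simp add: c_def algebra_simps)
  finally have e2: "t + r * cnj p = q" using c0 by simp
  let ?B = "addrow r k l (addrow c l k (addrow t k l A))"
  have "mat m m (\<lambda>(i, j). if i = k then p * A $$ (k, j) + q * A $$ (l, j)
     else if i = l then - cnj q * A $$ (k, j) + cnj p * A $$ (l, j) else A $$ (i, j)) = ?B"
  proof (rule eq_matI, goal_cases)
    case (1 i j)
    hence ij: "i < m" "j < m" using A by auto
    have u: "c * (t * A $$ (l, j) + A $$ (k, j)) + A $$ (l, j) = c * A $$ (k, j) + cnj p * A $$ (l, j)"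
      unfolding e1(2)[symmetric] by (simp add: algebra_simps)
    have v: "r * (c * A $$ (k, j) + cnj p * A $$ (l, j)) + (t * A $$ (l, j) + A $$ (k, j)) = p * A $$ (k, j) + q * A $$ (l, j)"
    proof -
      have "r * (c * A $$ (k, j) + cnj p * A $$ (l, j)) + (t * A $$ (l, j) + A $$ (k, j))
          = (1 + r * c) * A $$ (k, j) + (t + r * cnj p) * A $$ (l, j)" by (simp add: algebra_simps)
      thus ?thesis by (simp only: e1 e2)
    qed
    have "?B $$ (i, j) = (if i = k then r * (c * (t * A $$ (l, j) + A $$ (k, j)) + A $$ (l, j)) + (t * A $$ (l, j) + A $$ (k, j))
      else if i = l then c * (t * A $$ (l, j) + A $$ (k, j)) + A $$ (l, j) else A $$ (i, j))"
      using A k ij by (simp add: mat_addrow_def)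
    also have "\<dots> = (if i = k then p * A $$ (k, j) + q * A $$ (l, j)
     else if i = l then - cnj q * A $$ (k, j) + cnj p * A $$ (l, j) else A $$ (i, j))"
      unfolding u v by (simp add: c_def)
    finally show ?case using ij by simp
  qed (use A in auto)
  also have "Determinant.det \<dots> = Determinant.det A" using A k by (simp add: det_addrow)
  finally show ?thesis .
qed

lemma det_rot_cols:
  fixes A :: "complex mat"
  assumes A: "A \<in> carrier_mat m m" and k: "k < m" "l < m" "k \<noteq> l"
    and pq: "p * cnj p + q * cnj q = 1" and q0: "q \<noteq> 0"
  shows "Determinant.det (mat m m (\<lambda>(i, j). if j = k then p * A $$ (i, k) + q * A $$ (i, l)
     else if j = l then - cnj q * A $$ (i, k) + cnj p * A $$ (i, l) else A $$ (i, j))) = Determinant.det A" (is "Determinant.det ?M = _")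
proof -
  have "Determinant.det ?M = Determinant.det (transpose_mat ?M)" by (rule det_transpose[symmetric, of _ m]) simp
  also have "transpose_mat ?M = mat m m (\<lambda>(i, j). if i = k then p * transpose_mat A $$ (k, j) + q * transpose_mat A $$ (l, j)
     else if i = l then - cnj q * transpose_mat A $$ (k, j) + cnj p * transpose_mat A $$ (l, j) else transpose_mat A $$ (i, j))"
    using A k by (intro eq_matI) auto
  also have "Determinant.det \<dots> = Determinant.det A"
    by (subst det_rot_rows[OF _ k pq q0]) (use A in \<open>auto simp: det_transpose\<close>)
  finally show ?thesis .
qed

lemma borel_measurable_det_mat [measurable (raw)]:
  fixes f :: "nat \<Rightarrow> nat \<Rightarrow> 'b \<Rightarrow> complex"
  assumes "\<And>i j. i < n \<Longrightarrow> j < n \<Longrightarrow> f i j \<in> borel_measurable N"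
  shows "(\<lambda>x. Determinant.det (mat n n (\<lambda>(i, j). f i j x))) \<in> borel_measurable N"
proof -
  have eq: "Determinant.det (mat n n (\<lambda>(i, j). f i j x)) = (\<Sum>p | p permutes {0..<n}. signof p * (\<Prod>i = 0..<n. f i (p i) x))" for x
  proof -
    have "p i < n" if "p permutes {0..<n}" "i < n" for p i
      using permutes_in_image[OF that(1), of i] that(2) by simp
    thus ?thesis by (subst det_def'[of _ n]) (auto intro!: sum.cong prod.cong)
  qed
  have "p i < n" if "p permutes {0..<n}" "i < n" for p i
    using permutes_in_image[OF that(1), of i] that(2) by simp
  thus ?thesis unfolding eq
    by (intro borel_measurable_sum borel_measurable_times borel_measurable_prod borel_measurable_const assms) auto
qed

text \<open>Rotates all pairs (i, \<sigma> i) with i in T at once. When \<sigma> exchanges two rows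
  or two columns of an index grid, this is multiplication of the random matrix by a plane rotation
  from the left or from the right.\<close>

definition pair_rot :: "complex \<Rightarrow> complex \<Rightarrow> ('i \<Rightarrow> 'i) \<Rightarrow> 'i set \<Rightarrow> ('i \<Rightarrow> complex) \<Rightarrow> 'i \<Rightarrow> complex" where
  "pair_rot p q \<sigma> T g = (\<lambda>i. if i \<in> T then p * g i + q * g (\<sigma> i)
     else if \<sigma> i \<in> T then - cnj q * g (\<sigma> i) + cnj p * g i else g i)"

lemma nn_integral_PiM_gauss_pair_rot:
  fixes F :: "('i \<Rightarrow> complex) \<Rightarrow> ennreal"
  assumes F: "F \<in> borel_measurable (PiM I (\<lambda>_. std_complex_gaussian))"
    and I: "finite I" and T: "T \<subseteq> I" "\<And>i. i \<in> T \<Longrightarrow> \<sigma> i \<in> I - T" and \<sigma>: "\<And>i. \<sigma> (\<sigma> i) = i"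
    and pq: "p * cnj p + q * cnj q = 1" and q0: "q \<noteq> 0"
  shows "(\<integral>\<^sup>+ g. F (pair_rot p q \<sigma> T g) \<partial>PiM I (\<lambda>_. std_complex_gaussian))
       = (\<integral>\<^sup>+ g. F g \<partial>PiM I (\<lambda>_. std_complex_gaussian))"
proof -
  have "finite T" using T(1) I by (rule finite_subset)
  thus ?thesis using T F
  proof (induction T arbitrary: F rule: finite_induct)
    case empty
    thus ?case by (simp add: pair_rot_def)
  next
    case (insert a T)
    let ?u = "\<lambda>g. g(a := p * g a + q * g (\<sigma> a), \<sigma> a := - cnj q * g a + cnj p * g (\<sigma> a))"
    have aI: "a \<in> I" "\<sigma> a \<in> I" "a \<noteq> \<sigma> a" "\<sigma> a \<notin> T" using insert.prems(1) insert.prems(2)[of a] by auto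
    have nT: "\<sigma> i \<notin> T" if "i \<in> T" for i using insert.prems(2)[of i] that by auto
    have na: "\<sigma> i \<noteq> a" if "i \<in> T" for i using insert.prems(2)[of i] that by auto
    have u: "?u \<in> measurable (PiM I (\<lambda>_. std_complex_gaussian)) (PiM I (\<lambda>_. std_complex_gaussian))"
      using aI by (intro measurable_fun_upd[where J = I]) auto
    have eq: "pair_rot p q \<sigma> (insert a T) g = ?u (pair_rot p q \<sigma> T g)" for g
    proof
      fix i
      have s1: "\<sigma> i = a \<longleftrightarrow> i = \<sigma> a" using \<sigma> by metis
      have s2: "\<sigma> a \<notin> T" "\<sigma> (\<sigma> a) = a" "a \<notin> T" using aI \<sigma> insert.hyps by auto
      show "pair_rot p q \<sigma> (insert a T) g i = ?u (pair_rot p q \<sigma> T g) i"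
        using s1 s2 aI(3) by (auto simp: pair_rot_def \<sigma>)
    qed
    have "(\<integral>\<^sup>+ g. F (pair_rot p q \<sigma> (insert a T) g) \<partial>PiM I (\<lambda>_. std_complex_gaussian)) = (\<integral>\<^sup>+ g. F (?u (pair_rot p q \<sigma> T g)) \<partial>PiM I (\<lambda>_. std_complex_gaussian))"
      unfolding eq ..
    also have "\<dots> = (\<integral>\<^sup>+ g. F (?u g) \<partial>PiM I (\<lambda>_. std_complex_gaussian))"
      using insert.prems by (intro insert.IH[where F = "\<lambda>g. F (?u g)"] measurable_compose[OF u]) auto
    also have "\<dots> = (\<integral>\<^sup>+ g. F g \<partial>PiM I (\<lambda>_. std_complex_gaussian))"
      by (rule nn_integral_PiM_gauss_rotate2[OF insert.prems(3) I aI(1-3) pq q0])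
    finally show ?case .
  qed
qed

section \<open>Conditioning on the last column\<close>

definition column_mat :: "complex \<Rightarrow> nat \<Rightarrow> (nat \<times> nat \<Rightarrow> complex) \<Rightarrow> (nat \<Rightarrow> complex) \<Rightarrow> complex mat" where
  "column_mat z n g v = mat (Suc n) (Suc n) (\<lambda>(i, j). if j < n then g (i, j) + (if i = j then z else 0) else v i)"

text \<open>The moment conditioned on the last column v; the shift of the last diagonal entry is
  understood to be contained in v.\<close>

definition column_moment :: "real \<Rightarrow> complex \<Rightarrow> nat \<Rightarrow> (nat \<Rightarrow> complex) \<Rightarrow> ennreal" where
  "column_moment s z n v = (\<integral>\<^sup>+ g. ennreal (cmod (Determinant.det (column_mat z n g v)) powr (2 * s))
     \<partial>PiM ({..n} \<times> {..<n}) (\<lambda>_. std_complex_gaussian))"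

definition shifted_moment :: "real \<Rightarrow> complex \<Rightarrow> nat \<Rightarrow> complex \<Rightarrow> ennreal" where
  "shifted_moment s z n \<zeta> = (\<integral>\<^sup>+ g. ennreal (cmod (Determinant.det (mat n n (\<lambda>(i, j). g (i, j) +
       (if i = j then if Suc i = n then \<zeta> else z else 0)))) powr (2 * s))
     \<partial>PiM ({..<n} \<times> {..<n}) (\<lambda>_. std_complex_gaussian))"

lemma column_mat_carrier [simp]: "column_mat z n g v \<in> carrier_mat (Suc n) (Suc n)"
  by (simp add: column_mat_def)

lemma measurable_component_gauss [measurable (raw)]:
  "i \<in> I \<Longrightarrow> (\<lambda>g. g i) \<in> borel_measurable (PiM I (\<lambda>_. std_complex_gaussian))"
  by (rule measurable_compose[OF measurable_component_singleton]) auto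

lemma measurable_det_column_mat:
  "(\<lambda>g. Determinant.det (column_mat z n g v)) \<in> borel_measurable (PiM ({..n} \<times> {..<n}) (\<lambda>_. std_complex_gaussian))"
  unfolding column_mat_def
proof (rule borel_measurable_det_mat)
  fix i j assume "i < Suc n" "j < Suc n"
  thus "(\<lambda>g. if j < n then g (i, j) + (if i = j then z else 0) else v i) \<in> borel_measurable (PiM ({..n} \<times> {..<n}) (\<lambda>_. std_complex_gaussian))"
    by (cases "j < n") (auto intro!: borel_measurable_add measurable_component_gauss)
qed

text \<open>Conjugation by a rotation of the coordinates k and l, both below n, fixes the
  determinant, the law of the Gaussian block and the scalar shift z, so only the column v is moved.
  The column rotation has parameters cnj p and cnj q because it is the inverse of the row
  rotation.\<close>

lemma column_moment_conj:
  assumes k: "k < n" "l < n" "k \<noteq> l" and pq: "p * cnj p + q * cnj q = 1" and q0: "q \<noteq> 0"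
  shows "column_moment s z n v = column_moment s z n (v(k := p * v k + q * v l, l := - cnj q * v k + cnj p * v l))"
proof -
  let ?v = "v(k := p * v k + q * v l, l := - cnj q * v k + cnj p * v l)"
  let ?G = "PiM ({..n} \<times> {..<n}) (\<lambda>_. std_complex_gaussian)"
  let ?f = "\<lambda>i::nat. if i = k then l else if i = l then k else i"
  define \<sigma> where "\<sigma> = (\<lambda>(i, j::nat). (?f i, j))"
  define \<tau> where "\<tau> = (\<lambda>(i::nat, j). (i, ?f j))"
  let ?T = "{k} \<times> {..<n}" and ?S = "{..n} \<times> {k}"
  let ?R = "pair_rot p q \<sigma> ?T" and ?C = "pair_rot (cnj p) (cnj q) \<tau> ?S"
  let ?F = "\<lambda>v g. ennreal (cmod (Determinant.det (column_mat z n g v)) powr (2 * s))"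
  have Fm: "?F v \<in> borel_measurable ?G" for v
    by (intro measurable_compose[OF measurable_det_column_mat]) measurable
  have pq': "cnj p * cnj (cnj p) + cnj q * cnj (cnj q) = 1" using pq by (simp add: mult.commute)
  have q0': "cnj q \<noteq> 0" using q0 by simp
  have Rm: "?R \<in> measurable ?G ?G"
    unfolding pair_rot_def
    by (rule measurable_PiM_single') (use k in \<open>auto simp: \<sigma>_def space_PiM PiE_def extensional_def split: if_splits\<close>)
  have det: "Determinant.det (column_mat z n (?C (?R g)) ?v) = Determinant.det (column_mat z n g v)" for g
  proof -
    define A where "A = column_mat z n g v"
    have Ac: "A \<in> carrier_mat (Suc n) (Suc n)" by (simp add: A_def)
    define B where "B = mat (Suc n) (Suc n) (\<lambda>(i, j). if i = k then p * A $$ (k, j) + q * A $$ (l, j)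
     else if i = l then - cnj q * A $$ (k, j) + cnj p * A $$ (l, j) else A $$ (i, j))"
    have B: "B \<in> carrier_mat (Suc n) (Suc n)" by (simp add: B_def)
    have Bi: "B $$ (i, j) = (if i = k then p * A $$ (k, j) + q * A $$ (l, j)
     else if i = l then - cnj q * A $$ (k, j) + cnj p * A $$ (l, j) else A $$ (i, j))" if "i < Suc n" "j < Suc n" for i j
      using that by (simp add: B_def)
    have Ai: "A $$ (i, j) = (if j < n then g (i, j) + (if i = j then z else 0) else v i)" if "i < Suc n" "j < Suc n" for i j
      using that by (simp add: A_def column_mat_def)
    \<comment> \<open>Under the conjugation the shift at a rotated diagonal position becomes |p|^2 z
      + |q|^2 z, which is z again.\<close>
    have pqz: "cnj p * (p * z) + cnj q * (q * z) = z"
    proof -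
      have "cnj p * (p * z) + cnj q * (q * z) = (p * cnj p + q * cnj q) * z" by (simp add: algebra_simps)
      thus ?thesis using pq by simp
    qed
    have "column_mat z n (?C (?R g)) ?v = mat (Suc n) (Suc n) (\<lambda>(i, j). if j = k then cnj p * B $$ (i, k) + cnj q * B $$ (i, l)
     else if j = l then - cnj (cnj q) * B $$ (i, k) + cnj (cnj p) * B $$ (i, l) else B $$ (i, j))" (is "_ = ?D")
    proof (rule eq_matI)
      fix i j assume "i < dim_row ?D" "j < dim_col ?D"
      hence ij: "i < Suc n" "j < Suc n" by simp_all
      have [simp]: "k < Suc n" "l < Suc n" "k \<le> n" "l \<le> n" using k by auto
      show "column_mat z n (?C (?R g)) ?v $$ (i, j) = ?D $$ (i, j)"
        using ij k pqz
        by (cases "i = k"; cases "i = l"; cases "j = k"; cases "j = l"; cases "j = n")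
           (auto simp: column_mat_def Bi Ai pair_rot_def \<sigma>_def \<tau>_def algebra_simps)
    qed (auto simp: column_mat_def)
    also have "Determinant.det \<dots> = Determinant.det B"
      using k by (intro det_rot_cols[OF B _ _ _ pq' q0']) auto
    also have "\<dots> = Determinant.det A" unfolding B_def
      using k by (intro det_rot_rows[OF Ac _ _ _ pq q0]) auto
    finally show ?thesis by (simp add: A_def)
  qed
  have "column_moment s z n v = (\<integral>\<^sup>+ g. ?F ?v (?C (?R g)) \<partial>?G)"
    unfolding column_moment_def det ..
  also have "\<dots> = (\<integral>\<^sup>+ g. ?F ?v (?C g) \<partial>?G)"
  proof (rule nn_integral_PiM_gauss_pair_rot[OF _ _ _ _ _ pq q0, where F = "\<lambda>g. ?F ?v (?C g)"])
    have "?C \<in> measurable ?G ?G"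
      unfolding pair_rot_def
      by (rule measurable_PiM_single') (use k in \<open>auto simp: \<tau>_def space_PiM PiE_def extensional_def split: if_splits\<close>)
    thus "(\<lambda>g. ?F ?v (?C g)) \<in> borel_measurable ?G" by (rule measurable_compose[OF _ Fm])
  qed (use k in \<open>auto simp: \<sigma>_def\<close>)
  also have "\<dots> = (\<integral>\<^sup>+ g. ?F ?v g \<partial>?G)"
    by (rule nn_integral_PiM_gauss_pair_rot[OF Fm _ _ _ _ pq' q0']) (use k in \<open>auto simp: \<tau>_def\<close>)
  finally show ?thesis by (simp add: column_moment_def)
qed


text \<open>Plane rotations of neighbouring coordinates push the mass upwards, one coordinate at a
  time, and preserve the Euclidean norm of the first n entries. A coordinate that is already 0 needs
  no rotation; the others give a nonzero q.\<close>

lemma column_moment_concentrate: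
  assumes n: "0 < n"
  shows "\<exists>v'. (\<forall>i<n - 1. v' i = 0) \<and> (cmod (v' (n - 1)))\<^sup>2 = (\<Sum>i<n. (cmod (v i))\<^sup>2) \<and> v' n = v n \<and>
           column_moment s z n v = column_moment s z n v'"
proof -
  have "\<exists>v'. (\<forall>i<k. v' i = 0) \<and> (\<Sum>i<n. (cmod (v' i))\<^sup>2) = (\<Sum>i<n. (cmod (v i))\<^sup>2) \<and> v' n = v n \<and>
           column_moment s z n v = column_moment s z n v'" if "k < n" for k
    using that
  proof (induction k)
    case 0
    show ?case by (rule exI[of _ v]) auto
  next
    case (Suc k)
    then obtain w where w: "\<forall>i<k. w i = 0" "(\<Sum>i<n. (cmod (w i))\<^sup>2) = (\<Sum>i<n. (cmod (v i))\<^sup>2)" "w n = v n"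
      "column_moment s z n v = column_moment s z n w" by auto
    show ?case
    proof (cases "w k = 0")
      case True
      thus ?thesis using w by (intro exI[of _ w]) (auto simp: less_Suc_eq)
    next
      case False
      define \<rho> where "\<rho> = sqrt ((cmod (w k))\<^sup>2 + (cmod (w (Suc k)))\<^sup>2)"
      have \<rho>2: "\<rho>\<^sup>2 = (cmod (w k))\<^sup>2 + (cmod (w (Suc k)))\<^sup>2" by (simp add: \<rho>_def)
      have \<rho>0: "\<rho> > 0" using False by (simp add: \<rho>_def add_pos_nonneg)
      \<comment> \<open>The rotation with these parameters sends the pair (w k, w (k + 1)) to (0,
        \<rho>).\<close>
      define p where "p = w (Suc k) / of_real \<rho>"
      define q where "q = - w k / of_real \<rho>"
      have q0: "q \<noteq> 0" using False \<rho>0 by (simp add: q_def)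
      have "p * cnj p + q * cnj q = (w k * cnj (w k) + w (Suc k) * cnj (w (Suc k))) / (of_real \<rho>)\<^sup>2"
        by (simp add: p_def q_def power2_eq_square add_divide_distrib)
      also have "w k * cnj (w k) + w (Suc k) * cnj (w (Suc k)) = (of_real \<rho>)\<^sup>2"
        by (simp only: complex_norm_square[symmetric] of_real_add[symmetric] \<rho>2[symmetric]) simp
      finally have pq: "p * cnj p + q * cnj q = 1" using \<rho>0 by simp
      have k: "k < n" "Suc k < n" "k \<noteq> Suc k" using Suc.prems by auto
      let ?w = "w(k := p * w k + q * w (Suc k), Suc k := - cnj q * w k + cnj p * w (Suc k))"
      have z1: "p * w k + q * w (Suc k) = 0" by (simp add: p_def q_def)
      have "- cnj q * w k + cnj p * w (Suc k) = (w k * cnj (w k) + w (Suc k) * cnj (w (Suc k))) / of_real \<rho>"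
        by (simp add: p_def q_def add_divide_distrib mult.commute)
      also have "w k * cnj (w k) + w (Suc k) * cnj (w (Suc k)) = (of_real \<rho>)\<^sup>2"
        by (simp only: complex_norm_square[symmetric] of_real_add[symmetric] \<rho>2[symmetric]) simp
      finally have z2: "- cnj q * w k + cnj p * w (Suc k) = of_real \<rho>" by (simp add: power2_eq_square)
      have "(\<Sum>i<n. (cmod (?w i))\<^sup>2) = (cmod (?w k))\<^sup>2 + ((cmod (?w (Suc k)))\<^sup>2 + (\<Sum>i\<in>{..<n} - {k} - {Suc k}. (cmod (?w i))\<^sup>2))"
        using k by (subst sum.remove[of _ k], simp, simp, subst sum.remove[of _ "Suc k"]) auto
      also have "\<dots> = \<rho>\<^sup>2 + (\<Sum>i\<in>{..<n} - {k} - {Suc k}. (cmod (w i))\<^sup>2)"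
      proof -
        have "(\<Sum>i\<in>{..<n} - {k} - {Suc k}. (cmod (?w i))\<^sup>2) = (\<Sum>i\<in>{..<n} - {k} - {Suc k}. (cmod (w i))\<^sup>2)"
          by (intro sum.cong) auto
        moreover have "?w k = 0" "?w (Suc k) = of_real \<rho>" using z1 z2 by simp_all
        ultimately show ?thesis by (simp only:) (simp add: \<rho>0 less_imp_le)
      qed
      also have "\<dots> = (cmod (w k))\<^sup>2 + ((cmod (w (Suc k)))\<^sup>2 + (\<Sum>i\<in>{..<n} - {k} - {Suc k}. (cmod (w i))\<^sup>2))"
        by (simp add: \<rho>2)
      also have "\<dots> = (\<Sum>i<n. (cmod (w i))\<^sup>2)"
        using k by (subst sum.remove[of _ k], simp, simp, subst sum.remove[of _ "Suc k"]) auto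
      finally have sm: "(\<Sum>i<n. (cmod (?w i))\<^sup>2) = (\<Sum>i<n. (cmod (w i))\<^sup>2)" .
      have "column_moment s z n w = column_moment s z n ?w"
        by (rule column_moment_conj[OF k pq q0])
      hence "column_moment s z n v = column_moment s z n ?w" using w(4) by (rule trans[rotated])
      moreover have "\<forall>i<Suc k. ?w i = 0" using w(1) z1 by (auto simp: less_Suc_eq)
      moreover have "?w n = v n" using w(3) k by simp
      ultimately show ?thesis using trans[OF sm w(2)] by blast
    qed
  qed
  from this[of "n - 1"] n obtain w where w: "\<forall>i<n - 1. w i = 0" "(\<Sum>i<n. (cmod (w i))\<^sup>2) = (\<Sum>i<n. (cmod (v i))\<^sup>2)" "w n = v n"
      "column_moment s z n v = column_moment s z n w" by auto
  obtain m where m: "n = Suc m" using n by (cases n) auto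
  have "(\<Sum>i<n. (cmod (w i))\<^sup>2) = (cmod (w (n - 1)))\<^sup>2" using w(1) by (simp add: m)
  thus ?thesis using w by (intro exI[of _ w]) auto
qed

lemma nn_integral_PiM_gauss_restrict:
  fixes F :: "('i \<Rightarrow> complex) \<Rightarrow> ennreal"
  assumes F: "F \<in> borel_measurable (PiM J (\<lambda>_. std_complex_gaussian))" and J: "J \<subseteq> I" "finite I"
  shows "(\<integral>\<^sup>+ g. F (restrict g J) \<partial>PiM I (\<lambda>_. std_complex_gaussian)) = (\<integral>\<^sup>+ g. F g \<partial>PiM J (\<lambda>_. std_complex_gaussian))"
proof -
  interpret G: prob_space std_complex_gaussian by (rule prob_space_gauss)
  interpret product_prob_space "\<lambda>_::'i. std_complex_gaussian" ..
  have "finite J" using J finite_subset by blast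
  hence "(\<integral>\<^sup>+ g. F g \<partial>PiM J (\<lambda>_. std_complex_gaussian)) =
    (\<integral>\<^sup>+ g. F g \<partial>distr (PiM I (\<lambda>_. std_complex_gaussian)) (PiM J (\<lambda>_. std_complex_gaussian)) (\<lambda>x. restrict x J))"
    using J by (subst distr_PiM_restrict_finite) auto
  also have "\<dots> = (\<integral>\<^sup>+ g. F (restrict g J) \<partial>PiM I (\<lambda>_. std_complex_gaussian))"
    by (rule nn_integral_distr) (use F J in \<open>auto intro: measurable_restrict_subset\<close>)
  finally show ?thesis ..
qed

text \<open>After concentration the last column lives on the rows n - 1 and n. Rotating these two
  rows alone makes it R times the last unit vector, and expansion along it leaves an n x n Gaussian
  matrix. No column rotation compensates, so the diagonal shift in row n - 1 becomes p z with p = v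
  n / R. This is the origin of the separate shift.\<close>

lemma column_moment_eq:
  assumes n: "0 < n" and pos: "(\<Sum>i<n. (cmod (v i))\<^sup>2) > 0"
  defines "R \<equiv> sqrt (\<Sum>i\<le>n. (cmod (v i))\<^sup>2)"
  shows "column_moment s z n v = ennreal (R powr (2 * s)) * shifted_moment s z n (z * v n / of_real R)"
proof -
  obtain w where w: "\<forall>i<n - 1. w i = 0" "(cmod (w (n - 1)))\<^sup>2 = (\<Sum>i<n. (cmod (v i))\<^sup>2)" "w n = v n"
     "column_moment s z n v = column_moment s z n w" using column_moment_concentrate[OF n, of v s z] by auto
  define m where "m = n - 1"
  have mn: "m < n" "Suc m = n" using n by (auto simp: m_def)
  have R2: "R\<^sup>2 = (cmod (w m))\<^sup>2 + (cmod (w n))\<^sup>2"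
    unfolding R_def using w(2,3) by (subst real_sqrt_pow2) (auto intro!: sum_nonneg add_nonneg_nonneg simp: lessThan_Suc_atMost[symmetric] m_def)
  have wm: "w m \<noteq> 0" using pos w(2) by (auto simp: m_def)
  have R0: "R > 0"
  proof -
    have "R\<^sup>2 > 0" unfolding R2 using wm by (simp add: add_pos_nonneg)
    moreover have "R \<ge> 0" by (auto simp: R_def intro!: sum_nonneg)
    ultimately show ?thesis by (metis less_eq_real_def power_zero_numeral less_irrefl)
  qed
  define p where "p = w n / of_real R"
  define q where "q = - w m / of_real R"
  have q0: "q \<noteq> 0" using wm R0 by (simp add: q_def)
  have rr: "w m * cnj (w m) + w n * cnj (w n) = (of_real R)\<^sup>2"
    by (simp only: complex_norm_square[symmetric] of_real_add[symmetric] R2[symmetric]) simp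
  have "p * cnj p + q * cnj q = (w m * cnj (w m) + w n * cnj (w n)) / (of_real R)\<^sup>2"
    by (simp add: p_def q_def power2_eq_square add_divide_distrib)
  hence pq: "p * cnj p + q * cnj q = 1" using R0 rr by simp
  have z1: "p * w m + q * w n = 0" by (simp add: p_def q_def)
  have "- cnj q * w m + cnj p * w n = (w m * cnj (w m) + w n * cnj (w n)) / of_real R"
    by (simp add: p_def q_def add_divide_distrib mult.commute)
  hence z2: "- cnj q * w m + cnj p * w n = of_real R" unfolding rr by (simp add: power2_eq_square)
  let ?I = "{..n} \<times> {..<n}" and ?J = "{..<n} \<times> {..<n}"
  let ?G = "PiM ?I (\<lambda>_. std_complex_gaussian)"
  let ?f = "\<lambda>i::nat. if i = m then n else if i = n then m else i"
  define \<sigma> where "\<sigma> = (\<lambda>(i, j::nat). (?f i, j))"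
  let ?R = "pair_rot p q \<sigma> ({m} \<times> {..<n})"
  define N where "N g = mat n n (\<lambda>(i, j). g (i, j) + (if i = j then if Suc i = n then z * v n / of_real R else z else 0))" for g :: "nat \<times> nat \<Rightarrow> complex"
  have Nm: "(\<lambda>g. ennreal (R powr (2 * s)) * ennreal (cmod (Determinant.det (N g)) powr (2 * s))) \<in> borel_measurable (PiM ?J (\<lambda>_. std_complex_gaussian))"
  proof -
    have [measurable]: "(\<lambda>g. Determinant.det (N g)) \<in> borel_measurable (PiM ?J (\<lambda>_. std_complex_gaussian))"
      unfolding N_def by (rule borel_measurable_det_mat) (auto intro!: borel_measurable_add measurable_component_gauss)
    show ?thesis by measurable
  qed
  have Nm': "(\<lambda>g. ennreal (R powr (2 * s)) * ennreal (cmod (Determinant.det (N (restrict g ?J))) powr (2 * s))) \<in> borel_measurable ?G"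
    by (rule measurable_compose[OF measurable_restrict_subset Nm]) auto
  have det: "cmod (Determinant.det (column_mat z n g w)) = R * cmod (Determinant.det (N (restrict (?R g) ?J)))" for g
  proof -
    define A where "A = column_mat z n g w"
    have Ac: "A \<in> carrier_mat (Suc n) (Suc n)" by (simp add: A_def)
    define B where "B = mat (Suc n) (Suc n) (\<lambda>(i, j). if i = m then p * A $$ (m, j) + q * A $$ (n, j)
     else if i = n then - cnj q * A $$ (m, j) + cnj p * A $$ (n, j) else A $$ (i, j))"
    have B: "B \<in> carrier_mat (Suc n) (Suc n)" by (simp add: B_def)
    have Ai: "A $$ (i, j) = (if j < n then g (i, j) + (if i = j then z else 0) else w i)" if "i < Suc n" "j < Suc n" for i j
      using that by (simp add: A_def column_mat_def)
    have Bn: "B $$ (i, n) = (if i = n then of_real R else 0)" if "i < Suc n" for i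
    proof -
      have "i < n - 1" if "i \<noteq> m" "i \<noteq> n" using that \<open>i < Suc n\<close> mn by linarith
      thus ?thesis using that mn w(1) z1 z2 by (auto simp: B_def Ai)
    qed
    have "Determinant.det A = Determinant.det B" unfolding B_def
      by (rule det_rot_rows[OF Ac _ _ _ pq q0, symmetric]) (use mn in auto)
    also have "\<dots> = (\<Sum>i<Suc n. B $$ (i, n) * cofactor B i n)"
      by (rule laplace_expansion_column[OF B]) simp
    also have "\<dots> = of_real R * cofactor B n n" by (simp add: Bn)
    also have "cofactor B n n = Determinant.det (mat_delete B n n)" by (simp add: cofactor_def)
    also have "mat_delete B n n = N (restrict (?R g) ?J)"
    proof (rule eq_matI)
      fix i j assume "i < dim_row (N (restrict (?R g) ?J))" "j < dim_col (N (restrict (?R g) ?J))"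
      hence ij: "i < n" "j < n" by (auto simp: N_def)
      have pz: "z * v n / of_real R = p * z" by (simp add: p_def w(3))
      show "mat_delete B n n $$ (i, j) = N (restrict (?R g) ?J) $$ (i, j)"
        using ij mn unfolding N_def pz
        by (cases "i = m"; cases "i = j") (auto simp: mat_delete_def B_def Ai pair_rot_def \<sigma>_def algebra_simps)
    qed (auto simp: N_def B_def mat_delete_def)
    finally show ?thesis using R0 by (simp add: A_def norm_mult)
  qed
  have "column_moment s z n v = (\<integral>\<^sup>+ g. ennreal (R powr (2 * s)) * ennreal (cmod (Determinant.det (N (restrict (?R g) ?J))) powr (2 * s)) \<partial>?G)"
    using R0 by (subst w(4)) (simp add: column_moment_def det powr_mult ennreal_mult)
  also have "\<dots> = (\<integral>\<^sup>+ g. ennreal (R powr (2 * s)) * ennreal (cmod (Determinant.det (N (restrict g ?J))) powr (2 * s)) \<partial>?G)"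
    by (rule nn_integral_PiM_gauss_pair_rot[OF Nm' _ _ _ _ pq q0]) (use mn in \<open>auto simp: \<sigma>_def\<close>)
  also have "\<dots> = (\<integral>\<^sup>+ g. ennreal (R powr (2 * s)) * ennreal (cmod (Determinant.det (N g)) powr (2 * s)) \<partial>PiM ?J (\<lambda>_. std_complex_gaussian))"
    by (rule nn_integral_PiM_gauss_restrict[OF Nm]) auto
  also have "\<dots> = ennreal (R powr (2 * s)) * (\<integral>\<^sup>+ g. ennreal (cmod (Determinant.det (N g)) powr (2 * s)) \<partial>PiM ?J (\<lambda>_. std_complex_gaussian))"
  proof (rule nn_integral_cmult)
    have [measurable]: "(\<lambda>g. Determinant.det (N g)) \<in> borel_measurable (PiM ?J (\<lambda>_. std_complex_gaussian))"
      unfolding N_def by (rule borel_measurable_det_mat) (auto intro!: borel_measurable_add measurable_component_gauss)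
    show "(\<lambda>g. ennreal (cmod (Determinant.det (N g)) powr (2 * s))) \<in> borel_measurable (PiM ?J (\<lambda>_. std_complex_gaussian))" by measurable
  qed
  finally show ?thesis by (simp add: shifted_moment_def N_def)
qed

section \<open>Noncentral Gaussian variables and Gamma laws\<close>

lemma nn_integral_gauss_phase:
  assumes [measurable]: "F \<in> borel_measurable borel" and w: "cmod \<omega> = 1"
  shows "(\<integral>\<^sup>+ a. F (\<omega> * a) \<partial>std_complex_gaussian) = (\<integral>\<^sup>+ a. F a \<partial>std_complex_gaussian)"
proof -
  interpret G: prob_space std_complex_gaussian by (rule prob_space_gauss)
  \<comment> \<open>The plane rotation with p = 0 and q = \<omega> brings the second variable,
    multiplied by the phase, into the first slot; the spare variable integrates to 1.\<close>
  have "\<omega> * cnj \<omega> = 1" using w by (simp add: complex_norm_square[symmetric])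
  hence "(\<integral>\<^sup>+ a. \<integral>\<^sup>+ b. (\<lambda>(a, b). F a) (0 * a + \<omega> * b, - cnj \<omega> * a + cnj 0 * b) \<partial>std_complex_gaussian \<partial>std_complex_gaussian)
       = (\<integral>\<^sup>+ a. \<integral>\<^sup>+ b. (\<lambda>(a, b). F a) (a, b) \<partial>std_complex_gaussian \<partial>std_complex_gaussian)"
    using w by (intro nn_integral_gauss_rotate2) auto
  thus ?thesis by (simp add: G.emeasure_space_1[simplified])
qed

text \<open>Expanding (v + cnj v)^(2 k) produces the frequencies 2 i - 2 k, all of absolute value at
  most 2 k < m, so averaging over the m-th roots of unity keeps only the central term. The finite
  average is as good as an integral over the circle.\<close>

lemma sum_roots_of_unity_power:
  fixes c :: complex and k :: nat
  defines "m \<equiv> 2 * k + 1"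
  shows "(\<Sum>j<m. (2 * Re (cis (2 * pi / m) ^ j * c)) ^ (2 * k)) = m * (2 * k choose k) * (cmod c) ^ (2 * k)"
proof -
  define \<omega> where "\<omega> = cis (2 * pi / m)"
  have m0: "m > 0" by (simp add: m_def)
  have w1: "\<omega> * cnj \<omega> = 1" by (simp add: \<omega>_def cis_cnj cis_mult)
  define \<eta> where "\<eta> i = \<omega> ^ i * cnj \<omega> ^ (2 * k - i)" for i
  have \<eta>cis: "\<eta> i = cis (2 * pi * (2 * real i - 2 * real k) / m)" if "i \<le> 2 * k" for i
  proof -
    have "\<eta> i = cis (real i * (2 * pi / m) - real (2 * k - i) * (2 * pi / m))"
      by (simp add: \<eta>_def \<omega>_def cis_cnj Complex.DeMoivre cis_mult)
    also have "real i * (2 * pi / m) - real (2 * k - i) * (2 * pi / m) = 2 * pi * (2 * real i - 2 * real k) / m"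
    proof -
      have "real (2 * k - i) = 2 * real k - real i" using that by (simp add: of_nat_diff)
      thus ?thesis by (simp only: diff_divide_distrib) (simp add: algebra_simps add_divide_distrib diff_divide_distrib)
    qed
    finally show ?thesis .
  qed
  have \<eta>s: "(\<Sum>j<m. \<eta> i ^ j) = (if i = k then of_nat m else 0)" if i: "i \<le> 2 * k" for i
  proof (cases "i = k")
    case True
    have "\<eta> k = 1" by (simp add: \<eta>_def mult_2 power_mult_distrib[symmetric] w1)
    thus ?thesis using True by simp
  next
    case False
    have "\<eta> i ^ m = cis (2 * pi * of_int (2 * int i - 2 * int k))"
      unfolding \<eta>cis[OF i] Complex.DeMoivre using m0 by (simp add: mult.assoc)
    also have "\<dots> = 1" by (rule cis_multiple_2pi) auto
    finally have pm: "\<eta> i ^ m = 1" .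
    have "\<eta> i \<noteq> 1"
    proof
      assume "\<eta> i = 1"
      hence "exp (\<i> * of_real (2 * pi * (2 * real i - 2 * real k) / m)) = 1"
        unfolding \<eta>cis[OF i] cis_conv_exp .
      then obtain n :: int where "2 * pi * (2 * real i - 2 * real k) / m = of_int (2 * n) * pi"
        unfolding exp_eq_1 by auto
      hence "pi * ((2 * real i - 2 * real k) - of_int n * m) = 0" using m0 by (simp add: field_simps)
      hence "real_of_int (2 * int i - 2 * int k) = of_int (n * int m)" by simp
      hence e: "2 * int i - 2 * int k = n * int m" by (simp only: of_int_eq_iff)
      have "\<bar>2 * int i - 2 * int k\<bar> < int m" using i by (auto simp: m_def)
      hence lt: "\<bar>n\<bar> * int m < int m" by (simp add: e abs_mult)
      have "n = 0"
      proof (rule ccontr)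
        assume "n \<noteq> 0"
        hence "1 * int m \<le> \<bar>n\<bar> * int m" by (intro mult_right_mono) auto
        thus False using lt by simp
      qed
      thus False using e False by simp
    qed
    thus ?thesis using False pm by (simp add: geometric_sum)
  qed
  have re: "complex_of_real (2 * Re u) = u + cnj u" for u by (simp add: complex_add_cnj)
  have "complex_of_real (\<Sum>j<m. (2 * Re (\<omega> ^ j * c)) ^ (2 * k)) = (\<Sum>j<m. (\<omega> ^ j * c + cnj (\<omega> ^ j * c)) ^ (2 * k))"
    by (simp only: of_real_sum of_real_power re)
  also have "\<dots> = (\<Sum>j<m. \<Sum>i\<le>2*k. of_nat (2 * k choose i) * (c ^ i * cnj c ^ (2 * k - i)) * \<eta> i ^ j)"
    unfolding binomial_ring
    by (intro sum.cong refl) (simp add: \<eta>_def power_mult_distrib power_mult[symmetric] mult_ac)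
  also have "\<dots> = (\<Sum>i\<le>2*k. of_nat (2 * k choose i) * (c ^ i * cnj c ^ (2 * k - i)) * (\<Sum>j<m. \<eta> i ^ j))"
    by (subst sum.swap) (simp add: sum_distrib_left)
  also have "\<dots> = (\<Sum>i\<le>2*k. if i = k then of_nat (2 * k choose k) * (c ^ k * cnj c ^ (2 * k - k)) * of_nat m else 0)"
    by (intro sum.cong refl) (simp add: \<eta>s)
  also have "\<dots> = of_nat (2 * k choose k) * (c * cnj c) ^ k * of_nat m"
    by (simp add: mult_2 power_mult_distrib)
  also have "\<dots> = complex_of_real (m * (2 * k choose k) * (cmod c) ^ (2 * k))"
    unfolding complex_norm_square[symmetric] by (simp add: power_mult[symmetric] mult_ac)
  finally show ?thesis unfolding \<omega>_def by (simp only: of_real_eq_iff)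
qed

text \<open>By phase invariance the integrand may be averaged over the rotations by powers of
  \<omega>, which turns its angular factor into a radial one.\<close>

lemma nn_integral_gauss_Re_power:
  fixes F :: "real \<Rightarrow> ennreal"
  assumes [measurable]: "F \<in> borel_measurable borel"
  shows "(\<integral>\<^sup>+ w. F ((cmod w)\<^sup>2) * ennreal ((2 * Re (w * c)) ^ (2 * k)) \<partial>std_complex_gaussian)
       = (\<integral>\<^sup>+ w. F ((cmod w)\<^sup>2) * ennreal ((2 * k choose k) * ((cmod w)\<^sup>2 * (cmod c)\<^sup>2) ^ k) \<partial>std_complex_gaussian)"
    (is "?A = ?B")
proof -
  define m where "m = 2 * k + 1"
  define \<omega> where "\<omega> = cis (2 * pi / m)"
  have w1: "cmod (\<omega> ^ j) = 1" for j by (simp add: \<omega>_def norm_power)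
  let ?f = "\<lambda>j w. F ((cmod w)\<^sup>2) * ennreal ((2 * Re (\<omega> ^ j * (w * c))) ^ (2 * k))"
  have "(\<integral>\<^sup>+ w. ?f j w \<partial>std_complex_gaussian) = ?A" for j
  proof -
    have "?A = (\<integral>\<^sup>+ w. (\<lambda>w. F ((cmod w)\<^sup>2) * ennreal ((2 * Re (w * c)) ^ (2 * k))) (\<omega> ^ j * w) \<partial>std_complex_gaussian)"
      by (rule nn_integral_gauss_phase[OF _ w1, symmetric]) measurable
    thus ?thesis using w1[of j] by (simp add: norm_mult mult.assoc)
  qed
  hence "of_nat m * ?A = (\<Sum>j<m. \<integral>\<^sup>+ w. ?f j w \<partial>std_complex_gaussian)" by simp
  also have "\<dots> = (\<integral>\<^sup>+ w. (\<Sum>j<m. ?f j w) \<partial>std_complex_gaussian)"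
    by (rule nn_integral_sum[symmetric]) measurable
  also have "\<dots> = (\<integral>\<^sup>+ w. of_nat m * (F ((cmod w)\<^sup>2) * ennreal ((2 * k choose k) * ((cmod w)\<^sup>2 * (cmod c)\<^sup>2) ^ k)) \<partial>std_complex_gaussian)"
  proof (rule nn_integral_cong)
    fix w
    have "(\<Sum>j<m. ?f j w) = F ((cmod w)\<^sup>2) * ennreal (\<Sum>j<m. (2 * Re (\<omega> ^ j * (w * c))) ^ (2 * k))"
      by (simp add: sum_distrib_left[symmetric] sum_ennreal)
    also have "(\<Sum>j<m. (2 * Re (\<omega> ^ j * (w * c))) ^ (2 * k)) = real m * ((2 * k choose k) * ((cmod w)\<^sup>2 * (cmod c)\<^sup>2) ^ k)"
      unfolding \<omega>_def m_def sum_roots_of_unity_power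
      by (simp add: norm_mult power_mult_distrib power_mult[symmetric] algebra_simps)
    also have "ennreal \<dots> = of_nat m * ennreal ((2 * k choose k) * ((cmod w)\<^sup>2 * (cmod c)\<^sup>2) ^ k)"
      by (subst ennreal_mult) (simp_all add: ennreal_of_nat_eq_real_of_nat)
    finally show "(\<Sum>j<m. ?f j w) = of_nat m * (F ((cmod w)\<^sup>2) * ennreal ((2 * k choose k) * ((cmod w)\<^sup>2 * (cmod c)\<^sup>2) ^ k))"
      by (simp add: mult_ac)
  qed
  also have "\<dots> = of_nat m * ?B"
    by (rule nn_integral_cmult) measurable
  finally have "of_nat m * ?A = of_nat m * ?B" .
  moreover have "(of_nat m :: ennreal) \<noteq> 0" "(of_nat m :: ennreal) \<noteq> \<infinity>" by (auto simp: m_def ennreal_of_nat_eq_real_of_nat simp del: of_nat_add of_nat_mult of_nat_Suc)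
  ultimately show ?thesis by (simp add: ennreal_mult_cancel_left)
qed

text \<open>The symmetry w -> -w replaces exp by cosh, whose series has nonnegative terms and can be
  integrated termwise. Since binom(2 k, k) / (2 k)! = 1 / (k!)^2, the angular average is a Bessel
  series in t |c|^2.\<close>

lemma nn_integral_gauss_exp_Re:
  fixes F :: "real \<Rightarrow> ennreal"
  assumes [measurable]: "F \<in> borel_measurable borel"
  shows "(\<integral>\<^sup>+ w. F ((cmod w)\<^sup>2) * ennreal (exp (2 * Re (w * c))) \<partial>std_complex_gaussian)
       = (\<Sum>k. \<integral>\<^sup>+ t. ennreal (exp (- t) * indicator {0<..} t) * (F t * ennreal ((t * (cmod c)\<^sup>2) ^ k / (fact k)\<^sup>2)) \<partial>lborel)"
proof -
  let ?G = std_complex_gaussian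
  let ?A = "\<integral>\<^sup>+ w. F ((cmod w)\<^sup>2) * ennreal (exp (2 * Re (w * c))) \<partial>?G"
  have "?A = (\<integral>\<^sup>+ w. (\<lambda>w. F ((cmod w)\<^sup>2) * ennreal (exp (2 * Re (w * c)))) (- 1 * w) \<partial>?G)"
    by (rule nn_integral_gauss_phase[symmetric]) simp_all
  hence eq: "?A = (\<integral>\<^sup>+ w. F ((cmod w)\<^sup>2) * ennreal (exp (- (2 * Re (w * c)))) \<partial>?G)" by simp
  have "2 * ?A = ?A + ?A" by (rule mult_2)
  also have "\<dots> = ?A + (\<integral>\<^sup>+ w. F ((cmod w)\<^sup>2) * ennreal (exp (- (2 * Re (w * c)))) \<partial>?G)" by (rule arg_cong2[OF refl eq])
  also have "\<dots> = (\<integral>\<^sup>+ w. F ((cmod w)\<^sup>2) * ennreal (exp (2 * Re (w * c))) + F ((cmod w)\<^sup>2) * ennreal (exp (- (2 * Re (w * c)))) \<partial>?G)"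
    by (rule nn_integral_add[symmetric]) measurable
  also have "\<dots> = (\<integral>\<^sup>+ w. 2 * (\<Sum>k. F ((cmod w)\<^sup>2) * ennreal ((2 * Re (w * c)) ^ (2 * k)) * ennreal (1 / fact (2 * k))) \<partial>?G)"
  proof (rule nn_integral_cong)
    fix w
    let ?u = "2 * Re (w * c)"
    have sm: "(\<lambda>k. ?u ^ (2 * k) / fact (2 * k)) sums cosh ?u"
    proof -
      have "(\<lambda>n. if even n then inverse (fact n) *\<^sub>R ?u ^ n else 0) sums cosh ?u" by (rule cosh_converges)
      moreover have "((\<lambda>n. (if even (2 * n) then inverse (fact (2 * n)) *\<^sub>R ?u ^ (2 * n) else 0)) sums cosh ?u) \<longleftrightarrow>
          ((\<lambda>n. if even n then inverse (fact n) *\<^sub>R ?u ^ n else 0) sums cosh ?u)"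
      proof (rule sums_mono_reindex[of "\<lambda>n::nat. 2 * n" "\<lambda>n. if even n then inverse (fact n) *\<^sub>R ?u ^ n else 0"])
        show "(if even n then inverse (fact n) *\<^sub>R ?u ^ n else 0) = 0" if "n \<notin> range (\<lambda>n::nat. 2 * n)" for n
          using that by (auto elim!: evenE)
      qed (simp add: strict_mono_def)
      ultimately have "(\<lambda>n. if even (2 * n) then inverse (fact (2 * n)) *\<^sub>R ?u ^ (2 * n) else 0) sums cosh ?u" by blast
      thus ?thesis by (simp add: field_simps)
    qed
    have "F ((cmod w)\<^sup>2) * ennreal (exp ?u) + F ((cmod w)\<^sup>2) * ennreal (exp (- ?u)) = F ((cmod w)\<^sup>2) * ennreal (2 * cosh ?u)"
    proof -
      have "2 * cosh ?u = exp ?u + exp (- ?u)" by (simp add: cosh_field_def)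
      hence "ennreal (2 * cosh ?u) = ennreal (exp ?u) + ennreal (exp (- ?u))" by (simp only: ennreal_plus exp_ge_zero)
      thus ?thesis by (simp only: distrib_left)
    qed
    also have "ennreal (2 * cosh ?u) = 2 * (\<Sum>k. ennreal (?u ^ (2 * k) / fact (2 * k)))"
      using sm by (subst suminf_ennreal2) (auto simp: sums_iff ennreal_mult)
    also have "F ((cmod w)\<^sup>2) * (2 * (\<Sum>k. ennreal (?u ^ (2 * k) / fact (2 * k)))) = 2 * (\<Sum>k. F ((cmod w)\<^sup>2) * ennreal (?u ^ (2 * k)) * ennreal (1 / fact (2 * k)))"
    proof -
      have t: "F ((cmod w)\<^sup>2) * ennreal (?u ^ (2 * k)) * ennreal (1 / fact (2 * k)) = F ((cmod w)\<^sup>2) * ennreal (?u ^ (2 * k) / fact (2 * k))" for k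
        by (subst mult.assoc, subst ennreal_mult[symmetric]) simp_all
      show ?thesis unfolding t ennreal_suminf_cmult by (rule mult.left_commute)
    qed
    finally show "F ((cmod w)\<^sup>2) * ennreal (exp ?u) + F ((cmod w)\<^sup>2) * ennreal (exp (- ?u)) =
       2 * (\<Sum>k. F ((cmod w)\<^sup>2) * ennreal (?u ^ (2 * k)) * ennreal (1 / fact (2 * k)))"
      .
  qed
  also have "\<dots> = 2 * (\<integral>\<^sup>+ w. (\<Sum>k. F ((cmod w)\<^sup>2) * ennreal ((2 * Re (w * c)) ^ (2 * k)) * ennreal (1 / fact (2 * k))) \<partial>?G)"
    by (rule nn_integral_cmult) measurable
  finally have "?A = (\<integral>\<^sup>+ w. (\<Sum>k. F ((cmod w)\<^sup>2) * ennreal ((2 * Re (w * c)) ^ (2 * k)) * ennreal (1 / fact (2 * k))) \<partial>?G)"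
    by (simp add: ennreal_mult_cancel_left)
  also have "\<dots> = (\<Sum>k. \<integral>\<^sup>+ w. F ((cmod w)\<^sup>2) * ennreal ((2 * Re (w * c)) ^ (2 * k)) * ennreal (1 / fact (2 * k)) \<partial>?G)"
    by (rule nn_integral_suminf) measurable
  also have "\<dots> = (\<Sum>k. \<integral>\<^sup>+ t. ennreal (exp (- t) * indicator {0<..} t) * (F t * ennreal ((t * (cmod c)\<^sup>2) ^ k / (fact k)\<^sup>2)) \<partial>lborel)"
  proof (rule suminf_cong)
    fix k
    have bin: "real (2 * k choose k) / fact (2 * k) = 1 / (fact k)\<^sup>2"
      by (subst binomial_fact) (auto simp: power2_eq_square mult_2)
    have "(\<integral>\<^sup>+ w. F ((cmod w)\<^sup>2) * ennreal ((2 * Re (w * c)) ^ (2 * k)) * ennreal (1 / fact (2 * k)) \<partial>?G)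
        = (\<integral>\<^sup>+ w. F ((cmod w)\<^sup>2) * ennreal ((2 * Re (w * c)) ^ (2 * k)) \<partial>?G) * ennreal (1 / fact (2 * k))"
      by (rule nn_integral_multc) measurable
    also have "\<dots> = (\<integral>\<^sup>+ w. F ((cmod w)\<^sup>2) * ennreal ((2 * k choose k) * ((cmod w)\<^sup>2 * (cmod c)\<^sup>2) ^ k) \<partial>?G) * ennreal (1 / fact (2 * k))"
      by (subst nn_integral_gauss_Re_power) simp_all
    also have "\<dots> = (\<integral>\<^sup>+ w. F ((cmod w)\<^sup>2) * ennreal ((2 * k choose k) * ((cmod w)\<^sup>2 * (cmod c)\<^sup>2) ^ k) * ennreal (1 / fact (2 * k)) \<partial>?G)"
      by (rule nn_integral_multc[symmetric]) measurable
    also have "\<dots> = (\<integral>\<^sup>+ w. (\<lambda>t. F t * ennreal ((t * (cmod c)\<^sup>2) ^ k / (fact k)\<^sup>2)) ((cmod w)\<^sup>2) \<partial>?G)"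
    proof (rule nn_integral_cong)
      fix w
      have "(2 * k choose k) * ((cmod w)\<^sup>2 * (cmod c)\<^sup>2) ^ k * (1 / fact (2 * k)) = real (2 * k choose k) / fact (2 * k) * ((cmod w)\<^sup>2 * (cmod c)\<^sup>2) ^ k"
        by simp
      also have "\<dots> = ((cmod w)\<^sup>2 * (cmod c)\<^sup>2) ^ k / (fact k)\<^sup>2" unfolding bin by simp
      finally show "F ((cmod w)\<^sup>2) * ennreal ((2 * k choose k) * ((cmod w)\<^sup>2 * (cmod c)\<^sup>2) ^ k) * ennreal (1 / fact (2 * k))
        = F ((cmod w)\<^sup>2) * ennreal (((cmod w)\<^sup>2 * (cmod c)\<^sup>2) ^ k / (fact k)\<^sup>2)"
        by (simp add: mult.assoc ennreal_mult[symmetric])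
    qed
    also have "\<dots> = (\<integral>\<^sup>+ t. ennreal (exp (- t) * indicator {0<..} t) * (F t * ennreal ((t * (cmod c)\<^sup>2) ^ k / (fact k)\<^sup>2)) \<partial>lborel)"
      by (rule nn_integral_gauss_norm_square) measurable
    finally show "(\<integral>\<^sup>+ w. F ((cmod w)\<^sup>2) * ennreal ((2 * Re (w * c)) ^ (2 * k)) * ennreal (1 / fact (2 * k)) \<partial>?G) = \<dots>" .
  qed
  finally show ?thesis .
qed

text \<open>Completing the square and averaging over the phase: |a + \<zeta>|^2 is a Poisson
  mixture, with parameter |\<zeta>|^2, of Gamma variables of shape k + 1.\<close>

lemma nn_integral_gauss_noncentral:
  fixes F :: "real \<Rightarrow> ennreal"
  assumes [measurable]: "F \<in> borel_measurable borel"
  shows "(\<integral>\<^sup>+ a. F ((cmod (a + \<zeta>))\<^sup>2) \<partial>std_complex_gaussian)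
       = (\<Sum>k. ennreal (exp (- (cmod \<zeta>)\<^sup>2) * ((cmod \<zeta>)\<^sup>2) ^ k / (fact k)\<^sup>2) *
           (\<integral>\<^sup>+ t. ennreal (t ^ k * exp (- t) * indicator {0<..} t) * F t \<partial>lborel))"
proof -
  let ?e = "\<lambda>w. ennreal (exp (- (cmod w)\<^sup>2) / pi)"
  have "(\<integral>\<^sup>+ a. F ((cmod (a + \<zeta>))\<^sup>2) \<partial>std_complex_gaussian) = (\<integral>\<^sup>+ a. (\<lambda>w. ?e (w - \<zeta>) * F ((cmod w)\<^sup>2)) (a + \<zeta>) \<partial>lborel)"
    by (subst nn_integral_gauss) simp_all
  also have "\<dots> = (\<integral>\<^sup>+ w. ?e (w - \<zeta>) * F ((cmod w)\<^sup>2) \<partial>lborel)"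
    by (rule nn_integral_lborel_shift) measurable
  also have "\<dots> = (\<integral>\<^sup>+ w. ennreal (exp (- (cmod \<zeta>)\<^sup>2)) * (?e w * (F ((cmod w)\<^sup>2) * ennreal (exp (2 * Re (w * cnj \<zeta>))))) \<partial>lborel)"
  proof (rule nn_integral_cong)
    fix w
    have "exp (- (cmod (w - \<zeta>))\<^sup>2) / pi = exp (- (cmod \<zeta>)\<^sup>2) * (exp (- (cmod w)\<^sup>2) / pi * exp (2 * Re (w * cnj \<zeta>)))"
      unfolding cmod_power2 by (simp add: exp_add[symmetric] power2_eq_square algebra_simps)
    hence "?e (w - \<zeta>) = ennreal (exp (- (cmod \<zeta>)\<^sup>2)) * (?e w * ennreal (exp (2 * Re (w * cnj \<zeta>))))"
      by (simp add: ennreal_mult[symmetric])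
    thus "?e (w - \<zeta>) * F ((cmod w)\<^sup>2) = ennreal (exp (- (cmod \<zeta>)\<^sup>2)) * (?e w * (F ((cmod w)\<^sup>2) * ennreal (exp (2 * Re (w * cnj \<zeta>)))))"
      by (simp add: mult_ac)
  qed
  also have "\<dots> = ennreal (exp (- (cmod \<zeta>)\<^sup>2)) * (\<integral>\<^sup>+ w. F ((cmod w)\<^sup>2) * ennreal (exp (2 * Re (w * cnj \<zeta>))) \<partial>std_complex_gaussian)"
    by (subst nn_integral_gauss) (simp_all add: nn_integral_cmult)
  also have "\<dots> = (\<Sum>k. ennreal (exp (- (cmod \<zeta>)\<^sup>2)) * (\<integral>\<^sup>+ t. ennreal (exp (- t) * indicator {0<..} t) * (F t * ennreal ((t * (cmod \<zeta>)\<^sup>2) ^ k / (fact k)\<^sup>2)) \<partial>lborel))"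
    by (subst nn_integral_gauss_exp_Re) (simp_all add: ennreal_suminf_cmult)
  also have "\<dots> = (\<Sum>k. ennreal (exp (- (cmod \<zeta>)\<^sup>2) * ((cmod \<zeta>)\<^sup>2) ^ k / (fact k)\<^sup>2) *
           (\<integral>\<^sup>+ t. ennreal (t ^ k * exp (- t) * indicator {0<..} t) * F t \<partial>lborel))"
  proof (rule suminf_cong)
    fix k
    have "(\<integral>\<^sup>+ t. ennreal (exp (- t) * indicator {0<..} t) * (F t * ennreal ((t * (cmod \<zeta>)\<^sup>2) ^ k / (fact k)\<^sup>2)) \<partial>lborel)
       = (\<integral>\<^sup>+ t. ennreal (((cmod \<zeta>)\<^sup>2) ^ k / (fact k)\<^sup>2) * (ennreal (t ^ k * exp (- t) * indicator {0<..} t) * F t) \<partial>lborel)"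
    proof (rule nn_integral_cong)
      fix t :: real
      have "ennreal (exp (- t) * indicator {0<..} t) * ennreal ((t * (cmod \<zeta>)\<^sup>2) ^ k / (fact k)\<^sup>2)
        = ennreal (((cmod \<zeta>)\<^sup>2) ^ k / (fact k)\<^sup>2) * ennreal (t ^ k * exp (- t) * indicator {0<..} t)"
        by (cases "t > 0") (simp_all add: ennreal_mult[symmetric] power_mult_distrib)
      hence "ennreal (exp (- t) * indicator {0<..} t) * ennreal ((t * (cmod \<zeta>)\<^sup>2) ^ k / (fact k)\<^sup>2) * F t
        = ennreal (((cmod \<zeta>)\<^sup>2) ^ k / (fact k)\<^sup>2) * ennreal (t ^ k * exp (- t) * indicator {0<..} t) * F t" by (simp only:)
      thus "ennreal (exp (- t) * indicator {0<..} t) * (F t * ennreal ((t * (cmod \<zeta>)\<^sup>2) ^ k / (fact k)\<^sup>2)) =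
        ennreal (((cmod \<zeta>)\<^sup>2) ^ k / (fact k)\<^sup>2) * (ennreal (t ^ k * exp (- t) * indicator {0<..} t) * F t)"
        by (simp only: mult_ac)
    qed
    also have "\<dots> = ennreal (((cmod \<zeta>)\<^sup>2) ^ k / (fact k)\<^sup>2) * (\<integral>\<^sup>+ t. ennreal (t ^ k * exp (- t) * indicator {0<..} t) * F t \<partial>lborel)"
      by (rule nn_integral_cmult) measurable
    finally show "ennreal (exp (- (cmod \<zeta>)\<^sup>2)) * (\<integral>\<^sup>+ t. ennreal (exp (- t) * indicator {0<..} t) * (F t * ennreal ((t * (cmod \<zeta>)\<^sup>2) ^ k / (fact k)\<^sup>2)) \<partial>lborel)
      = ennreal (exp (- (cmod \<zeta>)\<^sup>2) * ((cmod \<zeta>)\<^sup>2) ^ k / (fact k)\<^sup>2) * (\<integral>\<^sup>+ t. ennreal (t ^ k * exp (- t) * indicator {0<..} t) * F t \<partial>lborel)"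
      by (simp add: ennreal_mult[symmetric] mult.assoc[symmetric])
  qed
  finally show ?thesis .
qed

text \<open>The substitution S = Y + T, b = Y / S with Jacobian S, carried out as a translation in T
  followed by a scaling in Y.\<close>

lemma nn_integral_dirichlet_subst:
  fixes f :: "real \<times> real \<Rightarrow> ennreal"
  assumes [measurable]: "f \<in> borel_measurable (borel \<Otimes>\<^sub>M borel)"
  shows "(\<integral>\<^sup>+ Y. \<integral>\<^sup>+ T. indicator {0<..} Y * indicator {0<..} T * f (Y, T) \<partial>lborel \<partial>lborel)
       = (\<integral>\<^sup>+ S. indicator {0<..} S * ennreal S * (\<integral>\<^sup>+ b. indicator {0<..<1} b * f (S * b, S * (1 - b)) \<partial>lborel) \<partial>lborel)"
proof -
  have "(\<integral>\<^sup>+ Y. \<integral>\<^sup>+ T. indicator {0<..} Y * indicator {0<..} T * f (Y, T) \<partial>lborel \<partial>lborel)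
      = (\<integral>\<^sup>+ Y. \<integral>\<^sup>+ S. indicator {0<..} Y * indicator {0<..} (S + - Y) * f (Y, S + - Y) \<partial>lborel \<partial>lborel)"
  proof (rule nn_integral_cong)
    fix Y :: real
    show "(\<integral>\<^sup>+ T. indicator {0<..} Y * indicator {0<..} T * f (Y, T) \<partial>lborel) = (\<integral>\<^sup>+ S. indicator {0<..} Y * indicator {0<..} (S + - Y) * f (Y, S + - Y) \<partial>lborel)"
      by (rule nn_integral_lborel_shift[where F = "\<lambda>T. indicator {0<..} Y * indicator {0<..} T * f (Y, T)", symmetric]) measurable
  qed
  also have "\<dots> = (\<integral>\<^sup>+ S. \<integral>\<^sup>+ Y. indicator {0<..} Y * indicator {0<..} (S + - Y) * f (Y, S + - Y) \<partial>lborel \<partial>lborel)"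
    by (rule lborel_pair.Fubini') measurable
  also have "\<dots> = (\<integral>\<^sup>+ S. indicator {0<..} S * ennreal S * (\<integral>\<^sup>+ b. indicator {0<..<1} b * f (S * b, S * (1 - b)) \<partial>lborel) \<partial>lborel)"
  proof (rule nn_integral_cong)
    fix S :: real
    show "(\<integral>\<^sup>+ Y. indicator {0<..} Y * indicator {0<..} (S + - Y) * f (Y, S + - Y) \<partial>lborel) = indicator {0<..} S * ennreal S * (\<integral>\<^sup>+ b. indicator {0<..<1} b * f (S * b, S * (1 - b)) \<partial>lborel)"
    proof (cases "S > 0")
      case False
      hence "indicator {0<..} Y * indicator {0<..} (S + - Y) * f (Y, S + - Y) = 0" for Y
        by (auto simp: indicator_def)
      hence "(\<integral>\<^sup>+ Y. indicator {0<..} Y * indicator {0<..} (S + - Y) * f (Y, S + - Y) \<partial>lborel) = integral\<^sup>N lborel (\<lambda>Y::real. 0)"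
        by (simp only:)
      thus ?thesis using False by simp
    next
      case True
      have "(\<integral>\<^sup>+ Y. indicator {0<..} Y * indicator {0<..} (S + - Y) * f (Y, S + - Y) \<partial>lborel) =
         ennreal \<bar>S\<bar> * (\<integral>\<^sup>+ b. indicator {0<..} (0 + S * b) * indicator {0<..} (S + - (0 + S * b)) * f (0 + S * b, S + - (0 + S * b)) \<partial>lborel)"
        by (rule nn_integral_real_affine) (use True in simp_all)
      also have "(\<integral>\<^sup>+ b. indicator {0<..} (0 + S * b) * indicator {0<..} (S + - (0 + S * b)) * f (0 + S * b, S + - (0 + S * b)) \<partial>lborel)
         = (\<integral>\<^sup>+ b. indicator {0<..<1} b * f (S * b, S * (1 - b)) \<partial>lborel)"
      proof (rule nn_integral_cong)
        fix b :: real
        have "indicator {0<..} (0 + S * b) * indicator {0<..} (S + - (0 + S * b)) = (indicator {0<..<1} b :: ennreal)"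
          using True by (auto simp: indicator_def zero_less_mult_iff)
        moreover have "S + - (0 + S * b) = S * (1 - b)" by (simp add: algebra_simps)
        ultimately show "indicator {0<..} (0 + S * b) * indicator {0<..} (S + - (0 + S * b)) * f (0 + S * b, S + - (0 + S * b)) = indicator {0<..<1} b * f (S * b, S * (1 - b))"
          by simp
      qed
      finally show ?thesis using True by simp
    qed
  qed
  finally show ?thesis .
qed

lemma nn_integral_power_unit:
  "(\<integral>\<^sup>+ b. indicator {0<..<1} b * ennreal ((1 - b) ^ m) \<partial>lborel) = ennreal (1 / real (Suc m))"
proof -
  have "(\<integral>\<^sup>+ b. indicator {0<..<1} b * ennreal ((1 - b) ^ m) \<partial>lborel) = (\<integral>\<^sup>+ b. ennreal ((1 - b) ^ m) * indicator {0..1} b \<partial>lborel)"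
  proof (rule nn_integral_cong_AE)
    show "AE b in lborel. indicator {0<..<1} b * ennreal ((1 - b) ^ m) = ennreal ((1 - b) ^ m) * indicator {0..1} b"
      using AE_lborel_singleton[of "0::real"] AE_lborel_singleton[of "1::real"]
      by eventually_elim (auto simp: indicator_def)
  qed
  also have "\<dots> = ennreal (- ((1 - 1) ^ Suc m / real (Suc m)) - - ((1 - 0) ^ Suc m / real (Suc m)))"
  proof (rule nn_integral_FTC_Icc[where F = "\<lambda>b. - ((1 - b) ^ Suc m / real (Suc m))"])
    fix b :: real
    have "((\<lambda>b. - ((1 - b) ^ Suc m / real (Suc m))) has_real_derivative - (real (Suc m) * (1 - b) ^ m * (- 1) / real (Suc m))) (at b)"
      by (rule derivative_eq_intros refl | simp)+
    thus "((\<lambda>b. - ((1 - b) ^ Suc m / real (Suc m))) has_real_derivative (1 - b) ^ m) (at b)"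
      by (simp del: of_nat_Suc power_Suc)
  qed auto
  finally show ?thesis by simp
qed

text \<open>A sum of m + 1 independent exponential variables has the Gamma law of shape m + 1; in
  the induction step the ratio b is integrated out.\<close>

lemma nn_integral_sum_norm_square_gauss:
  fixes F :: "real \<Rightarrow> ennreal"
  assumes F[measurable]: "F \<in> borel_measurable borel"
  shows "(\<integral>\<^sup>+ w. F (\<Sum>i<Suc m. (cmod (w i))\<^sup>2) \<partial>PiM {..<Suc m} (\<lambda>_. std_complex_gaussian))
       = (\<integral>\<^sup>+ t. indicator {0<..} t * ennreal (t ^ m / fact m * exp (- t)) * F t \<partial>lborel)"
  using F
proof (induction m arbitrary: F)
  case (0 F)
  interpret G: prob_space std_complex_gaussian by (rule prob_space_gauss)
  interpret product_sigma_finite "\<lambda>_::nat. std_complex_gaussian" ..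
  note [measurable] = 0
  have s0: "{..<Suc 0} = {0::nat}" by auto
  have "(\<integral>\<^sup>+ w. F (\<Sum>i<Suc 0. (cmod (w i))\<^sup>2) \<partial>PiM {..<Suc 0} (\<lambda>_. std_complex_gaussian)) = (\<integral>\<^sup>+ a. F ((cmod a)\<^sup>2) \<partial>std_complex_gaussian)"
    unfolding s0 by (simp add: product_nn_integral_singleton[of "\<lambda>a. F ((cmod a)\<^sup>2)"])
  also have "\<dots> = (\<integral>\<^sup>+ t. ennreal (exp (- t) * indicator {0<..} t) * F t \<partial>lborel)"
    by (rule nn_integral_gauss_norm_square) measurable
  also have "\<dots> = (\<integral>\<^sup>+ t. indicator {0<..} t * ennreal (t ^ 0 / fact 0 * exp (- t)) * F t \<partial>lborel)"
    by (intro nn_integral_cong) (auto simp: indicator_def)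
  finally show ?case .
next
  case (Suc m F)
  interpret G: prob_space std_complex_gaussian by (rule prob_space_gauss)
  interpret product_sigma_finite "\<lambda>_::nat. std_complex_gaussian" ..
  note [measurable] = Suc.prems
  let ?d = "\<lambda>t. indicator {0<..} t * ennreal (t ^ m / fact m * exp (- t))"
  have ins: "{..<Suc (Suc m)} = insert (Suc m) {..<Suc m}" by auto
  have "(\<integral>\<^sup>+ w. F (\<Sum>i<Suc (Suc m). (cmod (w i))\<^sup>2) \<partial>PiM {..<Suc (Suc m)} (\<lambda>_. std_complex_gaussian))
      = (\<integral>\<^sup>+ a. \<integral>\<^sup>+ w. F (\<Sum>i<Suc (Suc m). (cmod ((w(Suc m := a)) i))\<^sup>2) \<partial>PiM {..<Suc m} (\<lambda>_. std_complex_gaussian) \<partial>std_complex_gaussian)"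
    unfolding ins
    by (rule product_nn_integral_insert_rev)
       (auto intro!: measurable_compose[OF _ Suc.prems] borel_measurable_sum borel_measurable_power borel_measurable_norm measurable_component_gauss)
  also have "\<dots> = (\<integral>\<^sup>+ a. \<integral>\<^sup>+ w. (\<lambda>t. F ((cmod a)\<^sup>2 + t)) (\<Sum>i<Suc m. (cmod (w i))\<^sup>2) \<partial>PiM {..<Suc m} (\<lambda>_. std_complex_gaussian) \<partial>std_complex_gaussian)"
  proof (intro nn_integral_cong)
    fix a and w :: "nat \<Rightarrow> complex"
    have "(\<Sum>i<Suc (Suc m). (cmod ((w(Suc m := a)) i))\<^sup>2) = (cmod a)\<^sup>2 + (\<Sum>i<Suc m. (cmod ((w(Suc m := a)) i))\<^sup>2)"
      by (subst sum.lessThan_Suc) simp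
    also have "(\<Sum>i<Suc m. (cmod ((w(Suc m := a)) i))\<^sup>2) = (\<Sum>i<Suc m. (cmod (w i))\<^sup>2)"
      by (intro sum.cong) auto
    finally show "F (\<Sum>i<Suc (Suc m). (cmod ((w(Suc m := a)) i))\<^sup>2) = F ((cmod a)\<^sup>2 + (\<Sum>i<Suc m. (cmod (w i))\<^sup>2))" by (simp only:)
  qed
  also have "\<dots> = (\<integral>\<^sup>+ a. (\<lambda>u. \<integral>\<^sup>+ t. ?d t * F (u + t) \<partial>lborel) ((cmod a)\<^sup>2) \<partial>std_complex_gaussian)"
    by (intro nn_integral_cong) (subst Suc.IH, simp_all)
  also have "\<dots> = (\<integral>\<^sup>+ u. ennreal (exp (- u) * indicator {0<..} u) * (\<integral>\<^sup>+ t. ?d t * F (u + t) \<partial>lborel) \<partial>lborel)"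
    by (rule nn_integral_gauss_norm_square) measurable
  also have "\<dots> = (\<integral>\<^sup>+ u. \<integral>\<^sup>+ t. indicator {0<..} u * indicator {0<..} t * (\<lambda>(u, t). ennreal (exp (- u)) * ennreal (t ^ m / fact m * exp (- t)) * F (u + t)) (u, t) \<partial>lborel \<partial>lborel)"
  proof (rule nn_integral_cong)
    fix u :: real
    have "ennreal (exp (- u) * indicator {0<..} u) * (\<integral>\<^sup>+ t. ?d t * F (u + t) \<partial>lborel) = (\<integral>\<^sup>+ t. ennreal (exp (- u) * indicator {0<..} u) * (?d t * F (u + t)) \<partial>lborel)"
      by (rule nn_integral_cmult[symmetric]) measurable
    also have "\<dots> = (\<integral>\<^sup>+ t. indicator {0<..} u * indicator {0<..} t * (\<lambda>(u, t). ennreal (exp (- u)) * ennreal (t ^ m / fact m * exp (- t)) * F (u + t)) (u, t) \<partial>lborel)"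
      by (intro nn_integral_cong) (auto simp: indicator_def mult.assoc)
    finally show "ennreal (exp (- u) * indicator {0<..} u) * (\<integral>\<^sup>+ t. ?d t * F (u + t) \<partial>lborel) = \<dots>" .
  qed
  also have "\<dots> = (\<integral>\<^sup>+ S. indicator {0<..} S * ennreal S * (\<integral>\<^sup>+ b. indicator {0<..<1} b *
       (\<lambda>(u, t). ennreal (exp (- u)) * ennreal (t ^ m / fact m * exp (- t)) * F (u + t)) (S * b, S * (1 - b)) \<partial>lborel) \<partial>lborel)"
    by (rule nn_integral_dirichlet_subst) measurable
  also have "\<dots> = (\<integral>\<^sup>+ S. indicator {0<..} S * ennreal (S ^ Suc m / fact (Suc m) * exp (- S)) * F S \<partial>lborel)"
  proof (rule nn_integral_cong)
    fix S :: real
    show "indicator {0<..} S * ennreal S * (\<integral>\<^sup>+ b. indicator {0<..<1} b *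
       (\<lambda>(u, t). ennreal (exp (- u)) * ennreal (t ^ m / fact m * exp (- t)) * F (u + t)) (S * b, S * (1 - b)) \<partial>lborel)
       = indicator {0<..} S * ennreal (S ^ Suc m / fact (Suc m) * exp (- S)) * F S"
    proof (cases "S > 0")
      case False thus ?thesis by simp
    next
      case True
      have "(\<integral>\<^sup>+ b. indicator {0<..<1} b *
       (\<lambda>(u, t). ennreal (exp (- u)) * ennreal (t ^ m / fact m * exp (- t)) * F (u + t)) (S * b, S * (1 - b)) \<partial>lborel)
        = (\<integral>\<^sup>+ b. (ennreal (S ^ m / fact m * exp (- S)) * F S) * (indicator {0<..<1} b * ennreal ((1 - b) ^ m)) \<partial>lborel)"
      proof (rule nn_integral_cong)
        fix b :: real
        have e: "exp (- (S * b)) * exp (- (S * (1 - b))) = exp (- S)"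
          by (simp add: exp_add[symmetric] algebra_simps)
        have "ennreal (exp (- (S * b))) * ennreal ((S * (1 - b)) ^ m / fact m * exp (- (S * (1 - b)))) = ennreal (S ^ m / fact m * exp (- S)) * ennreal ((1 - b) ^ m)" if "0 < b" "b < 1"
          using that True unfolding e[symmetric]
          by (simp add: ennreal_mult[symmetric] power_mult_distrib mult_ac del: exp_minus_inverse)
        moreover have "S * b + S * (1 - b) = S" by (simp add: algebra_simps)
        ultimately show "indicator {0<..<1} b * (\<lambda>(u, t). ennreal (exp (- u)) * ennreal (t ^ m / fact m * exp (- t)) * F (u + t)) (S * b, S * (1 - b))
          = (ennreal (S ^ m / fact m * exp (- S)) * F S) * (indicator {0<..<1} b * ennreal ((1 - b) ^ m))"
          by (cases "0 < b \<and> b < 1") (auto simp: indicator_def mult_ac)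
      qed
      also have "\<dots> = (ennreal (S ^ m / fact m * exp (- S)) * F S) * ennreal (1 / real (Suc m))"
        by (subst nn_integral_cmult) (simp, simp only: nn_integral_power_unit)
      finally have *: "(\<integral>\<^sup>+ b. indicator {0<..<1} b *
       (\<lambda>(u, t). ennreal (exp (- u)) * ennreal (t ^ m / fact m * exp (- t)) * F (u + t)) (S * b, S * (1 - b)) \<partial>lborel) = \<dots>" .
      have "S * (S ^ m / fact m * exp (- S)) * (1 / real (Suc m)) = S ^ Suc m / fact (Suc m) * exp (- S)"
        unfolding fact_Suc power_Suc by (simp add: mult_ac del: of_nat_Suc)
      hence e: "ennreal S * ennreal (S ^ m / fact m * exp (- S)) * ennreal (1 / real (Suc m)) = ennreal (S ^ Suc m / fact (Suc m) * exp (- S))"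
        using True by (metis ennreal_mult exp_ge_zero fact_ge_zero less_imp_le mult_nonneg_nonneg of_nat_0_le_iff zero_le_divide_1_iff zero_le_power divide_nonneg_nonneg)
      have "ennreal S * ((ennreal (S ^ m / fact m * exp (- S)) * F S) * ennreal (1 / real (Suc m)))
        = ennreal S * ennreal (S ^ m / fact m * exp (- S)) * ennreal (1 / real (Suc m)) * F S" by (simp only: mult_ac)
      thus ?thesis unfolding * e using True by (simp del: of_nat_Suc fact_Suc power_Suc)
    qed
  qed
  finally show ?case .
qed

section \<open>The recursion in the size and its solution\<close>

lemma column_mat_cong:
  "(\<And>i. i \<le> n \<Longrightarrow> v i = v' i) \<Longrightarrow> column_mat z n g v = column_mat z n g v'"
  unfolding column_mat_def by (rule cong_mat) auto

lemma column_moment_cong: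
  "(\<And>i. i \<le> n \<Longrightarrow> v i = v' i) \<Longrightarrow> column_moment s z n v = column_moment s z n v'"
  unfolding column_moment_def using column_mat_cong[of n v v'] by simp

lemma measurable_column_moment:
  assumes "\<And>i. i \<le> n \<Longrightarrow> f i \<in> borel_measurable N"
  shows "(\<lambda>x. column_moment s z n (\<lambda>i. f i x)) \<in> borel_measurable N"
proof -
  let ?P = "PiM ({..n} \<times> {..<n}) (\<lambda>_. std_complex_gaussian)"
  interpret G: prob_space std_complex_gaussian by (rule prob_space_gauss)
  interpret P: prob_space ?P by (intro prob_space_PiM prob_space_gauss)
  have "(\<lambda>p. Determinant.det (column_mat z n (snd p) (\<lambda>i. f i (fst p)))) \<in> borel_measurable (N \<Otimes>\<^sub>M ?P)"
    unfolding column_mat_def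
  proof (rule borel_measurable_det_mat)
    fix i j assume ij: "i < Suc n" "j < Suc n"
    have "(\<lambda>p. snd p (i, j)) \<in> borel_measurable (N \<Otimes>\<^sub>M ?P)" if "j < n"
      by (rule measurable_compose[OF measurable_snd measurable_component_gauss]) (use that ij in auto)
    moreover have "(\<lambda>p. f i (fst p)) \<in> borel_measurable (N \<Otimes>\<^sub>M ?P)"
      by (rule measurable_compose[OF measurable_fst assms]) (use ij in auto)
    ultimately show "(\<lambda>p. if j < n then snd p (i, j) + (if i = j then z else 0) else f i (fst p)) \<in> borel_measurable (N \<Otimes>\<^sub>M ?P)"
      by (cases "j < n") (auto intro!: borel_measurable_add)
  qed
  hence "(\<lambda>p. ennreal (cmod (Determinant.det (column_mat z n (snd p) (\<lambda>i. f i (fst p)))) powr (2 * s))) \<in> borel_measurable (N \<Otimes>\<^sub>M ?P)"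
    by measurable
  thus ?thesis unfolding column_moment_def
    by (intro P.borel_measurable_nn_integral) (simp add: case_prod_beta')
qed

text \<open>Fubini between the last column and the others. The last entry a + \<zeta> of the column
  is kept apart because it alone is not centred.\<close>

lemma shifted_moment_Suc_eq_column_moment:
  "shifted_moment s z (Suc n) \<zeta> = (\<integral>\<^sup>+ a. \<integral>\<^sup>+ w. column_moment s z n (w(n := a + \<zeta>)) \<partial>PiM {..<n} (\<lambda>_. std_complex_gaussian) \<partial>std_complex_gaussian)"
proof -
  interpret G: prob_space std_complex_gaussian by (rule prob_space_gauss)
  interpret P: product_sigma_finite "\<lambda>_::nat\<times>nat. std_complex_gaussian" ..
  interpret Q: product_sigma_finite "\<lambda>_::nat. std_complex_gaussian" ..
  let ?g = std_complex_gaussian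
  let ?C = "{..n} \<times> {n}" and ?D = "{..n} \<times> {..<n}"
  define v where "v u i = u i + (if i = n then \<zeta> else 0)" for u :: "nat \<Rightarrow> complex" and i
  let ?mat = "\<lambda>g. mat (Suc n) (Suc n) (\<lambda>(i, j). g (i, j) + (if i = j then if Suc i = Suc n then \<zeta> else z else 0))"
  let ?F = "\<lambda>g :: nat \<times> nat \<Rightarrow> complex. ennreal (cmod (Determinant.det (?mat g)) powr (2 * s))"
  have un: "{..<Suc n} \<times> {..<Suc n} = ?C \<union> ?D" by auto
  have dm: "(\<lambda>g. Determinant.det (?mat g)) \<in> borel_measurable (PiM (?C \<union> ?D) (\<lambda>_. ?g))"
    by (rule borel_measurable_det_mat) (auto intro!: borel_measurable_add measurable_component_gauss)
  have "shifted_moment s z (Suc n) \<zeta> = (\<integral>\<^sup>+ x. \<integral>\<^sup>+ y. ?F (merge ?C ?D (x, y)) \<partial>PiM ?D (\<lambda>_. ?g) \<partial>PiM ?C (\<lambda>_. ?g))"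
    unfolding shifted_moment_def un
    by (rule P.product_nn_integral_fold) (use dm in \<open>auto\<close>)
  also have "\<dots> = (\<integral>\<^sup>+ x. (\<lambda>u. column_moment s z n (v u)) (\<lambda>i\<in>{..n}. x (i, n)) \<partial>PiM ?C (\<lambda>_. ?g))"
  proof (rule nn_integral_cong)
    fix x :: "nat \<times> nat \<Rightarrow> complex"
    have "?mat (merge ?C ?D (x, y)) = column_mat z n y (v (\<lambda>i\<in>{..n}. x (i, n)))" for y
      unfolding column_mat_def by (rule cong_mat) (auto simp: merge_def v_def less_Suc_eq)
    thus "(\<integral>\<^sup>+ y. ?F (merge ?C ?D (x, y)) \<partial>PiM ?D (\<lambda>_. ?g)) = column_moment s z n (v (\<lambda>i\<in>{..n}. x (i, n)))"
      by (simp add: column_moment_def)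
  qed
  also have "\<dots> = (\<integral>\<^sup>+ u. column_moment s z n (v u) \<partial>distr (PiM ?C (\<lambda>_. ?g)) (PiM {..n} (\<lambda>_. ?g)) (\<lambda>x. \<lambda>i\<in>{..n}. x (i, n)))"
  proof -
    have a: "(\<lambda>x. \<lambda>i\<in>{..n}. x (i, n)) \<in> measurable (PiM ?C (\<lambda>_. ?g)) (PiM {..n} (\<lambda>_. ?g))"
      by (rule measurable_restrict) (auto intro!: measurable_component_singleton)
    have b: "(\<lambda>u. column_moment s z n (v u)) \<in> borel_measurable (PiM {..n} (\<lambda>_. ?g))"
      unfolding v_def by (rule measurable_column_moment) (auto intro!: borel_measurable_add measurable_component_gauss)
    show ?thesis by (subst nn_integral_distr[OF a]) (use b in simp_all)
  qed
  also have "distr (PiM ?C (\<lambda>_. ?g)) (PiM {..n} (\<lambda>_. ?g)) (\<lambda>x. \<lambda>i\<in>{..n}. x (i, n)) = PiM {..n} (\<lambda>_. ?g)"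
    by (rule distr_PiM_reindex[where f = "\<lambda>i. (i, n)" and M = "\<lambda>_. ?g"]) (auto intro: prob_space_gauss inj_onI)
  also have "{..n} = insert n {..<n}" by auto
  also have "(\<integral>\<^sup>+ u. column_moment s z n (v u) \<partial>PiM (insert n {..<n}) (\<lambda>_. ?g)) = (\<integral>\<^sup>+ a. \<integral>\<^sup>+ w. column_moment s z n (v (w(n := a))) \<partial>PiM {..<n} (\<lambda>_. ?g) \<partial>?g)"
  proof (rule Q.product_nn_integral_insert_rev)
    show "(\<lambda>u. column_moment s z n (v u)) \<in> borel_measurable (PiM (insert n {..<n}) (\<lambda>_. ?g))"
      unfolding v_def by (rule measurable_column_moment) (auto intro!: borel_measurable_add measurable_component_gauss)
  qed auto
  also have "\<dots> = (\<integral>\<^sup>+ a. \<integral>\<^sup>+ w. column_moment s z n (w(n := a + \<zeta>)) \<partial>PiM {..<n} (\<lambda>_. std_complex_gaussian) \<partial>std_complex_gaussian)"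
    by (intro nn_integral_cong column_moment_cong) (auto simp: v_def)
  finally show ?thesis .
qed

text \<open>Discards the null event on which \<open>column_moment_eq\<close> says nothing.\<close>

lemma AE_sum_norm_square_pos:
  "AE w in PiM {..<Suc m} (\<lambda>_. std_complex_gaussian). (\<Sum>i<Suc m. (cmod (w i))\<^sup>2) > 0"
proof -
  let ?P = "PiM {..<Suc m} (\<lambda>_. std_complex_gaussian)"
  have meas: "(\<lambda>w. \<Sum>i<Suc m. (cmod (w i))\<^sup>2) \<in> borel_measurable ?P"
    by (auto intro!: borel_measurable_sum borel_measurable_power borel_measurable_norm measurable_component_gauss)
  have "(\<integral>\<^sup>+ w. indicator {0} (\<Sum>i<Suc m. (cmod (w i))\<^sup>2) \<partial>?P) = (\<integral>\<^sup>+ t. indicator {0<..} t * ennreal (t ^ m / fact m * exp (- t)) * indicator {0} t \<partial>lborel)"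
    by (rule nn_integral_sum_norm_square_gauss) measurable
  also have "\<dots> = integral\<^sup>N lborel (\<lambda>t::real. 0)"
    by (rule nn_integral_cong) (auto simp: indicator_def)
  finally have "(\<integral>\<^sup>+ w. indicator {0} (\<Sum>i<Suc m. (cmod (w i))\<^sup>2) \<partial>?P) = 0" by simp
  hence "AE w in ?P. (indicator {0} (\<Sum>i<Suc m. (cmod (w i))\<^sup>2) :: ennreal) = 0"
    by (subst (asm) nn_integral_0_iff_AE) (auto intro!: measurable_compose[OF meas])
  thus ?thesis
  proof eventually_elim
    case (elim w)
    hence "(\<Sum>i<Suc m. (cmod (w i))\<^sup>2) \<noteq> 0" by (auto simp: indicator_def)
    moreover have "(\<Sum>i<Suc m. (cmod (w i))\<^sup>2) \<ge> 0" by (rule sum_nonneg) simp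
    ultimately show ?case by linarith
  qed
qed

lemma nn_integral_powr_exp:
  fixes a :: real
  assumes "a > 0"
  shows "(\<integral>\<^sup>+ S. indicator {0<..} S * ennreal (S powr (a - 1) * exp (- S)) \<partial>lborel) = ennreal (Gamma a)"
proof -
  have "ennreal (Gamma a) = (\<integral>\<^sup>+ t. ennreal (indicator {0..} t * t powr (a - 1) / exp t) \<partial>lborel)"
    using assms by (rule Gamma_conv_nn_integral_real)
  also have "\<dots> = (\<integral>\<^sup>+ S. indicator {0<..} S * ennreal (S powr (a - 1) * exp (- S)) \<partial>lborel)"
  proof (rule nn_integral_cong_AE)
    show "AE t in lborel. ennreal (indicator {0..} t * t powr (a - 1) / exp t) = indicator {0<..} t * ennreal (t powr (a - 1) * exp (- t))"
      using AE_lborel_singleton[of "0::real"]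
      by eventually_elim (auto simp: indicator_def exp_minus field_simps)
  qed
  finally show ?thesis ..
qed

lemma shifted_moment_1:
  assumes s: "s > -1"
  shows "shifted_moment s z 1 \<zeta> = (\<Sum>k. ennreal (exp (- (cmod \<zeta>)\<^sup>2) * ((cmod \<zeta>)\<^sup>2) ^ k / (fact k)\<^sup>2) * ennreal (Gamma (s + 1 + real k)))"
proof -
  interpret G: prob_space std_complex_gaussian by (rule prob_space_gauss)
  interpret P: product_sigma_finite "\<lambda>_::nat\<times>nat. std_complex_gaussian" ..
  have s0: "{..<1} \<times> {..<1} = {(0::nat, 0::nat)}" by auto
  have det: "Determinant.det (mat 1 1 (\<lambda>(i, j). g (i, j) + (if i = j then if Suc i = 1 then \<zeta> else z else 0))) = g (0, 0) + \<zeta>" for g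
    by (subst det_single) simp_all
  have "shifted_moment s z 1 \<zeta> = (\<integral>\<^sup>+ g. (\<lambda>a. ennreal (cmod (a + \<zeta>) powr (2 * s))) (g (0, 0)) \<partial>PiM {(0::nat, 0::nat)} (\<lambda>_. std_complex_gaussian))"
    unfolding shifted_moment_def det s0 ..
  also have "\<dots> = (\<integral>\<^sup>+ a. ennreal (cmod (a + \<zeta>) powr (2 * s)) \<partial>std_complex_gaussian)"
    by (rule P.product_nn_integral_singleton) measurable
  also have "\<dots> = (\<integral>\<^sup>+ a. (\<lambda>Y. ennreal (Y powr s)) ((cmod (a + \<zeta>))\<^sup>2) \<partial>std_complex_gaussian)"
  proof (rule nn_integral_cong)
    fix a
    have "(cmod (a + \<zeta>))\<^sup>2 powr s = (cmod (a + \<zeta>) powr 2) powr s" by (subst powr_numeral) simp_all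
    also have "\<dots> = cmod (a + \<zeta>) powr (2 * s)" by (rule powr_powr)
    finally show "ennreal (cmod (a + \<zeta>) powr (2 * s)) = ennreal (((cmod (a + \<zeta>))\<^sup>2) powr s)" by simp
  qed
  also have "\<dots> = (\<Sum>k. ennreal (exp (- (cmod \<zeta>)\<^sup>2) * ((cmod \<zeta>)\<^sup>2) ^ k / (fact k)\<^sup>2) *
           (\<integral>\<^sup>+ t. ennreal (t ^ k * exp (- t) * indicator {0<..} t) * ennreal (t powr s) \<partial>lborel))"
    by (rule nn_integral_gauss_noncentral) measurable
  also have "\<dots> = (\<Sum>k. ennreal (exp (- (cmod \<zeta>)\<^sup>2) * ((cmod \<zeta>)\<^sup>2) ^ k / (fact k)\<^sup>2) * ennreal (Gamma (s + 1 + real k)))"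
  proof (rule suminf_cong)
    fix k
    have "(\<integral>\<^sup>+ t. ennreal (t ^ k * exp (- t) * indicator {0<..} t) * ennreal (t powr s) \<partial>lborel)
        = (\<integral>\<^sup>+ t. indicator {0<..} t * ennreal (t powr (s + 1 + real k - 1) * exp (- t)) \<partial>lborel)"
      by (intro nn_integral_cong) (auto simp: indicator_def ennreal_mult[symmetric] powr_add powr_realpow mult_ac)
    also have "\<dots> = ennreal (Gamma (s + 1 + real k))" using s by (intro nn_integral_powr_exp) auto
    finally show "ennreal (exp (- (cmod \<zeta>)\<^sup>2) * ((cmod \<zeta>)\<^sup>2) ^ k / (fact k)\<^sup>2) *
           (\<integral>\<^sup>+ t. ennreal (t ^ k * exp (- t) * indicator {0<..} t) * ennreal (t powr s) \<partial>lborel)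
        = ennreal (exp (- (cmod \<zeta>)\<^sup>2) * ((cmod \<zeta>)\<^sup>2) ^ k / (fact k)\<^sup>2) * ennreal (Gamma (s + 1 + real k))" by simp
  qed
  finally show ?thesis .
qed

text \<open>Let Y be the squared modulus of the last entry of the last column and T that of its
  other entries. Conditionally on the column the moment is (Y + T)^s times h at x Y / (Y + T).
  Expanding the noncentral Y and passing to S = Y + T and b = Y / S separates the variables: S
  yields the Gamma factor, b an integral over the unit interval.\<close>

lemma shifted_moment_Suc:
  fixes h :: "real \<Rightarrow> ennreal"
  assumes s: "s > -1" and [measurable]: "h \<in> borel_measurable borel"
    and h: "\<And>\<zeta>. shifted_moment s z (Suc m) \<zeta> = h ((cmod \<zeta>)\<^sup>2)"
  shows "shifted_moment s z (Suc (Suc m)) \<zeta> =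
    (\<Sum>k. ennreal (exp (- (cmod \<zeta>)\<^sup>2) * ((cmod \<zeta>)\<^sup>2) ^ k / (fact k)\<^sup>2) * (ennreal (Gamma (s + real (m + 2) + real k)) *
       (\<integral>\<^sup>+ b. indicator {0<..<1} b * ennreal (b ^ k * (1 - b) ^ m / fact m) * h ((cmod z)\<^sup>2 * b) \<partial>lborel)))"
proof -
  let ?g = std_complex_gaussian
  define x where "x = (cmod z)\<^sup>2"
  define n where "n = Suc m"
  define K where "K Y T = ennreal ((Y + T) powr s) * h (x * (Y / (Y + T)))" for Y T :: real
  have Km[measurable]: "(\<lambda>p. K (fst p) (snd p)) \<in> borel_measurable (borel \<Otimes>\<^sub>M borel)"
    unfolding K_def by measurable
  have [measurable]: "K Y \<in> borel_measurable borel" for Y unfolding K_def by measurable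
  have col: "column_moment s z n (w(n := a)) = K ((cmod a)\<^sup>2) (\<Sum>i<n. (cmod (w i))\<^sup>2)" if pos: "(\<Sum>i<n. (cmod (w i))\<^sup>2) > 0" for w a
  proof -
    let ?v = "w(n := a)" and ?T = "\<Sum>i<n. (cmod (w i))\<^sup>2"
    let ?R = "sqrt (\<Sum>i\<le>n. (cmod (?v i))\<^sup>2)"
    have sm: "(\<Sum>i<n. (cmod (?v i))\<^sup>2) = ?T" by (rule sum.cong) auto
    have R: "?R = sqrt ((cmod a)\<^sup>2 + ?T)" by (simp add: lessThan_Suc_atMost[symmetric] sm)
    have Y: "(cmod a)\<^sup>2 + ?T > 0" using pos by (simp add: add_nonneg_pos)
    have "column_moment s z n ?v = ennreal (?R powr (2 * s)) * shifted_moment s z n (z * ?v n / of_real ?R)"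
      by (rule column_moment_eq) (use pos in \<open>simp_all add: n_def sm[unfolded n_def]\<close>)
    also have "?R powr (2 * s) = ((cmod a)\<^sup>2 + ?T) powr s"
      unfolding R using Y by (simp add: powr_half_sqrt[symmetric] powr_powr)
    also have "shifted_moment s z n (z * ?v n / of_real ?R) = h ((cmod (z * ?v n / of_real ?R))\<^sup>2)"
      unfolding n_def by (rule h)
    also have "(cmod (z * ?v n / of_real ?R))\<^sup>2 = x * ((cmod a)\<^sup>2 / ((cmod a)\<^sup>2 + ?T))"
      unfolding R using Y by (simp add: norm_mult norm_divide power_mult_distrib power_divide x_def)
    finally show ?thesis unfolding K_def .
  qed
  let ?d = "\<lambda>T. indicator {0<..} T * ennreal (T ^ m / fact m * exp (- T))"
  have "shifted_moment s z (Suc n) \<zeta> = (\<integral>\<^sup>+ a. (\<lambda>Y. \<integral>\<^sup>+ T. ?d T * K Y T \<partial>lborel) ((cmod (a + \<zeta>))\<^sup>2) \<partial>?g)"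
    unfolding shifted_moment_Suc_eq_column_moment
  proof (rule nn_integral_cong)
    fix a
    have "(\<integral>\<^sup>+ w. column_moment s z n (w(n := a + \<zeta>)) \<partial>PiM {..<n} (\<lambda>_. ?g)) = (\<integral>\<^sup>+ w. K ((cmod (a + \<zeta>))\<^sup>2) (\<Sum>i<n. (cmod (w i))\<^sup>2) \<partial>PiM {..<n} (\<lambda>_. ?g))"
    proof (rule nn_integral_cong_AE)
      show "AE w in PiM {..<n} (\<lambda>_. ?g). column_moment s z n (w(n := a + \<zeta>)) = K ((cmod (a + \<zeta>))\<^sup>2) (\<Sum>i<n. (cmod (w i))\<^sup>2)"
        using AE_sum_norm_square_pos[of m] unfolding n_def[symmetric]
        by eventually_elim (rule col)
    qed
    also have "\<dots> = (\<integral>\<^sup>+ T. ?d T * K ((cmod (a + \<zeta>))\<^sup>2) T \<partial>lborel)"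
      unfolding n_def by (rule nn_integral_sum_norm_square_gauss) measurable
    finally show "(\<integral>\<^sup>+ w. column_moment s z n (w(n := a + \<zeta>)) \<partial>PiM {..<n} (\<lambda>_. ?g)) = \<dots>" .
  qed
  also have "\<dots> = (\<Sum>k. ennreal (exp (- (cmod \<zeta>)\<^sup>2) * ((cmod \<zeta>)\<^sup>2) ^ k / (fact k)\<^sup>2) *
           (\<integral>\<^sup>+ Y. ennreal (Y ^ k * exp (- Y) * indicator {0<..} Y) * (\<integral>\<^sup>+ T. ?d T * K Y T \<partial>lborel) \<partial>lborel))"
  proof (rule nn_integral_gauss_noncentral)
    have "(\<lambda>p. ?d (snd p) * K (fst p) (snd p)) \<in> borel_measurable (borel \<Otimes>\<^sub>M lborel)" by measurable
    thus "(\<lambda>Y. \<integral>\<^sup>+ T. ?d T * K Y T \<partial>lborel) \<in> borel_measurable borel"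
      by (intro sigma_finite_measure.borel_measurable_nn_integral lborel.sigma_finite_measure_axioms) (simp add: case_prod_beta')
  qed
  also have "\<dots> = (\<Sum>k. ennreal (exp (- (cmod \<zeta>)\<^sup>2) * ((cmod \<zeta>)\<^sup>2) ^ k / (fact k)\<^sup>2) * (ennreal (Gamma (s + real (m + 2) + real k)) *
       (\<integral>\<^sup>+ b. indicator {0<..<1} b * ennreal (b ^ k * (1 - b) ^ m / fact m) * h (x * b) \<partial>lborel)))"
  proof (rule suminf_cong)
    fix k
    let ?f = "\<lambda>(Y, T). ennreal (Y ^ k * exp (- Y)) * ennreal (T ^ m / fact m * exp (- T)) * K Y T"
    let ?I = "\<integral>\<^sup>+ b. indicator {0<..<1} b * ennreal (b ^ k * (1 - b) ^ m / fact m) * h (x * b) \<partial>lborel"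
    have fm: "?f \<in> borel_measurable (borel \<Otimes>\<^sub>M borel)" using Km by (simp add: case_prod_beta')
    have "(\<integral>\<^sup>+ Y. ennreal (Y ^ k * exp (- Y) * indicator {0<..} Y) * (\<integral>\<^sup>+ T. ?d T * K Y T \<partial>lborel) \<partial>lborel)
       = (\<integral>\<^sup>+ Y. \<integral>\<^sup>+ T. indicator {0<..} Y * indicator {0<..} T * ?f (Y, T) \<partial>lborel \<partial>lborel)"
    proof (rule nn_integral_cong)
      fix Y :: real
      have "ennreal (Y ^ k * exp (- Y) * indicator {0<..} Y) * (\<integral>\<^sup>+ T. ?d T * K Y T \<partial>lborel) = (\<integral>\<^sup>+ T. ennreal (Y ^ k * exp (- Y) * indicator {0<..} Y) * (?d T * K Y T) \<partial>lborel)"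
        by (rule nn_integral_cmult[symmetric]) measurable
      also have "\<dots> = (\<integral>\<^sup>+ T. indicator {0<..} Y * indicator {0<..} T * ?f (Y, T) \<partial>lborel)"
        by (intro nn_integral_cong) (auto simp: indicator_def mult.assoc)
      finally show "ennreal (Y ^ k * exp (- Y) * indicator {0<..} Y) * (\<integral>\<^sup>+ T. ?d T * K Y T \<partial>lborel) = \<dots>" .
    qed
    also have "\<dots> = (\<integral>\<^sup>+ S. indicator {0<..} S * ennreal S * (\<integral>\<^sup>+ b. indicator {0<..<1} b * ?f (S * b, S * (1 - b)) \<partial>lborel) \<partial>lborel)"
      by (rule nn_integral_dirichlet_subst) (rule fm)
    also have "\<dots> = (\<integral>\<^sup>+ S. indicator {0<..} S * ennreal (S powr (s + real (m + 2) + real k - 1) * exp (- S)) * ?I \<partial>lborel)"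
    proof (rule nn_integral_cong)
      fix S :: real
      show "indicator {0<..} S * ennreal S * (\<integral>\<^sup>+ b. indicator {0<..<1} b * ?f (S * b, S * (1 - b)) \<partial>lborel) =
         indicator {0<..} S * ennreal (S powr (s + real (m + 2) + real k - 1) * exp (- S)) * ?I"
      proof (cases "S > 0")
        case False thus ?thesis by simp
      next
        case True
        have "(\<integral>\<^sup>+ b. indicator {0<..<1} b * ?f (S * b, S * (1 - b)) \<partial>lborel) =
          (\<integral>\<^sup>+ b. ennreal (S ^ (k + m) * S powr s * exp (- S)) * (indicator {0<..<1} b * ennreal (b ^ k * (1 - b) ^ m / fact m) * h (x * b)) \<partial>lborel)"
        proof (rule nn_integral_cong)
          fix b :: real
          show "indicator {0<..<1} b * ?f (S * b, S * (1 - b)) = ennreal (S ^ (k + m) * S powr s * exp (- S)) * (indicator {0<..<1} b * ennreal (b ^ k * (1 - b) ^ m / fact m) * h (x * b))"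
          proof (cases "0 < b \<and> b < 1")
            case b: True
            have e: "exp (- (S * b)) * exp (- (S * (1 - b))) = exp (- S)"
              by (simp add: exp_add[symmetric] algebra_simps)
            have S: "S * b + S * (1 - b) = S" by (simp add: algebra_simps)
            have "ennreal ((S * b) ^ k * exp (- (S * b))) * ennreal ((S * (1 - b)) ^ m / fact m * exp (- (S * (1 - b)))) * ennreal (S powr s)
               = ennreal (((S * b) ^ k * exp (- (S * b))) * ((S * (1 - b)) ^ m / fact m * exp (- (S * (1 - b)))) * S powr s)"
              using True b by (subst ennreal_mult[symmetric], simp, simp, subst ennreal_mult[symmetric]) simp_all
            also have "((S * b) ^ k * exp (- (S * b))) * ((S * (1 - b)) ^ m / fact m * exp (- (S * (1 - b)))) * S powr s
               = (S ^ (k + m) * S powr s * exp (- S)) * (b ^ k * (1 - b) ^ m / fact m)"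
              unfolding e[symmetric] by (simp only: power_mult_distrib power_add times_divide_eq_left times_divide_eq_right mult_ac)
            also have "ennreal \<dots> = ennreal (S ^ (k + m) * S powr s * exp (- S)) * ennreal (b ^ k * (1 - b) ^ m / fact m)"
              using True b by (subst ennreal_mult) simp_all
            finally have e2: "ennreal ((S * b) ^ k * exp (- (S * b))) * ennreal ((S * (1 - b)) ^ m / fact m * exp (- (S * (1 - b)))) * ennreal (S powr s)
               = ennreal (S ^ (k + m) * S powr s * exp (- S)) * ennreal (b ^ k * (1 - b) ^ m / fact m)" .
            have "?f (S * b, S * (1 - b)) = ennreal ((S * b) ^ k * exp (- (S * b))) * ennreal ((S * (1 - b)) ^ m / fact m * exp (- (S * (1 - b)))) * ennreal (S powr s) * h (x * b)"
              using True by (simp add: K_def S mult.assoc)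
            also have "\<dots> = ennreal (S ^ (k + m) * S powr s * exp (- S)) * (ennreal (b ^ k * (1 - b) ^ m / fact m) * h (x * b))"
              unfolding e2 by (rule mult.assoc)
            finally show ?thesis using b by simp
          qed (auto simp: indicator_def)
        qed
        also have "\<dots> = ennreal (S ^ (k + m) * S powr s * exp (- S)) * ?I"
          by (rule nn_integral_cmult) measurable
        finally have *: "(\<integral>\<^sup>+ b. indicator {0<..<1} b * ?f (S * b, S * (1 - b)) \<partial>lborel) = \<dots>" .
        \<comment> \<open>The exponent consists of k + m from the two densities, s from the factor
          R^(2 s), and 1 from the Jacobian.\<close>
        have "S powr (s + real (m + 2) + real k - 1) = S powr (real (Suc (k + m)) + s)"
          by (rule arg_cong[where f = "(powr) S"]) simp
        also have "\<dots> = S * (S ^ (k + m) * S powr s)" using True by (simp only: powr_add powr_realpow) simp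
        finally have "ennreal (S powr (s + real (m + 2) + real k - 1) * exp (- S)) = ennreal S * ennreal (S ^ (k + m) * S powr s * exp (- S))"
          using True by (simp add: ennreal_mult[symmetric] mult_ac)
        thus ?thesis unfolding * using True by (simp add: mult_ac)
      qed
    qed
    also have "\<dots> = (\<integral>\<^sup>+ S. indicator {0<..} S * ennreal (S powr (s + real (m + 2) + real k - 1) * exp (- S)) \<partial>lborel) * ?I"
      by (rule nn_integral_multc) measurable
    also have "(\<integral>\<^sup>+ S. indicator {0<..} S * ennreal (S powr (s + real (m + 2) + real k - 1) * exp (- S)) \<partial>lborel) = ennreal (Gamma (s + real (m + 2) + real k))"
      using s by (intro nn_integral_powr_exp) auto
    finally show "ennreal (exp (- (cmod \<zeta>)\<^sup>2) * ((cmod \<zeta>)\<^sup>2) ^ k / (fact k)\<^sup>2) *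
           (\<integral>\<^sup>+ Y. ennreal (Y ^ k * exp (- Y) * indicator {0<..} Y) * (\<integral>\<^sup>+ T. ?d T * K Y T \<partial>lborel) \<partial>lborel) =
        ennreal (exp (- (cmod \<zeta>)\<^sup>2) * ((cmod \<zeta>)\<^sup>2) ^ k / (fact k)\<^sup>2) * (ennreal (Gamma (s + real (m + 2) + real k)) * ?I)" by simp
  qed
  finally show ?thesis by (simp add: n_def x_def)
qed

text \<open>The value of the moment at z = 0, each factor being the s-th moment of a Gamma variable
  of shape i + 1. The type stays general because real and complex exponents both occur.\<close>

definition ginibre_const :: "'a::Gamma \<Rightarrow> nat \<Rightarrow> 'a" where
  "ginibre_const s n = (\<Prod>i<n. Gamma (s + 1 + of_nat i) / fact i)"

lemma ginibre_const_Suc: "ginibre_const s (Suc n) = ginibre_const s n * (Gamma (s + 1 + of_nat n) / fact n)"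
  by (simp add: ginibre_const_def)

lemma ginibre_const_pos: "(s::real) > -1 \<Longrightarrow> ginibre_const s n > 0"
  unfolding ginibre_const_def by (intro prod_pos) auto

lemma borel_measurable_moment_fun [measurable]: "moment_fun s x m \<in> borel_measurable borel"
  by (rule borel_measurable_continuous_onI[OF continuous_on_moment_fun])

text \<open>The relation Gamma(a + k) = Gamma(a) (a)_k pulls the Gamma factor out of the series, and
  real summability shows that the extended sum is finite.\<close>

lemma moment_series_ennreal:
  fixes a y :: real
  assumes a: "a > 0" and y: "y \<ge> 0" and m: "\<And>k. \<mu> k \<ge> 0" and c: "c \<ge> 0"
    and sm: "summable (\<lambda>k. pochhammer a k / (fact k)\<^sup>2 * \<mu> k * y ^ k)"
  shows "(\<Sum>k. ennreal (exp (- y) * y ^ k / (fact k)\<^sup>2) * (ennreal (Gamma (a + real k)) * ennreal (c * \<mu> k)))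
    = ennreal (c * Gamma a * (exp (- y) * (\<Sum>k. pochhammer a k / (fact k)\<^sup>2 * \<mu> k * y ^ k)))"
proof -
  have G: "Gamma (a + real k) = Gamma a * pochhammer a k" for k
  proof -
    have "Gamma a \<noteq> 0" using Gamma_real_pos[OF a] by linarith
    moreover have "a \<notin> \<int>\<^sub>\<le>\<^sub>0" using a by (auto elim!: nonpos_Ints_cases)
    ultimately show ?thesis using pochhammer_Gamma[of a k] by simp
  qed
  have t: "ennreal (exp (- y) * y ^ k / (fact k)\<^sup>2) * (ennreal (Gamma (a + real k)) * ennreal (c * \<mu> k))
     = ennreal (c * Gamma a * exp (- y) * (pochhammer a k / (fact k)\<^sup>2 * \<mu> k * y ^ k))" for k
  proof -
    have "Gamma (a + real k) \<ge> 0" using a by (intro less_imp_le Gamma_real_pos) auto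
    hence "ennreal (exp (- y) * y ^ k / (fact k)\<^sup>2) * (ennreal (Gamma (a + real k)) * ennreal (c * \<mu> k))
       = ennreal ((exp (- y) * y ^ k / (fact k)\<^sup>2) * (Gamma (a + real k) * (c * \<mu> k)))"
      using y m[of k] c by (simp add: ennreal_mult[symmetric])
    also have "(exp (- y) * y ^ k / (fact k)\<^sup>2) * (Gamma (a + real k) * (c * \<mu> k)) = c * Gamma a * exp (- y) * (pochhammer a k / (fact k)\<^sup>2 * \<mu> k * y ^ k)"
      unfolding G by simp
    finally show ?thesis .
  qed
  have nn: "0 \<le> c * Gamma a * exp (- y) * (pochhammer a k / (fact k)\<^sup>2 * \<mu> k * y ^ k)" for k
    using a y m[of k] c by (intro mult_nonneg_nonneg divide_nonneg_nonneg pochhammer_nonneg) (auto intro: less_imp_le Gamma_real_pos)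
  have "(\<Sum>k. ennreal (c * Gamma a * exp (- y) * (pochhammer a k / (fact k)\<^sup>2 * \<mu> k * y ^ k)))
     = ennreal (\<Sum>k. c * Gamma a * exp (- y) * (pochhammer a k / (fact k)\<^sup>2 * \<mu> k * y ^ k))"
    by (rule suminf_ennreal2[OF nn summable_mult[OF sm]])
  also have "(\<Sum>k. c * Gamma a * exp (- y) * (pochhammer a k / (fact k)\<^sup>2 * \<mu> k * y ^ k)) = c * Gamma a * (exp (- y) * (\<Sum>k. pochhammer a k / (fact k)\<^sup>2 * \<mu> k * y ^ k))"
    using suminf_mult[OF sm, of "c * Gamma a * exp (- y)"] by (simp add: mult.assoc)
  finally show ?thesis unfolding t .
qed

text \<open>The induction keeps \<zeta> arbitrary, since the step uses the smaller moment at all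
  values |z|^2 b of the squared shift with b between 0 and 1.\<close>

lemma shifted_moment_eq_moment_fun:
  assumes s: "s > -1"
  shows "shifted_moment s z (Suc m) \<zeta> = ennreal (ginibre_const s (Suc m) * moment_fun s ((cmod z)\<^sup>2) m ((cmod \<zeta>)\<^sup>2))"
proof (induction m arbitrary: \<zeta>)
  case 0
  have sm: "summable (\<lambda>k. pochhammer (s + 1) k / (fact k)\<^sup>2 * 1 * ((cmod \<zeta>)\<^sup>2) ^ k)"
    using summable_moment[of s "(cmod z)\<^sup>2" 0 "(cmod \<zeta>)\<^sup>2"] by (simp add: moment_coeff_def)
  have "shifted_moment s z (Suc 0) \<zeta> = (\<Sum>k. ennreal (exp (- (cmod \<zeta>)\<^sup>2) * ((cmod \<zeta>)\<^sup>2) ^ k / (fact k)\<^sup>2) * (ennreal (Gamma (s + 1 + real k)) * ennreal (1 * 1)))"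
    using shifted_moment_1[OF s, of z \<zeta>] by simp
  also have "\<dots> = ennreal (1 * Gamma (s + 1) * (exp (- (cmod \<zeta>)\<^sup>2) * (\<Sum>k. pochhammer (s + 1) k / (fact k)\<^sup>2 * 1 * ((cmod \<zeta>)\<^sup>2) ^ k)))"
    by (rule moment_series_ennreal) (use s sm in auto)
  finally show ?case by (simp add: moment_fun.simps ginibre_const_def)
next
  case (Suc m)
  let ?x = "(cmod z)\<^sup>2" and ?c = "ginibre_const s (Suc m)" and ?y = "(cmod \<zeta>)\<^sup>2"
  have c0: "?c > 0" by (rule ginibre_const_pos[OF s])
  have int: "(\<integral>\<^sup>+ b. indicator {0<..<1} b * ennreal (b ^ k * (1 - b) ^ m / fact m) * ennreal (?c * moment_fun s ?x m (?x * b)) \<partial>lborel)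
     = ennreal (?c / fact (Suc m) * beta_moment s ?x m k)" for k
  proof -
    have "(\<integral>\<^sup>+ b. indicator {0<..<1} b * ennreal (b ^ k * (1 - b) ^ m / fact m) * ennreal (?c * moment_fun s ?x m (?x * b)) \<partial>lborel)
       = (\<integral>\<^sup>+ b. ennreal (?c / fact m * ((1 - b) ^ m * b ^ k * moment_fun s ?x m (?x * b))) * indicator {0..1} b \<partial>lborel)"
    proof (rule nn_integral_cong_AE)
      show "AE b in lborel. indicator {0<..<1} b * ennreal (b ^ k * (1 - b) ^ m / fact m) * ennreal (?c * moment_fun s ?x m (?x * b)) =
        ennreal (?c / fact m * ((1 - b) ^ m * b ^ k * moment_fun s ?x m (?x * b))) * indicator {0..1} b"
        using AE_lborel_singleton[of "0::real"] AE_lborel_singleton[of "1::real"]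
      proof eventually_elim
        case (elim b)
        show ?case
        proof (cases "0 < b \<and> b < 1")
          case True
          hence "moment_fun s ?x m (?x * b) \<ge> 0" by (intro less_imp_le[OF moment_fun_pos(1)[OF s]]) auto
          hence "ennreal (b ^ k * (1 - b) ^ m / fact m) * ennreal (?c * moment_fun s ?x m (?x * b)) =
             ennreal ((b ^ k * (1 - b) ^ m / fact m) * (?c * moment_fun s ?x m (?x * b)))"
            using True c0 by (subst ennreal_mult) auto
          also have "(b ^ k * (1 - b) ^ m / fact m) * (?c * moment_fun s ?x m (?x * b)) = ?c / fact m * ((1 - b) ^ m * b ^ k * moment_fun s ?x m (?x * b))"
            by simp
          finally show ?thesis using True by simp
        next
          case False
          thus ?thesis using elim by (auto simp: indicator_def)
        qed
      qed
    qed
    also have "\<dots> = ennreal (?c / fact m * integral {0..1} (\<lambda>b. (1 - b) ^ m * b ^ k * moment_fun s ?x m (?x * b)))"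
    proof (rule nn_integral_has_integral_lebesgue')
      fix b :: real assume "b \<in> {0..1}"
      moreover from this have "moment_fun s ?x m (?x * b) \<ge> 0" by (intro less_imp_le[OF moment_fun_pos(1)[OF s]]) auto
      ultimately show "0 \<le> ?c / fact m * ((1 - b) ^ m * b ^ k * moment_fun s ?x m (?x * b))" using c0 by simp
    next
      show "((\<lambda>b. ?c / fact m * ((1 - b) ^ m * b ^ k * moment_fun s ?x m (?x * b))) has_integral
         ?c / fact m * integral {0..1} (\<lambda>b. (1 - b) ^ m * b ^ k * moment_fun s ?x m (?x * b))) {0..1}"
        by (intro has_integral_mult_right integrable_integral integrable_continuous_real continuous_on_beta_integrand)
    qed
    \<comment> \<open>The density of T contributed 1 / m!; the normalisation m + 1 of the beta
      moment turns this into 1 / (m + 1)!.\<close>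
    also have "?c / fact m * integral {0..1} (\<lambda>b. (1 - b) ^ m * b ^ k * moment_fun s ?x m (?x * b)) = ?c / fact (Suc m) * beta_moment s ?x m k"
      by (simp add: beta_moment_def del: of_nat_Suc)
    finally show ?thesis .
  qed
  have "shifted_moment s z (Suc (Suc m)) \<zeta> =
    (\<Sum>k. ennreal (exp (- ?y) * ?y ^ k / (fact k)\<^sup>2) * (ennreal (Gamma (s + real (m + 2) + real k)) *
       (\<integral>\<^sup>+ b. indicator {0<..<1} b * ennreal (b ^ k * (1 - b) ^ m / fact m) * (\<lambda>y. ennreal (?c * moment_fun s ?x m y)) (?x * b) \<partial>lborel)))"
    by (rule shifted_moment_Suc[OF s _ Suc.IH]) measurable
  also have "\<dots> = (\<Sum>k. ennreal (exp (- ?y) * ?y ^ k / (fact k)\<^sup>2) * (ennreal (Gamma (s + real (m + 2) + real k)) * ennreal (?c / fact (Suc m) * beta_moment s ?x m k)))"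
    unfolding int ..
  also have "\<dots> = ennreal (?c / fact (Suc m) * Gamma (s + real (m + 2)) * (exp (- ?y) * (\<Sum>k. pochhammer (s + real (m + 2)) k / (fact k)\<^sup>2 * beta_moment s ?x m k * ?y ^ k)))"
  proof (rule moment_series_ennreal)
    show "beta_moment s ?x m k \<ge> 0" for k by (rule moment_fun_pos(3)[OF s]) simp
    show "summable (\<lambda>k. pochhammer (s + real (m + 2)) k / (fact k)\<^sup>2 * beta_moment s ?x m k * ?y ^ k)"
      using summable_moment[of s ?x "Suc m" ?y] by (simp add: moment_coeff_def add_ac)
  qed (use s c0 in auto)
  also have "?c / fact (Suc m) * Gamma (s + real (m + 2)) = ginibre_const s (Suc (Suc m))"
    by (subst (2) ginibre_const_Suc) (simp add: add_ac del: fact_Suc)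
  also have "exp (- ?y) * (\<Sum>k. pochhammer (s + real (m + 2)) k / (fact k)\<^sup>2 * beta_moment s ?x m k * ?y ^ k) = moment_fun s ?x (Suc m) ?y"
    by (simp add: moment_fun_eq moment_coeff_def add_ac)
  finally show ?case .
qed

text \<open>At x = 0 the symbol is (1 + 1/u)^s, without positive powers of u, so the matrix is lower
  triangular with unit diagonal. This settles z = 0 and also provides the initial value for the
  differential inequality in x.\<close>

lemma det_toeplitz_at_0:
  fixes s :: "'a::{real_normed_field,banach}"
  shows "Determinant.det (toeplitz s 0 n 0) = 1"
proof -
  have "Determinant.det (toeplitz s 0 n 0) = prod_list (diag_mat (toeplitz s 0 n 0))"
    by (rule det_lower_triangular[OF _ toeplitz_carrier]) (auto simp: toeplitz_def symbol_coeff_at_0 int_gbinomial_def)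
  also have "diag_mat (toeplitz s 0 n 0) = map (\<lambda>_. 1) [0..<n]"
    by (auto simp: diag_mat_def toeplitz_def symbol_coeff_at_0 int_gbinomial_def)
  also have "prod_list (map (\<lambda>_. 1 :: 'a) [0..<n]) = 1" by (induction n) auto
  finally show ?thesis .
qed

lemma moment_fun_0_eq_1: "moment_fun s 0 m 0 = 1"
proof (induction m)
  case (Suc m)
  have "integral {0..1} (\<lambda>b::real. (1 - b) ^ m) = 1 / real (Suc m)"
  proof -
    have "((\<lambda>b::real. (1 - b) ^ m) has_integral (- ((1 - 1) ^ Suc m / real (Suc m)) - - ((1 - 0) ^ Suc m / real (Suc m)))) {0..1}"
    proof (rule fundamental_theorem_of_calculus)
      fix b :: real
      have "((\<lambda>b. - ((1 - b) ^ Suc m / real (Suc m))) has_real_derivative - (real (Suc m) * (1 - b) ^ m * (- 1) / real (Suc m))) (at b)"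
        by (rule derivative_eq_intros refl | simp)+
      thus "((\<lambda>b. - ((1 - b) ^ Suc m / real (Suc m))) has_vector_derivative (1 - b) ^ m) (at b within {0..1})"
        by (simp add: has_real_derivative_iff_has_vector_derivative has_vector_derivative_at_within del: of_nat_Suc power_Suc)
    qed simp
    thus ?thesis by (simp add: integral_unique)
  qed
  thus ?case unfolding moment_fun_Suc_0 by (simp add: beta_moment_def Suc del: of_nat_Suc)
qed (simp add: moment_fun_0_0)

theorem shifted_moment_eq_toeplitz:
  assumes s: "s > -1" and n: "n > 0"
  shows "shifted_moment s z n z = ennreal (ginibre_const s n * Determinant.det (toeplitz s 0 n ((cmod z)\<^sup>2)))"
proof -
  obtain m where m: "n = Suc m" using n by (cases n) auto
  have "moment_fun s ((cmod z)\<^sup>2) m ((cmod z)\<^sup>2) = Determinant.det (toeplitz s 0 (Suc m) ((cmod z)\<^sup>2))"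
  \<comment> \<open>The factors 1 - y / x make sense for x > 0 only; at the origin both sides equal
    1.\<close>
  proof (cases "z = 0")
    case True
    thus ?thesis by (simp add: moment_fun_0_eq_1 det_toeplitz_at_0)
  next
    case False
    thus ?thesis using det_toeplitz_eq_moment_fun[OF s, of "(cmod z)\<^sup>2" m] by simp
  qed
  thus ?thesis unfolding m shifted_moment_eq_moment_fun[OF s] by simp
qed

section \<open>Asymptotics of the Toeplitz determinants\<close>

definition l1_seq :: "(int \<Rightarrow> complex) \<Rightarrow> bool" where
  "l1_seq f \<longleftrightarrow> (\<lambda>n. norm (f n)) summable_on UNIV"

definition conv :: "(int \<Rightarrow> complex) \<Rightarrow> (int \<Rightarrow> complex) \<Rightarrow> int \<Rightarrow> complex" where
  "conv f g n = (\<Sum>\<^sub>\<infinity>k. f k * g (n - k))"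

lemma l1_seq_pair:
  assumes "l1_seq f" "l1_seq g"
  shows "(\<lambda>(k, n). norm (f k * g (n - k))) summable_on UNIV \<times> UNIV"
proof -
  have "(\<lambda>(k, j). norm (f k) * norm (g j)) summable_on UNIV \<times> UNIV"
    by (rule summable_on_SigmaI[where g = "\<lambda>k. norm (f k) * infsum (\<lambda>j. norm (g j)) UNIV"])
       (use assms in \<open>auto simp: l1_seq_def intro!: has_sum_cmult_right has_sum_infsum summable_on_cmult_left\<close>)
  hence "(\<lambda>p. (\<lambda>(k, j). norm (f k) * norm (g j)) ((\<lambda>(k, n). (k, n - k)) p)) summable_on UNIV \<times> UNIV"
    by (subst summable_on_reindex_bij_betw[where g = "\<lambda>(k, n). (k, n - k)" and B = "UNIV \<times> UNIV"])
       (auto intro!: bij_betwI[where g = "\<lambda>(k, j). (k, j + k)"])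
  thus ?thesis by (simp add: case_prod_unfold norm_mult)
qed

lemma l1_seq_bounded:
  assumes "l1_seq f"
  obtains B where "\<And>n. norm (f n) \<le> B"
proof
  fix n
  have "(\<Sum>\<^sub>\<infinity>k\<in>{n}. norm (f k)) \<le> (\<Sum>\<^sub>\<infinity>k. norm (f k))"
    using assms by (intro infsum_mono_neutral) (auto simp: l1_seq_def)
  thus "norm (f n) \<le> (\<Sum>\<^sub>\<infinity>k. norm (f k))" by simp
qed

lemma l1_seq_summable: "l1_seq f \<Longrightarrow> (\<lambda>n. norm (f n)) summable_on A"
  unfolding l1_seq_def by (rule summable_on_subset_banach) auto

lemma l1_seq_mono: "l1_seq g \<Longrightarrow> (\<And>n. norm (f n) \<le> norm (g n)) \<Longrightarrow> l1_seq f"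
  unfolding l1_seq_def by (erule Infinite_Sum.abs_summable_on_comparison_test') auto

lemma conv_summable:
  assumes "l1_seq f" "l1_seq g"
  shows "(\<lambda>k. norm (f k * g (n - k))) summable_on UNIV"
proof -
  obtain B where B: "\<And>n. norm (g n) \<le> B" using l1_seq_bounded[OF assms(2)] by blast
  have "(\<lambda>k. norm (f k) * B) summable_on UNIV" using assms(1) by (intro summable_on_cmult_left) (simp add: l1_seq_def)
  thus ?thesis by (rule Infinite_Sum.abs_summable_on_comparison_test') (auto simp: norm_mult intro!: mult_left_mono B)
qed

lemma conv_summable': "l1_seq f \<Longrightarrow> l1_seq g \<Longrightarrow> (\<lambda>k. f k * g (n - k)) summable_on UNIV"
  by (rule abs_summable_summable[OF conv_summable])

lemma l1_seq_conv:
  assumes "l1_seq f" "l1_seq g"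
  shows "l1_seq (conv f g)"
proof -
  have "(\<lambda>(k, n). norm (f k * g (n - k))) summable_on UNIV \<times> UNIV" by (rule l1_seq_pair[OF assms])
  hence "(\<lambda>(n, k). norm (f k * g (n - k))) summable_on UNIV \<times> UNIV"
    by (subst (asm) summable_on_swap) simp
  hence "(\<lambda>n. \<Sum>\<^sub>\<infinity>k. norm (f k * g (n - k))) summable_on UNIV"
    by (rule summable_on_Sigma_banach)
  thus ?thesis unfolding l1_seq_def
    by (rule Infinite_Sum.abs_summable_on_comparison_test') (auto simp: conv_def intro!: norm_infsum_bound conv_summable assms)
qed

text \<open>Fubini for the double sum, which is dominated by an absolutely summable double sequence
  times a bound for h.\<close>

lemma conv_assoc:
  assumes "l1_seq f" "l1_seq g" "l1_seq h"
  shows "conv (conv f g) h = conv f (conv g h)"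
proof
  fix n
  obtain B where B: "\<And>n. norm (h n) \<le> B" using l1_seq_bounded[OF assms(3)] by blast
  have "(\<lambda>p. (case p of (k, m) \<Rightarrow> norm (f k * g (m - k))) * B) summable_on UNIV \<times> UNIV"
    by (intro summable_on_cmult_left l1_seq_pair assms)
  hence "(\<lambda>p. norm (case p of (k, m) \<Rightarrow> f k * g (m - k) * h (n - m))) summable_on UNIV \<times> UNIV"
    by (rule Infinite_Sum.abs_summable_on_comparison_test') (auto simp: norm_mult intro!: mult_left_mono B mult_nonneg_nonneg)
  hence sm: "(\<lambda>(k, m). f k * g (m - k) * h (n - m)) summable_on UNIV \<times> UNIV"
    by (rule abs_summable_summable)
  have "conv (conv f g) h n = (\<Sum>\<^sub>\<infinity>m. \<Sum>\<^sub>\<infinity>k. f k * g (m - k) * h (n - m))"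
    unfolding conv_def by (intro infsum_cong infsum_cmult_left[symmetric] conv_summable' assms)
  also have "\<dots> = (\<Sum>\<^sub>\<infinity>k. \<Sum>\<^sub>\<infinity>m. f k * g (m - k) * h (n - m))"
    by (rule infsum_swap_banach[OF sm, symmetric])
  also have "\<dots> = (\<Sum>\<^sub>\<infinity>k. f k * conv g h (n - k))"
  proof (rule infsum_cong)
    fix k
    have "(\<Sum>\<^sub>\<infinity>m. f k * g (m - k) * h (n - m)) = (\<Sum>\<^sub>\<infinity>j. f k * g (j + k - k) * h (n - (j + k)))"
      by (rule infsum_reindex_bij_betw[where g = "\<lambda>j. j + k", symmetric]) (auto intro!: bij_betwI[where g = "\<lambda>j. j - k"])
    also have "\<dots> = (\<Sum>\<^sub>\<infinity>j. f k * (g j * h (n - k - j)))"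
      by (intro infsum_cong) (simp add: algebra_simps)
    also have "\<dots> = f k * (\<Sum>\<^sub>\<infinity>j. g j * h (n - k - j))"
      by (intro infsum_cmult_right conv_summable' assms)
    finally show "(\<Sum>\<^sub>\<infinity>m. f k * g (m - k) * h (n - m)) = f k * conv g h (n - k)" by (simp add: conv_def)
  qed
  finally show "conv (conv f g) h n = conv f (conv g h) n" by (simp add: conv_def)
qed

lemma conv_commute: "conv f g = conv g f"
proof
  fix n
  have "conv f g n = (\<Sum>\<^sub>\<infinity>j. f (n - j) * g (n - (n - j)))"
    unfolding conv_def
    by (rule infsum_reindex_bij_betw[where g = "\<lambda>j. n - j", symmetric]) (auto intro!: bij_betwI[where g = "\<lambda>j. n - j"])
  thus "conv f g n = conv g f n" by (simp add: conv_def mult.commute)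
qed

lemma conv_add_left:
  assumes "l1_seq f" "l1_seq f'" "l1_seq g"
  shows "conv (\<lambda>n. f n + f' n) g n = conv f g n + conv f' g n"
  unfolding conv_def distrib_right by (intro infsum_add conv_summable' assms)

definition delta_seq :: "int \<Rightarrow> complex" where
  "delta_seq n = (if n = 0 then 1 else 0)"

lemma l1_seq_finite_support: "finite {n. f n \<noteq> 0} \<Longrightarrow> l1_seq f"
  unfolding l1_seq_def
proof -
  assume "finite {n. f n \<noteq> 0}"
  hence "(\<lambda>n. norm (f n)) summable_on {n. f n \<noteq> 0}" by (rule summable_on_finite)
  also have "?this \<longleftrightarrow> (\<lambda>n. norm (f n)) summable_on UNIV"
    by (rule summable_on_cong_neutral) auto
  finally show "(\<lambda>n. norm (f n)) summable_on UNIV" .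
qed

lemma conv_finite_support:
  assumes "finite S" "\<And>k. k \<notin> S \<Longrightarrow> f k = 0"
  shows "conv f g n = (\<Sum>k\<in>S. f k * g (n - k))"
proof -
  have "conv f g n = (\<Sum>\<^sub>\<infinity>k\<in>S. f k * g (n - k))"
    unfolding conv_def by (rule infsum_cong_neutral) (use assms in auto)
  thus ?thesis using assms(1) by simp
qed

lemma conv_delta: "conv delta_seq g = g"
  by (rule ext) (subst conv_finite_support[of "{0}"], auto simp: delta_seq_def)

text \<open>The weights \<open>w ^ n\<close> turn the Laurent coefficients of the factors of the symbol into absolutely summable sequences.\<close>

definition exp_seq :: "complex \<Rightarrow> int \<Rightarrow> complex" where
  "exp_seq x n = (if n < 0 then 0 else x ^ nat n / fact (nat n))"

definition binom_seq :: "complex \<Rightarrow> real \<Rightarrow> int \<Rightarrow> complex" where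
  "binom_seq s w n = (if n > 0 then 0 else (s gchoose nat (- n)) / of_real w ^ nat (- n))"

section \<open>The two one-sided factors of the symbol\<close>

lemma bij_betw_int_nonneg: "bij_betw int UNIV {0..}"
  by (rule bij_betwI[where g = nat]) auto

lemma l1_seq_nat_embed:
  assumes "summable (\<lambda>k. norm (f (int k)))" "\<And>n. n < 0 \<Longrightarrow> f n = 0"
  shows "l1_seq f"
proof -
  have "(\<lambda>k. norm (f (int k))) summable_on UNIV"
    using norm_summable_imp_summable_on[of "\<lambda>k. norm (f (int k))"] assms(1) by simp
  also have "?this \<longleftrightarrow> (\<lambda>n. norm (f n)) summable_on {0..}"
    by (rule summable_on_reindex_bij_betw[where f = "\<lambda>n. norm (f n)"]) (rule bij_betw_int_nonneg)
  also have "\<dots> \<longleftrightarrow> (\<lambda>n. norm (f n)) summable_on UNIV"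
    by (rule summable_on_cong_neutral) (use assms(2) in auto)
  finally show ?thesis unfolding l1_seq_def .
qed

lemma l1_seq_uminus: "l1_seq (\<lambda>n. f (- n)) \<longleftrightarrow> l1_seq f"
  unfolding l1_seq_def
  by (rule summable_on_reindex_bij_betw[where g = uminus and f = "\<lambda>n. norm (f n)"]) (auto intro!: bij_betwI[where g = uminus])

lemma l1_seq_exp_seq: "l1_seq (exp_seq x)"
proof (rule l1_seq_nat_embed)
  show "summable (\<lambda>k. norm (exp_seq x (int k)))"
    using summable_exp[of "norm x"] by (simp add: exp_seq_def norm_divide norm_power field_simps)
qed (simp add: exp_seq_def)

text \<open>With the crude bound \<open>norm_gbinomial_le\<close> the coefficients are dominated by
  powers of (1 + |s|) / w, which fixes the threshold for w.\<close>

lemma l1_seq_binom_seq: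
  assumes "w > 1 + cmod s"
  shows "l1_seq (binom_seq s w)"
proof -
  have w: "w > 0" using assms norm_ge_zero[of s] by linarith
  have "l1_seq (\<lambda>n. binom_seq s w (- n))"
  proof (rule l1_seq_nat_embed)
    show "summable (\<lambda>k. norm (binom_seq s w (- int k)))"
    proof (rule summable_comparison_test')
      show "summable (\<lambda>k. ((1 + cmod s) / w) ^ k)" using assms w by (intro summable_geometric) simp
      show "norm (norm (binom_seq s w (- int k))) \<le> ((1 + cmod s) / w) ^ k" for k
        using norm_gbinomial_le[of s k] w by (simp add: binom_seq_def norm_divide norm_power power_divide divide_right_mono)
    qed
  qed (simp add: binom_seq_def)
  thus ?thesis by (simp add: l1_seq_uminus)
qed

lemma conv_exp_seq: "conv (exp_seq x) (exp_seq y) = exp_seq (x + y)"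
proof
  fix n
  show "conv (exp_seq x) (exp_seq y) n = exp_seq (x + y) n"
  proof (cases "n < 0")
    case True
    hence "exp_seq x k * exp_seq y (n - k) = 0" for k by (simp add: exp_seq_def)
    hence "conv (exp_seq x) (exp_seq y) n = 0" unfolding conv_def by (intro infsum_0)
    thus ?thesis using True by (simp add: exp_seq_def)
  next
    case False
    define m where "m = nat n"
    have n: "n = int m" using False by (simp add: m_def)
    have "conv (exp_seq x) (exp_seq y) n = (\<Sum>\<^sub>\<infinity>k\<in>int ` {..m}. exp_seq x k * exp_seq y (n - k))"
      unfolding conv_def
    proof (rule infsum_cong_neutral)
      fix k :: int assume k: "k \<in> UNIV - int ` {..m}"
      have "k < 0 \<or> k > n"
      proof (rule ccontr)
        assume "\<not> (k < 0 \<or> k > n)"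
        hence "k = int (nat k)" "nat k \<in> {..m}" unfolding n by auto
        thus False using k by blast
      qed
      thus "exp_seq x k * exp_seq y (n - k) = 0" by (auto simp: exp_seq_def)
    qed auto
    also have "\<dots> = (\<Sum>k\<le>m. exp_seq x (int k) * exp_seq y (n - int k))"
      by (simp add: sum.reindex)
    also have "\<dots> = (\<Sum>k\<le>m. of_nat (m choose k) * x ^ k * y ^ (m - k)) / fact m"
      unfolding sum_divide_distrib
    proof (rule sum.cong[OF refl])
      fix k assume k: "k \<in> {..m}"
      hence e: "n - int k = int (m - k)" by (simp add: n of_nat_diff)
      have "exp_seq x (int k) * exp_seq y (int (m - k)) = x ^ k / fact k * (y ^ (m - k) / fact (m - k))"
        unfolding exp_seq_def nat_int by simp
      also have "\<dots> = of_nat (m choose k) * x ^ k * y ^ (m - k) / fact m"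
        using k by (simp add: binomial_fact)
      finally show "exp_seq x (int k) * exp_seq y (n - int k) = of_nat (m choose k) * x ^ k * y ^ (m - k) / fact m"
        unfolding e .
    qed
    also have "\<dots> = exp_seq (x + y) n" unfolding binomial_ring[symmetric] by (simp add: exp_seq_def n)
    finally show ?thesis .
  qed
qed

lemma exp_seq_0: "exp_seq 0 = delta_seq"
  by (rule ext) (auto simp: exp_seq_def delta_seq_def)

text \<open>Both sequences are binomial series in 1 / (w u), whose exponents add by Vandermonde; s
  and -s therefore give inverse sequences.\<close>

lemma conv_binom_seq:
  assumes w: "w \<noteq> 0"
  shows "conv (binom_seq s w) (binom_seq t w) = binom_seq (s + t) w"
proof
  fix n
  show "conv (binom_seq s w) (binom_seq t w) n = binom_seq (s + t) w n"
  proof (cases "n > 0")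
    case True
    hence "binom_seq s w k * binom_seq t w (n - k) = 0" for k by (simp add: binom_seq_def)
    hence "conv (binom_seq s w) (binom_seq t w) n = 0" unfolding conv_def by (intro infsum_0)
    thus ?thesis using True by (simp add: binom_seq_def)
  next
    case False
    define m where "m = nat (- n)"
    have n: "n = - int m" using False by (simp add: m_def)
    have "conv (binom_seq s w) (binom_seq t w) n = (\<Sum>\<^sub>\<infinity>k\<in>(\<lambda>k. - int k) ` {0..m}. binom_seq s w k * binom_seq t w (n - k))"
      unfolding conv_def
    proof (rule infsum_cong_neutral)
      fix k :: int assume k: "k \<in> UNIV - (\<lambda>k. - int k) ` {0..m}"
      have "k > 0 \<or> k < n"
      proof (rule ccontr)
        assume "\<not> (k > 0 \<or> k < n)"
        hence "k = - int (nat (- k))" "nat (- k) \<in> {0..m}" unfolding n by auto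
        thus False using k by blast
      qed
      thus "binom_seq s w k * binom_seq t w (n - k) = 0" by (auto simp: binom_seq_def)
    qed auto
    also have "\<dots> = (\<Sum>k=0..m. binom_seq s w (- int k) * binom_seq t w (n + int k))"
      by (subst infsum_finite, simp, subst sum.reindex) (auto simp: inj_on_def)
    also have "\<dots> = (\<Sum>k=0..m. (s gchoose k) * (t gchoose (m - k))) / of_real w ^ m"
      unfolding sum_divide_distrib
    proof (rule sum.cong[OF refl])
      fix k assume k: "k \<in> {0..m}"
      hence "- (n + int k) = int (m - k)" by (simp add: n of_nat_diff)
      hence "nat (- (n + int k)) = m - k" "\<not> n + int k > 0" by linarith+
      moreover have "of_real w ^ m = (of_real w ^ k * of_real w ^ (m - k) :: complex)" using k by (simp add: power_add[symmetric])
      ultimately show "binom_seq s w (- int k) * binom_seq t w (n + int k) = (s gchoose k) * (t gchoose (m - k)) / of_real w ^ m"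
        by (simp add: binom_seq_def)
    qed
    also have "\<dots> = binom_seq (s + t) w n" unfolding gbinomial_Vandermonde by (simp add: binom_seq_def n)
    finally show ?thesis .
  qed
qed

lemma binom_seq_0: "binom_seq 0 w = delta_seq"
proof
  fix n
  show "binom_seq 0 w n = delta_seq n"
    by (cases "nat (- n)") (auto simp: binom_seq_def delta_seq_def gbinomial_0_left)
qed

text \<open>The product of the two factors is the symbol evaluated at w u, so the weight only
  multiplies the coefficient of index n by w^n, for n of either sign.\<close>

lemma conv_binom_exp:
  assumes w: "w > 1 + cmod s"
  shows "conv (binom_seq s w) (exp_seq (of_real w * x)) n = of_real w powi n * symbol_coeff s n x"
proof -
  have w0: "w > 0" using w norm_ge_zero[of s] by linarith
  let ?E = "exp_seq (of_real w * x)" and ?B = "binom_seq s w"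
  have "conv ?B ?E n = (\<Sum>\<^sub>\<infinity>k. ?E k * ?B (n - k))" by (subst conv_commute) (simp add: conv_def)
  also have "\<dots> = (\<Sum>\<^sub>\<infinity>k\<in>{0..}. ?E k * ?B (n - k))"
    by (rule infsum_cong_neutral) (auto simp: exp_seq_def)
  also have "\<dots> = (\<Sum>\<^sub>\<infinity>k. ?E (int k) * ?B (n - int k))"
    by (rule infsum_reindex_bij_betw[OF bij_betw_int_nonneg, symmetric])
  also have "(\<lambda>k. ?E (int k) * ?B (n - int k)) = (\<lambda>k. of_real w powi n * (int_gbinomial s (int k - n) / fact k * x ^ k))"
  proof
    fix k
    show "?E (int k) * ?B (n - int k) = of_real w powi n * (int_gbinomial s (int k - n) / fact k * x ^ k)"
    proof (cases "int k < n")
      case True thus ?thesis by (simp add: binom_seq_def int_gbinomial_def)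
    next
      case False
      define j where "j = nat (int k - n)"
      have j: "int k - n = int j" "- (n - int k) = int j" using False by (auto simp: j_def)
      have nk: "n = int k - int j" using j by simp
      have pw: "of_real w powi n = (of_real w ^ k / of_real w ^ j :: complex)"
        unfolding nk using w0 by (simp add: power_int_diff)
      have "?E (int k) * ?B (n - int k) = (of_real w * x) ^ k / fact k * ((s gchoose j) / of_real w ^ j)"
        using False j by (simp add: exp_seq_def binom_seq_def)
      also have "\<dots> = of_real w powi n * (int_gbinomial s (int k - n) / fact k * x ^ k)"
        unfolding pw j by (simp add: int_gbinomial_def power_mult_distrib mult_ac)
      finally show ?thesis .
    qed
  qed
  also have "(\<Sum>\<^sub>\<infinity>k. of_real w powi n * (int_gbinomial s (int k - n) / fact k * x ^ k)) = of_real w powi n * symbol_coeff s n x"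
  proof (rule infsumI, rule has_sum_cmult_right)
    show "((\<lambda>k. int_gbinomial s (int k - n) / fact k * x ^ k) has_sum symbol_coeff s n x) UNIV"
      by (rule norm_summable_imp_has_sum[OF summable_norm_symbol_coeff sums_symbol_coeff])
  qed
  finally show ?thesis .
qed

lemma l1_seq_restrict: "l1_seq f \<Longrightarrow> l1_seq (\<lambda>n. if P n then f n else 0)"
  by (erule l1_seq_mono) auto

text \<open>The Wiener-Hopf factorisation of the symbol turns the orthogonality relations for \<open>\<alpha>\<close> into a
  fixed-point system for the coefficients \<open>H\<close> and \<open>P\<close> of the two one-sided remainders.\<close>

lemma wiener_hopf_system:
  fixes \<alpha> :: "nat \<Rightarrow> complex" and s x :: complex and w :: real
  assumes w: "w > 1 + cmod s" and N: "N \<ge> 1"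
    and orth: "\<And>l. l < N \<Longrightarrow> (\<Sum>i\<le>N. \<alpha> i * symbol_coeff s (int l - int i) x) = 0"
  obtains H P :: "nat \<Rightarrow> complex" where
    "(\<lambda>n. norm (H n) * w ^ n) summable_on {N..}"
    "\<And>k. k \<ge> 1 \<Longrightarrow> P k = - (\<Sum>\<^sub>\<infinity>n\<in>{N..}. H n * symbol_coeff (- s) (- int (n + k)) x)"
    "\<And>n. n \<ge> N \<Longrightarrow> H n = (if n = N then \<alpha> N else 0) - (\<Sum>\<^sub>\<infinity>k\<in>{1..}. P k * symbol_coeff s (int (n + k)) (- x))"
    "\<alpha> (N - 1) + s * \<alpha> N = (\<Sum>\<^sub>\<infinity>k\<in>{1..}. P k * symbol_coeff s (int (N - 1 + k)) (- x))"
proof -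
  have w0: "w > 0" using w norm_ge_zero[of s] by linarith
  have w': "w > 1 + cmod (- s)" using w by simp
  define A where "A n = (if 0 \<le> n \<and> n \<le> int N then \<alpha> (nat n) * of_real w ^ nat n else 0)" for n
  let ?C = "binom_seq s w" and ?C' = "binom_seq (- s) w" and ?E = "exp_seq (of_real w * x)" and ?E' = "exp_seq (- (of_real w * x))"
  have lA: "l1_seq A"
    by (rule l1_seq_finite_support, rule finite_subset[of _ "{0..int N}"]) (auto simp: A_def split: if_splits)
  note l1 = lA l1_seq_exp_seq l1_seq_binom_seq[OF w] l1_seq_binom_seq[OF w'] l1_seq_conv
  \<comment> \<open>As Laurent series, r = A C E. The orthogonality relations say that r has a gap
    at the indices 0, ..., N - 1, so it splits into a part of degree at least N and a part of
    negative degree.\<close>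
  define r where "r = conv A (conv ?C ?E)"
  define rp where "rp n = (if n \<ge> int N then r n else 0)" for n
  define rm where "rm n = (if n < 0 then r n else 0)" for n
  \<comment> \<open>Dividing the upper part by E and the lower part by C keeps both one-sided,
    because E and its inverse contain only nonnegative powers, C and its inverse only nonpositive
    ones.\<close>
  define h where "h = conv rp ?E'"
  define \<rho> where "\<rho> = conv rm ?C'"
  have lr: "l1_seq r" unfolding r_def by (intro l1)
  have lrp: "l1_seq rp" and lrm: "l1_seq rm" unfolding rp_def rm_def by (intro l1_seq_restrict lr)+
  have lh: "l1_seq h" and l\<rho>: "l1_seq \<rho>" unfolding h_def \<rho>_def by (intro l1 lrp lrm)+
  have Aconv: "conv A g n = (\<Sum>i\<le>N. \<alpha> i * of_real w ^ i * g (n - int i))" for g n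
  proof -
    have "conv A g n = (\<Sum>k\<in>int ` {..N}. A k * g (n - k))"
    proof (rule conv_finite_support)
      fix k assume "k \<notin> int ` {..N}"
      moreover have "k = int (nat k)" "nat k \<in> {..N}" if "0 \<le> k" "k \<le> int N" using that by auto
      ultimately show "A k = 0" unfolding A_def by (metis image_eqI)
    qed simp
    also have "\<dots> = (\<Sum>i\<le>N. A (int i) * g (n - int i))" by (simp add: sum.reindex)
    also have "\<dots> = (\<Sum>i\<le>N. \<alpha> i * of_real w ^ i * g (n - int i))"
      by (intro sum.cong refl) (simp add: A_def)
    finally show ?thesis .
  qed
  have r0: "r n = 0" if "0 \<le> n" "n < int N" for n
  proof -
    have "r n = (\<Sum>i\<le>N. of_real w powi n * (\<alpha> i * symbol_coeff s (n - int i) x))"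
      unfolding r_def Aconv
    proof (rule sum.cong[OF refl])
      fix i
      have "of_real w powi n = (of_real w ^ i * of_real w powi (n - int i) :: complex)"
        using w0 by (simp add: power_int_diff)
      thus "\<alpha> i * of_real w ^ i * conv ?C ?E (n - int i) = of_real w powi n * (\<alpha> i * symbol_coeff s (n - int i) x)"
        by (simp add: conv_binom_exp[OF w])
    qed
    also have "\<dots> = 0" using orth[of "nat n"] that by (simp add: sum_distrib_left[symmetric])
    finally show ?thesis .
  qed
  have split: "r = (\<lambda>n. rp n + rm n)"
    by (rule ext) (use r0 in \<open>auto simp: rp_def rm_def not_le\<close>)
  have EE: "conv ?E ?E' = delta_seq" "conv ?E' ?E = delta_seq"
    by (simp_all add: conv_exp_seq exp_seq_0)
  have CC: "conv ?C ?C' = delta_seq" "conv ?C' ?C = delta_seq"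
    using w0 by (simp_all add: conv_binom_seq binom_seq_0)
  have cd: "conv g delta_seq = g" for g by (subst conv_commute) (rule conv_delta)
  have rp: "rp = conv h ?E" unfolding h_def
    by (subst conv_assoc[OF lrp]) (auto intro: l1 simp: EE cd)
  have rm: "rm = conv \<rho> ?C" unfolding \<rho>_def
    by (subst conv_assoc[OF lrm]) (auto intro: l1 simp: CC cd)
  have h0: "h n = 0" if "n < int N" for n
    unfolding h_def conv_def by (rule infsum_0) (use that in \<open>auto simp: rp_def exp_seq_def\<close>)
  have \<rho>0: "\<rho> n = 0" if "n \<ge> 0" for n
    unfolding \<rho>_def conv_def by (rule infsum_0) (use that in \<open>auto simp: rm_def binom_seq_def\<close>)
  \<comment> \<open>The weights are undone here; in the resulting equations w survives only in the
    summability of \<open>H\<close>.\<close>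
  define H where "H n = h (int n) / of_real w ^ n" for n
  define P where "P k = \<rho> (- int k) * of_real w ^ k" for k
  \<comment> \<open>The quotient r / C = A E has no negative powers, which gives the equation for
    \<open>P\<close>.\<close>
  have rC: "conv r ?C' = conv A ?E"
  proof -
    have "conv r ?C' = conv A (conv (conv ?C ?E) ?C')" unfolding r_def by (rule conv_assoc) (intro l1)+
    also have "conv (conv ?C ?E) ?C' = conv (conv ?E ?C) ?C'" by (simp add: conv_commute)
    also have "\<dots> = conv ?E (conv ?C ?C')" by (rule conv_assoc) (intro l1)+
    finally show ?thesis by (simp add: CC cd)
  qed
  \<comment> \<open>The quotient r / E = A C has degree at most N. Its coefficients from N on give
    the equation for \<open>H\<close>; the one at N - 1 is, up to a weight, the combination of
    \<alpha> in the last conclusion.\<close>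
  have rE: "conv r ?E' = conv A ?C"
  proof -
    have "conv r ?E' = conv A (conv (conv ?C ?E) ?E')" unfolding r_def by (rule conv_assoc) (intro l1)+
    also have "conv (conv ?C ?E) ?E' = conv ?C (conv ?E ?E')" by (rule conv_assoc) (intro l1)+
    finally show ?thesis by (simp add: EE cd)
  qed
  have sumH: "(\<lambda>n. norm (H n) * w ^ n) summable_on {N..}"
  proof -
    have "(\<lambda>n. norm (h n)) summable_on (int ` {N..})" by (rule l1_seq_summable[OF lh])
    hence "(\<lambda>n. norm (h (int n))) summable_on {N..}"
      by (subst (asm) summable_on_reindex) (auto simp: o_def)
    thus ?thesis using w0 by (simp add: H_def norm_divide norm_power)
  qed
  have eqP: "P k = - (\<Sum>\<^sub>\<infinity>n\<in>{N..}. H n * symbol_coeff (- s) (- int (n + k)) x)" if k: "k \<ge> 1" for k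
  proof -
    let ?n = "- int k"
    have "conv A ?E ?n = 0" unfolding Aconv using k by (intro sum.neutral) (auto simp: exp_seq_def)
    hence "conv r ?C' ?n = 0" by (simp add: rC)
    moreover have "conv r ?C' ?n = conv rp ?C' ?n + \<rho> ?n"
      unfolding split \<rho>_def by (intro conv_add_left lrp lrm l1)
    moreover have "conv rp ?C' = conv h (conv ?E ?C')" unfolding rp by (rule conv_assoc) (intro l1 lh)+
    ultimately have "\<rho> ?n = - conv h (conv ?C' ?E) ?n"
      by (simp add: conv_commute[of ?E] eq_neg_iff_add_eq_0 add.commute)
    also have "conv h (conv ?C' ?E) ?n = (\<Sum>\<^sub>\<infinity>m\<in>{int N..}. h m * conv ?C' ?E (?n - m))"
      unfolding conv_def[of h] by (rule infsum_cong_neutral) (auto simp: h0)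
    also have "\<dots> = (\<Sum>\<^sub>\<infinity>n\<in>{N..}. h (int n) * conv ?C' ?E (?n - int n))"
      by (rule infsum_reindex_bij_betw[symmetric, where g = int]) (rule bij_betwI[where g = nat], auto)
    finally have "P k = - (of_real w ^ k * (\<Sum>\<^sub>\<infinity>n\<in>{N..}. h (int n) * conv ?C' ?E (?n - int n)))"
      by (simp add: P_def)
    also have "of_real w ^ k * (\<Sum>\<^sub>\<infinity>n\<in>{N..}. h (int n) * conv ?C' ?E (?n - int n)) = (\<Sum>\<^sub>\<infinity>n\<in>{N..}. of_real w ^ k * (h (int n) * conv ?C' ?E (?n - int n)))"
      using w0 by (intro infsum_cmult_right'[symmetric])
    also have "\<dots> = (\<Sum>\<^sub>\<infinity>n\<in>{N..}. H n * symbol_coeff (- s) (- int (n + k)) x)"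
    proof (rule infsum_cong)
      fix n
      have e: "- int k - int n = - int (n + k)" by simp
      have "conv ?C' ?E (- int k - int n) = symbol_coeff (- s) (- int (n + k)) x / of_real w ^ (n + k)"
        unfolding e conv_binom_exp[OF w'] power_int_minus power_int_of_nat by (simp only: divide_inverse mult.commute)
      thus "of_real w ^ k * (h (int n) * conv ?C' ?E (?n - int n)) = H n * symbol_coeff (- s) (- int (n + k)) x"
        using w0 by (simp add: H_def power_add)
    qed
    finally show ?thesis .
  qed
  have main: "conv A ?C n = h n + of_real w ^ nat n * (\<Sum>\<^sub>\<infinity>k\<in>{1..}. P k * symbol_coeff s (int (nat n + k)) (- x))" if n: "n \<ge> 0" for n
  proof -
    have "conv A ?C n = conv r ?E' n" by (simp add: rE)
    also have "\<dots> = h n + conv rm ?E' n" unfolding split h_def by (intro conv_add_left lrp lrm l1)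
    also have "conv rm ?E' = conv \<rho> (conv ?C ?E')" unfolding rm by (rule conv_assoc) (intro l1 l\<rho>)+
    also have "conv \<rho> (conv ?C ?E') n = (\<Sum>\<^sub>\<infinity>m\<in>{..-1}. \<rho> m * conv ?C ?E' (n - m))"
      unfolding conv_def[of \<rho>] by (rule infsum_cong_neutral) (auto simp: \<rho>0)
    also have "\<dots> = (\<Sum>\<^sub>\<infinity>k\<in>{1..}. \<rho> (- int k) * conv ?C ?E' (n - (- int k)))"
      by (rule infsum_reindex_bij_betw[symmetric, where g = "\<lambda>k. - int k"]) (rule bij_betwI[where g = "\<lambda>m. nat (- m)"], auto)
    also have "\<dots> = (\<Sum>\<^sub>\<infinity>k\<in>{1..}. of_real w ^ nat n * (P k * symbol_coeff s (int (nat n + k)) (- x)))"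
    proof (rule infsum_cong)
      fix k
      have e: "n - (- int k) = int (nat n + k)" using n by simp
      have "conv ?C ?E' (n - (- int k)) = of_real w ^ (nat n + k) * symbol_coeff s (int (nat n + k)) (- x)"
        unfolding e by (rule conv_binom_exp[OF w, of "- x" "int (nat n + k)", unfolded power_int_of_nat mult_minus_right])
      thus "\<rho> (- int k) * conv ?C ?E' (n - (- int k)) = of_real w ^ nat n * (P k * symbol_coeff s (int (nat n + k)) (- x))"
        by (simp add: P_def power_add)
    qed
    also have "\<dots> = of_real w ^ nat n * (\<Sum>\<^sub>\<infinity>k\<in>{1..}. P k * symbol_coeff s (int (nat n + k)) (- x))"
      using w0 by (intro infsum_cmult_right')
    finally show ?thesis .
  qed
  have eqH: "H n = (if n = N then \<alpha> N else 0) - (\<Sum>\<^sub>\<infinity>k\<in>{1..}. P k * symbol_coeff s (int (n + k)) (- x))" if n: "n \<ge> N" for n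
  proof -
    have "conv A ?C (int n) = (\<Sum>i\<le>N. if i = n then \<alpha> n * of_real w ^ n else 0)"
      unfolding Aconv using n by (intro sum.cong refl) (auto simp: binom_seq_def)
    also have "\<dots> = (if n = N then \<alpha> N else 0) * of_real w ^ n" using n by auto
    finally have "h (int n) = ((if n = N then \<alpha> N else 0) - (\<Sum>\<^sub>\<infinity>k\<in>{1..}. P k * symbol_coeff s (int (n + k)) (- x))) * of_real w ^ n"
      using main[of "int n"] by (simp add: algebra_simps)
    thus ?thesis using w0 by (simp add: H_def)
  qed
  have "\<alpha> (N - 1) + s * \<alpha> N = (\<Sum>\<^sub>\<infinity>k\<in>{1..}. P k * symbol_coeff s (int (N - 1 + k)) (- x))"
  proof -
    obtain M where M: "N = Suc M" using N by (cases N) auto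
    have "conv A ?C (int M) = (\<Sum>i\<le>Suc M. \<alpha> i * of_real w ^ i * ?C (int M - int i))"
      unfolding Aconv M ..
    also have "\<dots> = (\<Sum>i<M. \<alpha> i * of_real w ^ i * ?C (int M - int i)) + \<alpha> M * of_real w ^ M * ?C 0 + \<alpha> (Suc M) * of_real w ^ Suc M * ?C (-1)"
      by (simp add: lessThan_Suc_atMost[symmetric])
    finally have "conv A ?C (int M) = (\<Sum>i<M. \<alpha> i * of_real w ^ i * ?C (int M - int i)) + \<alpha> M * of_real w ^ M * ?C 0 + \<alpha> (Suc M) * of_real w ^ Suc M * ?C (-1)" .
    moreover have "(\<Sum>i<M. \<alpha> i * of_real w ^ i * ?C (int M - int i)) = 0"
      by (intro sum.neutral) (auto simp: binom_seq_def)
    moreover have "?C 0 = 1" "?C (-1) = s / of_real w" by (simp_all add: binom_seq_def)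
    ultimately have "conv A ?C (int M) = of_real w ^ M * (\<alpha> M + s * \<alpha> (Suc M))"
      using w0 by (simp add: algebra_simps)
    moreover have "h (int M) = 0" using M by (intro h0) simp
    ultimately have X: "of_real w ^ M * (\<Sum>\<^sub>\<infinity>k\<in>{1..}. P k * symbol_coeff s (int (M + k)) (- x)) = of_real w ^ M * (\<alpha> M + s * \<alpha> (Suc M))"
      using main[of "int M"] by (simp only: nat_int of_nat_0_le_iff add_0)
    have "(\<Sum>\<^sub>\<infinity>k\<in>{1..}. P k * symbol_coeff s (int (M + k)) (- x)) = \<alpha> M + s * \<alpha> (Suc M)"
      by (rule mult_left_cancel[THEN iffD1, OF _ X]) (use w0 in simp)
    thus ?thesis unfolding M diff_Suc_1 by (rule sym)
  qed
  from that[OF sumH eqP eqH this] show ?thesis .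
qed

text \<open>A contraction argument in the norm W, the sum of (n + 1)^S |H n|. The weight matches the
  polynomial growth allowed at negative index, and n + k + 1 <= (n + 1) (k + 1) separates the
  variables. When one equation is inserted into the other, exp x and exp (-x) cancel, and the
  smallness assumption bounds W by twice the source term.\<close>

lemma wiener_hopf_bound:
  fixes \<alpha> :: "nat \<Rightarrow> complex" and s :: complex and x :: real
  assumes N: "N \<ge> 1"
    and orth: "\<And>l. l < N \<Longrightarrow> (\<Sum>i\<le>N. \<alpha> i * symbol_coeff s (int l - int i) (of_real x)) = 0"
    and a: "\<And>M. M \<ge> N \<Longrightarrow> cmod (symbol_coeff s (int M) (- of_real x)) \<le> c1 * exp x * q ^ M"
    and b: "\<And>M. M \<ge> N \<Longrightarrow> cmod (symbol_coeff (- s) (- int M) (of_real x)) \<le> c2 * exp (- x) * real (M + 1) ^ S"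
    and c: "c1 \<ge> 0" "c2 \<ge> 0" "q \<ge> 0"
    and Q: "((\<lambda>k. real (k + 1) ^ S * q ^ k) has_sum Q) {1..}"
    and T: "((\<lambda>n. real (n + 1) ^ S * q ^ n) has_sum T) {N..}"
    and small: "c1 * c2 * Q * T \<le> 1 / 2"
  shows "cmod (\<alpha> (N - 1) + s * \<alpha> N) \<le> 2 * c1 * c2 * Q * real (N + 1) ^ S * q ^ (N - 1) * cmod (\<alpha> N)"
proof -
  \<comment> \<open>The first entry meets the condition of the system; the second gives (n + 1)^S <=
    w^n, hence finiteness of W.\<close>
  define w where "w = max (2 + cmod s) (2 ^ S)"
  have w: "w > 1 + cmod s" "w \<ge> 2 ^ S" by (auto simp: w_def)
  have w0: "w > 0" using w(1) norm_ge_zero[of s] by linarith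
  obtain H P where HP: "(\<lambda>n. norm (H n) * w ^ n) summable_on {N..}"
    "\<And>k. k \<ge> 1 \<Longrightarrow> P k = - (\<Sum>\<^sub>\<infinity>n\<in>{N..}. H n * symbol_coeff (- s) (- int (n + k)) (of_real x))"
    "\<And>n. n \<ge> N \<Longrightarrow> H n = (if n = N then \<alpha> N else 0) - (\<Sum>\<^sub>\<infinity>k\<in>{1..}. P k * symbol_coeff s (int (n + k)) (- of_real x))"
    "\<alpha> (N - 1) + s * \<alpha> N = (\<Sum>\<^sub>\<infinity>k\<in>{1..}. P k * symbol_coeff s (int (N - 1 + k)) (- of_real x))"
    by (rule wiener_hopf_system[OF w(1) N orth]) (assumption, rule that)
  define W where "W = (\<Sum>\<^sub>\<infinity>n\<in>{N..}. real (n + 1) ^ S * cmod (H n))"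
  have sumW: "(\<lambda>n. real (n + 1) ^ S * cmod (H n)) summable_on {N..}"
  proof (rule summable_on_comparison_test[OF HP(1)])
    fix n
    have "real (n + 1) \<le> 2 ^ n"
    proof -
      have "n + 1 \<le> 2 ^ n" by (induction n) auto
      hence "real (n + 1) \<le> real (2 ^ n)" by (simp only: of_nat_le_iff)
      thus ?thesis by simp
    qed
    hence "real (n + 1) ^ S \<le> (2 ^ n) ^ S" by (intro power_mono) auto
    also have "\<dots> = (2 ^ S) ^ n" by (simp add: power_mult[symmetric] mult.commute)
    also have "\<dots> \<le> w ^ n" using w(2) by (intro power_mono) auto
    finally have "real (n + 1) ^ S * cmod (H n) \<le> w ^ n * cmod (H n)" by (rule mult_right_mono) simp
    thus "real (n + 1) ^ S * cmod (H n) \<le> cmod (H n) * w ^ n" by (simp only: mult.commute[of "w ^ n"])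
  qed auto
  have W0: "W \<ge> 0" unfolding W_def by (intro infsum_nonneg) auto
  have Q0: "Q \<ge> 0" by (rule has_sum_nonneg[OF Q]) (use c in auto)
  have P: "cmod (P k) \<le> c2 * exp (- x) * real (k + 1) ^ S * W" if k: "k \<ge> 1" for k
  proof -
    have le: "cmod (H n * symbol_coeff (- s) (- int (n + k)) (of_real x)) \<le> c2 * exp (- x) * real (k + 1) ^ S * (real (n + 1) ^ S * cmod (H n))" if "n \<in> {N..}" for n
    proof -
      have "real (n + k + 1) \<le> real (k + 1) * real (n + 1)" by (simp add: algebra_simps)
      hence "real (n + k + 1) ^ S \<le> (real (k + 1) * real (n + 1)) ^ S" by (intro power_mono) auto
      hence "c2 * exp (- x) * real (n + k + 1) ^ S \<le> c2 * exp (- x) * (real (k + 1) ^ S * real (n + 1) ^ S)"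
        using c by (intro mult_left_mono) (auto simp: power_mult_distrib)
      moreover have "cmod (symbol_coeff (- s) (- int (n + k)) (of_real x)) \<le> c2 * exp (- x) * real (n + k + 1) ^ S"
        using b[of "n + k"] that by simp
      ultimately have "cmod (symbol_coeff (- s) (- int (n + k)) (of_real x)) \<le> c2 * exp (- x) * (real (k + 1) ^ S * real (n + 1) ^ S)" by linarith
      hence "cmod (H n) * cmod (symbol_coeff (- s) (- int (n + k)) (of_real x)) \<le> cmod (H n) * (c2 * exp (- x) * (real (k + 1) ^ S * real (n + 1) ^ S))"
        by (intro mult_left_mono) auto
      thus ?thesis by (simp add: norm_mult mult_ac)
    qed
    have sm: "(\<lambda>n. c2 * exp (- x) * real (k + 1) ^ S * (real (n + 1) ^ S * cmod (H n))) summable_on {N..}"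
      by (intro summable_on_cmult_right sumW)
    have "cmod (P k) = cmod (\<Sum>\<^sub>\<infinity>n\<in>{N..}. H n * symbol_coeff (- s) (- int (n + k)) (of_real x))"
      unfolding HP(2)[OF k] by simp
    also have "\<dots> \<le> (\<Sum>\<^sub>\<infinity>n\<in>{N..}. c2 * exp (- x) * real (k + 1) ^ S * (real (n + 1) ^ S * cmod (H n)))"
      by (rule norm_infsum_le[OF has_sum_infsum has_sum_infsum]) (use le sm in \<open>auto intro!: abs_summable_summable[OF Infinite_Sum.abs_summable_on_comparison_test'[OF sm]]\<close>)
    also have "\<dots> = c2 * exp (- x) * real (k + 1) ^ S * W" unfolding W_def by (rule infsum_cmult_right') 
    finally show ?thesis .
  qed
  \<comment> \<open>The case n = N - 1 is included: k starts at 1, so the index n + k is at least N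
    throughout.\<close>
  have inner: "cmod (\<Sum>\<^sub>\<infinity>k\<in>{1..}. P k * symbol_coeff s (int (n + k)) (- of_real x)) \<le> c1 * c2 * Q * W * q ^ n" if n: "n + 1 \<ge> N" for n
  proof -
    have le: "cmod (P k * symbol_coeff s (int (n + k)) (- of_real x)) \<le> c1 * c2 * W * q ^ n * (real (k + 1) ^ S * q ^ k)" if k: "k \<in> {1..}" for k
    proof -
      have "cmod (symbol_coeff s (int (n + k)) (- of_real x)) \<le> c1 * exp x * q ^ (n + k)"
        using n k by (intro a) auto
      hence "cmod (P k) * cmod (symbol_coeff s (int (n + k)) (- of_real x)) \<le> (c2 * exp (- x) * real (k + 1) ^ S * W) * (c1 * exp x * q ^ (n + k))"
        using P[of k] k c W0 by (intro mult_mono) auto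
      also have "\<dots> = (exp (- x) * exp x) * (c1 * c2 * W * q ^ n * (real (k + 1) ^ S * q ^ k))"
        by (simp only: power_add mult_ac)
      also have "exp (- x) * exp x = 1" by (simp add: exp_minus)
      finally show ?thesis by (simp add: norm_mult)
    qed
    have hs: "((\<lambda>k. c1 * c2 * W * q ^ n * (real (k + 1) ^ S * q ^ k)) has_sum (c1 * c2 * W * q ^ n * Q)) {1..}"
      by (intro has_sum_cmult_right Q)
    have "cmod (\<Sum>\<^sub>\<infinity>k\<in>{1..}. P k * symbol_coeff s (int (n + k)) (- of_real x)) \<le> c1 * c2 * W * q ^ n * Q"
    proof (rule norm_infsum_le[OF has_sum_infsum hs])
      show "(\<lambda>k. P k * symbol_coeff s (int (n + k)) (- of_real x)) summable_on {1..}"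
        by (rule abs_summable_summable[OF Infinite_Sum.abs_summable_on_comparison_test'[OF has_sum_imp_summable[OF hs] le]])
    qed (rule le)
    thus ?thesis by (simp add: mult_ac)
  qed
  have "W \<le> real (N + 1) ^ S * cmod (\<alpha> N) + c1 * c2 * Q * W * T"
  proof -
    have h1: "((\<lambda>n. if n = N then real (N + 1) ^ S * cmod (\<alpha> N) else 0) has_sum (real (N + 1) ^ S * cmod (\<alpha> N))) {N..}"
      by (rule has_sum_finite_neutralI[of "{N}"]) auto
    have h2: "((\<lambda>n. c1 * c2 * Q * W * (real (n + 1) ^ S * q ^ n)) has_sum (c1 * c2 * Q * W * T)) {N..}"
      by (intro has_sum_cmult_right T)
    show ?thesis
    proof (rule has_sum_mono[OF _ has_sum_add[OF h1 h2]])
      show "((\<lambda>n. real (n + 1) ^ S * cmod (H n)) has_sum W) {N..}"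
        unfolding W_def by (rule has_sum_infsum[OF sumW])
      fix n assume "n \<in> {N..}"
      hence n: "n \<ge> N" by simp
      have "cmod (H n) \<le> cmod (if n = N then \<alpha> N else 0) + cmod (\<Sum>\<^sub>\<infinity>k\<in>{1..}. P k * symbol_coeff s (int (n + k)) (- of_real x))"
        unfolding HP(3)[OF n] by (rule norm_triangle_ineq4)
      also have "\<dots> \<le> (if n = N then cmod (\<alpha> N) else 0) + c1 * c2 * Q * W * q ^ n"
        using inner[of n] n by (intro add_mono) auto
      finally have "real (n + 1) ^ S * cmod (H n) \<le> real (n + 1) ^ S * ((if n = N then cmod (\<alpha> N) else 0) + c1 * c2 * Q * W * q ^ n)"
        by (intro mult_left_mono) auto
      also have "\<dots> = (if n = N then real (N + 1) ^ S * cmod (\<alpha> N) else 0) + c1 * c2 * Q * W * (real (n + 1) ^ S * q ^ n)"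
        by (simp add: algebra_simps)
      finally show "real (n + 1) ^ S * cmod (H n) \<le> (if n = N then real (N + 1) ^ S * cmod (\<alpha> N) else 0) + c1 * c2 * Q * W * (real (n + 1) ^ S * q ^ n)" .
    qed
  qed
  also have "c1 * c2 * Q * W * T = (c1 * c2 * Q * T) * W" by (simp add: mult_ac)
  also have "\<dots> \<le> 1 / 2 * W" using small W0 by (rule mult_right_mono)
  finally have W: "W \<le> 2 * real (N + 1) ^ S * cmod (\<alpha> N)" by simp
  have "cmod (\<alpha> (N - 1) + s * \<alpha> N) \<le> c1 * c2 * Q * W * q ^ (N - 1)"
    unfolding HP(4) using N by (intro inner) auto
  also have "\<dots> \<le> c1 * c2 * Q * (2 * real (N + 1) ^ S * cmod (\<alpha> N)) * q ^ (N - 1)"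
    using c Q0 W by (intro mult_right_mono mult_left_mono) auto
  finally show ?thesis by (simp add: mult_ac)
qed

section \<open>Size of the Laurent coefficients of large index\<close>

lemma pochhammer_ge_0: "(0::real) \<le> a \<Longrightarrow> 0 \<le> pochhammer a k"
  by (induction k) (auto simp: pochhammer_Suc)

lemma norm_pochhammer_le_pochhammer:
  fixes a :: "'a::real_normed_field"
  shows "norm (pochhammer a k) \<le> pochhammer (norm a) k"
proof (induction k)
  case (Suc k)
  have "norm (pochhammer a (Suc k)) = norm (pochhammer a k) * norm (a + of_nat k)"
    by (simp add: pochhammer_Suc norm_mult)
  also have "\<dots> \<le> pochhammer (norm a) k * (norm a + real k)"
    using norm_triangle_ineq[of a "of_nat k"] Suc by (intro mult_mono) (auto intro: pochhammer_ge_0)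
  finally show ?case by (simp add: pochhammer_Suc)
qed simp

lemma pochhammer_mono_real:
  assumes "0 \<le> a" "a \<le> (b::real)"
  shows "pochhammer a k \<le> pochhammer b k"
proof (induction k)
  case (Suc k)
  show ?case unfolding pochhammer_Suc
    using assms Suc by (intro mult_mono pochhammer_ge_0) auto
qed simp

lemma norm_gbinomial_le_pochhammer:
  fixes s :: complex
  assumes "cmod s \<le> S"
  shows "cmod (s gchoose m) \<le> pochhammer S m / fact m"
proof -
  have "cmod (s gchoose m) = cmod (pochhammer (- s) m) / fact m"
    by (simp add: gbinomial_pochhammer norm_mult norm_divide norm_power)
  also have "\<dots> \<le> pochhammer S m / fact m"
    using norm_pochhammer_le_pochhammer[of "- s" m] pochhammer_mono_real[of "cmod (- s)" S m] assms
    by (intro divide_right_mono) auto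
  finally show ?thesis .
qed

lemma pochhammer_series_sums:
  assumes "0 \<le> R" "R < (1::real)"
  shows "(\<lambda>m. pochhammer S m / fact m * R ^ m) sums ((1 - R) powr (- S))"
proof -
  have "(\<lambda>n. (- S gchoose n) * (- R) ^ n) sums (1 + - R) powr (- S)"
    using assms by (intro gen_binomial_real) auto
  also have "(\<lambda>n. (- S gchoose n) * (- R) ^ n) = (\<lambda>m. pochhammer S m / fact m * R ^ m)"
  proof
    fix n
    have "(- S gchoose n) * (- R) ^ n = ((-1) ^ n * (- R) ^ n) * (pochhammer S n / fact n)"
      by (simp add: gbinomial_pochhammer)
    also have "(-1) ^ n * (- R) ^ n = R ^ n" by (simp add: power_mult_distrib[symmetric])
    finally show "(- S gchoose n) * (- R) ^ n = pochhammer S n / fact n * R ^ n" by simp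
  qed
  finally show ?thesis by simp
qed

lemma fact_add_ge: "real n ^ m * fact n \<le> fact (n + m)"
proof (induction m)
  case (Suc m)
  have "real n ^ Suc m * fact n = real n * (real n ^ m * fact n)" by simp
  also have "\<dots> \<le> real (Suc (n + m)) * fact (n + m)" using Suc by (intro mult_mono) auto
  also have "\<dots> = fact (n + Suc m)" by simp
  finally show ?case .
qed simp

text \<open>From index n on, the terms of the exponential series decrease at least geometrically
  with ratio R, because x <= R n.\<close>

lemma power_div_fact_add_le:
  assumes "0 \<le> x" "x \<le> R * real n" "n > 0"
  shows "x ^ (n + m) / fact (n + m) \<le> x ^ n / fact n * R ^ m"
proof -
  have "x ^ m \<le> (R * real n) ^ m" using assms by (intro power_mono) auto
  hence "x ^ n * x ^ m * fact n \<le> x ^ n * (R ^ m * real n ^ m) * fact n"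
    using assms by (intro mult_left_mono mult_right_mono) (auto simp: power_mult_distrib)
  also have "\<dots> = x ^ n * R ^ m * (real n ^ m * fact n)" by simp
  also have "\<dots> \<le> x ^ n * R ^ m * fact (n + m)"
  proof (intro mult_left_mono fact_add_ge mult_nonneg_nonneg zero_le_power)
    have "0 \<le> R * real n" using assms by linarith
    thus "R \<ge> 0" using assms by (simp add: zero_le_mult_iff)
  qed (use assms in auto)
  finally show ?thesis by (simp add: divide_simps power_add mult_ac)
qed

text \<open>The series begins at k = n. Its leading exponential term factors out and the remainder
  is dominated by the binomial series of (1 - R)^(-S).\<close>

lemma symbol_coeff_pos_bound:
  fixes s :: complex and x :: real
  assumes s: "cmod s \<le> S" and x: "0 \<le> x" "x \<le> R * real n" "n > 0" and R: "0 \<le> R" "R < 1"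
  shows "cmod (symbol_coeff s (int n) (- of_real x)) \<le> (1 - R) powr (- S) * (x ^ n / fact n)"
proof -
  let ?f = "\<lambda>k. int_gbinomial s (int k - int n) / fact k * (- of_real x) ^ k :: complex"
  let ?g = "\<lambda>m. x ^ n / fact n * (pochhammer S m / fact m * R ^ m)"
  have S0: "S \<ge> 0" using s norm_ge_zero[of s] by linarith
  have g: "?g sums (x ^ n / fact n * ((1 - R) powr (- S)))"
    by (intro sums_mult pochhammer_series_sums R)
  have le: "cmod (?f (m + n)) \<le> ?g m" for m
  proof -
    have "cmod (?f (m + n)) = cmod (s gchoose m) * (x ^ (n + m) / fact (n + m))"
      using x by (simp add: int_gbinomial_def norm_mult norm_divide norm_power add.commute)
    also have "\<dots> \<le> (pochhammer S m / fact m) * (x ^ n / fact n * R ^ m)"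
      using x S0 by (intro mult_mono norm_gbinomial_le_pochhammer s power_div_fact_add_le) (auto intro!: divide_nonneg_nonneg pochhammer_ge_0)
    finally show ?thesis by (simp add: mult_ac)
  qed
  have sm: "summable (\<lambda>m. cmod (?f (m + n)))"
    by (rule summable_comparison_test'[OF sums_summable[OF g]]) (use le in simp)
  have "symbol_coeff s (int n) (- of_real x) = (\<Sum>m. ?f (m + n)) + (\<Sum>k<n. ?f k)"
    unfolding symbol_coeff_def by (rule suminf_split_initial_segment[OF summable_symbol_coeff])
  also have "(\<Sum>k<n. ?f k) = 0" by (intro sum.neutral) (auto simp: int_gbinomial_def)
  finally have "cmod (symbol_coeff s (int n) (- of_real x)) = cmod (\<Sum>m. ?f (m + n))" by simp
  also have "\<dots> \<le> (\<Sum>m. cmod (?f (m + n)))" by (rule summable_norm[OF sm])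
  also have "\<dots> \<le> (\<Sum>m. ?g m)" by (rule suminf_le[OF le sm sums_summable[OF g]])
  also have "\<dots> = (1 - R) powr (- S) * (x ^ n / fact n)" using sums_unique[OF g] by (simp add: mult.commute)
  finally show ?thesis .
qed

text \<open>Kummer's transformation for nonpositive index. Termwise bounds on the defining series
  would lose the factor exp (-x) that has to cancel against exp x in the Wiener-Hopf bound; after
  multiplication by exp x termwise bounds suffice.\<close>

lemma symbol_coeff_neg_kummer:
  fixes s x :: complex
  shows "(\<lambda>j. (of_nat j - s gchoose (n + j)) / fact j * x ^ j) sums (exp x * symbol_coeff (- s) (- int n) x)"
proof -
  let ?a = "\<lambda>k. int_gbinomial (- s) (int k + int n) / fact k * x ^ k" and ?e = "\<lambda>k. x ^ k /\<^sub>R fact k"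
  have sa: "summable (\<lambda>k. norm (?a k))" using summable_norm_symbol_coeff[of "- s" "- int n" x] by simp
  have "(\<lambda>j. \<Sum>k\<le>j. ?a k * ?e (j - k)) sums ((\<Sum>k. ?a k) * (\<Sum>k. ?e k))"
    by (rule Cauchy_product_sums[OF sa summable_norm_exp])
  also have "(\<lambda>j. \<Sum>k\<le>j. ?a k * ?e (j - k)) = (\<lambda>j. (of_nat j - s gchoose (n + j)) / fact j * x ^ j)"
  proof
    fix j
    have "(\<Sum>k\<le>j. ?a k * ?e (j - k)) = (\<Sum>k\<le>j. x ^ j / fact j * ((- s gchoose (n + k)) * (of_nat j gchoose (j - k))))"
    proof (rule sum.cong[OF refl])
      fix k assume "k \<in> {..j}"
      hence k: "k \<le> j" by simp
      have b: "(of_nat j gchoose (j - k)) = (fact j / (fact k * fact (j - k)) :: complex)"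
        using binomial_fact[OF diff_le_self[of j k], where 'a = complex] k by (simp add: binomial_gbinomial)
      have "nat (int k + int n) = n + k" by simp
      hence "?a k * ?e (j - k) = (- s gchoose (n + k)) / fact k * x ^ k * (x ^ (j - k) / fact (j - k))"
        by (simp add: int_gbinomial_def scaleR_conv_of_real divide_inverse mult_ac)
      also have "\<dots> = (x ^ k * x ^ (j - k)) / fact j * ((- s gchoose (n + k)) * (fact j / (fact k * fact (j - k))))"
        by simp
      also have "x ^ k * x ^ (j - k) = x ^ j" using k by (simp add: power_add[symmetric])
      finally show "?a k * ?e (j - k) = x ^ j / fact j * ((- s gchoose (n + k)) * (of_nat j gchoose (j - k)))" unfolding b .
    qed
    also have "\<dots> = x ^ j / fact j * (\<Sum>k\<le>j. (- s gchoose (n + k)) * (of_nat j gchoose (j - k)))"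
      by (simp add: sum_distrib_left)
    also have "(\<Sum>k\<le>j. (- s gchoose (n + k)) * (of_nat j gchoose (j - k))) = (\<Sum>i\<in>{n..n + j}. (- s gchoose i) * (of_nat j gchoose (n + j - i)))"
      by (rule sum.reindex_bij_witness[where i = "\<lambda>i. i - n" and j = "\<lambda>k. n + k"]) auto
    \<comment> \<open>For i < n the lower index n + j - i exceeds j and the binomial vanishes, so
      the range may be completed for Vandermonde.\<close>
    also have "\<dots> = (\<Sum>i=0..n + j. (- s gchoose i) * (of_nat j gchoose (n + j - i)))"
    proof (rule sum.mono_neutral_left)
      show "\<forall>i\<in>{0..n + j} - {n..n + j}. (- s gchoose i) * (of_nat j gchoose (n + j - i)) = 0"
        by (auto simp: binomial_gbinomial[symmetric])
    qed auto
    also have "\<dots> = (- s + of_nat j gchoose (n + j))" by (rule gbinomial_Vandermonde)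
    finally show "(\<Sum>k\<le>j. ?a k * ?e (j - k)) = (of_nat j - s gchoose (n + j)) / fact j * x ^ j" by (simp add: algebra_simps)
  qed
  also have "(\<Sum>k. ?e k) = exp x" by (simp add: exp_def)
  also have "(\<Sum>k. ?a k) = symbol_coeff (- s) (- int n) x" by (simp add: symbol_coeff_def)
  finally show ?thesis by (simp add: mult.commute)
qed

text \<open>The rising factorial in the transformed series splits as (1 - s - n)_n (1 - s)_j, with
  first factor (s)_n up to sign. The last j factors of (n + j)! reduce x^j to R^j, which leaves the
  binomial series of (1 - R)^(-(1 + S)).\<close>

lemma symbol_coeff_neg_bound:
  fixes s :: complex and x :: real
  assumes s: "cmod s \<le> S" and x: "0 \<le> x" "x \<le> R * real n" "n > 0" and R: "0 \<le> R" "R < 1"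
  shows "cmod (symbol_coeff (- s) (- int n) (of_real x)) \<le> (1 - R) powr (- (1 + S)) * exp (- x) * (pochhammer S n / fact n)"
proof -
  let ?f = "\<lambda>j. (of_nat j - s gchoose (n + j)) / fact j * (of_real x) ^ j :: complex"
  let ?g = "\<lambda>j. pochhammer S n / fact n * (pochhammer (1 + S) j / fact j * R ^ j)"
  have S0: "S \<ge> 0" using s norm_ge_zero[of s] by linarith
  have f: "?f sums (exp (of_real x) * symbol_coeff (- s) (- int n) (of_real x))" by (rule symbol_coeff_neg_kummer)
  have g: "?g sums (pochhammer S n / fact n * (1 - R) powr (- (1 + S)))"
    by (intro sums_mult pochhammer_series_sums R)
  have le: "cmod (?f j) \<le> ?g j" for j
  proof -
    have e: "of_nat j - s - of_nat (n + j) + 1 = 1 - s - of_nat n" by (simp add: algebra_simps)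
    have "(of_nat j - s gchoose (n + j)) = pochhammer (1 - s - of_nat n) (n + j) / fact (n + j)"
      unfolding gbinomial_pochhammer' e ..
    also have "pochhammer (1 - s - of_nat n) (n + j) = pochhammer (1 - s - of_nat n) n * pochhammer (1 - s) j"
      by (subst pochhammer_product') simp
    also have "cmod (pochhammer (1 - s - of_nat n) n * pochhammer (1 - s) j / fact (n + j)) = cmod (pochhammer s n) * cmod (pochhammer (1 - s) j) / fact (n + j)"
    proof -
      have "pochhammer s n = (-1) ^ n * pochhammer (1 - s - of_nat n) n"
        using pochhammer_minus[of "- s" n] by (simp add: algebra_simps)
      hence "cmod (pochhammer s n) = cmod (pochhammer (1 - s - of_nat n) n)" by (simp only: norm_mult norm_power norm_minus_cancel norm_one power_one mult_1)
      thus ?thesis by (simp only: norm_mult norm_divide norm_fact)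
    qed
    also have "\<dots> \<le> pochhammer S n * pochhammer (1 + S) j / fact (n + j)"
    proof (intro divide_right_mono mult_mono)
      show "cmod (pochhammer s n) \<le> pochhammer S n"
        using norm_pochhammer_le_pochhammer[of s n] pochhammer_mono_real[of "cmod s" S n] s by simp
      have "cmod (1 - s) \<le> 1 + S" using norm_triangle_ineq4[of 1 s] s by simp
      thus "cmod (pochhammer (1 - s) j) \<le> pochhammer (1 + S) j"
        using norm_pochhammer_le_pochhammer[of "1 - s" j] pochhammer_mono_real[of "cmod (1 - s)" "1 + S" j] by simp
    qed (use S0 in \<open>auto intro: pochhammer_ge_0\<close>)
    finally have c: "cmod (of_nat j - s gchoose (n + j)) \<le> pochhammer S n * pochhammer (1 + S) j / fact (n + j)" .
    have "x ^ j / fact (n + j) \<le> R ^ j / fact n"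
    proof -
      have "x ^ j * fact n \<le> (R * real n) ^ j * fact n" using x by (intro mult_right_mono power_mono) auto
      also have "\<dots> = R ^ j * (real n ^ j * fact n)" by (simp add: power_mult_distrib)
      also have "\<dots> \<le> R ^ j * fact (n + j)" using R by (intro mult_left_mono fact_add_ge) auto
      finally show ?thesis by (simp add: divide_simps mult.commute)
    qed
    hence "pochhammer S n * pochhammer (1 + S) j / fact j * (x ^ j / fact (n + j)) \<le> pochhammer S n * pochhammer (1 + S) j / fact j * (R ^ j / fact n)"
      using S0 by (intro mult_left_mono) (auto intro!: divide_nonneg_nonneg mult_nonneg_nonneg pochhammer_ge_0)
    moreover have "cmod (?f j) \<le> (pochhammer S n * pochhammer (1 + S) j / fact (n + j)) * (x ^ j / fact j)"
    proof -
      have "cmod (?f j) = cmod (of_nat j - s gchoose (n + j)) * (x ^ j / fact j)"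
        using x by (simp add: norm_mult norm_divide norm_power)
      thus ?thesis using x by (simp only:) (intro mult_right_mono c, simp)
    qed
    ultimately show ?thesis by (simp add: mult_ac)
  qed
  have sm: "summable (\<lambda>j. cmod (?f j))"
    by (rule summable_comparison_test'[OF sums_summable[OF g]]) (use le in simp)
  have "cmod (exp (of_real x) * symbol_coeff (- s) (- int n) (of_real x)) = cmod (\<Sum>j. ?f j)"
    using sums_unique[OF f] by simp
  also have "\<dots> \<le> (\<Sum>j. cmod (?f j))" by (rule summable_norm[OF sm])
  also have "\<dots> \<le> (\<Sum>j. ?g j)" by (rule suminf_le[OF le sm sums_summable[OF g]])
  also have "\<dots> = (1 - R) powr (- (1 + S)) * (pochhammer S n / fact n)" using sums_unique[OF g] by (simp add: mult.commute)
  finally have "exp x * cmod (symbol_coeff (- s) (- int n) (of_real x)) \<le> (1 - R) powr (- (1 + S)) * (pochhammer S n / fact n)"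
    by (simp add: norm_mult exp_of_real)
  hence "exp (- x) * (exp x * cmod (symbol_coeff (- s) (- int n) (of_real x))) \<le> exp (- x) * ((1 - R) powr (- (1 + S)) * (pochhammer S n / fact n))"
    by (intro mult_left_mono) auto
  thus ?thesis by (simp add: exp_minus field_simps)
qed

text \<open>The ratio of consecutive terms on the left is at most 1 + S / (n + 1), which Bernoulli's
  inequality bounds by ((n + 2) / (n + 1))^S.\<close>

lemma pochhammer_nat_div_fact_le: "pochhammer (real S) n / fact n \<le> real (n + 1) ^ S"
proof (induction n)
  case (Suc n)
  have "(real S + real n) / real (n + 1) \<le> (real (n + 2) / real (n + 1)) ^ S"
  proof -
    have "1 + real S * (1 / real (n + 1)) \<le> (1 + 1 / real (n + 1)) ^ S"
      by (rule Bernoulli_inequality) (auto intro: order_trans[of _ 0])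
    moreover have "1 + 1 / real (n + 1) = real (n + 2) / real (n + 1)" by (simp add: field_simps)
    moreover have "(real S + real n) / real (n + 1) \<le> 1 + real S * (1 / real (n + 1))" by (simp add: field_simps)
    ultimately show ?thesis by simp
  qed
  hence "pochhammer (real S) n / fact n * ((real S + real n) / real (n + 1)) \<le> real (n + 1) ^ S * (real (n + 2) / real (n + 1)) ^ S"
    using Suc by (intro mult_mono) auto
  also have "\<dots> = real (n + 2) ^ S" by (simp add: power_divide)
  finally show ?case by (simp add: pochhammer_Suc mult_ac)
qed simp

text \<open>A Chernoff bound for a Poisson weight: x is compared with R M, and M^M / M! <= exp
  M.\<close>

lemma poisson_term_le:
  assumes R: "0 < R" "R < 1" and x: "0 \<le> x" "x \<le> R * real M"
  shows "x ^ M / fact M \<le> exp x * (R * exp (1 - R)) ^ M"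
proof (cases "M = 0 \<or> x = 0")
  case True
  thus ?thesis using x R by (cases "M = 0") (auto simp: power_0_left)
next
  case False
  hence M: "M > 0" and x0: "x > 0" using x by auto
  have fm: "real M ^ M / fact M \<le> exp (real M)"
  proof -
    have "(\<Sum>n\<in>{M}. real M ^ n /\<^sub>R fact n) \<le> (\<Sum>n. real M ^ n /\<^sub>R fact n)"
      by (rule sum_le_suminf[OF summable_exp_generic]) auto
    thus ?thesis by (simp add: exp_def divide_inverse mult.commute)
  qed
  have "x / (R * real M) \<le> 1" using M R x by simp
  let ?t = "x / (R * real M)"
  \<comment> \<open>As t - 1 is not positive, the prefactor M may be lowered to R M; the bound for
    the logarithm of t^M is then exactly x - R M.\<close>
  have "ln ?t \<le> ?t - 1" using x0 R M by (intro ln_le_minus_one) simp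
  hence "real M * ln ?t \<le> R * real M * (?t - 1)"
  proof -
    assume a: "ln ?t \<le> ?t - 1"
    have "real M * ln ?t \<le> real M * (?t - 1)" using a by (intro mult_left_mono) auto
    also have "\<dots> \<le> R * real M * (?t - 1)"
    proof -
      have "?t - 1 \<le> 0" using \<open>?t \<le> 1\<close> by simp
      moreover have "R * real M \<le> real M" using R by (simp add: mult_left_le_one_le)
      ultimately show ?thesis by (rule mult_right_mono_neg[rotated])
    qed
    finally show ?thesis .
  qed
  also have "R * real M * (?t - 1) = x - R * real M" using R M by (simp add: field_simps)
  finally have "exp (real M * ln ?t) \<le> exp (x - R * real M)" by simp
  moreover have "exp (real M * ln ?t) = ?t ^ M" using x0 R M by (simp add: exp_of_nat_mult)
  ultimately have t: "?t ^ M \<le> exp (x - R * real M)" by simp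
  have "x ^ M / fact M = ?t ^ M * (R ^ M * (real M ^ M / fact M))"
    using R M by (simp add: power_divide power_mult_distrib)
  also have "\<dots> \<le> exp (x - R * real M) * (R ^ M * exp (real M))"
    using t fm R by (intro mult_mono) auto
  also have "\<dots> = exp x * (R ^ M * (exp (real M) * exp (- R * real M)))"
    by (simp add: exp_diff exp_minus field_simps)
  also have "exp (real M) * exp (- R * real M) = exp (1 - R) ^ M"
    by (simp add: exp_add[symmetric] exp_of_nat_mult[symmetric] algebra_simps)
  finally show ?thesis by (simp add: power_mult_distrib)
qed

lemma poisson_ratio_lt_1:
  assumes "0 < R" "R < (1::real)"
  shows "R * exp (1 - R) < 1"
proof -
  have "ln R < R - 1" using assms ln_le_minus_one[of R] ln_eq_minus_one[of R] by fastforce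
  hence "exp (ln R + (1 - R)) < exp 0" by (subst exp_less_cancel_iff) simp
  thus ?thesis using assms by (simp add: exp_add)
qed

text \<open>The cofactors of the border satisfy the orthogonality relations of \<open>wiener_hopf_system\<close>; the last
  two of them are \<open>D\<^sub>N\<close> and, up to sign, its derivative in \<open>x\<close>.\<close>

definition bordered :: "complex \<Rightarrow> nat \<Rightarrow> complex \<Rightarrow> (nat \<Rightarrow> complex) \<Rightarrow> complex mat" where
  "bordered s N x c = mat (Suc N) (Suc N) (\<lambda>(i, l). if l < N then symbol_coeff s (int l - int i) x else c i)"

definition border_cofactor :: "complex \<Rightarrow> nat \<Rightarrow> complex \<Rightarrow> nat \<Rightarrow> complex" where
  "border_cofactor s N x i = cofactor (bordered s N x (\<lambda>_. 0)) i N"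

section \<open>Bordered determinants and the derivative in x\<close>

lemma bordered_carrier [simp]: "bordered s N x c \<in> carrier_mat (Suc N) (Suc N)"
  by (simp add: bordered_def)

lemma det_bordered: "Determinant.det (bordered s N x c) = (\<Sum>i\<le>N. c i * border_cofactor s N x i)"
proof -
  have "Determinant.det (bordered s N x c) = (\<Sum>i<Suc N. bordered s N x c $$ (i, N) * cofactor (bordered s N x c) i N)"
    by (rule laplace_expansion_column[OF bordered_carrier]) simp
  also have "\<dots> = (\<Sum>i\<le>N. c i * border_cofactor s N x i)"
    unfolding lessThan_Suc_atMost
  proof (rule sum.cong[OF refl])
    fix i assume "i \<in> {..N}"
    hence i: "i \<le> N" by simp
    have "mat_delete (bordered s N x c) i N = mat_delete (bordered s N x (\<lambda>_. 0)) i N"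
      by (rule eq_matI) (auto simp: mat_delete_def bordered_def)
    thus "bordered s N x c $$ (i, N) * cofactor (bordered s N x c) i N = c i * border_cofactor s N x i"
      using i by (simp add: border_cofactor_def cofactor_def) (simp add: bordered_def)
  qed
  finally show ?thesis .
qed

text \<open>A border equal to column l produces two equal columns, and expansion along the border
  gives the relation.\<close>

lemma border_cofactor_orth:
  assumes "l < N"
  shows "(\<Sum>i\<le>N. border_cofactor s N x i * symbol_coeff s (int l - int i) x) = 0"
proof -
  let ?B = "bordered s N x (\<lambda>i. symbol_coeff s (int l - int i) x)"
  have "Determinant.det ?B = 0"
  proof (rule det_identical_columns[OF bordered_carrier])
    show "Matrix.col ?B l = Matrix.col ?B N"
      using assms by (intro eq_vecI) (auto simp: bordered_def)
  qed (use assms in auto)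
  thus ?thesis unfolding det_bordered by (simp add: mult.commute)
qed

lemma border_cofactor_last: "border_cofactor s N x N = Determinant.det (toeplitz s 0 N x)"
proof -
  have "mat_delete (bordered s N x (\<lambda>_. 0)) N N = toeplitz s 0 N x"
    by (rule eq_matI) (auto simp: mat_delete_def bordered_def toeplitz_def)
  thus ?thesis by (simp add: border_cofactor_def cofactor_def)
qed

text \<open>Differentiating row k lowers its indices by one and so produces row k + 1. Every row
  except the last then coincides with its successor and contributes nothing; the last row
  contributes the minor of the bordered matrix without row N - 1, whose cofactor sign is -1.\<close>

lemma det_toeplitz_deriv:
  assumes N: "N \<ge> 1"
  shows "((\<lambda>x. Determinant.det (toeplitz s 0 N x)) has_field_derivative - border_cofactor s N x (N - 1)) (at x)"
proof -
  let ?f = "\<lambda>i l. symbol_coeff s (int l - int i)"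
  let ?P = "{p. p permutes {0..<N}}"
  define M where "M k = mat N N (\<lambda>(i, l). if i = k then ?f (Suc k) l x else ?f i l x)" for k
  have pN: "p i < N" if "p permutes {0..<N}" "i < N" for p i
    using permutes_in_image[OF that(1), of i] that(2) by simp
  have det: "Determinant.det (toeplitz s 0 N x) = (\<Sum>p\<in>?P. signof p * (\<Prod>i\<in>{0..<N}. ?f i (p i) x))" for x
    by (subst det_def'[of _ N]) (auto intro!: sum.cong prod.cong simp: toeplitz_def pN)
  have "((\<lambda>x. \<Sum>p\<in>?P. signof p * (\<Prod>i\<in>{0..<N}. ?f i (p i) x)) has_field_derivative
     (\<Sum>p\<in>?P. signof p * (\<Sum>k\<in>{0..<N}. ?f (Suc k) (p k) x * (\<Prod>i\<in>{0..<N} - {k}. ?f i (p i) x)))) (at x)"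
  proof (intro DERIV_sum DERIV_cmult has_field_derivative_prod)
    fix p k
    have e: "int (p k) - int (Suc k) = int (p k) - int k - 1" by simp
    show "(?f k (p k) has_field_derivative ?f (Suc k) (p k) x) (at x)" unfolding e by (rule symbol_coeff_deriv)
  qed
  also have "(\<Sum>p\<in>?P. signof p * (\<Sum>k\<in>{0..<N}. ?f (Suc k) (p k) x * (\<Prod>i\<in>{0..<N} - {k}. ?f i (p i) x)))
     = (\<Sum>k\<in>{0..<N}. \<Sum>p\<in>?P. signof p * (?f (Suc k) (p k) x * (\<Prod>i\<in>{0..<N} - {k}. ?f i (p i) x)))"
    unfolding sum_distrib_left by (rule sum.swap)
  also have "\<dots> = (\<Sum>k\<in>{0..<N}. Determinant.det (M k))"
  proof (rule sum.cong[OF refl])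
    fix k assume k: "k \<in> {0..<N}"
    have "Determinant.det (M k) = (\<Sum>p\<in>?P. signof p * (\<Prod>i\<in>{0..<N}. if i = k then ?f (Suc k) (p i) x else ?f i (p i) x))"
      by (subst det_def'[of _ N]) (auto intro!: sum.cong prod.cong simp: M_def pN)
    also have "\<dots> = (\<Sum>p\<in>?P. signof p * (?f (Suc k) (p k) x * (\<Prod>i\<in>{0..<N} - {k}. ?f i (p i) x)))"
      using k by (intro sum.cong refl arg_cong2[where f = "(*)"]) (subst prod.remove[of _ k], auto intro!: prod.cong)
    finally show "(\<Sum>p\<in>?P. signof p * (?f (Suc k) (p k) x * (\<Prod>i\<in>{0..<N} - {k}. ?f i (p i) x))) = Determinant.det (M k)" ..
  qed
  also have "\<dots> = (\<Sum>k\<in>{0..<N}. if k = N - 1 then Determinant.det (M (N - 1)) else 0)"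
  proof (rule sum.cong[OF refl])
    fix k assume k: "k \<in> {0..<N}"
    show "Determinant.det (M k) = (if k = N - 1 then Determinant.det (M (N - 1)) else 0)"
    proof (cases "k = N - 1")
      case False
      hence k1: "Suc k < N" using k by auto
      have "Determinant.det (M k) = 0"
      proof (rule det_identical_rows[of _ N k "Suc k"])
        show "Matrix.row (M k) k = Matrix.row (M k) (Suc k)" using k1 by (intro eq_vecI) (auto simp: M_def)
      qed (use k1 in \<open>auto simp: M_def\<close>)
      thus ?thesis using False by simp
    qed simp
  qed
  also have "\<dots> = Determinant.det (M (N - 1))" using N by simp
  also have "M (N - 1) = mat_delete (bordered s N x (\<lambda>_. 0)) (N - 1) N"
    using N by (intro eq_matI) (auto simp: mat_delete_def bordered_def M_def)
  also have "Determinant.det \<dots> = - border_cofactor s N x (N - 1)"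
  proof -
    have "odd (N - 1 + N)" using N by (cases N) auto
    thus ?thesis by (simp add: border_cofactor_def cofactor_def)
  qed
  finally show ?thesis unfolding det .
qed

section \<open>Closing the differential inequality\<close>

lemma summable_poly_geometric:
  assumes q: "0 \<le> q" "q < (1::real)"
  shows "summable (\<lambda>k. real (k + 1) ^ S * q ^ k)"
proof (cases "q = 0")
  case True
  thus ?thesis by (intro summable_finite[of "{0}"]) (auto simp: power_0_left)
next
  case False
  hence q0: "q > 0" using q by simp
  have "((\<lambda>k. (1 + 1 / real (k + 1)) ^ S * q) \<longlongrightarrow> (1 + 0) ^ S * q) sequentially"
    by (intro tendsto_intros) (use lim_1_over_n LIMSEQ_ignore_initial_segment[OF lim_1_over_n, of 1] in auto)
  hence "eventually (\<lambda>k. (1 + 1 / real (k + 1)) ^ S * q < (1 + q) / 2) sequentially"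
    by (rule order_tendstoD) (use q in auto)
  then obtain N where N: "\<And>k. k \<ge> N \<Longrightarrow> (1 + 1 / real (k + 1)) ^ S * q < (1 + q) / 2"
    unfolding eventually_sequentially by blast
  show ?thesis
  proof (rule summable_ratio_test[of "(1 + q) / 2" N])
    fix k assume k: "k \<ge> N"
    have e: "real (Suc k + 1) = (1 + 1 / real (k + 1)) * real (k + 1)" by (simp add: field_simps)
    have "real (Suc k + 1) ^ S * q ^ Suc k = ((1 + 1 / real (k + 1)) ^ S * q) * (real (k + 1) ^ S * q ^ k)"
      unfolding e power_mult_distrib by simp
    also have "\<dots> \<le> (1 + q) / 2 * (real (k + 1) ^ S * q ^ k)"
      using N[OF k] q by (intro mult_right_mono) auto
    finally show "norm (real (Suc k + 1) ^ S * q ^ Suc k) \<le> (1 + q) / 2 * norm (real (k + 1) ^ S * q ^ k)"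
      using q by simp
  qed (use q in auto)
qed

lemma has_sum_atLeast_shift:
  fixes f :: "nat \<Rightarrow> real"
  assumes "summable f" "\<And>n. f n \<ge> 0"
  shows "(f has_sum (\<Sum>i. f (i + N))) {N..}"
proof -
  have sm: "summable (\<lambda>i. f (i + N))" using assms(1) by (simp add: summable_iff_shift)
  have "((\<lambda>i. f (i + N)) has_sum (\<Sum>i. f (i + N))) UNIV"
    using sm assms(2) by (intro norm_summable_imp_has_sum summable_sums) auto
  thus ?thesis
    by (subst (asm) has_sum_reindex_bij_betw[where g = "\<lambda>i. i + N" and B = "{N..}"])
       (auto intro!: bij_betwI[where g = "\<lambda>i. i - N"])
qed

text \<open>The function g = D exp (-s z) satisfies |g'| <= e |g|. Its maximum on the segment is at
  most 1 plus e X times itself, hence at most 2, and a mean value estimate finishes.\<close>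

lemma gronwall_exp_close:
  fixes D D' :: "complex \<Rightarrow> complex" and X :: real
  assumes X: "X \<ge> 0" and D: "\<And>z. (D has_field_derivative D' z) (at z)" and D0: "D 0 = 1"
    and bound: "\<And>t. 0 \<le> t \<Longrightarrow> t \<le> X \<Longrightarrow> cmod (D' (of_real t) - s * D (of_real t)) \<le> e * cmod (D (of_real t))"
    and e: "e \<ge> 0" "e * X \<le> 1 / 2"
  shows "cmod (D (of_real X) * exp (- (s * of_real X)) - 1) \<le> 2 * e * X"
proof -
  define g where "g z = D z * exp (- (s * z))" for z
  define g' where "g' z = (D' z - s * D z) * exp (- (s * z))" for z
  let ?K = "closed_segment 0 (complex_of_real X)"
  have dg: "(g has_field_derivative g' z) (at z)" for z
    unfolding g_def g'_def by (rule derivative_eq_intros D refl | simp add: algebra_simps)+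
  have seg: "\<exists>t. z = of_real t \<and> 0 \<le> t \<and> t \<le> X" if "z \<in> ?K" for z
  proof -
    from that obtain u where "0 \<le> u" "u \<le> 1" "z = (1 - u) *\<^sub>R 0 + u *\<^sub>R complex_of_real X" unfolding in_segment by auto
    hence "z = of_real (u * X)" "0 \<le> u * X" "u * X \<le> X" using X by (auto simp: scaleR_conv_of_real mult_left_le_one_le)
    thus ?thesis by blast
  qed
  have g': "cmod (g' z) \<le> e * cmod (g z)" if z: "z \<in> ?K" for z
  proof -
    obtain t where t: "z = of_real t" "0 \<le> t" "t \<le> X" using seg[OF z] by blast
    have "cmod (D' z - s * D z) * cmod (exp (- (s * z))) \<le> e * cmod (D z) * cmod (exp (- (s * z)))"
      unfolding t(1) by (intro mult_right_mono bound t) auto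
    thus ?thesis by (simp add: g_def g'_def norm_mult)
  qed
  have "continuous_on ?K (\<lambda>z. cmod (g z))"
    by (intro continuous_on_norm continuous_at_imp_continuous_on ballI DERIV_isCont[OF dg])
  then obtain z0 where z0: "z0 \<in> ?K" "\<And>z. z \<in> ?K \<Longrightarrow> cmod (g z) \<le> cmod (g z0)"
    using continuous_attains_sup[of ?K "\<lambda>z. cmod (g z)"] by auto
  let ?M = "cmod (g z0)"
  have close: "cmod (g z - g 0) \<le> e * ?M * X" if z: "z \<in> ?K" for z
  proof -
    have "cmod (g z - g 0) \<le> e * ?M * cmod (z - 0)"
    proof (rule field_differentiable_bound[where S = ?K])
      show "(g has_field_derivative g' w) (at w within ?K)" if "w \<in> ?K" for w by (rule has_field_derivative_at_within[OF dg])
      show "cmod (g' w) \<le> e * ?M" if "w \<in> ?K" for w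
        using g'[OF that] z0(2)[OF that] e(1) by (meson mult_left_mono order_trans)
    qed (use z in auto)
    also have "cmod (z - 0) \<le> X" using seg[OF z] by auto
    finally show ?thesis using e by (simp add: mult_left_mono)
  qed
  have g0: "g 0 = 1" by (simp add: g_def D0)
  have "?M \<le> cmod (g z0 - g 0) + 1" using norm_triangle_ineq2[of "g z0" "g 0"] g0 by simp
  also have "cmod (g z0 - g 0) \<le> (e * X) * ?M" using close[OF z0(1)] by (simp add: mult_ac)
  also have "(e * X) * ?M \<le> 1 / 2 * ?M" by (intro mult_right_mono e) auto
  finally have M: "?M \<le> 2" by simp
  have "cmod (g (of_real X) - 1) \<le> e * ?M * X" using close[of "of_real X"] g0 by simp
  also have "\<dots> \<le> e * 2 * X" using M e X by (intro mult_right_mono mult_left_mono) auto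
  finally show ?thesis by (simp add: g_def mult_ac)
qed

text \<open>The relative defect in D' = s D is of order N^S q^N on an interval of length at most N,
  so the accumulated error tends to 0. All constants depend on S and R only, which gives uniformity
  in s and x.\<close>

theorem det_toeplitz_asymptotics:
  assumes R: "0 < R" "R < 1" and \<epsilon>: "\<epsilon> > 0"
  shows "eventually (\<lambda>N. \<forall>s x. cmod s \<le> real S \<longrightarrow> 0 \<le> x \<longrightarrow> x \<le> R * real N \<longrightarrow>
     cmod (Determinant.det (toeplitz s 0 N (of_real x)) * exp (- (s * of_real x)) - 1) \<le> \<epsilon>) sequentially"
proof -
  define q where "q = R * exp (1 - R)"
  have q: "0 < q" "q < 1" using R poisson_ratio_lt_1[OF R] by (auto simp: q_def)
  define c1 where "c1 = (1 - R) powr (- real S)"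
  define c2 where "c2 = (1 - R) powr (- (1 + real S))"
  have c: "c1 > 0" "c2 > 0" using R by (auto simp: c1_def c2_def)
  let ?f = "\<lambda>k. real (k + 1) ^ S * q ^ k"
  have sf: "summable ?f" using q by (intro summable_poly_geometric) auto
  define Q where "Q = (\<Sum>i. ?f (i + 1))"
  have Q: "(?f has_sum Q) {1..}" unfolding Q_def by (rule has_sum_atLeast_shift[OF sf]) (use q in auto)
  have Q0: "Q \<ge> 0" by (rule has_sum_nonneg[OF Q]) (use q in auto)
  define e where "e N = 2 * c1 * c2 * Q * real (N + 1) ^ S * q ^ (N - 1)" for N :: nat
  have "eventually (\<lambda>N. c1 * c2 * Q * (\<Sum>i. ?f (i + N)) \<le> 1 / 2) sequentially"
  proof -
    obtain N0 where "\<And>N. N \<ge> N0 \<Longrightarrow> norm (\<Sum>i. ?f (i + N)) < 1 / (2 * (c1 * c2 * Q + 1))"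
      using suminf_exist_split[of "1 / (2 * (c1 * c2 * Q + 1))", OF _ sf] c Q0 by (auto simp: add_nonneg_pos)
    hence "c1 * c2 * Q * (\<Sum>i. ?f (i + N)) \<le> 1 / 2" if "N \<ge> N0" for N
    proof -
      have "(\<Sum>i. ?f (i + N)) \<le> 1 / (2 * (c1 * c2 * Q + 1))" 
        using \<open>\<And>N. N \<ge> N0 \<Longrightarrow> norm (\<Sum>i. ?f (i + N)) < 1 / (2 * (c1 * c2 * Q + 1))\<close>[OF that] by (auto simp: abs_less_iff)
      hence "c1 * c2 * Q * (\<Sum>i. ?f (i + N)) \<le> c1 * c2 * Q * (1 / (2 * (c1 * c2 * Q + 1)))"
        using c Q0 by (intro mult_left_mono) auto
      also have "\<dots> \<le> 1 / 2"
      proof -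
        have "0 \<le> c1 * c2 * Q" using c Q0 by simp
        thus ?thesis by (simp add: divide_simps)
      qed
      finally show ?thesis .
    qed
    thus ?thesis unfolding eventually_sequentially by blast
  qed
  moreover have "(\<lambda>N. e N * real N) \<longlonglongrightarrow> 0"
  proof -
    have "(\<lambda>k. real (k + 1) ^ Suc S * q ^ k) \<longlonglongrightarrow> 0"
      using q by (intro summable_LIMSEQ_zero summable_poly_geometric) auto
    hence lim: "(\<lambda>k. 2 * c1 * c2 * Q / q * (real (k + 1) ^ Suc S * q ^ k)) \<longlonglongrightarrow> 0"
      by (rule tendsto_mult_right_zero)
    show ?thesis
    proof (rule tendsto_sandwich[OF _ _ tendsto_const lim])
      show "eventually (\<lambda>N. 0 \<le> e N * real N) sequentially" using c Q0 q by (auto simp: e_def)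
      show "eventually (\<lambda>N. e N * real N \<le> 2 * c1 * c2 * Q / q * (real (N + 1) ^ Suc S * q ^ N)) sequentially"
        using eventually_ge_at_top[of 1]
      proof eventually_elim
        case (elim N)
        have "q ^ (N - 1) = q ^ N / q" using elim q by (cases N) auto
        hence "e N * real N = 2 * c1 * c2 * Q / q * (real (N + 1) ^ S * real N * q ^ N)"
          by (simp add: e_def)
        also have "\<dots> \<le> 2 * c1 * c2 * Q / q * (real (N + 1) ^ S * real (N + 1) * q ^ N)"
          using c Q0 q by (intro mult_left_mono mult_right_mono) auto
        finally show ?case by (simp add: mult_ac)
      qed
    qed
  qed
  hence "eventually (\<lambda>N. e N * real N < min (1 / 2) (\<epsilon> / 2)) sequentially"
    by (rule order_tendstoD) (use \<epsilon> in auto)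
  ultimately show ?thesis using eventually_ge_at_top[of "1::nat"]
  proof eventually_elim
    case (elim N)
    show ?case
    proof (intro allI impI)
      fix s :: complex and X :: real
      assume s: "cmod s \<le> real S" and X: "0 \<le> X" "X \<le> R * real N"
      have XN: "X \<le> real N" using X R by (meson mult_left_le_one_le of_nat_0_le_iff order_trans less_imp_le)
      have e0: "e N \<ge> 0" using c Q0 q by (simp add: e_def)
      have eX: "e N * X \<le> e N * real N" using XN e0 by (rule mult_left_mono)
      have "cmod (Determinant.det (toeplitz s 0 N (of_real X)) * exp (- (s * of_real X)) - 1) \<le> 2 * e N * X"
      proof (rule gronwall_exp_close[where D' = "\<lambda>z. - border_cofactor s N z (N - 1)"])
        fix t :: real assume t: "0 \<le> t" "t \<le> X"
        have tM: "t \<le> R * real M" if "M \<ge> N" for M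
        proof -
          have "R * real N \<le> R * real M" using R that by (intro mult_left_mono) auto
          thus ?thesis using t X by linarith
        qed
        let ?\<alpha> = "border_cofactor s N (of_real t)"
        have "cmod (?\<alpha> (N - 1) + s * ?\<alpha> N) \<le> 2 * c1 * c2 * Q * real (N + 1) ^ S * q ^ (N - 1) * cmod (?\<alpha> N)"
        proof (rule wiener_hopf_bound[OF elim(3) border_cofactor_orth _ _ _ _ _ Q])
          fix M assume M: "M \<ge> N"
          hence M0: "M > 0" using elim(3) by simp
          have "cmod (symbol_coeff s (int M) (- of_real t)) \<le> c1 * (t ^ M / fact M)"
            unfolding c1_def using R t M0 by (intro symbol_coeff_pos_bound s tM[OF M]) auto
          also have "\<dots> \<le> c1 * (exp t * q ^ M)"
            unfolding q_def using R t c by (intro mult_left_mono poisson_term_le tM[OF M]) auto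
          finally show "cmod (symbol_coeff s (int M) (- of_real t)) \<le> c1 * exp t * q ^ M" by simp
          have "cmod (symbol_coeff (- s) (- int M) (of_real t)) \<le> c2 * exp (- t) * (pochhammer (real S) M / fact M)"
            unfolding c2_def using R t M0 by (intro symbol_coeff_neg_bound s tM[OF M]) auto
          also have "\<dots> \<le> c2 * exp (- t) * real (M + 1) ^ S"
            using c by (intro mult_left_mono pochhammer_nat_div_fact_le) auto
          finally show "cmod (symbol_coeff (- s) (- int M) (of_real t)) \<le> c2 * exp (- t) * real (M + 1) ^ S" .
        next
          show "(?f has_sum (\<Sum>i. ?f (i + N))) {N..}" by (rule has_sum_atLeast_shift[OF sf]) (use q in auto)
          show "c1 * c2 * Q * (\<Sum>i. ?f (i + N)) \<le> 1 / 2" by (rule elim(1))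
        qed (use c q in auto)
        \<comment> \<open>The determinant is the last cofactor and its derivative is minus the one
          before, so the defect D' - s D is minus the combination bounded by the Wiener-Hopf
          argument.\<close>
        moreover have "cmod (- ?\<alpha> (N - 1) - s * ?\<alpha> N) = cmod (?\<alpha> (N - 1) + s * ?\<alpha> N)"
          using norm_minus_cancel[of "?\<alpha> (N - 1) + s * ?\<alpha> N"] by simp
        ultimately show "cmod (- ?\<alpha> (N - 1) - s * Determinant.det (toeplitz s 0 N (of_real t))) \<le> e N * cmod (Determinant.det (toeplitz s 0 N (of_real t)))"
          by (simp add: e_def border_cofactor_last)
      next
        show "((\<lambda>z. Determinant.det (toeplitz s 0 N z)) has_field_derivative - border_cofactor s N z (N - 1)) (at z)" for z
          by (rule det_toeplitz_deriv[OF elim(3)])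
        show "e N * X \<le> 1 / 2" using eX elim(2) by simp
      qed (use X e0 det_toeplitz_at_0 in auto)
      also have "\<dots> \<le> \<epsilon>" using eX elim(2) by simp
      finally show "cmod (Determinant.det (toeplitz s 0 N (of_real X)) * exp (- (s * of_real X)) - 1) \<le> \<epsilon>" .
    qed
  qed
qed

section \<open>Asymptotics towards the Barnes function\<close>

definition ln_rem :: "complex \<Rightarrow> complex" where
  "ln_rem z = Ln (1 + z) - z + z\<^sup>2 / 2"

text \<open>The derivative is w^2 / (1 + w), which is at most 2 |z|^2 in modulus on the segment from
  0 to z.\<close>

lemma norm_ln_rem_le:
  assumes "cmod z \<le> 1 / 2"
  shows "cmod (ln_rem z) \<le> 2 * cmod z ^ 3"
proof -
  let ?K = "closed_segment 0 z"
  have K: "cmod w \<le> cmod z" if "w \<in> ?K" for w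
    using that segment_bound1[of w 0 z] by simp
  have "cmod (ln_rem z - ln_rem 0) \<le> (2 * cmod z ^ 2) * cmod (z - 0)"
  proof (rule field_differentiable_bound[where S = ?K and f' = "\<lambda>w. w\<^sup>2 / (1 + w)"])
    fix w assume w: "w \<in> ?K"
    have w1: "cmod w \<le> 1 / 2" using K[OF w] assms by linarith
    have re: "Re (1 + w) > 0" using abs_Re_le_cmod[of w] w1 by simp
    have n0: "1 + w \<noteq> 0" using re by (metis less_irrefl zero_complex.simps(1))
    have nn: "1 + w \<notin> \<real>\<^sub>\<le>\<^sub>0" using re by (auto simp: complex_nonpos_Reals_iff)
    have "(ln_rem has_field_derivative (1 / (1 + w) - 1 + w)) (at w)"
      unfolding ln_rem_def[abs_def]
      by (rule derivative_eq_intros refl nn | simp add: field_simps)+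
    also have "1 / (1 + w) - 1 + w = w\<^sup>2 / (1 + w)" using n0 by (simp add: field_simps power2_eq_square)
    finally show "(ln_rem has_field_derivative w\<^sup>2 / (1 + w)) (at w within ?K)" by (rule has_field_derivative_at_within)
    have "cmod (1 + w) \<ge> 1 / 2" using norm_triangle_ineq2[of 1 "- w"] w1 by simp
    hence "cmod w ^ 2 / cmod (1 + w) \<le> cmod z ^ 2 / (1 / 2)"
      using K[OF w] by (intro frac_le power_mono) auto
    thus "cmod (w\<^sup>2 / (1 + w)) \<le> 2 * cmod z ^ 2" by (simp add: norm_divide norm_power)
  qed auto
  thus ?thesis by (simp add: ln_rem_def power3_eq_cube power2_eq_square)
qed

lemma norm_exp_minus_1_le:
  assumes "cmod z \<le> 1"
  shows "cmod (exp z - 1) \<le> 3 * cmod z"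
proof -
  have "cmod (exp z - exp 0) \<le> 3 * cmod (z - 0)"
  proof (rule field_differentiable_bound[where S = "closed_segment 0 z" and f' = exp])
    fix w assume w: "w \<in> closed_segment 0 z"
    show "(exp has_field_derivative exp w) (at w within closed_segment 0 z)"
      by (rule has_field_derivative_at_within) (rule DERIV_exp)
    have "cmod w \<le> 1" using w segment_bound1[of w 0 z] assms by simp
    hence "exp (cmod w) \<le> exp 1" by simp
    also have "\<dots> \<le> (3::real)" using exp_le by simp
    finally show "cmod (exp w) \<le> 3" using norm_exp[of w] by linarith
  qed auto
  thus ?thesis by simp
qed

lemma sum_inverse_squares_le:
  assumes "1 \<le> N" "N \<le> M"
  shows "(\<Sum>k\<in>{N<..M}. 1 / real k ^ 2) \<le> 1 / real N - 1 / real M"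
  using assms(2)
proof (induction M rule: dec_induct)
  case (step M)
  have M: "M > 0" using assms(1) step by linarith
  have "{N<..Suc M} = insert (Suc M) {N<..M}" using step by auto
  hence "(\<Sum>k\<in>{N<..Suc M}. 1 / real k ^ 2) = 1 / real (Suc M) ^ 2 + (\<Sum>k\<in>{N<..M}. 1 / real k ^ 2)" by simp
  also have "1 / real (Suc M) ^ 2 \<le> 1 / real M - 1 / real (Suc M)"
  proof -
    have "1 / real M - 1 / real (Suc M) = 1 / (real M * real (Suc M))" using M by (simp add: field_simps)
    moreover have "1 / real (Suc M) ^ 2 \<le> 1 / (real M * real (Suc M))"
      using M unfolding power2_eq_square by (intro divide_left_mono mult_right_mono) auto
    ultimately show ?thesis by simp
  qed
  finally show ?case using step by linarith
qed simp

lemma norm_sum_le_inverse_squares: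
  fixes d :: "nat \<Rightarrow> complex"
  assumes N: "1 \<le> N" "N \<le> M" and d: "\<And>k. k > N \<Longrightarrow> cmod (d k) \<le> C / real k ^ 2" and C: "C \<ge> 0"
  shows "cmod (\<Sum>k\<in>{N<..M}. d k) \<le> C / real N"
proof -
  have "cmod (\<Sum>k\<in>{N<..M}. d k) \<le> (\<Sum>k\<in>{N<..M}. C * (1 / real k ^ 2))"
    using d by (intro sum_norm_le) auto
  also have "\<dots> = C * (\<Sum>k\<in>{N<..M}. 1 / real k ^ 2)" by (simp add: sum_distrib_left)
  also have "\<dots> \<le> C * (1 / real N)"
  proof (intro mult_left_mono C)
    have "1 / real M \<ge> 0" by simp
    thus "(\<Sum>k\<in>{N<..M}. 1 / real k ^ 2) \<le> 1 / real N" using sum_inverse_squares_le[OF N] by linarith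
  qed
  finally show ?thesis by simp
qed

section \<open>The Weierstrass product of the Barnes function\<close>

definition weierstrass_factor :: "complex \<Rightarrow> nat \<Rightarrow> complex" where
  "weierstrass_factor s k = (1 + s / of_nat k) ^ k * exp (s\<^sup>2 / (2 * of_nat k) - s)"

text \<open>The exponential factor removes the first two terms of k Ln (1 + s / k), so that k times
  a cubic remainder is left, a quantity of order 1 / k^2.\<close>

lemma weierstrass_factor_eq_exp:
  assumes "k > 0" "cmod s \<le> real k / 2"
  shows "weierstrass_factor s k = exp (of_nat k * ln_rem (s / of_nat k))"
proof -
  have "cmod (s / of_nat k) \<le> 1 / 2" using assms by (simp add: norm_divide field_simps)
  hence "1 + s / of_nat k \<noteq> 0" by (metis add_eq_0_iff norm_minus_cancel norm_one half_gt_zero_iff linorder_not_le one_less_numeral_iff semiring_norm(76) divide_less_eq_1_pos zero_less_numeral)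
  hence "exp (of_nat k * Ln (1 + s / of_nat k)) = (1 + s / of_nat k) ^ k" by (simp add: exp_of_nat_mult)
  moreover have "of_nat k * ln_rem (s / of_nat k) = of_nat k * Ln (1 + s / of_nat k) + (s\<^sup>2 / (2 * of_nat k) - s)"
    using assms by (simp add: ln_rem_def field_simps power2_eq_square)
  ultimately show ?thesis by (simp add: weierstrass_factor_def exp_add)
qed

lemma norm_weierstrass_exponent_le:
  assumes "k > 0" "cmod s \<le> B" "2 * B \<le> real k"
  shows "cmod (of_nat k * ln_rem (s / of_nat k)) \<le> 2 * B ^ 3 / real k ^ 2"
proof -
  have "cmod (s / of_nat k) \<le> 1 / 2" using assms by (simp add: norm_divide field_simps)
  hence "cmod (ln_rem (s / of_nat k)) \<le> 2 * cmod (s / of_nat k) ^ 3" by (rule norm_ln_rem_le)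
  also have "\<dots> \<le> 2 * (B / real k) ^ 3"
    using assms by (intro mult_left_mono power_mono) (auto simp: norm_divide divide_right_mono)
  finally have "real k * cmod (ln_rem (s / of_nat k)) \<le> real k * (2 * (B / real k) ^ 3)" by (intro mult_left_mono) auto
  also have "\<dots> = 2 * B ^ 3 / real k ^ 2" using assms by (simp add: power_divide power2_eq_square power3_eq_cube)
  finally show ?thesis by (simp add: norm_mult)
qed

definition weierstrass_prod :: "complex \<Rightarrow> nat \<Rightarrow> complex" where
  "weierstrass_prod s M = (\<Prod>k<M. weierstrass_factor s (Suc k))"

definition weierstrass_lim :: "complex \<Rightarrow> complex" where
  "weierstrass_lim s = (\<Prod>k. weierstrass_factor s (Suc k))"

text \<open>The first m factors are set aside so that |s / k| <= 1/2 in the rest, which is then the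
  exponential of an absolutely summable series.\<close>

lemma convergent_weierstrass: "convergent_prod (\<lambda>k. weierstrass_factor s (Suc k))"
proof -
  define B where "B = cmod s"
  obtain m where m: "2 * B \<le> real m" using real_arch_simple by blast
  have k: "2 * B \<le> real (Suc (n + m))" for n using m by simp
  have "summable (\<lambda>n. of_nat (Suc (n + m)) * ln_rem (s / of_nat (Suc (n + m))))"
  proof (rule summable_comparison_test')
    have "summable (\<lambda>k. inverse (real k ^ 2))" by (rule inverse_power_summable) simp
    hence "summable (\<lambda>n. inverse (real (n + Suc m) ^ 2))" by (subst summable_iff_shift)
    thus "summable (\<lambda>n. 2 * B ^ 3 * inverse (real (n + Suc m) ^ 2))" by (rule summable_mult)
    fix n
    show "norm (of_nat (Suc (n + m)) * ln_rem (s / of_nat (Suc (n + m)))) \<le> 2 * B ^ 3 * inverse (real (n + Suc m) ^ 2)"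
      using norm_weierstrass_exponent_le[of "Suc (n + m)" s B, OF _ _ k] by (simp add: B_def divide_inverse)
  qed
  hence "convergent_prod (\<lambda>n. exp (of_nat (Suc (n + m)) * ln_rem (s / of_nat (Suc (n + m)))))"
    by (rule convergent_prod_exp)
  also have "(\<lambda>n. exp (of_nat (Suc (n + m)) * ln_rem (s / of_nat (Suc (n + m))))) = (\<lambda>n. weierstrass_factor s (Suc (n + m)))"
    by (rule ext, rule weierstrass_factor_eq_exp[symmetric]) (use k in \<open>auto simp: B_def field_simps\<close>)
  finally show ?thesis by (rule convergent_prod_offset)
qed

lemma weierstrass_prod_LIMSEQ: "weierstrass_prod s \<longlonglongrightarrow> weierstrass_lim s"
proof -
  have "(\<lambda>n. weierstrass_prod s (Suc n)) \<longlonglongrightarrow> weierstrass_lim s"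
    using convergent_prod_LIMSEQ[OF convergent_weierstrass[of s]]
    by (simp add: weierstrass_prod_def weierstrass_lim_def lessThan_Suc_atMost)
  thus ?thesis by (rule LIMSEQ_imp_Suc)
qed

lemma one_plus_div_neq_0:
  assumes "Re s > -1" "k > 0"
  shows "1 + s / of_nat k \<noteq> 0"
proof
  assume "1 + s / of_nat k = 0"
  hence "s = - of_nat k" using assms by (simp add: field_simps add_eq_0_iff)
  hence "Re s = - real k" by simp
  thus False using assms by simp
qed

lemma weierstrass_factor_neq_0: "Re s > -1 \<Longrightarrow> k > 0 \<Longrightarrow> weierstrass_factor s k \<noteq> 0"
  by (simp add: weierstrass_factor_def one_plus_div_neq_0)

lemma weierstrass_prod_neq_0: "Re s > -1 \<Longrightarrow> weierstrass_prod s N \<noteq> 0"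
  unfolding weierstrass_prod_def using weierstrass_factor_neq_0 by (simp add: prod_zero_iff)

lemma weierstrass_lim_neq_0: "Re s > -1 \<Longrightarrow> weierstrass_lim s \<noteq> 0"
  unfolding weierstrass_lim_def by (intro prodinf_nonzero convergent_weierstrass weierstrass_factor_neq_0) auto

lemma barnes_G_eq:
  "barnes_G (1 + s) = of_real (2 * pi) powr (s / 2) * exp (- (s + s\<^sup>2 * (1 + euler_mascheroni)) / 2) * weierstrass_lim s"
  by (simp add: barnes_G_def weierstrass_lim_def weierstrass_factor_def del: of_nat_Suc)

text \<open>The part of the product beyond N is the exponential of a sum of size at most 2 B^3 / N;
  the factor 3 between this and the bound comes from |exp t - 1| <= 3 |t|. An explicit rate is
  wanted for uniformity in s.\<close>

lemma weierstrass_tail_close: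
  assumes s: "Re s > -1" "cmod s \<le> B" and N: "1 \<le> N" "2 * B \<le> real N" "2 * B ^ 3 \<le> real N"
  shows "cmod (weierstrass_lim s / weierstrass_prod s N - 1) \<le> 6 * B ^ 3 / real N"
proof -
  have B: "B \<ge> 0" using s(2) norm_ge_zero[of s] by linarith
  let ?d = "\<lambda>k. of_nat k * ln_rem (s / of_nat k)"
  have step: "weierstrass_prod s M = weierstrass_prod s N * exp (\<Sum>k\<in>{N<..M}. ?d k)" if "N \<le> M" for M
    using that
  proof (induction M rule: dec_induct)
    case (step M)
    have "{N<..Suc M} = insert (Suc M) {N<..M}" using step by auto
    hence "exp (\<Sum>k\<in>{N<..Suc M}. ?d k) = exp (\<Sum>k\<in>{N<..M}. ?d k) * exp (?d (Suc M))"
      by (simp add: exp_add mult.commute del: of_nat_Suc)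
    moreover have "exp (?d (Suc M)) = weierstrass_factor s (Suc M)"
      by (rule weierstrass_factor_eq_exp[symmetric]) (use s N step in auto)
    moreover have "weierstrass_prod s (Suc M) = weierstrass_prod s M * weierstrass_factor s (Suc M)"
      by (simp add: weierstrass_prod_def)
    ultimately show ?case using step by simp
  qed simp
  have close: "cmod (weierstrass_prod s M / weierstrass_prod s N - 1) \<le> 6 * B ^ 3 / real N" if M: "N \<le> M" for M
  proof -
    have sm: "cmod (\<Sum>k\<in>{N<..M}. ?d k) \<le> 2 * B ^ 3 / real N"
      by (rule norm_sum_le_inverse_squares[OF N(1) M]) (use s N B in \<open>auto intro!: norm_weierstrass_exponent_le\<close>)
    also have "\<dots> \<le> 1" using N by simp
    finally have "cmod (exp (\<Sum>k\<in>{N<..M}. ?d k) - 1) \<le> 3 * cmod (\<Sum>k\<in>{N<..M}. ?d k)" by (rule norm_exp_minus_1_le)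
    also have "\<dots> \<le> 3 * (2 * B ^ 3 / real N)" using sm by simp
    finally show ?thesis using step[OF M] weierstrass_prod_neq_0[OF s(1), of N] by simp
  qed
  have "(\<lambda>M. cmod (weierstrass_prod s M / weierstrass_prod s N - 1)) \<longlonglongrightarrow> cmod (weierstrass_lim s / weierstrass_prod s N - 1)"
    by (intro tendsto_intros weierstrass_prod_LIMSEQ weierstrass_prod_neq_0 s)
  thus ?thesis by (rule LIMSEQ_le_const2) (use close in blast)
qed

section \<open>Powers of Gamma quotients\<close>

lemma not_nonpos_Int_Re: "Re z > 0 \<Longrightarrow> z \<notin> \<int>\<^sub>\<le>\<^sub>0"
  by (auto elim!: nonpos_Ints_cases')

lemma Gamma_over_fact_Suc:
  assumes s: "Re s > -1"
  shows "Gamma (s + of_nat (Suc N) + 1) / fact (Suc N) = (1 + s / of_nat (Suc N)) * (Gamma (s + of_nat N + 1) / fact N)"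
proof -
  define k :: complex where "k = of_nat (Suc N)"
  have k0: "k \<noteq> 0" unfolding k_def by (rule of_nat_neq_0)
  have "s + of_nat N + 1 \<notin> \<int>\<^sub>\<le>\<^sub>0" using s by (intro not_nonpos_Int_Re) simp
  hence "Gamma ((s + of_nat N + 1) + 1) = (s + of_nat N + 1) * Gamma (s + of_nat N + 1)" by (rule Gamma_plus1)
  also have "s + of_nat N + 1 = s + k" by (simp add: k_def add_ac)
  finally have "Gamma (s + k + 1) / (k * fact N) = ((s + k) / k) * (Gamma (s + k) / fact N)" by simp
  also have "(s + k) / k = 1 + s / k" using k0 by (simp add: add_divide_distrib)
  finally show ?thesis unfolding fact_Suc k_def by (simp add: add_ac)
qed

text \<open>Gamma(s + N + 1) / (N! N^s) behaves like 1 + (s^2 + s) / (2 N). It will be raised to the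
  power N, so the term of order 1 / N has to be divided out beforehand for the power to tend to
  1.\<close>

definition gamma_quot :: "complex \<Rightarrow> nat \<Rightarrow> complex" where
  "gamma_quot s N = Gamma (s + of_nat N + 1) / (fact N * exp (s * of_real (ln (real N)))) * exp (- (s\<^sup>2 + s) / (2 * of_nat N))"

text \<open>A logarithm of \<open>gamma_quot s k\<close> over \<open>gamma_quot s (k - 1)\<close>.
  The correction factor cancels the quadratic terms, and each of the three summands is of order 1 /
  k^3.\<close>

definition gamma_quot_exponent :: "complex \<Rightarrow> nat \<Rightarrow> complex" where
  "gamma_quot_exponent s k = ln_rem (s / of_nat k) + s * ln_rem (- 1 / of_nat k) +
     (s\<^sup>2 + s) / 2 * (1 / (of_nat k * (of_nat k - 1)) - 1 / of_nat k ^ 2)"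

lemma gamma_quot_Suc:
  assumes s: "Re s > -1" and N: "1 \<le> N" "cmod s \<le> real (Suc N) / 2"
  shows "gamma_quot s (Suc N) = gamma_quot s N * exp (gamma_quot_exponent s (Suc N))"
proof -
  define k :: complex where "k = of_nat (Suc N)"
  have "k - 1 = of_nat N" by (simp add: k_def)
  hence k0: "k \<noteq> 0" "k - 1 \<noteq> 0" using N unfolding k_def by (simp_all del: of_nat_Suc)
  have Nk: "of_nat N = k - 1" by (simp add: k_def)
  have lnN: "Ln (1 + - 1 / k) = of_real (ln (real N) - ln (real (Suc N)))"
  proof -
    have "1 + - 1 / k = (k - 1) / k" using k0 by (simp add: diff_divide_distrib)
    hence "1 + - 1 / k = of_real (real N / real (Suc N))" unfolding Nk[symmetric] by (simp add: k_def)
    also have "Ln \<dots> = of_real (ln (real N / real (Suc N)))" using N by (intro Ln_of_real) auto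
    also have "ln (real N / real (Suc N)) = ln (real N) - ln (real (Suc N))" using N by (simp add: ln_div del: of_nat_Suc)
    finally show ?thesis .
  qed
  have sk: "1 + s / k \<noteq> 0" unfolding k_def by (rule one_plus_div_neq_0[OF s]) simp
  have "gamma_quot_exponent s (Suc N) = Ln (1 + s / k) + s * Ln (1 + - 1 / k) + (s\<^sup>2 + s) / (2 * (k - 1)) - (s\<^sup>2 + s) / (2 * k)"
    using k0 unfolding gamma_quot_exponent_def ln_rem_def k_def[symmetric]
    by (simp add: divide_simps) (simp add: algebra_simps power2_eq_square)
  hence "exp (gamma_quot_exponent s (Suc N)) = exp (Ln (1 + s / k)) * exp (s * Ln (1 + - 1 / k)) * exp ((s\<^sup>2 + s) / (2 * (k - 1))) * exp (- (s\<^sup>2 + s) / (2 * k))"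
    by (simp only: exp_add[symmetric] minus_divide_left[symmetric] diff_conv_add_uminus)
  also have "exp (Ln (1 + s / k)) = 1 + s / k" using sk by simp
  also have "exp (s * Ln (1 + - 1 / k)) = exp (s * of_real (ln (real N))) / exp (s * of_real (ln (real (Suc N))))"
    unfolding lnN by (simp add: right_diff_distrib exp_diff)
  finally have e: "exp (gamma_quot_exponent s (Suc N)) = (1 + s / k) * (exp (s * of_real (ln (real N))) / exp (s * of_real (ln (real (Suc N)))))
      * exp ((s\<^sup>2 + s) / (2 * (k - 1))) * exp (- (s\<^sup>2 + s) / (2 * k))" .
  have G: "Gamma (s + of_nat (Suc N) + 1) / fact (Suc N) = (1 + s / k) * (Gamma (s + of_nat N + 1) / fact N)"
    unfolding k_def by (rule Gamma_over_fact_Suc[OF s])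
  have inv: "exp (- (s\<^sup>2 + s) / (2 * (k - 1))) * exp ((s\<^sup>2 + s) / (2 * (k - 1))) = 1"
    by (simp add: exp_add[symmetric] add_divide_distrib[symmetric])
  have "gamma_quot s N * exp (gamma_quot_exponent s (Suc N)) =
     (1 + s / k) * (Gamma (s + of_nat N + 1) / fact N) / exp (s * of_real (ln (real (Suc N)))) *
     (exp (- (s\<^sup>2 + s) / (2 * (k - 1))) * exp ((s\<^sup>2 + s) / (2 * (k - 1)))) * exp (- (s\<^sup>2 + s) / (2 * k))"
    unfolding e gamma_quot_def Nk by simp
  also have "\<dots> = gamma_quot s (Suc N)" unfolding inv G[symmetric] by (simp add: gamma_quot_def k_def)
  finally show ?thesis ..
qed

lemma norm_gamma_quot_exponent_le:
  assumes "k \<ge> 2" "cmod s \<le> B" "2 * B \<le> real k"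
  shows "cmod (gamma_quot_exponent s k) \<le> (2 * B ^ 3 + B ^ 2 + 3 * B) / real k ^ 3"
proof -
  have B: "B \<ge> 0" using assms(2) norm_ge_zero[of s] by linarith
  have k: "real k \<ge> 2" using assms by simp
  have "cmod (s / of_nat k) \<le> 1 / 2" using assms by (simp add: norm_divide field_simps)
  hence "cmod (ln_rem (s / of_nat k)) \<le> 2 * cmod (s / of_nat k) ^ 3" by (rule norm_ln_rem_le)
  also have "\<dots> \<le> 2 * (B / real k) ^ 3"
    using assms by (intro mult_left_mono power_mono) (auto simp: norm_divide divide_right_mono)
  finally have t1: "cmod (ln_rem (s / of_nat k)) \<le> 2 * B ^ 3 / real k ^ 3" by (simp add: power_divide)
  have "cmod (- 1 / of_nat k) \<le> 1 / 2" using k by (simp add: norm_divide field_simps)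
  hence "cmod (ln_rem (- 1 / of_nat k)) \<le> 2 * cmod (- 1 / of_nat k) ^ 3" by (rule norm_ln_rem_le)
  hence "cmod s * cmod (ln_rem (- 1 / of_nat k)) \<le> B * (2 / real k ^ 3)"
    using assms B by (intro mult_mono) (auto simp: norm_divide power_divide)
  hence t2: "cmod (s * ln_rem (- 1 / of_nat k)) \<le> 2 * B / real k ^ 3" by (simp add: norm_mult mult.commute)
  have e: "1 / (of_nat k * (of_nat k - 1)) - 1 / of_nat k ^ 2 = (of_real (1 / (real k ^ 2 * (real k - 1))) :: complex)"
    using k by (simp add: divide_simps) (simp add: algebra_simps power2_eq_square)
  have "1 / (real k ^ 2 * (real k - 1)) \<le> 1 / (real k ^ 2 * (real k / 2))"
    using k by (intro divide_left_mono mult_left_mono) auto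
  hence f: "1 / (real k ^ 2 * (real k - 1)) \<le> 2 / real k ^ 3" by (simp add: power2_eq_square power3_eq_cube)
  have "cmod ((s\<^sup>2 + s) / 2) \<le> (B ^ 2 + B) / 2"
  proof -
    have "cmod (s\<^sup>2 + s) \<le> cmod s ^ 2 + cmod s" using norm_triangle_ineq[of "s\<^sup>2" s] by (simp add: norm_power)
    also have "\<dots> \<le> B ^ 2 + B" using assms by (intro add_mono power_mono) auto
    finally show ?thesis by (simp add: norm_divide)
  qed
  hence t3': "cmod ((s\<^sup>2 + s) / 2) * (1 / (real k ^ 2 * (real k - 1))) \<le> (B ^ 2 + B) / 2 * (2 / real k ^ 3)"
    using f B k by (intro mult_mono) auto
  have t3: "cmod ((s\<^sup>2 + s) / 2 * (1 / (of_nat k * (of_nat k - 1)) - 1 / of_nat k ^ 2)) \<le> (B ^ 2 + B) / real k ^ 3"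
  proof -
    have "\<bar>1 / (real k ^ 2 * (real k - 1))\<bar> = 1 / (real k ^ 2 * (real k - 1))" using k by simp
    moreover have "(B ^ 2 + B) / 2 * (2 / real k ^ 3) = (B ^ 2 + B) / real k ^ 3" by (metis times_divide_times_eq mult.commute nonzero_mult_divide_mult_cancel_left zero_neq_numeral)
    ultimately show ?thesis
      using t3' unfolding e norm_mult norm_of_real by simp
  qed
  have "cmod (gamma_quot_exponent s k) \<le> 2 * B ^ 3 / real k ^ 3 + 2 * B / real k ^ 3 + (B ^ 2 + B) / real k ^ 3"
    unfolding gamma_quot_exponent_def by (intro norm_triangle_le add_mono t1 t2 t3)
  thus ?thesis by (simp add: add_divide_distrib[symmetric] algebra_simps)
qed

text \<open>The limit is Gauss's product for Gamma at s + 1; the rate is obtained separately by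
  telescoping instead of from Stirling's formula.\<close>

lemma gamma_quot_LIMSEQ:
  assumes s: "Re s > -1"
  shows "gamma_quot s \<longlonglongrightarrow> 1"
proof -
  have np: "s + 1 \<notin> \<int>\<^sub>\<le>\<^sub>0" using s by (intro not_nonpos_Int_Re) simp
  have G0: "Gamma (s + 1) \<noteq> 0" using np by (simp add: Gamma_eq_zero_iff)
  have "(\<lambda>N. Gamma (s + 1) / Gamma_series (s + 1) N * (of_nat N / (of_nat N + (s + 1))) * exp (- (s\<^sup>2 + s) / (2 * of_nat N)))
      \<longlonglongrightarrow> Gamma (s + 1) / Gamma (s + 1) * 1 * exp 0"
  proof (intro tendsto_intros G0)
    have "(\<lambda>N. 1 / (1 + (s + 1) / of_nat N)) \<longlonglongrightarrow> 1 / (1 + 0)"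
      by (intro tendsto_intros lim_const_over_n) auto
    hence l: "(\<lambda>N. 1 / (1 + (s + 1) / of_nat N)) \<longlonglongrightarrow> 1" by simp
    show "(\<lambda>N. of_nat N / (of_nat N + (s + 1))) \<longlonglongrightarrow> 1"
    proof (rule Lim_transform_eventually[OF l])
      show "eventually (\<lambda>N. 1 / (1 + (s + 1) / of_nat N) = of_nat N / (of_nat N + (s + 1))) sequentially"
        using eventually_gt_at_top[of 0]
      proof eventually_elim
        case (elim N)
        hence "(1::complex) + (s + 1) / of_nat N = (of_nat N + (s + 1)) / of_nat N" by (simp add: add_divide_distrib)
        thus ?case by simp
      qed
    qed
    have "(\<lambda>N. (- (s\<^sup>2 + s) / 2) / of_nat N) \<longlonglongrightarrow> 0" by (rule lim_const_over_n)
    thus "(\<lambda>N. - (s\<^sup>2 + s) / (2 * of_nat N)) \<longlonglongrightarrow> 0" by simp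
  qed
  hence l: "(\<lambda>N. Gamma (s + 1) / Gamma_series (s + 1) N * (of_nat N / (of_nat N + (s + 1))) * exp (- (s\<^sup>2 + s) / (2 * of_nat N))) \<longlonglongrightarrow> 1"
    using G0 by simp
  show ?thesis
  proof (rule Lim_transform_eventually[OF l])
    show "eventually (\<lambda>N. Gamma (s + 1) / Gamma_series (s + 1) N * (of_nat N / (of_nat N + (s + 1))) * exp (- (s\<^sup>2 + s) / (2 * of_nat N)) = gamma_quot s N) sequentially"
      using eventually_gt_at_top[of 0]
    proof eventually_elim
      case (elim N)
      have P: "pochhammer (s + 1) N = Gamma (s + 1 + of_nat N) / Gamma (s + 1)" by (rule pochhammer_Gamma[OF np])
      have E: "exp ((s + 1) * of_real (ln (real N))) = exp (s * of_real (ln (real N))) * of_nat N"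
      proof -
        have "exp (of_real (ln (real N)) :: complex) = of_real (real N)"
          using elim by (simp only: exp_of_real exp_ln of_nat_0_less_iff)
        thus ?thesis by (simp add: distrib_right exp_add)
      qed
      have ne: "of_nat N + (s + 1) \<noteq> 0"
      proof
        assume "of_nat N + (s + 1) = 0"
        hence "Re (of_nat N + (s + 1)) = 0" by simp
        thus False using s by simp
      qed
      have "Gamma_series (s + 1) N = fact N * (exp (s * of_real (ln (real N))) * of_nat N) / (Gamma (s + 1 + of_nat N) / Gamma (s + 1) * (s + 1 + of_nat N))"
        unfolding Gamma_series_def E[symmetric] P[symmetric] by (simp add: pochhammer_Suc)
      hence "Gamma (s + 1) / Gamma_series (s + 1) N * (of_nat N / (of_nat N + (s + 1))) = Gamma (s + of_nat N + 1) / (fact N * exp (s * of_real (ln (real N))))"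
      proof -
        have "g / (f * (e * m) / (p / g * q)) * (m / q) = p / (f * e)"
          if "g \<noteq> 0" "m \<noteq> 0" "q \<noteq> 0" for g f e m p q :: complex
          using that by simp
        from this[OF G0, of "of_nat N" "of_nat N + (s + 1)"] show ?thesis
          using elim ne \<open>Gamma_series (s + 1) N = _\<close> by (simp add: add_ac)
      qed
      thus ?case by (simp add: gamma_quot_def)
    qed
  qed
qed

text \<open>Telescoping from N to M and letting M tend to infinity shows that
  \<open>gamma_quot s N\<close> is the exponential of a quantity of order 1 / N^2, so its N-th power
  is 1 + O(1 / N). For k > N the cubic decay is used as C / N times 1 / k^2.\<close>

lemma gamma_quot_power_close:
  assumes s: "Re s > -1" "cmod s \<le> B" and N: "1 \<le> N" "2 * B \<le> real N" "2 * B ^ 3 + B ^ 2 + 3 * B \<le> real N"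
  shows "cmod (gamma_quot s N ^ N - 1) \<le> 3 * (2 * B ^ 3 + B ^ 2 + 3 * B) / real N"
proof -
  define C where "C = 2 * B ^ 3 + B ^ 2 + 3 * B"
  have B: "B \<ge> 0" using s(2) norm_ge_zero[of s] by linarith
  have C: "C \<ge> 0" using B by (simp add: C_def)
  let ?d = "gamma_quot_exponent s"
  have step: "gamma_quot s M = gamma_quot s N * exp (\<Sum>k\<in>{N<..M}. ?d k)" if "N \<le> M" for M
    using that
  proof (induction M rule: dec_induct)
    case (step M)
    have "{N<..Suc M} = insert (Suc M) {N<..M}" using step by auto
    hence "exp (\<Sum>k\<in>{N<..Suc M}. ?d k) = exp (\<Sum>k\<in>{N<..M}. ?d k) * exp (?d (Suc M))"
      by (simp add: exp_add mult.commute del: of_nat_Suc)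
    moreover have "gamma_quot s (Suc M) = gamma_quot s M * exp (?d (Suc M))"
      by (rule gamma_quot_Suc) (use s N step in auto)
    ultimately show ?case using step by simp
  qed simp
  have close: "cmod (gamma_quot s N ^ N - gamma_quot s M ^ N) \<le> cmod (gamma_quot s M) ^ N * (3 * C / real N)" if M: "N \<le> M" for M
  proof -
    let ?S = "\<Sum>k\<in>{N<..M}. ?d k"
    have "cmod ?S \<le> (C / real N) / real N"
    proof (rule norm_sum_le_inverse_squares[OF N(1) M])
      fix k assume k: "N < k"
      have "cmod (?d k) \<le> C / real k ^ 3" unfolding C_def
        by (rule norm_gamma_quot_exponent_le) (use s N k in auto)
      also have "\<dots> = C / real k / real k ^ 2" by (simp add: power3_eq_cube power2_eq_square)
      also have "\<dots> \<le> C / real N / real k ^ 2" using k N C by (intro divide_right_mono divide_left_mono) auto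
      finally show "cmod (?d k) \<le> C / real N / real k ^ 2" .
    qed (use C N in auto)
    hence "real N * cmod ?S \<le> real N * (C / real N / real N)" by (intro mult_left_mono) auto
    hence S: "cmod (- of_nat N * ?S) \<le> C / real N" using N by (simp add: norm_mult)
    also have "\<dots> \<le> 1" using N by (simp add: C_def)
    finally have "cmod (exp (- of_nat N * ?S) - 1) \<le> 3 * cmod (- of_nat N * ?S)" by (rule norm_exp_minus_1_le)
    hence e: "cmod (exp (- of_nat N * ?S) - 1) \<le> 3 * C / real N" using S by simp
    have "gamma_quot s N ^ N = gamma_quot s M ^ N * exp (- of_nat N * ?S)"
      unfolding step[OF M] by (simp add: power_mult_distrib exp_of_nat_mult[symmetric] exp_minus)
    hence "gamma_quot s N ^ N - gamma_quot s M ^ N = gamma_quot s M ^ N * (exp (- of_nat N * ?S) - 1)"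
      by (simp add: algebra_simps)
    thus ?thesis using mult_left_mono[OF e, of "cmod (gamma_quot s M) ^ N"] by (simp only: norm_mult norm_power) simp
  qed
  have "cmod (gamma_quot s N ^ N - 1 ^ N) \<le> cmod 1 ^ N * (3 * C / real N)"
  proof (rule LIMSEQ_le)
    show "(\<lambda>M. cmod (gamma_quot s N ^ N - gamma_quot s M ^ N)) \<longlonglongrightarrow> cmod (gamma_quot s N ^ N - 1 ^ N)"
      by (intro tendsto_intros gamma_quot_LIMSEQ s)
    show "(\<lambda>M. cmod (gamma_quot s M) ^ N * (3 * C / real N)) \<longlonglongrightarrow> cmod 1 ^ N * (3 * C / real N)"
      by (intro tendsto_intros gamma_quot_LIMSEQ s)
  qed (use close in blast)
  thus ?thesis by (simp add: C_def)
qed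

text \<open>Each Gamma(s + 1 + i) / i! is the corresponding value at N divided by the factors 1 + s
  / k with i < k <= N; over all i < N the factor with index k is met k times.\<close>

lemma ginibre_const_eq:
  assumes s: "Re s > -1"
  shows "ginibre_const s N = (Gamma (s + of_nat N + 1) / fact N) ^ N / (\<Prod>k<N. (1 + s / of_nat (Suc k)) ^ Suc k)"
proof (induction N)
  case (Suc N)
  define t where "t = Gamma (s + of_nat N + 1) / fact N"
  define q where "q = 1 + s / of_nat (Suc N)"
  define P where "P = (\<Prod>k<N. (1 + s / of_nat (Suc k)) ^ Suc k)"
  have q: "q \<noteq> 0" unfolding q_def by (rule one_plus_div_neq_0[OF s]) simp
  have "ginibre_const s (Suc N) = t ^ N / P * t"
    unfolding ginibre_const_Suc Suc.IH by (simp add: t_def P_def add_ac)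
  also have "\<dots> = (q * t) ^ Suc N / (P * q ^ Suc N)"
  proof -
    have "(q * t) ^ Suc N / (P * q ^ Suc N) = q ^ Suc N * t ^ Suc N / (q ^ Suc N * P)"
      by (simp only: power_mult_distrib mult.commute)
    also have "\<dots> = t ^ Suc N / P" using q by (intro mult_divide_mult_cancel_left) simp
    finally show ?thesis by simp
  qed
  also have "q * t = Gamma (s + of_nat (Suc N) + 1) / fact (Suc N)"
    unfolding q_def t_def by (rule Gamma_over_fact_Suc[OF s, symmetric])
  also have "P * q ^ Suc N = (\<Prod>k<Suc N. (1 + s / of_nat (Suc k)) ^ Suc k)" by (simp add: P_def q_def)
  finally show ?case .
qed (simp add: ginibre_const_def)

text \<open>The convergence factors add up to a harmonic number, through which ln N and Euler's
  constant enter.\<close>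

lemma weierstrass_prod_eq:
  "weierstrass_prod s N = (\<Prod>k<N. (1 + s / of_nat (Suc k)) ^ Suc k) * exp (s\<^sup>2 / 2 * of_real (harm N) - s * of_nat N)"
proof (induction N)
  case (Suc N)
  have h: "harm (Suc N) = harm N + inverse (real (Suc N))" by (rule harm_Suc)
  have "s\<^sup>2 / 2 * of_real (harm (Suc N)) - s * of_nat (Suc N) =
     (s\<^sup>2 / 2 * of_real (harm N) - s * of_nat N) + (s\<^sup>2 / (2 * of_nat (Suc N)) - s)"
    unfolding h of_real_add of_real_inverse of_real_of_nat_eq of_nat_Suc[of N, where 'a = complex]
    by (simp add: algebra_simps inverse_eq_divide)
  hence "exp (s\<^sup>2 / 2 * of_real (harm (Suc N)) - s * of_nat (Suc N)) =
     exp (s\<^sup>2 / 2 * of_real (harm N) - s * of_nat N) * exp (s\<^sup>2 / (2 * of_nat (Suc N)) - s)"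
    by (simp only: exp_add)
  moreover have "weierstrass_prod s (Suc N) = weierstrass_prod s N * weierstrass_factor s (Suc N)"
    by (simp add: weierstrass_prod_def)
  ultimately show ?case unfolding Suc.IH weierstrass_factor_def by (simp del: of_nat_Suc)
qed (simp add: weierstrass_prod_def harm_def)

text \<open>The three sources of error: the Gamma quotient, the truncation of the product, and the
  harmonic number in place of ln N plus Euler's constant.\<close>

definition barnes_ratio :: "nat \<Rightarrow> complex \<Rightarrow> complex" where
  "barnes_ratio N s = gamma_quot s N ^ N * (weierstrass_lim s / weierstrass_prod s N) *
     exp (s\<^sup>2 / 2 * of_real (harm N - ln (real N) - euler_mascheroni))"

text \<open>An exact identity. The power of N is exp (s^2 / 2 ln N), contained in the harmonic
  number; exp (-s N) comes from the linear terms of the convergence factors; the prefactor on the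
  left cancels the power of N in the Gamma quotients.\<close>

lemma ginibre_const_eq_barnes:
  assumes s: "Re s > -1" and N: "N \<ge> 1"
  shows "of_nat N powr (- (of_nat N * s)) * ginibre_const s N =
    barnes_ratio N s * (of_nat N powr (s\<^sup>2 / 2) * exp (- (s * of_nat N)) * (of_real (2 * pi) powr (s / 2) / barnes_G (1 + s)))"
proof -
  define l :: complex where "l = of_real (ln (real N))"
  define h :: complex where "h = of_real (harm N)"
  define c :: complex where "c = of_real euler_mascheroni"
  define T where "T = Gamma (s + of_nat N + 1) / fact N"
  define P where "P = (\<Prod>k<N. (1 + s / of_nat (Suc k)) ^ Suc k)"
  define W where "W = weierstrass_lim s"
  define b where "b = complex_of_real (2 * pi) powr (s / 2)"
  define e where "e = exp (- (of_nat N * s * l))"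
  have W: "W \<noteq> 0" unfolding W_def by (rule weierstrass_lim_neq_0[OF s])
  have P: "P \<noteq> 0" unfolding P_def using one_plus_div_neq_0[OF s] by (simp add: prod_zero_iff del: of_nat_Suc)
  have b: "b \<noteq> 0" by (simp add: b_def)
  have powr: "of_nat N powr w = exp (w * l)" for w
  proof -
    have "Ln (of_nat N) = l" using N Ln_of_real[of "real N"] by (simp add: l_def)
    thus ?thesis using N by (simp add: powr_def)
  qed
  have g: "gamma_quot s N ^ N = T ^ N * e * exp (- (s\<^sup>2 + s) / 2)"
  proof -
    have "gamma_quot s N = T * exp (- (s * l) - (s\<^sup>2 + s) / (2 * of_nat N))"
    proof -
      have "exp (- (s * l) - q) = exp (- q) / exp (s * l)" for q
        by (simp add: exp_diff exp_minus divide_simps)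
      thus ?thesis by (simp only: gamma_quot_def T_def l_def minus_divide_left) simp
    qed
    hence "gamma_quot s N ^ N = T ^ N * exp (of_nat N * (- (s * l) - (s\<^sup>2 + s) / (2 * of_nat N)))"
      by (simp only: power_mult_distrib exp_of_nat_mult)
    also have "of_nat N * (- (s * l) - (s\<^sup>2 + s) / (2 * of_nat N)) = - (of_nat N * s * l) + - (s\<^sup>2 + s) / 2"
    proof -
      have "of_nat N * (q / (2 * of_nat N)) = q / 2" for q :: complex using N by simp
      thus ?thesis by (simp only: distrib_left mult_minus_right mult.assoc diff_conv_add_uminus minus_divide_left)
    qed
    finally show ?thesis by (simp only: exp_add e_def mult.assoc)
  qed
  have G: "barnes_G (1 + s) = b * exp (- (s + s\<^sup>2 * (1 + c)) / 2) * W"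
    unfolding barnes_G_eq b_def c_def W_def by simp
  have p: "weierstrass_prod s N = P * exp (s\<^sup>2 / 2 * h - s * of_nat N)"
    unfolding weierstrass_prod_eq P_def h_def ..
  have E: "exp (- (s\<^sup>2 + s) / 2) * exp (s\<^sup>2 / 2 * (h - l - c)) * exp (s\<^sup>2 / 2 * l) * exp (- (s * of_nat N)) =
      exp (s\<^sup>2 / 2 * h - s * of_nat N) * exp (- (s + s\<^sup>2 * (1 + c)) / 2)"
    by (simp only: exp_add[symmetric]) (simp add: algebra_simps add_divide_distrib diff_divide_distrib)
  have "T ^ N * e * f1 * (W / (P * f2)) * f3 * (f4 * f5 * (b / (b * f6 * W))) = e * (T ^ N / P)"
    if "f1 * f3 * f4 * f5 = f2 * f6" "f2 \<noteq> 0" "f6 \<noteq> 0" for f1 f2 f3 f4 f5 f6 :: complex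
  proof -
    have "T ^ N * e * f1 * (W / (P * f2)) * f3 * (f4 * f5 * (b / (b * f6 * W))) =
       T ^ N * e / P * ((f1 * f3 * f4 * f5) / (f2 * f6)) * (W / W) * (b / b)"
      by (simp add: mult_ac)
    thus ?thesis unfolding that(1) using that(2,3) W b by simp
  qed
  from this[OF E] show ?thesis
    unfolding barnes_ratio_def g p G powr b_def[symmetric] W_def[symmetric] of_real_diff l_def[symmetric] h_def[symmetric] c_def[symmetric]
    unfolding ginibre_const_eq[OF s] T_def[symmetric] P_def[symmetric]
    by (simp add: e_def mult.assoc)
qed

text \<open>The explicit rates are uniform up to the line Re s = -1, since the Weierstrass product
  enters only through a quotient in which the common zero at s = -1 cancels.\<close>

lemma uniform_limit_barnes_ratio:
  "uniform_limit {s. Re s > -1 \<and> cmod s \<le> B} barnes_ratio (\<lambda>_. 1) sequentially"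
proof -
  let ?X = "{s. Re s > -1 \<and> cmod s \<le> B}"
  have rate: "uniform_limit ?X f (\<lambda>_. 1) sequentially"
    if "\<And>N s. s \<in> ?X \<Longrightarrow> N0 \<le> real N \<Longrightarrow> cmod (f N s - 1) \<le> C / real N" for f :: "nat \<Rightarrow> complex \<Rightarrow> complex" and C N0
  proof (rule uniform_limitI)
    fix \<epsilon> :: real assume e: "\<epsilon> > 0"
    have "(\<lambda>N. C / real N) \<longlonglongrightarrow> 0" by (rule lim_const_over_n)
    hence "eventually (\<lambda>N. C / real N < \<epsilon>) sequentially" using e by (rule order_tendstoD)
    moreover have "eventually (\<lambda>N. N0 \<le> real N) sequentially"
      using filterlim_real_sequentially by (simp add: filterlim_at_top)
    ultimately show "eventually (\<lambda>N. \<forall>s\<in>?X. dist (f N s) 1 < \<epsilon>) sequentially"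
    proof eventually_elim
      case (elim N)
      show ?case using that elim by (metis dist_norm order.strict_trans1)
    qed
  qed
  have 1: "uniform_limit ?X (\<lambda>N s. gamma_quot s N ^ N) (\<lambda>_. 1) sequentially"
    by (rule rate[where C = "3 * (2 * B ^ 3 + B ^ 2 + 3 * B)" and ?N0.0 = "max 1 (max (2 * B) (2 * B ^ 3 + B ^ 2 + 3 * B))"])
      (rule gamma_quot_power_close; simp)
  have 2: "uniform_limit ?X (\<lambda>N s. weierstrass_lim s / weierstrass_prod s N) (\<lambda>_. 1) sequentially"
    by (rule rate[where C = "6 * B ^ 3" and ?N0.0 = "max 1 (max (2 * B) (2 * B ^ 3))"])
      (rule weierstrass_tail_close; simp)
  have 3: "uniform_limit ?X (\<lambda>N s. exp (s\<^sup>2 / 2 * of_real (harm N - ln (real N) - euler_mascheroni))) (\<lambda>_. 1) sequentially"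
  proof (rule uniform_limitI)
    fix \<epsilon> :: real assume e: "\<epsilon> > 0"
    define r where "r N = harm N - ln (real N) - euler_mascheroni" for N
    have "(\<lambda>N. harm N - ln (real N) - euler_mascheroni) \<longlonglongrightarrow> euler_mascheroni - (euler_mascheroni :: real)"
      by (intro tendsto_diff euler_mascheroni_LIMSEQ tendsto_const)
    hence "(\<lambda>N. B ^ 2 / 2 * \<bar>r N\<bar>) \<longlonglongrightarrow> B ^ 2 / 2 * \<bar>0\<bar>"
      unfolding r_def by (intro tendsto_intros) simp
    hence l: "(\<lambda>N. B ^ 2 / 2 * \<bar>r N\<bar>) \<longlonglongrightarrow> 0" by simp
    have "eventually (\<lambda>N. B ^ 2 / 2 * \<bar>r N\<bar> < min 1 (\<epsilon> / 3)) sequentially"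
      using e by (intro order_tendstoD(2)[OF l]) simp
    thus "eventually (\<lambda>N. \<forall>s\<in>?X. dist (exp (s\<^sup>2 / 2 * of_real (r N))) 1 < \<epsilon>) sequentially"
    proof eventually_elim
      case (elim N)
      show ?case
      proof
        fix s assume "s \<in> ?X"
        hence "cmod s ^ 2 \<le> B ^ 2" by (intro power_mono) auto
        hence "cmod s ^ 2 / 2 * \<bar>r N\<bar> \<le> B ^ 2 / 2 * \<bar>r N\<bar>" by (intro mult_right_mono) auto
        hence le: "cmod (s\<^sup>2 / 2 * of_real (r N)) < min 1 (\<epsilon> / 3)" using elim by (simp add: norm_mult norm_power norm_divide)
        hence "cmod (exp (s\<^sup>2 / 2 * of_real (r N)) - 1) \<le> 3 * cmod (s\<^sup>2 / 2 * of_real (r N))" by (intro norm_exp_minus_1_le) simp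
        thus "dist (exp (s\<^sup>2 / 2 * of_real (r N))) 1 < \<epsilon>" using le by (simp add: dist_norm)
      qed
    qed
  qed
  have b: "bounded ((\<lambda>_. 1 :: complex) ` ?X)" by (rule finite_imp_bounded) (rule finite_subset[of _ "{1}"]; auto)
  have "uniform_limit ?X (\<lambda>N s. gamma_quot s N ^ N * (weierstrass_lim s / weierstrass_prod s N)) (\<lambda>_. 1 * 1) sequentially"
    by (rule uniform_lim_mult[OF 1 2 b b])
  hence 12: "uniform_limit ?X (\<lambda>N s. gamma_quot s N ^ N * (weierstrass_lim s / weierstrass_prod s N)) (\<lambda>_. 1) sequentially" by simp
  have "uniform_limit ?X (\<lambda>N s. gamma_quot s N ^ N * (weierstrass_lim s / weierstrass_prod s N) *
     exp (s\<^sup>2 / 2 * of_real (harm N - ln (real N) - euler_mascheroni))) (\<lambda>_. 1 * 1) sequentially"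
    by (rule uniform_lim_mult[OF 12 3 b b])
  thus ?thesis by (simp add: barnes_ratio_def[abs_def])
qed

section \<open>Analytic continuation in the exponent\<close>

lemma det_toeplitz_pos:
  assumes "s > -1" "x \<ge> 0"
  shows "Determinant.det (toeplitz s 0 n x) > (0::real)"
proof (cases "x = 0 \<or> n = 0")
  case True
  thus ?thesis by (auto simp: det_toeplitz_at_0 det_dim_zero[OF toeplitz_carrier])
next
  case False
  then obtain m where "n = Suc m" by (cases n) auto
  thus ?thesis using False assms moment_fun_pos(1)[of s x x m] by (simp add: det_toeplitz_eq_moment_fun)
qed

section \<open>Scaling the Ginibre matrix to standard Gaussian entries\<close>

lemma complex_ginibre_measurable_entry:
  assumes "complex_ginibre N M A" "i < N" "j < N"
  shows "(\<lambda>\<omega>. A \<omega> $$ (i, j)) \<in> borel_measurable M"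
proof -
  interpret prob_space M using assms by (simp add: complex_ginibre_def)
  have "indep_vars (\<lambda>_. borel) (\<lambda>(i, j) \<omega>. A \<omega> $$ (i, j)) ({..<N} \<times> {..<N})"
    using assms by (simp add: complex_ginibre_def)
  hence "(case (i, j) of (i, j) \<Rightarrow> \<lambda>\<omega>. A \<omega> $$ (i, j)) \<in> borel_measurable M"
    unfolding indep_vars_def using assms by blast
  thus ?thesis by simp
qed

lemma distr_ginibre:
  assumes A: "complex_ginibre N M A" and N: "N \<ge> 1"
  defines "I \<equiv> {..<N} \<times> {..<N}"
  shows "distr M (PiM I (\<lambda>_. borel)) (\<lambda>\<omega>. \<lambda>(i, j)\<in>I. of_real (sqrt (real N)) * A \<omega> $$ (i, j))
     = PiM I (\<lambda>_. std_complex_gaussian)"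
proof -
  interpret prob_space M using A by (simp add: complex_ginibre_def)
  define Y where "Y = (\<lambda>(i, j) \<omega>. of_real (sqrt (real N)) * A \<omega> $$ (i, j))"
  have I: "I \<noteq> {}" using N by (auto simp: I_def lessThan_empty_iff)
  have "indep_vars (\<lambda>_. borel) (\<lambda>(i, j) \<omega>. A \<omega> $$ (i, j)) I"
    using A by (simp add: complex_ginibre_def I_def)
  hence "indep_vars (\<lambda>_. borel) (\<lambda>ij \<omega>. of_real (sqrt (real N)) * (case ij of (i, j) \<Rightarrow> \<lambda>\<omega>. A \<omega> $$ (i, j)) \<omega>) I"
    by (rule indep_vars_compose2[where Y = "\<lambda>_ w. of_real (sqrt (real N)) * w"]) simp
  also have "(\<lambda>ij \<omega>. of_real (sqrt (real N)) * (case ij of (i, j) \<Rightarrow> \<lambda>\<omega>. A \<omega> $$ (i, j)) \<omega>) = Y"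
    by (auto simp: Y_def fun_eq_iff)
  finally have ind: "indep_vars (\<lambda>_. borel) Y I" .
  have Ym: "Y ij \<in> borel_measurable M" if "ij \<in> I" for ij
    using that ind unfolding indep_vars_def by blast
  have dY: "distr M borel (Y ij) = std_complex_gaussian" if ij: "ij \<in> I" for ij
  proof -
    obtain i j where ij': "ij = (i, j)" "i < N" "j < N" using ij by (auto simp: I_def)
    note [measurable] = complex_ginibre_measurable_entry[OF A ij'(2,3)]
    have s: "complex_of_real (sqrt (real N)) \<noteq> 0" using N by simp
    have "distr M borel (Y ij) = distr (distr M borel (\<lambda>\<omega>. A \<omega> $$ (i, j))) borel (\<lambda>w. of_real (sqrt (real N)) * w)"
      by (subst distr_distr) (auto simp: ij' Y_def comp_def)
    also have "distr M borel (\<lambda>\<omega>. A \<omega> $$ (i, j)) = distr std_complex_gaussian borel (\<lambda>w. w / of_real (sqrt (real N)))"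
      using A ij' by (simp add: complex_ginibre_def)
    also have "distr \<dots> borel (\<lambda>w. of_real (sqrt (real N)) * w) = distr std_complex_gaussian borel (\<lambda>w. w)"
      using s by (subst distr_distr) (auto simp: comp_def measurable_cong_sets[OF sets_gauss refl])
    also have "\<dots> = std_complex_gaussian" by (rule distr_id2) simp
    finally show ?thesis .
  qed
  have "distr M (\<Pi>\<^sub>M i\<in>I. borel) (\<lambda>x. \<lambda>i\<in>I. Y i x) = (\<Pi>\<^sub>M i\<in>I. distr M borel (Y i))"
    using indep_vars_iff_distr_eq_PiM'[OF I, of Y "\<lambda>_. borel"] Ym ind by simp
  also have "\<dots> = PiM I (\<lambda>_. std_complex_gaussian)" by (intro PiM_cong refl) (simp add: dY)
  also have "(\<lambda>x. \<lambda>i\<in>I. Y i x) = (\<lambda>\<omega>. \<lambda>(i, j)\<in>I. of_real (sqrt (real N)) * A \<omega> $$ (i, j))"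
    by (auto simp: Y_def fun_eq_iff restrict_def)
  finally show ?thesis .
qed

lemma det_ginibre_eq:
  fixes A :: "complex mat"
  assumes "A \<in> carrier_mat N N"
  shows "Determinant.det (A - z \<cdot>\<^sub>m 1\<^sub>m N) = Determinant.det (mat N N (\<lambda>(i, j). A $$ (i, j) - (if i = j then z else 0)))"
proof -
  have "A - z \<cdot>\<^sub>m 1\<^sub>m N = mat N N (\<lambda>(i, j). A $$ (i, j) - (if i = j then z else 0))"
    using assms by (intro eq_matI) auto
  thus ?thesis by simp
qed

lemma borel_measurable_det_ginibre:
  assumes A: "complex_ginibre N M A"
  shows "(\<lambda>\<omega>. Determinant.det (A \<omega> - z \<cdot>\<^sub>m 1\<^sub>m N)) \<in> borel_measurable M"
proof -
  have "(\<lambda>\<omega>. Determinant.det (mat N N (\<lambda>(i, j). A \<omega> $$ (i, j) - (if i = j then z else 0)))) \<in> borel_measurable M"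
    by (intro borel_measurable_det_mat borel_measurable_diff complex_ginibre_measurable_entry[OF A]) auto
  thus ?thesis
  proof (rule measurable_cong[THEN iffD2, rotated])
    fix \<omega> assume "\<omega> \<in> space M"
    hence "A \<omega> \<in> carrier_mat N N" using A by (simp add: complex_ginibre_def)
    thus "Determinant.det (A \<omega> - z \<cdot>\<^sub>m 1\<^sub>m N) = Determinant.det (mat N N (\<lambda>(i, j). A \<omega> $$ (i, j) - (if i = j then z else 0)))"
      by (rule det_ginibre_eq)
  qed
qed

lemma ginibre_moment_real:
  assumes A: "complex_ginibre N M A" and N: "N \<ge> 1" and s: "s > -1"
  shows "(\<integral>\<^sup>+ \<omega>. ennreal (cmod (Determinant.det (A \<omega> - z \<cdot>\<^sub>m 1\<^sub>m N)) powr (2 * s)) \<partial>M) =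
    ennreal (real N powr (- (real N * s)) * (ginibre_const s N * Determinant.det (toeplitz s 0 N (real N * (cmod z)\<^sup>2))))"
proof -
  interpret prob_space M using A by (simp add: complex_ginibre_def)
  define I where "I = {..<N} \<times> {..<N}"
  define r where "r = sqrt (real N)"
  \<comment> \<open>Scaling by sqrt N gives standard Gaussian entries with every diagonal shift
    equal to -sqrt N z, which is how x = N |z|^2 arises.\<close>
  define z' where "z' = - (of_real r * z)"
  define F where "F g = ennreal (cmod (Determinant.det (mat N N (\<lambda>(i, j). g (i, j) +
       (if i = j then if Suc i = N then z' else z' else 0)))) powr (2 * s))" for g :: "nat \<times> nat \<Rightarrow> complex"
  define G where "G \<omega> = (\<lambda>(i, j)\<in>I. of_real r * A \<omega> $$ (i, j))" for \<omega>
  define X where "X \<omega> = cmod (Determinant.det (A \<omega> - z \<cdot>\<^sub>m 1\<^sub>m N))" for \<omega>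
  define c where "c = real N powr (real N * s)"
  have r: "r > 0" using N by (simp add: r_def)
  have c: "c > 0" using N by (simp add: c_def)
  have Fm: "F \<in> borel_measurable (PiM I (\<lambda>_. borel))"
  proof -
    have "(\<lambda>g. Determinant.det (mat N N (\<lambda>(i, j). g (i, j) + (if i = j then if Suc i = N then z' else z' else 0)))) \<in> borel_measurable (PiM I (\<lambda>_. borel))"
      by (intro borel_measurable_det_mat borel_measurable_add borel_measurable_const measurable_component_singleton) (auto simp: I_def)
    thus ?thesis unfolding F_def by measurable
  qed
  have Gm: "G \<in> measurable M (PiM I (\<lambda>_. borel))"
    unfolding G_def[abs_def] by (intro measurable_restrict) (auto simp: I_def intro!: borel_measurable_times complex_ginibre_measurable_entry[OF A])
  have det: "F (G \<omega>) = ennreal c * ennreal (X \<omega> powr (2 * s))" if w: "\<omega> \<in> space M" for \<omega>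
  proof -
    have C: "A \<omega> \<in> carrier_mat N N" using w A by (simp add: complex_ginibre_def)
    have "mat N N (\<lambda>(i, j). G \<omega> (i, j) + (if i = j then if Suc i = N then z' else z' else 0)) = of_real r \<cdot>\<^sub>m (A \<omega> - z \<cdot>\<^sub>m 1\<^sub>m N)"
      using C by (intro eq_matI) (auto simp: G_def I_def z'_def algebra_simps)
    hence "F (G \<omega>) = ennreal ((r ^ N * X \<omega>) powr (2 * s))"
      using C r by (simp add: F_def det_smult norm_mult norm_power X_def)
    also have "(r ^ N * X \<omega>) powr (2 * s) = (r ^ N) powr (2 * s) * X \<omega> powr (2 * s)"
      by (rule powr_mult)
    also have "(r ^ N) powr (2 * s) = c"
      using r N by (simp add: c_def r_def powr_half_sqrt[symmetric] powr_powr powr_realpow[symmetric])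
    finally show ?thesis using c by (simp add: ennreal_mult)
  qed
  have Xm: "(\<lambda>\<omega>. ennreal (X \<omega> powr (2 * s))) \<in> borel_measurable M"
    using borel_measurable_det_ginibre[OF A, of z] unfolding X_def by measurable
  have "ennreal c * (\<integral>\<^sup>+ \<omega>. ennreal (X \<omega> powr (2 * s)) \<partial>M) = (\<integral>\<^sup>+ \<omega>. F (G \<omega>) \<partial>M)"
    using Xm by (subst nn_integral_cmult[symmetric]) (auto simp: det cong: nn_integral_cong)
  also have "\<dots> = (\<integral>\<^sup>+ g. F g \<partial>distr M (PiM I (\<lambda>_. borel)) G)"
    by (rule nn_integral_distr[OF Gm, symmetric]) (simp add: Fm)
  also have "distr M (PiM I (\<lambda>_. borel)) G = PiM I (\<lambda>_. std_complex_gaussian)"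
    using distr_ginibre[OF A N] unfolding I_def r_def G_def[abs_def] .
  also have "(\<integral>\<^sup>+ g. F g \<partial>PiM I (\<lambda>_. std_complex_gaussian)) = shifted_moment s z' N z'"
    unfolding shifted_moment_def F_def I_def ..
  also have "\<dots> = ennreal (ginibre_const s N * Determinant.det (toeplitz s 0 N ((cmod z')\<^sup>2)))"
    by (rule shifted_moment_eq_toeplitz) (use s N in auto)
  also have "(cmod z')\<^sup>2 = real N * (cmod z)\<^sup>2"
    using r by (simp add: z'_def norm_mult power_mult_distrib) (simp add: r_def)
  finally have e: "ennreal c * (\<integral>\<^sup>+ \<omega>. ennreal (X \<omega> powr (2 * s)) \<partial>M) =
     ennreal (ginibre_const s N * Determinant.det (toeplitz s 0 N (real N * (cmod z)\<^sup>2)))" .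
  have "(\<integral>\<^sup>+ \<omega>. ennreal (X \<omega> powr (2 * s)) \<partial>M) = ennreal (1 / c) * (ennreal c * (\<integral>\<^sup>+ \<omega>. ennreal (X \<omega> powr (2 * s)) \<partial>M))"
    using c by (simp add: mult.assoc[symmetric] ennreal_mult[symmetric])
  also have "\<dots> = ennreal (1 / c * (ginibre_const s N * Determinant.det (toeplitz s 0 N (real N * (cmod z)\<^sup>2))))"
    unfolding e using c by (intro ennreal_mult'[symmetric]) simp
  also have "1 / c = real N powr (- (real N * s))" by (simp add: c_def powr_minus_divide)
  finally show ?thesis by (simp add: X_def)
qed

text \<open>X^(2 s) is expanded in powers of s - s0. At distance r the absolute values sum to at
  most X^(2 (Re s0 + r)) + X^(2 (Re s0 - r)), which is integrable as long as Re s0 - r > -1; this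
  determines the radius.\<close>

lemma holomorphic_moment_ball:
  fixes X :: "'a \<Rightarrow> real"
  assumes Xm [measurable]: "X \<in> borel_measurable M" and X0: "\<And>\<omega>. X \<omega> \<ge> 0"
    and fin: "\<And>\<sigma>. \<sigma> > -1 \<Longrightarrow> (\<integral>\<^sup>+ \<omega>. ennreal (X \<omega> powr (2 * \<sigma>)) \<partial>M) < \<infinity>"
  shows "(\<lambda>s. \<integral>\<omega>. complex_of_real (X \<omega>) powr (2 * s) \<partial>M) holomorphic_on ball s0 (Re s0 + 1)"
proof -
  define t where "t n \<omega> = complex_of_real (X \<omega>) powr (2 * s0) * (of_real (2 * ln (X \<omega>)) ^ n / fact n)" for n \<omega>
  have [measurable]: "(\<lambda>\<omega>. complex_of_real (X \<omega>) powr (2 * s0)) \<in> borel_measurable M"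
  proof -
    have "(\<lambda>\<omega>. if X \<omega> = 0 then 0 else exp (2 * s0 * of_real (ln (X \<omega>)))) \<in> borel_measurable M" by measurable
    also have "(\<lambda>\<omega>. if X \<omega> = 0 then 0 else exp (2 * s0 * of_real (ln (X \<omega>)))) = (\<lambda>\<omega>. complex_of_real (X \<omega>) powr (2 * s0))"
      using X0 by (auto simp: fun_eq_iff powr_def Ln_of_real order.strict_iff_order)
    finally show ?thesis .
  qed
  show ?thesis
  proof (rule power_series_holomorphic[where a = "\<lambda>n. \<integral>\<omega>. t n \<omega> \<partial>M"])
    fix w assume w: "w \<in> ball s0 (Re s0 + 1)"
    define r where "r = cmod (w - s0)"
    have r: "r \<ge> 0" "r < Re s0 + 1" using w by (simp_all add: r_def dist_norm norm_minus_commute)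
    define f where "f n \<omega> = t n \<omega> * (w - s0) ^ n" for n \<omega>
    have [measurable]: "f n \<in> borel_measurable M" for n unfolding f_def[abs_def] t_def[abs_def] by measurable
    have nf: "cmod (f n \<omega>) = X \<omega> powr (2 * Re s0) * ((2 * r * \<bar>ln (X \<omega>)\<bar>) ^ n / fact n)" for n \<omega>
    proof -
      have "cmod (complex_of_real (X \<omega>) powr (2 * s0)) = X \<omega> powr (2 * Re s0)"
        using X0 by (subst norm_powr_real_powr) auto
      moreover have "cmod (of_real (2 * ln (X \<omega>)) ^ n / fact n * (w - s0) ^ n) = (2 * r * \<bar>ln (X \<omega>)\<bar>) ^ n / fact n"
        by (simp add: norm_mult norm_divide norm_power r_def abs_mult power_mult_distrib mult_ac del: of_real_mult)
      ultimately show ?thesis by (simp only: f_def t_def mult.assoc norm_mult)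
    qed
    have exps: "(\<lambda>n. x ^ n / fact n) sums exp x" for x :: "'b::{real_normed_field,banach}"
      using exp_converges[of x] by (simp add: scaleR_conv_of_real field_simps)
    have nf_sums: "(\<lambda>n. cmod (f n \<omega>)) sums (X \<omega> powr (2 * Re s0) * exp (2 * r * \<bar>ln (X \<omega>)\<bar>))" for \<omega>
      unfolding nf by (intro sums_mult exps)
    have f_sums: "(\<lambda>n. f n \<omega>) sums (complex_of_real (X \<omega>) powr (2 * w))" for \<omega>
    proof -
      have "(\<lambda>n. complex_of_real (X \<omega>) powr (2 * s0) * ((of_real (2 * ln (X \<omega>)) * (w - s0)) ^ n / fact n)) sums
          (complex_of_real (X \<omega>) powr (2 * s0) * exp (of_real (2 * ln (X \<omega>)) * (w - s0)))"
        by (intro sums_mult exps)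
      also have "complex_of_real (X \<omega>) powr (2 * s0) * exp (of_real (2 * ln (X \<omega>)) * (w - s0)) = complex_of_real (X \<omega>) powr (2 * w)"
      \<comment> \<open>Where X vanishes both sides are 0, by the convention that every power of 0
        is 0.\<close>
      proof (cases "X \<omega> = 0")
        case False
        hence "X \<omega> > 0" using X0[of \<omega>] by simp
        thus ?thesis by (simp add: powr_def Ln_of_real exp_add[symmetric]) (simp add: algebra_simps)
      qed simp
      finally show ?thesis by (simp add: f_def[abs_def] t_def power_mult_distrib mult.assoc)
    qed
    have bound: "X \<omega> powr (2 * Re s0) * exp (2 * r * \<bar>ln (X \<omega>)\<bar>) \<le> X \<omega> powr (2 * (Re s0 + r)) + X \<omega> powr (2 * (Re s0 - r))" for \<omega>
    proof (cases "X \<omega> = 0")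
      case False
      hence x: "X \<omega> > 0" using X0[of \<omega>] by simp
      have e: "X \<omega> powr u = exp (u * ln (X \<omega>))" for u using x by (simp add: powr_def)
      have "exp (2 * r * \<bar>ln (X \<omega>)\<bar>) \<le> exp (2 * r * ln (X \<omega>)) + exp (- (2 * r * ln (X \<omega>)))"
        by (cases "ln (X \<omega>) \<ge> 0") auto
      hence "X \<omega> powr (2 * Re s0) * exp (2 * r * \<bar>ln (X \<omega>)\<bar>) \<le> exp (2 * Re s0 * ln (X \<omega>)) * (exp (2 * r * ln (X \<omega>)) + exp (- (2 * r * ln (X \<omega>))))"
        unfolding e by (intro mult_left_mono) auto
      also have "\<dots> = exp (2 * (Re s0 + r) * ln (X \<omega>)) + exp (2 * (Re s0 - r) * ln (X \<omega>))"
        by (simp add: distrib_left exp_add[symmetric]) (simp add: algebra_simps)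
      finally show ?thesis unfolding e .
    qed simp
    have "(\<integral>\<^sup>+ \<omega>. (\<Sum>n. ennreal (cmod (f n \<omega>))) \<partial>M) \<le> (\<integral>\<^sup>+ \<omega>. ennreal (X \<omega> powr (2 * (Re s0 + r))) + ennreal (X \<omega> powr (2 * (Re s0 - r))) \<partial>M)"
    proof (rule nn_integral_mono)
      fix \<omega>
      have "(\<Sum>n. ennreal (cmod (f n \<omega>))) = ennreal (X \<omega> powr (2 * Re s0) * exp (2 * r * \<bar>ln (X \<omega>)\<bar>))"
        by (intro suminf_ennreal_eq nf_sums) simp
      also have "\<dots> \<le> ennreal (X \<omega> powr (2 * (Re s0 + r)) + X \<omega> powr (2 * (Re s0 - r)))" by (intro ennreal_leI bound)
      finally show "(\<Sum>n. ennreal (cmod (f n \<omega>))) \<le> ennreal (X \<omega> powr (2 * (Re s0 + r))) + ennreal (X \<omega> powr (2 * (Re s0 - r)))"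
        by simp
    qed
    also have "\<dots> = (\<integral>\<^sup>+ \<omega>. ennreal (X \<omega> powr (2 * (Re s0 + r))) \<partial>M) + (\<integral>\<^sup>+ \<omega>. ennreal (X \<omega> powr (2 * (Re s0 - r))) \<partial>M)"
      by (intro nn_integral_add) measurable
    also have "\<dots> < \<infinity>" using fin[of "Re s0 + r"] fin[of "Re s0 - r"] r by simp
    also have "(\<integral>\<^sup>+ \<omega>. (\<Sum>n. ennreal (cmod (f n \<omega>))) \<partial>M) = (\<Sum>n. \<integral>\<^sup>+ \<omega>. ennreal (cmod (f n \<omega>)) \<partial>M)"
      by (intro nn_integral_suminf) measurable
    finally have S: "(\<Sum>n. \<integral>\<^sup>+ \<omega>. ennreal (cmod (f n \<omega>)) \<partial>M) < \<infinity>" .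
    have fint: "integrable M (f n)" for n
    proof (rule integrableI_bounded)
      have "(\<integral>\<^sup>+ \<omega>. ennreal (cmod (f n \<omega>)) \<partial>M) = (\<Sum>k\<in>{n}. \<integral>\<^sup>+ \<omega>. ennreal (cmod (f k \<omega>)) \<partial>M)" by simp
      also have "\<dots> \<le> (\<Sum>n. \<integral>\<^sup>+ \<omega>. ennreal (cmod (f n \<omega>)) \<partial>M)" by (intro sum_le_suminf summableI) auto
      also note S
      finally show "(\<integral>\<^sup>+ \<omega>. ennreal (cmod (f n \<omega>)) \<partial>M) < \<infinity>" .
    qed measurable
    have "(\<lambda>n. \<integral>\<omega>. f n \<omega> \<partial>M) sums (\<integral>\<omega>. (\<Sum>n. f n \<omega>) \<partial>M)"
    proof (rule sums_integral[OF fint])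
      show "AE \<omega> in M. summable (\<lambda>n. norm (f n \<omega>))" using nf_sums by (auto simp: sums_iff)
      show "summable (\<lambda>n. \<integral>\<omega>. norm (f n \<omega>) \<partial>M)"
      proof (rule summable_suminf_not_top)
        have "(\<Sum>n. ennreal (\<integral>\<omega>. norm (f n \<omega>) \<partial>M)) = (\<Sum>n. \<integral>\<^sup>+ \<omega>. ennreal (cmod (f n \<omega>)) \<partial>M)"
          by (intro suminf_cong nn_integral_eq_integral[symmetric] integrable_norm fint) auto
        thus "(\<Sum>n. ennreal (\<integral>\<omega>. norm (f n \<omega>) \<partial>M)) \<noteq> Orderings.top_class.top" using S by simp
      qed simp
    qed
    also have "(\<lambda>\<omega>. \<Sum>n. f n \<omega>) = (\<lambda>\<omega>. complex_of_real (X \<omega>) powr (2 * w))"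
      using f_sums by (auto simp: sums_iff)
    finally show "(\<lambda>n. (\<integral>\<omega>. t n \<omega> \<partial>M) * (w - s0) ^ n) sums (\<integral>\<omega>. complex_of_real (X \<omega>) powr (2 * w) \<partial>M)"
      by (simp add: f_def)
  qed
qed

lemma holomorphic_moment:
  fixes X :: "'a \<Rightarrow> real"
  assumes "X \<in> borel_measurable M" "\<And>\<omega>. X \<omega> \<ge> 0"
    and "\<And>\<sigma>. \<sigma> > -1 \<Longrightarrow> (\<integral>\<^sup>+ \<omega>. ennreal (X \<omega> powr (2 * \<sigma>)) \<partial>M) < \<infinity>"
  shows "(\<lambda>s. \<integral>\<omega>. complex_of_real (X \<omega>) powr (2 * s) \<partial>M) holomorphic_on {s. Re s > -1}"
proof -
  have "(\<lambda>s. \<integral>\<omega>. complex_of_real (X \<omega>) powr (2 * s) \<partial>M) holomorphic_on (\<Union>s0\<in>{s. Re s > -1}. ball s0 (Re s0 + 1))"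
    by (intro holomorphic_on_UN_open holomorphic_moment_ball assms open_ball)
  thus ?thesis by (rule holomorphic_on_subset) auto
qed

section \<open>Passage from real to complex exponents\<close>

lemma of_real_int_gbinomial: "of_real (int_gbinomial s j) = int_gbinomial (complex_of_real s) j"
  by (simp add: int_gbinomial_def gbinomial_prod_rev)

lemma of_real_symbol_coeff: "of_real (symbol_coeff s n x) = symbol_coeff (complex_of_real s) n (of_real x)"
proof -
  have "(\<lambda>k. complex_of_real (int_gbinomial s (int k - n) / fact k * x ^ k)) sums of_real (symbol_coeff s n x)"
    by (intro sums_of_real sums_symbol_coeff)
  moreover have "(\<lambda>k. complex_of_real (int_gbinomial s (int k - n) / fact k * x ^ k)) sums symbol_coeff (complex_of_real s) n (of_real x)"
    using sums_symbol_coeff[of "complex_of_real s" n "of_real x"] by (simp add: of_real_int_gbinomial)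
  ultimately show ?thesis by (rule sums_unique2)
qed

lemma det_toeplitz_eq_sum:
  "Determinant.det (toeplitz s d n x) =
    (\<Sum>p | p permutes {0..<n}. signof p * (\<Prod>i = 0..<n. symbol_coeff s (int (p i) - int i + d) x))"
  unfolding det_def'[OF toeplitz_carrier]
proof (intro sum.cong refl arg_cong2[where f = "(*)"] prod.cong)
  fix p i assume p: "p \<in> {p. p permutes {0..<n}}" and i: "i \<in> {0..<n}"
  have "p i < n" using permutes_in_image[of p "{0..<n}" i] p i by simp
  thus "toeplitz s d n x $$ (i, p i) = symbol_coeff s (int (p i) - int i + d) x"
    using i by (simp add: toeplitz_def)
qed

lemma of_real_det_toeplitz:
  "of_real (Determinant.det (toeplitz s d n x)) = Determinant.det (toeplitz (complex_of_real s) d n (of_real x))"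
  by (simp add: det_toeplitz_eq_sum of_real_symbol_coeff)

lemma of_real_ginibre_const: "of_real (ginibre_const s n) = ginibre_const (complex_of_real s) n"
  by (simp add: ginibre_const_def Gamma_complex_of_real[symmetric])

text \<open>The partial sums are polynomials in s, and the M-test on unit balls rests on the bound
  (1 + |s|)^j for binomials.\<close>

lemma holomorphic_symbol_coeff: "(\<lambda>s. symbol_coeff s n x) holomorphic_on UNIV"
proof (rule holomorphic_uniform_sequence[where f = "\<lambda>m s. \<Sum>k<m. int_gbinomial s (int k - n) / fact k * x ^ k"])
  fix m
  have "(\<lambda>s. int_gbinomial s j) holomorphic_on UNIV" for j
    by (cases "j < 0") (auto simp: int_gbinomial_def gbinomial_prod_rev intro!: holomorphic_intros)
  thus "(\<lambda>s. \<Sum>k<m. int_gbinomial s (int k - n) / fact k * x ^ k) holomorphic_on UNIV"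
    by (intro holomorphic_intros) auto
next
  fix s0 :: complex
  define B where "B = 2 + cmod s0"
  have "uniform_limit (cball s0 1) (\<lambda>m s. \<Sum>k<m. int_gbinomial s (int k - n) / fact k * x ^ k) (\<lambda>s. symbol_coeff s n x) sequentially"
    unfolding symbol_coeff_def
  proof (rule Weierstrass_m_test)
    show "summable (\<lambda>k. B ^ nat (-n) * ((B * cmod x) ^ k / fact k))"
      by (intro summable_mult) (use summable_exp[of "B * cmod x"] in \<open>simp add: field_simps\<close>)
    fix k and s assume "s \<in> cball s0 1"
    hence "1 + cmod s \<le> B" using norm_triangle_sub[of s s0] by (simp add: B_def dist_norm norm_minus_commute)
    have "norm (int_gbinomial s (int k - n)) \<le> (1 + cmod s) ^ nat (int k - n)" by (rule norm_int_gbinomial_le)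
    also have "\<dots> \<le> B ^ nat (int k - n)" using \<open>1 + cmod s \<le> B\<close> by (intro power_mono) auto
    also have "\<dots> \<le> B ^ (nat (-n) + k)" by (intro power_increasing) (auto simp: B_def)
    finally have "norm (int_gbinomial s (int k - n)) * (norm x ^ k / fact k) \<le> B ^ (nat (-n) + k) * (norm x ^ k / fact k)"
      by (intro mult_right_mono) auto
    thus "norm (int_gbinomial s (int k - n) / fact k * x ^ k) \<le> B ^ nat (-n) * ((B * cmod x) ^ k / fact k)"
      by (simp add: norm_mult norm_divide norm_power power_add power_mult_distrib mult_ac)
  qed
  thus "\<exists>d. 0 < d \<and> cball s0 d \<subseteq> UNIV \<and>
      uniform_limit (cball s0 d) (\<lambda>m s. \<Sum>k<m. int_gbinomial s (int k - n) / fact k * x ^ k) (\<lambda>s. symbol_coeff s n x) sequentially"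
    by (intro exI[of _ 1]) auto
qed auto

lemma holomorphic_det_toeplitz: "(\<lambda>s. Determinant.det (toeplitz s d n x)) holomorphic_on S"
proof -
  have "(\<lambda>s. symbol_coeff s j x) holomorphic_on S" for j
    by (rule holomorphic_on_subset[OF holomorphic_symbol_coeff]) auto
  thus ?thesis unfolding det_toeplitz_eq_sum by (intro holomorphic_intros)
qed

lemma holomorphic_ginibre_const: "(\<lambda>s. ginibre_const s n) holomorphic_on {s. Re s > -1}"
  unfolding ginibre_const_def
proof (intro holomorphic_intros)
  fix i z assume "z \<in> {s. Re s > -1}"
  thus "z + 1 + of_nat i \<notin> \<int>\<^sub>\<le>\<^sub>0" by (auto elim!: nonpos_Ints_cases' simp: complex_eq_iff)
qed auto

text \<open>The identity theorem on the half-plane, applied with agreement on the real ray s > -1.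
  The left side is holomorphic because the real moments have been found to be finite.\<close>

theorem ginibre_moment:
  assumes A: "complex_ginibre N M A" and N: "N \<ge> 1" and s: "Re s > -1"
  shows "(\<integral>\<omega>. of_real (cmod (Determinant.det (A \<omega> - z \<cdot>\<^sub>m 1\<^sub>m N))) powr (2 * s) \<partial>M) =
    of_nat N powr (- (of_nat N * s)) * (ginibre_const s N * Determinant.det (toeplitz s 0 N (of_real (real N * (cmod z)\<^sup>2))))"
proof -
  define X where "X \<omega> = cmod (Determinant.det (A \<omega> - z \<cdot>\<^sub>m 1\<^sub>m N))" for \<omega>
  define f where "f s = (\<integral>\<omega>. complex_of_real (X \<omega>) powr (2 * s) \<partial>M)" for s
  define x where "x = real N * (cmod z)\<^sup>2"
  define g where "g s = of_nat N powr (- (of_nat N * s)) * (ginibre_const s N * Determinant.det (toeplitz s 0 N (of_real x)))" for s :: complex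
  have Xm: "X \<in> borel_measurable M" using borel_measurable_det_ginibre[OF A, of z] unfolding X_def by measurable
  have mom: "(\<integral>\<^sup>+ \<omega>. ennreal (X \<omega> powr (2 * \<sigma>)) \<partial>M) =
      ennreal (real N powr (- (real N * \<sigma>)) * (ginibre_const \<sigma> N * Determinant.det (toeplitz \<sigma> 0 N x)))" if "\<sigma> > -1" for \<sigma>
    unfolding X_def x_def by (rule ginibre_moment_real[OF A N that])
  have real_axis: "f (of_real \<sigma>) = g (of_real \<sigma>)" if \<sigma>: "\<sigma> > -1" for \<sigma>
  proof -
    define m where "m = real N powr (- (real N * \<sigma>)) * (ginibre_const \<sigma> N * Determinant.det (toeplitz \<sigma> 0 N x))"
    have "m \<ge> 0" unfolding m_def x_def
      by (intro mult_nonneg_nonneg less_imp_le[OF ginibre_const_pos[OF \<sigma>]] less_imp_le[OF det_toeplitz_pos[OF \<sigma>]]) auto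
    have "f (of_real \<sigma>) = (\<integral>\<omega>. complex_of_real (X \<omega> powr (2 * \<sigma>)) \<partial>M)"
      unfolding f_def by (intro Bochner_Integration.integral_cong refl) (simp add: powr_of_real[symmetric] X_def)
    also have "\<dots> = of_real (\<integral>\<omega>. X \<omega> powr (2 * \<sigma>) \<partial>M)" by (rule integral_complex_of_real)
    also have "(\<integral>\<omega>. X \<omega> powr (2 * \<sigma>) \<partial>M) = m"
    proof (rule integral_eq_nn_integral[THEN trans])
      show "(\<lambda>\<omega>. X \<omega> powr (2 * \<sigma>)) \<in> borel_measurable M" using Xm by measurable
      show "enn2real (\<integral>\<^sup>+ \<omega>. ennreal (X \<omega> powr (2 * \<sigma>)) \<partial>M) = m"
        unfolding mom[OF \<sigma>] m_def[symmetric] using \<open>m \<ge> 0\<close> by simp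
    qed simp
    also have "of_real m = g (of_real \<sigma>)"
    proof -
      have "complex_of_real (real N powr (- (real N * \<sigma>))) = of_nat N powr (- (of_nat N * of_real \<sigma>))"
        using powr_of_real[of "real N" "- (real N * \<sigma>)"] by simp
      thus ?thesis unfolding m_def g_def of_real_mult of_real_ginibre_const of_real_det_toeplitz by simp
    qed
    finally show ?thesis .
  qed
  have "f s - g s = 0"
  proof (rule analytic_continuation[where f = "\<lambda>s. f s - g s" and S = "{s. Re s > -1}" and U = "of_real ` {-1<..}" and \<xi> = 0])
    have "f holomorphic_on {s. Re s > -1}" unfolding f_def[abs_def]
      by (intro holomorphic_moment Xm) (auto simp: X_def mom[unfolded X_def])
    moreover have "g holomorphic_on {s. Re s > -1}" unfolding g_def[abs_def]
      by (intro holomorphic_intros holomorphic_ginibre_const holomorphic_det_toeplitz) (use N in auto)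
    ultimately show "(\<lambda>s. f s - g s) holomorphic_on {s. Re s > -1}" by (rule holomorphic_on_diff)
    show "open {s. Re s > -1}" by (rule open_halfspace_Re_gt)
    show "connected {s. Re s > -1}" by (intro convex_connected convex_halfspace_Re_gt)
    show "(0::complex) islimpt of_real ` {-1<..}"
      unfolding islimpt_approachable
    proof (intro allI impI)
      fix e :: real assume "e > 0"
      thus "\<exists>x'\<in>complex_of_real ` {-1<..}. x' \<noteq> 0 \<and> dist x' 0 < e"
        by (intro bexI[of _ "complex_of_real (e / 2)"] imageI) (auto simp: norm_divide)
    qed
  qed (use real_axis s in auto)
  thus ?thesis by (simp add: f_def g_def X_def x_def)
qed

section \<open>Exact factorisation and uniform error\<close>

definition toeplitz_ratio :: "nat \<Rightarrow> complex \<Rightarrow> complex \<Rightarrow> complex" where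
  "toeplitz_ratio N s z = Determinant.det (toeplitz s 0 N (of_real (real N * (cmod z)\<^sup>2))) * exp (- (s * of_real (real N * (cmod z)\<^sup>2)))"

text \<open>With s = \<gamma> / 2, the factor exp (s x) split off from the Toeplitz determinant
  combines with exp (-s N) from the constant to exp (s N (|z|^2 - 1)).\<close>

lemma charpoly_moment_eq:
  assumes A: "complex_ginibre N M A" and N: "N \<ge> 1" and \<gamma>: "Re \<gamma> > -2"
  shows "charpoly_moment M A N \<gamma> z = barnes_ratio N (\<gamma> / 2) * toeplitz_ratio N (\<gamma> / 2) z * moment_asymptotic N \<gamma> z"
proof -
  define s where "s = \<gamma> / 2"
  define x :: complex where "x = of_real (real N * (cmod z)\<^sup>2)"
  define D where "D = Determinant.det (toeplitz s 0 N x)"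
  have \<gamma>: "\<gamma> = 2 * s" and s: "Re s > -1" using \<gamma> by (simp_all add: s_def)
  have e: "exp (- (s * of_nat N)) = exp (- (s * x)) * exp (s * of_nat N * of_real ((cmod z)\<^sup>2 - 1))"
    by (simp add: exp_add[symmetric] x_def) (simp add: algebra_simps)
  have as: "moment_asymptotic N \<gamma> z = of_nat N powr (s\<^sup>2 / 2) * exp (s * of_nat N * of_real ((cmod z)\<^sup>2 - 1)) *
      (of_real (2 * pi) powr (s / 2) / barnes_G (1 + s))"
    by (simp add: moment_asymptotic_def \<gamma> power_mult_distrib)
  have "charpoly_moment M A N \<gamma> z = (of_nat N powr (- (of_nat N * s)) * ginibre_const s N) * D"
    unfolding charpoly_moment_def \<gamma> D_def x_def ginibre_moment[OF A N s] by (simp only: mult.assoc)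
  also have "\<dots> = barnes_ratio N s * (D * exp (- (s * x))) * moment_asymptotic N \<gamma> z"
    unfolding ginibre_const_eq_barnes[OF s N] as e by (simp only: mult_ac)
  also have "D * exp (- (s * x)) = toeplitz_ratio N s z" by (simp add: toeplitz_ratio_def D_def x_def)
  finally show ?thesis by (simp only: s_def)
qed

lemma uniform_limit_ratio:
  assumes R: "0 < R" "R < 1"
  shows "uniform_limit ({\<gamma>. Re \<gamma> > -2 \<and> cmod \<gamma> \<le> B} \<times> {z. cmod z \<le> R})
    (\<lambda>N (\<gamma>, z). barnes_ratio N (\<gamma> / 2) * toeplitz_ratio N (\<gamma> / 2) z - 1) (\<lambda>_. 0) sequentially"
    (is "uniform_limit ?X _ _ _")
proof -
  have 1: "uniform_limit ?X (\<lambda>N p. barnes_ratio N (fst p / 2)) (\<lambda>_. 1) sequentially"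
  proof (rule uniform_limitI)
    fix e :: real assume "e > 0"
    from uniform_limitD[OF uniform_limit_barnes_ratio[of "B / 2"] this]
    show "eventually (\<lambda>N. \<forall>p\<in>?X. dist (barnes_ratio N (fst p / 2)) 1 < e) sequentially"
      by (rule eventually_mono) (auto simp: norm_divide)
  qed
  have 2: "uniform_limit ?X (\<lambda>N p. toeplitz_ratio N (fst p / 2) (snd p)) (\<lambda>_. 1) sequentially"
  proof (rule uniform_limitI)
    fix e :: real assume e: "e > 0"
    obtain S :: nat where S: "B / 2 \<le> real S" using real_arch_simple by blast
    have "0 < R\<^sup>2" "R\<^sup>2 < 1" using R by (simp_all add: power_less_one_iff)
    \<comment> \<open>The variable of the Toeplitz asymptotics is x = N |z|^2, so the radius R
      enters squared.\<close>
    from det_toeplitz_asymptotics[OF this, of "e / 2" S] e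
    have "eventually (\<lambda>N. \<forall>s x. cmod s \<le> real S \<longrightarrow> 0 \<le> x \<longrightarrow> x \<le> R\<^sup>2 * real N \<longrightarrow>
       cmod (Determinant.det (toeplitz s 0 N (of_real x)) * exp (- (s * of_real x)) - 1) \<le> e / 2) sequentially" by simp
    thus "eventually (\<lambda>N. \<forall>p\<in>?X. dist (toeplitz_ratio N (fst p / 2) (snd p)) 1 < e) sequentially"
    proof eventually_elim
      case (elim N)
      show ?case
      proof
        fix p assume "p \<in> ?X"
        hence p: "cmod (fst p / 2) \<le> real S" "(cmod (snd p))\<^sup>2 \<le> R\<^sup>2" using S by (auto simp: norm_divide intro: power_mono)
        have "real N * (cmod (snd p))\<^sup>2 \<le> R\<^sup>2 * real N" using mult_left_mono[OF p(2), of "real N"] by (simp add: mult.commute)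
        hence "cmod (toeplitz_ratio N (fst p / 2) (snd p) - 1) \<le> e / 2"
          unfolding toeplitz_ratio_def using p(1) by (intro elim[rule_format]) auto
        thus "dist (toeplitz_ratio N (fst p / 2) (snd p)) 1 < e" using e by (simp add: dist_norm)
      qed
    qed
  qed
  have b: "bounded ((\<lambda>_. 1 :: complex) ` ?X)" by (rule finite_imp_bounded) (rule finite_subset[of _ "{1}"]; auto)
  have "uniform_limit ?X (\<lambda>N p. barnes_ratio N (fst p / 2) * toeplitz_ratio N (fst p / 2) (snd p) - 1) (\<lambda>_. 1 * 1 - 1) sequentially"
    by (intro uniform_limit_minus uniform_limit_const uniform_lim_mult[OF 1 2 b b])
  thus ?thesis by (simp add: case_prod_unfold)
qed

theorem theorem1p1:
  fixes M :: "nat \<Rightarrow> 'a measure" and A :: "nat \<Rightarrow> 'a \<Rightarrow> complex mat"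
  assumes "\<And>N. N \<ge> 1 \<Longrightarrow> complex_ginibre N (M N) (A N)"
  shows "\<exists>err :: nat \<Rightarrow> complex \<Rightarrow> complex \<Rightarrow> complex.
    (\<forall>N \<gamma> z. N \<ge> 1 \<longrightarrow> Re \<gamma> > - 2 \<longrightarrow> cmod z < 1 \<longrightarrow>
       charpoly_moment (M N) (A N) N \<gamma> z = (1 + err N \<gamma> z) * moment_asymptotic N \<gamma> z) \<and>
    (\<forall>\<gamma> z. Re \<gamma> > - 2 \<longrightarrow> cmod z < 1 \<longrightarrow> (\<lambda>N. err N \<gamma> z) \<longlonglongrightarrow> 0) \<and>
    (\<forall>K r R. compact K \<longrightarrow> K \<subseteq> {\<gamma>. Re \<gamma> > - 2} \<longrightarrow> 0 < r \<longrightarrow> r \<le> R \<longrightarrow> R < 1 \<longrightarrow>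
       uniform_limit (K \<times> {w. r \<le> cmod w \<and> cmod w \<le> R})
         (\<lambda>N (\<gamma>, z). err N \<gamma> z) (\<lambda>_. 0) sequentially)"
proof -
  \<comment> \<open>Since the factorisation is exact, the error is known for every N, and pointwise
    and uniform convergence both follow from a single uniform limit.\<close>
  define err where "err N \<gamma> z = barnes_ratio N (\<gamma> / 2) * toeplitz_ratio N (\<gamma> / 2) z - 1" for N \<gamma> z
  have unif: "uniform_limit ({\<gamma>. Re \<gamma> > -2 \<and> cmod \<gamma> \<le> B} \<times> {z. cmod z \<le> R}) (\<lambda>N (\<gamma>, z). err N \<gamma> z) (\<lambda>_. 0) sequentially"
    if "0 < R" "R < 1" for B R
    unfolding err_def by (rule uniform_limit_ratio[OF that])
  show ?thesis
  proof (intro exI[of _ err] conjI allI impI)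
    fix N :: nat and \<gamma> z :: complex assume "N \<ge> 1" "Re \<gamma> > -2"
    thus "charpoly_moment (M N) (A N) N \<gamma> z = (1 + err N \<gamma> z) * moment_asymptotic N \<gamma> z"
      using charpoly_moment_eq[OF assms[of N], of \<gamma> z] by (simp add: err_def)
  next
    fix \<gamma> z :: complex assume \<gamma>: "Re \<gamma> > -2" and z: "cmod z < 1"
    \<comment> \<open>The midpoint between |z| and 1 is a positive radius even for z = 0.\<close>
    define R where "R = (1 + cmod z) / 2"
    have R: "0 < R" "R < 1" "cmod z \<le> R" using z by (simp_all add: R_def add_pos_nonneg)
    show "(\<lambda>N. err N \<gamma> z) \<longlonglongrightarrow> 0"
      using tendsto_uniform_limitI[OF unif[OF R(1,2), of "cmod \<gamma>"], of "(\<gamma>, z)"] \<gamma> R(3) by simp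
  next
    fix K :: "complex set" and r R :: real
    assume K: "compact K" "K \<subseteq> {\<gamma>. Re \<gamma> > -2}" and r: "0 < r" "r \<le> R" "R < 1"
    obtain B where "\<forall>\<gamma>\<in>K. cmod \<gamma> \<le> B" using compact_imp_bounded[OF K(1)] unfolding bounded_iff by blast
    hence sub: "K \<times> {w. r \<le> cmod w \<and> cmod w \<le> R} \<subseteq> {\<gamma>. Re \<gamma> > -2 \<and> cmod \<gamma> \<le> B} \<times> {z. cmod z \<le> R}" using K(2) by auto
    have "0 < R" using r by simp
    show "uniform_limit (K \<times> {w. r \<le> cmod w \<and> cmod w \<le> R}) (\<lambda>N (\<gamma>, z). err N \<gamma> z) (\<lambda>_. 0) sequentially"
      by (rule uniform_limit_on_subset[OF unif[OF \<open>0 < R\<close> r(3)] sub])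
  qed
qed

end
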